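(* Let $1\le p,q\le\infty$, $\varphi_0\in\mathcal{S}(\mathbb{R}^n)\setminus\{0\}$ and $T>0$. Set $\varphi(t,x)=(e^{\frac12 it\Delta}\varphi_0)(x)$. Let $V\in C^\infty(\mathbb{R}\times\mathbb{R}^n)$ be real valued and suppose that for every multi-index $\alpha$ with $|\alpha|\ge 1$ there exists $C_\alpha>0$ such that $$|\partial_x^\alpha V(t,x)|\le C_\alpha\quad\text{for all }(t,x)\in\mathbb{R}\times\mathbb{R}^n .$$ Then there exists $C_T>0$ such that $$\|u(t,\cdot)\|_{M^{p,q}_{\varphi(t,\cdot)}}\le C_T\,\|u_0\|_{M^{p,q}_{\varphi_0}}$$ for all $u_0\in\mathcal{S}(\mathbb{R}^n)$ and all $t\in[-T,T]$, where $u(t,x)$ denotes the solution in $C(\mathbb{R};L^2(\mathbb{R}^n))$ of $$i\partial_t u(t,x)=-\tfrac12\Delta u(t,x)+V(t,x)u(t,x),\quad (t,x)\in\mathbb{R}\times\mathbb{R}^n,\qquad u(0,x)=u_0(x).$$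
   Context: $\Delta=\sum_{j=1}^n\partial^2/\partial x_j^2$. Fourier transform: $\mathcal{F}f(\xi)=\int_{\mathbb{R}^n}f(x)e^{-ix\cdot\xi}\,dx$ and $\mathcal{F}^{-1}f(x)=(2\pi)^{-n}\int_{\mathbb{R}^n}f(\xi)e^{ix\cdot\xi}\,d\xi$. The free Schrödinger propagator is $(e^{\frac12 it\Delta}f)(x)=\mathcal{F}^{-1}_{\xi\to x}[e^{-\frac12 it|\xi|^2}\mathcal{F}f(\xi)](x)$ for $f\in\mathcal{S}(\mathbb{R}^n)$. For $\varphi\in\mathcal{S}(\mathbb{R}^n)\setminus\{0\}$ (the window function) and $f\in\mathcal{S}'(\mathbb{R}^n)$, the wave packet transform (short-time Fourier transform) is $$W_\varphi f(x,\xi)=\int_{\mathbb{R}^n}\overline{\varphi(y-x)}\,f(y)\,e^{-iy\cdot\xi}\,dy .$$ For $1\le p,q\le\infty$ the modulation space norm with window $\varphi$ is $$\|f\|_{M^{p,q}_\varphi}=\big\|\,\|W_\varphi f(x,\xi)\|_{L^p_x}\big\|_{L^q_\xi}=\Big(\int_{\mathbb{R}^n}\Big(\int_{\mathbb{R}^n}|W_\varphi f(x,\xi)|^p\,dx\Big)^{q/p}d\xi\Big)^{1/q},$$ with the usual modifications if $p=\infty$ or $q=\infty$. In the norm $\|u(t,\cdot)\|_{M^{p,q}_{\varphi(t,\cdot)}}$ the window is the time-dependent function $\varphi(t,\cdot)$. *)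

theory Defs
  imports "HOL-Analysis.Analysis" "HOL-Probability.Essential_Supremum"
begin

section \<open>Smooth functions and Schwartz functions\<close>

definition dir_deriv :: "'a::real_normed_vector \<Rightarrow> ('a \<Rightarrow> 'b::real_normed_vector) \<Rightarrow> 'a \<Rightarrow> 'b"
  where "dir_deriv b f x = vector_derivative (\<lambda>s::real. f (x + s *\<^sub>R b)) (at 0)"

fun iter_deriv :: "'a::real_normed_vector list \<Rightarrow> ('a \<Rightarrow> 'b::real_normed_vector) \<Rightarrow> 'a \<Rightarrow> 'b"
  where
    "iter_deriv [] f = f"
  | "iter_deriv (b # bs) f = dir_deriv b (iter_deriv bs f)"

text \<open>The class \<open>C\<^sup>\<infinity>\<close> on a whole Euclidean space: all partial derivatives of all orders
  (in every order of differentiation) exist and are continuous.\<close>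

definition smooth :: "('a::euclidean_space \<Rightarrow> 'b::real_normed_vector) \<Rightarrow> bool"
  where "smooth f \<longleftrightarrow>
    (\<forall>bs. set bs \<subseteq> Basis \<longrightarrow>
      continuous_on UNIV (iter_deriv bs f) \<and>
      (\<forall>b\<in>Basis. \<forall>x. (\<lambda>s::real. iter_deriv bs f (x + s *\<^sub>R b)) differentiable (at 0)))"

text \<open>For a multi-index \<open>\<alpha>\<close>, the derivative \<open>\<partial>\<^sup>\<alpha>\<close> differentiates \<open>\<alpha> i\<close> times in the \<open>i\<close>-th
  coordinate. The index type carries no order, so an arbitrary order of differentiation is
  fixed by choice; it is immaterial for smooth functions.\<close>

definition multi_deriv ::
    "('n::finite \<Rightarrow> nat) \<Rightarrow> (real^'n \<Rightarrow> 'b::real_normed_vector) \<Rightarrow> real^'n \<Rightarrow> 'b"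
  where "multi_deriv \<alpha> f =
    iter_deriv (map (\<lambda>i. axis i 1) (SOME is. \<forall>i. count_list is i = \<alpha> i)) f"

definition laplacian :: "(real^'n::finite \<Rightarrow> 'b::real_normed_vector) \<Rightarrow> real^'n \<Rightarrow> 'b"
  where "laplacian f x = (\<Sum>i\<in>UNIV. dir_deriv (axis i 1) (dir_deriv (axis i 1) f) x)"

definition schwartz :: "(real^'n::finite \<Rightarrow> complex) \<Rightarrow> bool"
  where "schwartz f \<longleftrightarrow> smooth f \<and>
    (\<forall>(\<alpha> :: 'n \<Rightarrow> nat) (\<beta> :: 'n \<Rightarrow> nat). \<exists>C. \<forall>x.
      \<bar>\<Prod>i\<in>UNIV. (x $ i) ^ \<beta> i\<bar> * cmod (multi_deriv \<alpha> f x) \<le> C)"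


section \<open>Fourier transform and free propagator\<close>

definition fourier :: "(real^'n::finite \<Rightarrow> complex) \<Rightarrow> real^'n \<Rightarrow> complex"
  where "fourier f \<xi> = (LINT x|lborel. f x * exp (- \<i> * complex_of_real (x \<bullet> \<xi>)))"

definition inv_fourier :: "(real^'n::finite \<Rightarrow> complex) \<Rightarrow> real^'n \<Rightarrow> complex"
  where "inv_fourier f x =
    complex_of_real (1 / (2 * pi) ^ CARD('n)) *
      (LINT \<xi>|lborel. f \<xi> * exp (\<i> * complex_of_real (x \<bullet> \<xi>)))"

definition free_propagator ::
    "real \<Rightarrow> (real^'n::finite \<Rightarrow> complex) \<Rightarrow> real^'n \<Rightarrow> complex"
  where "free_propagator t f =
    inv_fourier (\<lambda>\<xi>. exp (- (\<i> * complex_of_real (t * (norm \<xi>)\<^sup>2 / 2))) * fourier f \<xi>)"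


section \<open>Wave packet transform and modulation space norms\<close>

text \<open>On functions \<open>f\<close> in \<open>L\<^sup>2\<close> the pairing that defines the transform of a tempered distribution
  is the Lebesgue integral below.\<close>

definition wave_packet ::
    "(real^'n::finite \<Rightarrow> complex) \<Rightarrow> (real^'n \<Rightarrow> complex) \<Rightarrow> real^'n \<Rightarrow> real^'n \<Rightarrow> complex"
  where "wave_packet \<phi> f x \<xi> =
    (LINT y|lborel. cnj (\<phi> (y - x)) * f y * exp (- \<i> * complex_of_real (y \<bullet> \<xi>)))"

definition ennpowr :: "ennreal \<Rightarrow> real \<Rightarrow> ennreal"
  where "ennpowr x a = (if x = \<infinity> then \<infinity> else ennreal (enn2real x powr a))"

text \<open>The \<open>L\<^sup>p\<close> norm, for an exponent \<open>p\<close> in \<open>[1,\<infinity>]\<close>, of a function with values in \<open>[0,\<infinity>]\<close>;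
  the norm itself may be infinite.\<close>

definition Lp_norm :: "ennreal \<Rightarrow> ('a::euclidean_space \<Rightarrow> ennreal) \<Rightarrow> ennreal"
  where "Lp_norm p g =
    (if p = \<infinity> then esssup lborel g
     else ennpowr (\<integral>\<^sup>+ x. ennpowr (g x) (enn2real p) \<partial>lborel) (1 / enn2real p))"

definition modulation_norm ::
    "ennreal \<Rightarrow> ennreal \<Rightarrow> (real^'n::finite \<Rightarrow> complex) \<Rightarrow> (real^'n \<Rightarrow> complex) \<Rightarrow> ennreal"
  where "modulation_norm p q \<phi> f =
    Lp_norm q (\<lambda>\<xi>. Lp_norm p (\<lambda>x. ennreal (cmod (wave_packet \<phi> f x \<xi>))))"


section \<open>Solutions of the Schroedinger equation in \<open>C(\<real>; L\<^sup>2)\<close>\<close>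

definition in_L2 :: "(real^'n::finite \<Rightarrow> complex) \<Rightarrow> bool"
  where "in_L2 f \<longleftrightarrow> f \<in> borel_measurable lborel \<and> integrable lborel (\<lambda>x. (cmod (f x))\<^sup>2)"

definition continuous_L2 :: "(real \<Rightarrow> real^'n::finite \<Rightarrow> complex) \<Rightarrow> bool"
  where "continuous_L2 u \<longleftrightarrow> (\<forall>t. in_L2 (u t)) \<and>
    (\<forall>t. ((\<lambda>s. LINT x|lborel. (cmod (u s x - u t x))\<^sup>2) \<longlongrightarrow> 0) (at t))"

definition test_function :: "(real \<Rightarrow> real^'n::finite \<Rightarrow> complex) \<Rightarrow> bool"
  where "test_function \<psi> \<longleftrightarrow>
    smooth (\<lambda>(t, x). \<psi> t x) \<and> compact (closure {(t, x). \<psi> t x \<noteq> 0})"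

text \<open>The equation \<open>i \<partial>\<^sub>t u = - \<Delta>u / 2 + V u\<close> holds in the sense of distributions on
  \<open>\<real> \<times> \<real>\<^sup>n\<close>, with derivatives moved to the test function (bilinear pairing, no complex conjugate).
  The integrals are iterated because \<open>u\<close> is a curve of representatives of \<open>L\<^sup>2\<close> classes,
  chosen separately at each time, and need not be jointly measurable.\<close>

definition schroedinger_solution ::
    "(real \<Rightarrow> real^'n::finite \<Rightarrow> real) \<Rightarrow> (real^'n \<Rightarrow> complex) \<Rightarrow>
     (real \<Rightarrow> real^'n \<Rightarrow> complex) \<Rightarrow> bool"
  where "schroedinger_solution V u0 u \<longleftrightarrow>
    continuous_L2 u \<and>
    (AE x in lborel. u 0 x = u0 x) \<and>
    (\<forall>\<psi>. test_function \<psi> \<longrightarrow>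
      (LINT t|lborel. LINT x|lborel.
         u t x * (- \<i> * vector_derivative (\<lambda>s. \<psi> s x) (at t))) =
      (LINT t|lborel. LINT x|lborel.
         u t x * (- (1 / 2) * laplacian (\<psi> t) x + complex_of_real (V t x) * \<psi> t x)))"

end

theory Submission
  imports Defs "HOL-Probability.Probability"
begin

text \<open>The windows \<open>\<phi>(t)\<close> evolve freely, so the transform of \<open>u(t)\<close> at \<open>(x + t \<xi>, \<xi>)\<close> is, up to a phase, the pairing of
  \<open>u(t)\<close> with the free evolution of the wave packet \<open>e\<^bsup>iz\<cdot>\<xi>\<^esup> \<phi>\<^sub>0(z - x)\<close>. Its time derivative is the pairing with \<open>V\<close> times that
  packet. Replacing \<open>V(s, y)\<close> by \<open>V(s, x + s \<xi>)\<close> only rotates the phase, because \<open>V\<close> is real, and the error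
  \<open>V(s, y) - V(s, x + s \<xi>)\<close> has bounded derivatives and grows linearly in \<open>y - x - s \<xi>\<close>; hence it acts on the transform
  through a kernel that decays rapidly off the diagonal. A Gronwall argument bounds the transform at time \<open>t\<close>
  pointwise by the convolution of the initial transform with an integrable weight, and Minkowski's integral
  inequality turns this into the bound of the mixed norms, which are invariant under the shear \<open>x \<mapsto> x + t \<xi>\<close>.\<close>

section \<open>Calculus of smooth functions\<close>

text \<open>The main estimate is pointwise in phase space, so p and q enter only at the very end. It
  rests on the weight \<open>wt\<close>: integrable, subject to a Peetre inequality coordinate by
  coordinate, and stable under the shear uniformly for |s| <= T. Two obstacles shape the rest.
  \<open>V\<close> is unbounded, and \<open>u\<close> is only a weak solution whose representatives
  are chosen separately at each time. Wave packets become test functions only after a cutoff in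
  space, removed by dominated convergence; continuity in time of the pairings replaces joint
  measurability. Powers of decay are budgeted. Each window supplies four; the linear growth of the
  potential difference consumes one; the kernel keeps wt(x' - x)^2 and wt(\<eta>)^3. One factor of
  each is integrated, the others move the weight from one phase-space point to another. Three powers
  in frequency, at two derivatives per power and coordinate, give the order
  \<open>2 * (3 * CARD('n))\<close>. The exponential rate in the Gronwall argument is tuned so that
  the remainder contributes at most half of the supremum and is absorbed.\<close>

lemma iter_deriv_append: "iter_deriv (as @ bs) f = iter_deriv as (iter_deriv bs f)"
  by (induction as) auto

lemma smooth_continuous: "smooth f \<Longrightarrow> continuous_on UNIV f"
  unfolding smooth_def by (metis empty_subsetI iter_deriv.simps(1) list.set(1))

lemma smooth_dir_deriv:
  fixes f :: "'a::euclidean_space \<Rightarrow> 'b::real_normed_vector"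
  shows "smooth f \<Longrightarrow> b \<in> Basis \<Longrightarrow> smooth (dir_deriv b f)"
  unfolding smooth_def
proof (intro allI impI)
  fix bs :: "'a list" assume A: "\<forall>bs. set bs \<subseteq> Basis \<longrightarrow> continuous_on UNIV (iter_deriv bs f) \<and>
      (\<forall>b\<in>Basis. \<forall>x. (\<lambda>s::real. iter_deriv bs f (x + s *\<^sub>R b)) differentiable (at 0))"
     and b: "b \<in> Basis" and bs: "set bs \<subseteq> Basis"
  have "iter_deriv bs (dir_deriv b f) = iter_deriv (bs @ [b]) f" by (simp add: iter_deriv_append)
  moreover have "set (bs @ [b]) \<subseteq> Basis" using b bs by auto
  ultimately show "continuous_on UNIV (iter_deriv bs (dir_deriv b f)) \<and>
      (\<forall>ba\<in>Basis. \<forall>x. (\<lambda>s::real. iter_deriv bs (dir_deriv b f) (x + s *\<^sub>R ba)) differentiable (at 0))"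
    using A by metis
qed

lemma smooth_iter_deriv: "smooth f \<Longrightarrow> set bs \<subseteq> Basis \<Longrightarrow> smooth (iter_deriv bs f)"
  by (induction bs) (auto intro: smooth_dir_deriv)

lemma smooth_has_derivative0:
  fixes f :: "'a::euclidean_space \<Rightarrow> 'b::real_normed_vector"
  assumes "smooth f" "b \<in> Basis"
  shows "((\<lambda>s::real. f (x + s *\<^sub>R b)) has_vector_derivative dir_deriv b f x) (at 0)"
proof -
  have "(\<lambda>s::real. iter_deriv [] f (x + s *\<^sub>R b)) differentiable (at 0)"
    using assms unfolding smooth_def by (metis empty_subsetI list.set(1))
  then show ?thesis by (simp add: dir_deriv_def vector_derivative_works)
qed

lemma shift_vector_derivative:
  fixes f :: "'a::real_normed_vector \<Rightarrow> 'b::real_normed_vector"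
  assumes "((\<lambda>s::real. f ((x + r *\<^sub>R b) + s *\<^sub>R b)) has_vector_derivative d) (at 0)"
  shows "((\<lambda>s::real. f (x + s *\<^sub>R b)) has_vector_derivative d) (at r)"
proof -
  have "((\<lambda>s::real. s - r) has_vector_derivative 1) (at r)"
    by (auto intro!: derivative_eq_intros)
  moreover have "((\<lambda>s::real. f ((x + r *\<^sub>R b) + s *\<^sub>R b)) has_vector_derivative d) (at (r - r))"
    using assms by simp
  ultimately have "(((\<lambda>s::real. f ((x + r *\<^sub>R b) + s *\<^sub>R b)) \<circ> (\<lambda>s. s - r)) has_vector_derivative 1 *\<^sub>R d) (at r)"
    by (rule vector_diff_chain_at)
  then show ?thesis by (simp add: o_def algebra_simps)
qed

lemma smooth_has_derivative:
  assumes "smooth f" "b \<in> Basis"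
  shows "((\<lambda>s::real. f (x + s *\<^sub>R b)) has_vector_derivative dir_deriv b f (x + r *\<^sub>R b)) (at r)"
  by (rule shift_vector_derivative, rule smooth_has_derivative0[OF assms])

lemma dir_derivI:
  "(\<And>x. ((\<lambda>s::real. f (x + s *\<^sub>R b)) has_vector_derivative f' x) (at 0)) \<Longrightarrow> dir_deriv b f = f'"
  by (auto simp: dir_deriv_def vector_derivative_at)

text \<open>Every iterated derivative stays in a class that is closed under differentiation along
  basis vectors, so continuity on the class is enough. Choosing the class well (sums of products,
  composites, free evolutions of Schwartz functions) avoids formulas for higher derivatives.\<close>

lemma smooth_coinduct:
  fixes f :: "'a::euclidean_space \<Rightarrow> 'b::real_normed_vector"
  assumes "Q f"
    and "\<And>g. Q g \<Longrightarrow> continuous_on UNIV g"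
    and "\<And>g b. Q g \<Longrightarrow> b \<in> Basis \<Longrightarrow>
      \<exists>g'. Q g' \<and> (\<forall>x. ((\<lambda>s::real. g (x + s *\<^sub>R b)) has_vector_derivative g' x) (at 0))"
  shows "smooth f"
proof -
  have Q: "Q (iter_deriv bs f)" if "set bs \<subseteq> Basis" for bs
    using that
  proof (induction bs)
    case (Cons b bs)
    then obtain g' where "Q g'" "\<forall>x. ((\<lambda>s::real. iter_deriv bs f (x + s *\<^sub>R b)) has_vector_derivative g' x) (at 0)"
      using assms(3) by (metis insert_subset list.simps(15))
    then show ?case using dir_derivI[of "iter_deriv bs f" b g'] by simp
  qed (use assms(1) in simp)
  show ?thesis unfolding smooth_def
  proof (intro allI impI conjI ballI)
    fix bs assume "set bs \<subseteq> (Basis :: 'a set)"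
    note q = Q[OF this]
    show "continuous_on UNIV (iter_deriv bs f)" by (rule assms(2)[OF q])
    fix b :: 'a and x assume "b \<in> Basis"
    from assms(3)[OF q this] show "(\<lambda>s::real. iter_deriv bs f (x + s *\<^sub>R b)) differentiable (at 0)"
      using differentiableI_vector by blast
  qed
qed

lemma smooth_const [simp, intro]: "smooth (\<lambda>x. c)"
  by (rule smooth_coinduct[where Q="\<lambda>f. \<exists>c. f = (\<lambda>x. c)"])
     (auto intro!: exI[where x="\<lambda>x. 0"])

lemma dir_deriv_const [simp]: "dir_deriv b (\<lambda>x. c) = (\<lambda>x. 0)"
  by (rule dir_derivI) auto

lemma smooth_linear:
  fixes f :: "'a::euclidean_space \<Rightarrow> 'c::real_normed_vector" and h :: "'c \<Rightarrow> 'b::real_normed_vector"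
  assumes h: "bounded_linear h" and f: "smooth f"
  shows "smooth (\<lambda>x. h (f x))"
    and "b \<in> Basis \<Longrightarrow> dir_deriv b (\<lambda>x. h (f x)) = (\<lambda>x. h (dir_deriv b f x))"
proof -
  have d: "((\<lambda>s::real. h (f (x + s *\<^sub>R b))) has_vector_derivative h (dir_deriv b f x)) (at 0)"
    if "smooth f" "b \<in> Basis" for f :: "'a \<Rightarrow> 'c" and b x
    by (rule bounded_linear.has_vector_derivative[OF h smooth_has_derivative0[OF that]])
  show "smooth (\<lambda>x. h (f x))"
  proof (rule smooth_coinduct[where Q="\<lambda>k. \<exists>f. smooth f \<and> k = (\<lambda>x. h (f x))"])
    fix g :: "'a \<Rightarrow> 'b" and b :: 'a assume "\<exists>f. smooth f \<and> g = (\<lambda>x. h (f x))" and b: "b \<in> Basis"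
    then obtain f where f: "smooth f" "g = (\<lambda>x. h (f x))" by auto
    then show "\<exists>g'. (\<exists>f. smooth f \<and> g' = (\<lambda>x. h (f x))) \<and>
      (\<forall>x. ((\<lambda>s::real. g (x + s *\<^sub>R b)) has_vector_derivative g' x) (at 0))"
      using d[OF f(1) b] smooth_dir_deriv[OF f(1) b] by blast
  qed (use f in \<open>auto intro!: bounded_linear.continuous_on[OF h] dest: smooth_continuous\<close>)
  show "b \<in> Basis \<Longrightarrow> dir_deriv b (\<lambda>x. h (f x)) = (\<lambda>x. h (dir_deriv b f x))"
    by (rule dir_derivI) (use d f in blast)
qed

lemma smooth_add:
  fixes f g :: "'a::euclidean_space \<Rightarrow> 'b::real_normed_vector"
  assumes "smooth f" "smooth g"
  shows "smooth (\<lambda>x. f x + g x)"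
    and "b \<in> Basis \<Longrightarrow> dir_deriv b (\<lambda>x. f x + g x) = (\<lambda>x. dir_deriv b f x + dir_deriv b g x)"
proof -
  have d: "((\<lambda>s::real. f (x + s *\<^sub>R b) + g (x + s *\<^sub>R b)) has_vector_derivative (dir_deriv b f x + dir_deriv b g x)) (at 0)"
    if "smooth f" "smooth g" "b \<in> Basis" for f g :: "'a \<Rightarrow> 'b" and b x
    by (rule has_vector_derivative_add) (use that smooth_has_derivative0 in auto)
  show "smooth (\<lambda>x. f x + g x)"
  proof (rule smooth_coinduct[where Q="\<lambda>k. \<exists>f g. smooth f \<and> smooth g \<and> k = (\<lambda>x. f x + g x)"])
    fix k :: "'a \<Rightarrow> 'b" and b :: 'a
    assume "\<exists>f g. smooth f \<and> smooth g \<and> k = (\<lambda>x. f x + g x)" and b: "b \<in> Basis"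
    then obtain f g where f: "smooth f" "smooth g" "k = (\<lambda>x. f x + g x)" by auto
    then show "\<exists>g'. (\<exists>f g. smooth f \<and> smooth g \<and> g' = (\<lambda>x. f x + g x)) \<and>
      (\<forall>x. ((\<lambda>s::real. k (x + s *\<^sub>R b)) has_vector_derivative g' x) (at 0))"
      using d[OF f(1,2) b] smooth_dir_deriv[OF f(1) b] smooth_dir_deriv[OF f(2) b] by blast
  qed (use assms in \<open>auto intro!: continuous_on_add dest: smooth_continuous\<close>)
  show "b \<in> Basis \<Longrightarrow> dir_deriv b (\<lambda>x. f x + g x) = (\<lambda>x. dir_deriv b f x + dir_deriv b g x)"
    by (rule dir_derivI) (use d assms in blast)
qed

lemma smooth_bilinear_deriv:
  fixes f :: "'a::euclidean_space \<Rightarrow> 'b::real_normed_vector" and g :: "'a \<Rightarrow> 'c::real_normed_vector"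
    and B :: "'b \<Rightarrow> 'c \<Rightarrow> 'd::real_normed_vector"
  assumes B: "bounded_bilinear B" and "smooth f" "smooth g" "b \<in> Basis"
  shows "((\<lambda>s::real. B (f (x + s *\<^sub>R b)) (g (x + s *\<^sub>R b))) has_vector_derivative
     (B (f x) (dir_deriv b g x) + B (dir_deriv b f x) (g x))) (at 0)"
  using bounded_bilinear.has_vector_derivative[OF B smooth_has_derivative0[OF assms(2,4)] smooth_has_derivative0[OF assms(3,4)], of x x]
  by simp

lemma dir_deriv_bilinear:
  fixes f :: "'a::euclidean_space \<Rightarrow> 'b::real_normed_vector" and g :: "'a \<Rightarrow> 'c::real_normed_vector"
    and B :: "'b \<Rightarrow> 'c \<Rightarrow> 'd::real_normed_vector"
  assumes B: "bounded_bilinear B" and "smooth f" "smooth g" "b \<in> Basis"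
  shows "dir_deriv b (\<lambda>x. B (f x) (g x)) = (\<lambda>x. B (f x) (dir_deriv b g x) + B (dir_deriv b f x) (g x))"
  by (rule dir_derivI) (use smooth_bilinear_deriv[OF assms] in blast)

text \<open>The Leibniz rule turns one product into two, so single products are not closed under
  differentiation; finite sums of them are. This is the class handed to
  \<open>smooth_coinduct\<close>.\<close>

inductive smooth_products ::
    "('b::real_normed_vector \<Rightarrow> 'c::real_normed_vector \<Rightarrow> 'd::real_normed_vector) \<Rightarrow> ('a::euclidean_space \<Rightarrow> 'd) \<Rightarrow> bool"
  for B
  where prod: "smooth f \<Longrightarrow> smooth g \<Longrightarrow> smooth_products B (\<lambda>x. B (f x) (g x))"
  | add: "smooth_products B h \<Longrightarrow> smooth_products B k \<Longrightarrow> smooth_products B (\<lambda>x. h x + k x)"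

lemma smooth_bilinear:
  fixes f :: "'a::euclidean_space \<Rightarrow> 'b::real_normed_vector" and g :: "'a \<Rightarrow> 'c::real_normed_vector"
    and B :: "'b \<Rightarrow> 'c \<Rightarrow> 'd::real_normed_vector"
  assumes B: "bounded_bilinear B" and "smooth f" "smooth g"
  shows "smooth (\<lambda>x. B (f x) (g x))"
proof (rule smooth_coinduct[where Q="smooth_products B"])
  show "smooth_products B (\<lambda>x. B (f x) (g x))" by (rule prod) fact+
next
  fix h :: "'a \<Rightarrow> 'd" assume "smooth_products B h" then show "continuous_on UNIV h"
    by induction (auto intro!: continuous_on_add bounded_bilinear.continuous_on[OF B] dest: smooth_continuous)
next
  fix h :: "'a \<Rightarrow> 'd" and b :: 'a assume "smooth_products B h" and b: "b \<in> Basis"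
  then show "\<exists>g'. smooth_products B g' \<and> (\<forall>x. ((\<lambda>s::real. h (x + s *\<^sub>R b)) has_vector_derivative g' x) (at 0))"
  proof induction
    case (prod f g)
    then show ?case using smooth_bilinear_deriv[OF B prod(1,2) b]
      by (intro exI[of _ "\<lambda>x. B (f x) (dir_deriv b g x) + B (dir_deriv b f x) (g x)"])
         (auto intro!: smooth_products.intros smooth_dir_deriv b)
  next
    case (add h k)
    then obtain h' k' where "smooth_products B h'" "\<forall>x. ((\<lambda>s::real. h (x + s *\<^sub>R b)) has_vector_derivative h' x) (at 0)"
        "smooth_products B k'" "\<forall>x. ((\<lambda>s::real. k (x + s *\<^sub>R b)) has_vector_derivative k' x) (at 0)" by auto
    then show ?case
      by (intro exI[of _ "\<lambda>x. h' x + k' x"]) (auto intro!: smooth_products.intros has_vector_derivative_add)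
  qed
qed

lemmas smooth_mult = smooth_bilinear[OF bounded_bilinear_mult]
lemmas dir_deriv_mult = dir_deriv_bilinear[OF bounded_bilinear_mult]
lemmas smooth_cnj = smooth_linear(1)[OF bounded_linear_cnj]
lemmas dir_deriv_cnj = smooth_linear(2)[OF bounded_linear_cnj]
lemmas smooth_of_real = smooth_linear(1)[OF bounded_linear_of_real]

lemma smooth_cmult: fixes f :: "'a::euclidean_space \<Rightarrow> 'b::real_normed_algebra"
  assumes "smooth f"
  shows "smooth (\<lambda>x. c * f x)" "b \<in> Basis \<Longrightarrow> dir_deriv b (\<lambda>x. c * f x) = (\<lambda>x. c * dir_deriv b f x)"
  using smooth_linear[OF bounded_linear_mult_right assms] by auto

lemma smooth_minus:
  fixes f :: "'a::euclidean_space \<Rightarrow> 'b::real_normed_vector"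
  assumes "smooth f"
  shows "smooth (\<lambda>x. - f x)" "b \<in> Basis \<Longrightarrow> dir_deriv b (\<lambda>x. - f x) = (\<lambda>x. - dir_deriv b f x)"
  using smooth_linear[OF bounded_linear_minus[OF bounded_linear_ident] assms] by auto

lemma smooth_diff:
  fixes f g :: "'a::euclidean_space \<Rightarrow> 'b::real_normed_vector"
  assumes "smooth f" "smooth g"
  shows "smooth (\<lambda>x. f x - g x)"
    and "b \<in> Basis \<Longrightarrow> dir_deriv b (\<lambda>x. f x - g x) = (\<lambda>x. dir_deriv b f x - dir_deriv b g x)"
  using smooth_add[OF assms(1) smooth_minus(1)[OF assms(2)]] smooth_minus(2)[OF assms(2)] by auto

lemma smooth_sum:
  fixes f :: "'i \<Rightarrow> 'a::euclidean_space \<Rightarrow> 'b::real_normed_vector"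
  assumes "\<And>i. i \<in> I \<Longrightarrow> smooth (f i)"
  shows "smooth (\<lambda>x. \<Sum>i\<in>I. f i x)"
    and "b \<in> Basis \<Longrightarrow> dir_deriv b (\<lambda>x. \<Sum>i\<in>I. f i x) = (\<lambda>x. \<Sum>i\<in>I. dir_deriv b (f i) x)"
proof -
  have "smooth (\<lambda>x. \<Sum>i\<in>I. f i x) \<and>
    (b \<in> Basis \<longrightarrow> dir_deriv b (\<lambda>x. \<Sum>i\<in>I. f i x) = (\<lambda>x. \<Sum>i\<in>I. dir_deriv b (f i) x))"
    using assms by (induction I rule: infinite_finite_induct) (auto simp: smooth_add)
  then show "smooth (\<lambda>x. \<Sum>i\<in>I. f i x)"
     "b \<in> Basis \<Longrightarrow> dir_deriv b (\<lambda>x. \<Sum>i\<in>I. f i x) = (\<lambda>x. \<Sum>i\<in>I. dir_deriv b (f i) x)" by auto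
qed

lemma smooth_inner_left:
  shows "smooth (\<lambda>x::'a::euclidean_space. x \<bullet> c)" "dir_deriv b (\<lambda>x::'a. x \<bullet> c) = (\<lambda>x. b \<bullet> c)"
proof -
  have d: "((\<lambda>s::real. (x + s *\<^sub>R b) \<bullet> c) has_vector_derivative b \<bullet> c) (at 0)" for x b :: 'a
    unfolding has_real_derivative_iff_has_vector_derivative[symmetric]
    by (auto simp: inner_add_left intro!: derivative_eq_intros)
  show "smooth (\<lambda>x::'a::euclidean_space. x \<bullet> c)"
  \<comment> \<open>One derivative already leads to a constant, so the class only has to add the
    function itself to the smooth ones.\<close>
  proof (rule smooth_coinduct[where Q="\<lambda>f. f = (\<lambda>x. x \<bullet> c) \<or> smooth f"])
    fix g :: "'a \<Rightarrow> real" and b :: 'a assume "g = (\<lambda>x. x \<bullet> c) \<or> smooth g" "b \<in> Basis"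
    then consider "g = (\<lambda>x. x \<bullet> c)" | "smooth g" by blast
    then show "\<exists>g'. (g' = (\<lambda>x. x \<bullet> c) \<or> smooth g') \<and>
      (\<forall>x. ((\<lambda>s::real. g (x + s *\<^sub>R b)) has_vector_derivative g' x) (at 0))"
    proof cases
      case 2 then show ?thesis
        using smooth_dir_deriv smooth_has_derivative0 \<open>b \<in> Basis\<close> by blast
    next
      case 1 then show ?thesis
        using d[of _ b] by (intro exI[of _ "\<lambda>x. b \<bullet> c"]) auto
    qed
  qed (auto intro: continuous_intros dest: smooth_continuous)
  show "dir_deriv b (\<lambda>x::'a. x \<bullet> c) = (\<lambda>x. b \<bullet> c)" by (rule dir_derivI) (rule d)
qed

lemma dir_deriv_compose_real:
  fixes l :: "'a::euclidean_space \<Rightarrow> real" and h :: "real \<Rightarrow> 'b::real_normed_vector"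
  assumes h: "smooth h" and l: "smooth l" and b: "b \<in> Basis"
  shows "((\<lambda>s::real. h (l (x + s *\<^sub>R b))) has_vector_derivative dir_deriv b l x *\<^sub>R dir_deriv 1 h (l x)) (at 0)"
proof -
  have "((\<lambda>s. h (0 + s *\<^sub>R 1)) has_vector_derivative dir_deriv 1 h (0 + l x *\<^sub>R 1)) (at (l x))"
    by (rule smooth_has_derivative[OF h]) simp
  then have "(h has_vector_derivative dir_deriv 1 h (l x)) (at (l (x + 0 *\<^sub>R b)))" by simp
  from vector_diff_chain_at[OF smooth_has_derivative0[OF l b] this] show ?thesis
    by (simp add: o_def)
qed

text \<open>The chain rule puts a derivative of \<open>l\<close> in front of the derivative of
  \<open>h\<close>, and later derivatives hit that factor too; the free smooth coefficient
  \<open>c\<close> keeps the class closed.\<close>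

inductive smooth_composites :: "('a::euclidean_space \<Rightarrow> real) \<Rightarrow> ('a \<Rightarrow> 'b::real_normed_vector) \<Rightarrow> bool"
  for l where comp: "smooth c \<Longrightarrow> smooth h \<Longrightarrow> smooth_composites l (\<lambda>x. c x *\<^sub>R h (l x))"
  | add: "smooth_composites l h \<Longrightarrow> smooth_composites l k \<Longrightarrow> smooth_composites l (\<lambda>x. h x + k x)"

lemma smooth_compose_real:
  fixes h :: "real \<Rightarrow> 'b::real_normed_vector" and l :: "'a::euclidean_space \<Rightarrow> real"
  assumes "smooth h" and l: "smooth l"
  shows "smooth (\<lambda>x. h (l x))"
proof (rule smooth_coinduct[where Q="smooth_composites l"])
  show "smooth_composites l (\<lambda>x. h (l x))"
    using smooth_composites.comp[OF smooth_const assms(1), of l 1] by simp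
next
  fix g :: "'a \<Rightarrow> 'b" assume "smooth_composites l g" then show "continuous_on UNIV g"
  proof induction
    case (comp c h)
    show ?case
      by (intro continuous_on_scaleR smooth_continuous[OF comp(1)]
          continuous_on_compose2[OF smooth_continuous[OF comp(2)] smooth_continuous[OF l]]) auto
  qed (auto intro!: continuous_on_add)
next
  fix g :: "'a \<Rightarrow> 'b" and b :: 'a assume "smooth_composites l g" and b: "b \<in> Basis"
  then show "\<exists>g'. smooth_composites l g' \<and> (\<forall>x. ((\<lambda>s::real. g (x + s *\<^sub>R b)) has_vector_derivative g' x) (at 0))"
  proof induction
    case (comp c h)
    have "((\<lambda>s::real. c (x + s *\<^sub>R b) *\<^sub>R h (l (x + s *\<^sub>R b))) has_vector_derivative
       (c x * dir_deriv b l x) *\<^sub>R dir_deriv 1 h (l x) + dir_deriv b c x *\<^sub>R h (l x)) (at 0)" for x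
      using bounded_bilinear.has_vector_derivative[OF bounded_bilinear_scaleR
         smooth_has_derivative0[OF comp(1) b, of x] dir_deriv_compose_real[OF comp(2) l b, of x]] by simp
    then show ?case using comp l b
      by (intro exI[of _ "\<lambda>x. (c x * dir_deriv b l x) *\<^sub>R dir_deriv 1 h (l x) + dir_deriv b c x *\<^sub>R h (l x)"])
        (auto intro!: smooth_composites.intros smooth_dir_deriv smooth_mult)
  next
    case (add h k)
    then obtain h' k' where "smooth_composites l h'" "\<forall>x. ((\<lambda>s::real. h (x + s *\<^sub>R b)) has_vector_derivative h' x) (at 0)"
        "smooth_composites l k'" "\<forall>x. ((\<lambda>s::real. k (x + s *\<^sub>R b)) has_vector_derivative k' x) (at 0)" by auto
    then show ?case
      by (intro exI[of _ "\<lambda>x. h' x + k' x"]) (auto intro!: smooth_composites.intros has_vector_derivative_add)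
  qed
qed

text \<open>Needed for the smooth step, which is available only as a primitive: \<open>h\<close>
  together with all smooth functions forms a class closed under differentiation.\<close>

lemma smooth_real_iff_deriv:
  fixes h :: "real \<Rightarrow> 'b::real_normed_vector"
  assumes "\<And>x. (h has_vector_derivative h' x) (at x)" "smooth h'"
  shows "smooth h" "dir_deriv 1 h = h'"
proof -
  have d: "((\<lambda>s::real. h (x + s *\<^sub>R 1)) has_vector_derivative h' x) (at 0)" for x
  proof -
    have "((\<lambda>s::real. x + s) has_vector_derivative 1) (at 0)"
      unfolding has_real_derivative_iff_has_vector_derivative[symmetric]
      by (auto intro!: derivative_eq_intros)
    from vector_diff_chain_at[OF this, of h "h' x"] show ?thesis
      using assms(1)[of x] by (simp add: o_def)
  qed
  have c: "continuous_on UNIV h"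
    by (meson assms(1) continuous_at_imp_continuous_on has_vector_derivative_continuous)
  show "smooth h"
  proof (rule smooth_coinduct[where Q="\<lambda>f. f = h \<or> smooth f"], goal_cases)
    case 1 show ?case by simp
  next
    case (2 g) then show ?case using c by (auto dest: smooth_continuous)
  next
    case (3 g b)
    then consider "g = h" | "smooth g" by blast
    then show ?case
    proof cases
      case 2 then show ?thesis
        using smooth_dir_deriv smooth_has_derivative0 \<open>b \<in> Basis\<close> by blast
    next
      case 1 then show ?thesis
        using d assms(2) \<open>b \<in> Basis\<close> by (intro exI[of _ h']) auto
    qed
  qed
  show "dir_deriv 1 h = h'" by (rule dir_derivI) (rule d)
qed

subsection \<open>Commuting derivatives\<close>

text \<open>The second difference is symmetric in \<open>a\<close> and \<open>b\<close>, while two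
  mean value steps, first along \<open>a\<close> and then along \<open>b\<close>, turn it into h^2
  times one mixed derivative near \<open>x\<close>. Exchanging the directions yields the other mixed
  derivative at another nearby point.\<close>

lemma mixed_difference_mvt:
  fixes f :: "'a::euclidean_space \<Rightarrow> real"
  assumes f: "smooth f" and a: "a \<in> Basis" and b: "b \<in> Basis" and h: "h > 0"
  shows "\<exists>p. dist p x \<le> 2 * h \<and>
    f (x + h *\<^sub>R a + h *\<^sub>R b) - f (x + h *\<^sub>R a) - f (x + h *\<^sub>R b) + f x = h * h * dir_deriv b (dir_deriv a f) p"
proof -
  let ?g = "\<lambda>s. f ((x + h *\<^sub>R b) + s *\<^sub>R a) - f (x + s *\<^sub>R a)"
  have dg: "(?g has_real_derivative (dir_deriv a f ((x + h *\<^sub>R b) + s *\<^sub>R a) - dir_deriv a f (x + s *\<^sub>R a))) (at s)" for s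
    using smooth_has_derivative[OF f a] unfolding has_real_derivative_iff_has_vector_derivative[symmetric]
    by (intro DERIV_diff) auto
  obtain s where s: "0 < s" "s < h" "?g h - ?g 0 = (h - 0) * (dir_deriv a f ((x + h *\<^sub>R b) + s *\<^sub>R a) - dir_deriv a f (x + s *\<^sub>R a))"
    using MVT2[OF h, of ?g, OF dg] by blast
  let ?k = "\<lambda>r. dir_deriv a f ((x + s *\<^sub>R a) + r *\<^sub>R b)"
  have dk: "(?k has_real_derivative (dir_deriv b (dir_deriv a f) ((x + s *\<^sub>R a) + r *\<^sub>R b))) (at r)" for r
    using smooth_has_derivative[OF smooth_dir_deriv[OF f a] b] unfolding has_real_derivative_iff_has_vector_derivative[symmetric]
    by auto
  obtain r where r: "0 < r" "r < h" "?k h - ?k 0 = (h - 0) * dir_deriv b (dir_deriv a f) ((x + s *\<^sub>R a) + r *\<^sub>R b)"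
    using MVT2[OF h, of ?k, OF dk] by blast
  have "dist ((x + s *\<^sub>R a) + r *\<^sub>R b) x = norm (s *\<^sub>R a + r *\<^sub>R b)"
    by (simp add: dist_norm algebra_simps)
  also have "\<dots> \<le> norm (s *\<^sub>R a) + norm (r *\<^sub>R b)" by (rule norm_triangle_ineq)
  also have "\<dots> \<le> 2 * h" using s r a b by simp
  finally show ?thesis using s(3) r(3)
    by (intro exI[of _ "(x + s *\<^sub>R a) + r *\<^sub>R b"]) (simp add: algebra_simps)
qed

lemma dir_deriv_commute_real:
  fixes f :: "'a::euclidean_space \<Rightarrow> real"
  assumes f: "smooth f" and a: "a \<in> Basis" and b: "b \<in> Basis"
  shows "dir_deriv b (dir_deriv a f) x = dir_deriv a (dir_deriv b f) x"
proof -
  \<comment> \<open>Equal values of the two mixed derivatives at points p and q that both approach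
    x; continuity of both derivatives carries the equality to x.\<close>
  have "\<forall>n. \<exists>p q. dist p x \<le> 2 * (1 / real (Suc n)) \<and> dist q x \<le> 2 * (1 / real (Suc n)) \<and>
     dir_deriv b (dir_deriv a f) p = dir_deriv a (dir_deriv b f) q"
  proof
    fix n
    let ?h = "1 / real (Suc n)"
    have h: "?h > 0" by simp
    obtain p where p: "dist p x \<le> 2 * ?h" "f (x + ?h *\<^sub>R a + ?h *\<^sub>R b) - f (x + ?h *\<^sub>R a) - f (x + ?h *\<^sub>R b) + f x = ?h * ?h * dir_deriv b (dir_deriv a f) p"
      using mixed_difference_mvt[OF f a b h] by blast
    obtain q where q: "dist q x \<le> 2 * ?h" "f (x + ?h *\<^sub>R b + ?h *\<^sub>R a) - f (x + ?h *\<^sub>R b) - f (x + ?h *\<^sub>R a) + f x = ?h * ?h * dir_deriv a (dir_deriv b f) q"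
      using mixed_difference_mvt[OF f b a h] by blast
    have "?h * ?h * dir_deriv b (dir_deriv a f) p = ?h * ?h * dir_deriv a (dir_deriv b f) q"
      using p(2) q(2) by (simp add: algebra_simps)
    then have "dir_deriv b (dir_deriv a f) p = dir_deriv a (dir_deriv b f) q" using h by simp
    then show "\<exists>p q. dist p x \<le> 2 * ?h \<and> dist q x \<le> 2 * ?h \<and>
     dir_deriv b (dir_deriv a f) p = dir_deriv a (dir_deriv b f) q" using p(1) q(1) by blast
  qed
  then obtain p q where pq: "\<And>n. dist (p n) x \<le> 2 * (1 / real (Suc n))" "\<And>n. dist (q n) x \<le> 2 * (1 / real (Suc n))"
     "\<And>n. dir_deriv b (dir_deriv a f) (p n) = dir_deriv a (dir_deriv b f) (q n)" by metis
  have z: "(\<lambda>n. 2 * (1 / real (Suc n))) \<longlonglongrightarrow> 0"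
    using tendsto_mult_right_zero[OF LIMSEQ_inverse_real_of_nat, of 2] by (simp add: inverse_eq_divide)
  have p: "p \<longlonglongrightarrow> x" and q: "q \<longlonglongrightarrow> x"
    using pq(1,2) by (auto intro!: metric_tendsto_imp_tendsto[OF z, of _ x] always_eventually simp: abs_of_nonneg simp del: of_nat_Suc)
  have c: "continuous_on UNIV (dir_deriv b (dir_deriv a f))" "continuous_on UNIV (dir_deriv a (dir_deriv b f))"
    using f a b by (auto intro!: smooth_continuous smooth_dir_deriv)
  have "(\<lambda>n. dir_deriv b (dir_deriv a f) (p n)) \<longlonglongrightarrow> dir_deriv b (dir_deriv a f) x"
    using continuous_on_tendsto_compose[OF c(1) p] by simp
  moreover have "(\<lambda>n. dir_deriv a (dir_deriv b f) (q n)) \<longlonglongrightarrow> dir_deriv a (dir_deriv b f) x"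
    using continuous_on_tendsto_compose[OF c(2) q] by simp
  ultimately show ?thesis using pq(3) LIMSEQ_unique by simp
qed

lemma dir_deriv_commute:
  fixes f :: "'a::euclidean_space \<Rightarrow> 'b::euclidean_space"
  assumes f: "smooth f" and a: "a \<in> Basis" and b: "b \<in> Basis"
  shows "dir_deriv b (dir_deriv a f) = dir_deriv a (dir_deriv b f)"
proof (rule ext, rule euclidean_eqI)
  fix x and c :: 'b assume "c \<in> Basis"
  have l: "bounded_linear (\<lambda>y::'b. y \<bullet> c)" by (rule bounded_linear_inner_left)
  have "dir_deriv b (dir_deriv a (\<lambda>x. f x \<bullet> c)) x = dir_deriv a (dir_deriv b (\<lambda>x. f x \<bullet> c)) x"
    by (rule dir_deriv_commute_real) (auto intro!: smooth_linear[OF l] assms)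
  then show "dir_deriv b (dir_deriv a f) x \<bullet> c = dir_deriv a (dir_deriv b f) x \<bullet> c"
    by (simp add: smooth_linear(2)[OF l] smooth_dir_deriv assms)
qed

lemma iter_deriv_dir_deriv:
  fixes f :: "'a::euclidean_space \<Rightarrow> 'b::euclidean_space"
  assumes f: "smooth f" and b: "b \<in> Basis" and bs: "set bs \<subseteq> Basis"
  shows "iter_deriv bs (dir_deriv b f) = dir_deriv b (iter_deriv bs f)"
  using bs by (induction bs) (auto intro!: dir_deriv_commute smooth_iter_deriv f b)

text \<open>Since basis derivatives commute, the first letter of one list can be pulled to the front
  of the other. This neutralizes the arbitrary order of differentiation inside
  \<open>multi_deriv\<close>.\<close>

lemma iter_deriv_mset:
  fixes f :: "'a::euclidean_space \<Rightarrow> 'b::euclidean_space"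
  assumes f: "smooth f" and "set bs \<subseteq> Basis" "mset bs = mset cs"
  shows "iter_deriv bs f = iter_deriv cs f"
  using assms(2,3)
proof (induction bs arbitrary: cs)
  case (Cons b bs)
  then have "b \<in> set cs" by (metis list.set_intros(1) set_mset_mset)
  then obtain c1 c2 where cs: "cs = c1 @ b # c2" by (meson split_list)
  have "set cs \<subseteq> Basis" using Cons.prems by (metis set_mset_mset)
  then have s: "set c1 \<subseteq> Basis" "set c2 \<subseteq> Basis" "b \<in> Basis" using cs by auto
  have "iter_deriv cs f = dir_deriv b (iter_deriv (c1 @ c2) f)"
    unfolding cs iter_deriv_append iter_deriv.simps
    by (rule iter_deriv_dir_deriv) (auto intro!: smooth_iter_deriv f s)
  moreover have "iter_deriv bs f = iter_deriv (c1 @ c2) f"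
    by (rule Cons.IH) (use Cons.prems cs in auto)
  ultimately show ?case by simp
qed simp

lemma Basis_vec_axis: "(Basis :: (real^'n::finite) set) = range (\<lambda>i. axis i 1)"
  by (auto simp: Basis_vec_def)

lemma axis_in_Basis [simp]: "axis i (1::real) \<in> Basis"
  by (simp add: axis_in_Basis_iff)

text \<open>The list selected by \<open>SOME\<close> in \<open>multi_deriv\<close> depends on the
  exponents alone, so one \<alpha> serves the whole family \<open>F\<close>. This uniformity carries
  the time-independent bounds on the potential over to iterated derivatives.\<close>

lemma iter_deriv_eq_multi_deriv_uniform:
  fixes F :: "'t \<Rightarrow> real^'n::finite \<Rightarrow> 'b::euclidean_space"
  assumes f: "\<And>t. smooth (F t)" and bs: "set bs \<subseteq> Basis"
  shows "\<exists>\<alpha>. (\<Sum>i\<in>UNIV. \<alpha> i) = length bs \<and> (\<forall>t. iter_deriv bs (F t) = multi_deriv \<alpha> (F t))"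
proof -
  obtain "is" :: "'n list" where iss: "bs = map (\<lambda>i. axis i 1) is"
  proof -
    have "\<exists>is :: 'n list. bs = map (\<lambda>i. axis i 1) is"
      using bs by (induction bs) (auto simp: Basis_vec_axis, metis list.simps(9))
    then show ?thesis using that by blast
  qed
  \<comment> \<open>Exactly the list that \<open>multi_deriv\<close> selects for the exponents
    \<open>count_list is\<close>; equal counts mean equal multisets.\<close>
  define js where "js = (SOME js. \<forall>i. count_list js i = count_list is i)"
  have "\<forall>i. count_list js i = count_list is i" unfolding js_def by (rule someI[of _ "is"]) simp
  then have "mset is = mset js" by (intro multiset_eqI) (simp add: count_mset)
  then have "iter_deriv bs (F t) = iter_deriv (map (\<lambda>i. axis i 1) js) (F t)" for t
    unfolding iss by (intro iter_deriv_mset[OF f]) auto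
  moreover have "(\<Sum>i\<in>UNIV. count_list is i) = length is"
    by (rule sum_count_set) auto
  ultimately show ?thesis using iss
    by (intro exI[of _ "count_list is"] conjI allI) (simp_all add: multi_deriv_def js_def[symmetric])
qed

lemma iter_deriv_eq_multi_deriv:
  fixes f :: "real^'n::finite \<Rightarrow> 'b::euclidean_space"
  assumes "smooth f" "set bs \<subseteq> Basis"
  shows "\<exists>\<alpha>. (\<Sum>i\<in>UNIV. \<alpha> i) = length bs \<and> iter_deriv bs f = multi_deriv \<alpha> f"
  using iter_deriv_eq_multi_deriv_uniform[of "\<lambda>_::unit. f" bs, OF assms] by simp

section \<open>The weight and its convolution inequalities\<close>

text \<open>A product of one-dimensional Cauchy profiles rather than a power of the norm: integrals
  factor over coordinates, and in frequency 1 / \<open>wt\<close> is the symbol of the product of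
  the operators 1 - d^2/dx_b^2, so Fourier decay comes out in powers of \<open>wt\<close>.\<close>

definition wt :: "'a::euclidean_space \<Rightarrow> real" where
  "wt x = (\<Prod>b\<in>Basis. 1 / (1 + (x \<bullet> b)\<^sup>2))"

lemma one_plus_sq_pos [simp]: "0 < 1 + (a::real)\<^sup>2" "1 + (a::real)\<^sup>2 \<noteq> 0"
  by (auto simp: add_pos_nonneg add_nonneg_eq_0_iff)

lemma wt_pos [simp]: "0 < wt x" by (auto simp: wt_def intro!: prod_pos)

lemma wt_nonneg [simp]: "0 \<le> wt x" using wt_pos[of x] by linarith

lemma wt_nonzero [simp]: "wt x \<noteq> 0" using wt_pos[of x] by linarith

lemma wt_le_1: "wt x \<le> 1"
  unfolding wt_def by (rule prod_le_1) auto

lemma wt_minus [simp]: "wt (- x) = wt x" by (simp add: wt_def)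

lemma wt_commute: "wt (x - y) = wt (y - x)" using wt_minus[of "x - y"] by simp

lemma continuous_wt: "continuous_on S wt"
  unfolding wt_def by (auto intro!: continuous_intros)

lemma wt_measurable [measurable]: "wt \<in> borel_measurable borel"
  using continuous_wt[of UNIV] by (rule borel_measurable_continuous_onI)

text \<open>Peetre's inequality, with constant 2 in each coordinate. It trades a weight centred at
  one point for a weight centred at another, at the price of one factor in the displacement.\<close>

lemma wt_mult_le: "wt a * wt b \<le> 2 ^ DIM('a) * wt (a + b :: 'a::euclidean_space)"
proof -
  have s: "1 + (p + q)\<^sup>2 \<le> 2 * ((1 + p\<^sup>2) * (1 + q\<^sup>2))" for p q :: real
  proof -
    have "2 * ((1 + p\<^sup>2) * (1 + q\<^sup>2)) - (1 + (p + q)\<^sup>2) = 1 + (p - q)\<^sup>2 + 2 * (p\<^sup>2 * q\<^sup>2)"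
      by (simp add: power2_eq_square algebra_simps)
    moreover have "0 \<le> 1 + (p - q)\<^sup>2 + 2 * (p\<^sup>2 * q\<^sup>2)" by simp
    ultimately show ?thesis by linarith
  qed
  have "wt a * wt b = (\<Prod>i\<in>Basis. 1 / (1 + (a \<bullet> i)\<^sup>2) * (1 / (1 + (b \<bullet> i)\<^sup>2)))"
    unfolding wt_def prod.distrib ..
  also have "\<dots> \<le> (\<Prod>i\<in>Basis. 2 * (1 / (1 + ((a + b) \<bullet> i)\<^sup>2)))"
  proof (rule prod_mono, rule conjI)
    fix i :: 'a
    have "1 + ((a + b) \<bullet> i)\<^sup>2 \<le> 2 * ((1 + (a \<bullet> i)\<^sup>2) * (1 + (b \<bullet> i)\<^sup>2))"
      using s[of "a \<bullet> i" "b \<bullet> i"] by (simp add: inner_add_left)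
    moreover have "0 < (1 + (a \<bullet> i)\<^sup>2) * (1 + (b \<bullet> i)\<^sup>2)" by (intro mult_pos_pos) auto
    ultimately show "1 / (1 + (a \<bullet> i)\<^sup>2) * (1 / (1 + (b \<bullet> i)\<^sup>2)) \<le> 2 * (1 / (1 + ((a + b) \<bullet> i)\<^sup>2))"
      by (simp add: divide_simps del: mult_pos_pos) (simp add: mult.commute)?
  qed auto
  also have "\<dots> = 2 ^ DIM('a) * wt (a + b)"
    unfolding prod.distrib wt_def by (simp only: prod_constant)
  finally show ?thesis .
qed

lemma wt_mult_diff_le: "wt (a - c) * wt (b - c) \<le> 2 ^ DIM('a) * wt (a - b :: 'a::euclidean_space)"
  using wt_mult_le[of "a - c" "c - b"] by (simp add: wt_commute[of b c])

text \<open>The kernel decays in position and in the frequency shift, but coordinates moving with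
  the flow mix the two, because another frequency means another trajectory. For |s| <= T both decays
  together control the sheared displacement with a constant free of s.\<close>

lemma wt_shear:
  fixes a e :: "'a::euclidean_space"
  assumes "\<bar>s\<bar> \<le> T"
  shows "wt a * wt e \<le> (2 * (1 + T\<^sup>2)) ^ DIM('a) * wt (a - s *\<^sub>R e)"
proof -
  have c: "1 + (p - s * q)\<^sup>2 \<le> 2 * (1 + T\<^sup>2) * ((1 + p\<^sup>2) * (1 + q\<^sup>2))" for p q :: real
  proof -
    have "s\<^sup>2 \<le> T\<^sup>2" using assms by (metis abs_ge_zero power2_abs power_mono)
    have "2 * (1 + s\<^sup>2) * ((1 + p\<^sup>2) * (1 + q\<^sup>2)) - (1 + (p - s * q)\<^sup>2)
       = 1 + (p + s * q)\<^sup>2 + 2 * s\<^sup>2 + 2 * q\<^sup>2 + 2 * s\<^sup>2 * p\<^sup>2 + 2 * (p\<^sup>2 * q\<^sup>2) + 2 * s\<^sup>2 * p\<^sup>2 * q\<^sup>2"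
      by (simp add: power2_eq_square algebra_simps)
    then have "1 + (p - s * q)\<^sup>2 \<le> 2 * (1 + s\<^sup>2) * ((1 + p\<^sup>2) * (1 + q\<^sup>2))"
      by (smt (verit) mult_nonneg_nonneg zero_le_power2)
    also have "\<dots> \<le> 2 * (1 + T\<^sup>2) * ((1 + p\<^sup>2) * (1 + q\<^sup>2))"
      using \<open>s\<^sup>2 \<le> T\<^sup>2\<close> by (intro mult_right_mono) auto
    finally show ?thesis .
  qed
  have "wt a * wt e = (\<Prod>i\<in>Basis. 1 / (1 + (a \<bullet> i)\<^sup>2) * (1 / (1 + (e \<bullet> i)\<^sup>2)))"
    unfolding wt_def prod.distrib ..
  also have "\<dots> \<le> (\<Prod>i\<in>Basis. (2 * (1 + T\<^sup>2)) * (1 / (1 + ((a - s *\<^sub>R e) \<bullet> i)\<^sup>2)))"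
  proof (rule prod_mono, rule conjI)
    fix i :: 'a
    have "1 + ((a - s *\<^sub>R e) \<bullet> i)\<^sup>2 \<le> (2 * (1 + T\<^sup>2)) * ((1 + (a \<bullet> i)\<^sup>2) * (1 + (e \<bullet> i)\<^sup>2))"
      using c[of "a \<bullet> i" "e \<bullet> i"] by (simp add: inner_diff_left)
    moreover have "0 < 1 + T\<^sup>2" by simp
    ultimately show "1 / (1 + (a \<bullet> i)\<^sup>2) * (1 / (1 + (e \<bullet> i)\<^sup>2)) \<le> (2 * (1 + T\<^sup>2)) * (1 / (1 + ((a - s *\<^sub>R e) \<bullet> i)\<^sup>2))"
      by (simp add: divide_simps)
  qed auto
  also have "\<dots> = (2 * (1 + T\<^sup>2)) ^ DIM('a) * wt (a - s *\<^sub>R e)"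
    unfolding prod.distrib wt_def by (simp only: prod_constant power_mult_distrib)
  finally show ?thesis .
qed

lemma abs_inner_Basis_le_wt:
  fixes x :: "'a::euclidean_space"
  assumes "b \<in> Basis" shows "(1 + (x \<bullet> b)\<^sup>2) * wt x \<le> 1" and "\<bar>x \<bullet> b\<bar> * wt x \<le> 1"
proof -
  have "wt x = 1 / (1 + (x \<bullet> b)\<^sup>2) * (\<Prod>b\<in>Basis - {b}. 1 / (1 + (x \<bullet> b)\<^sup>2))"
    unfolding wt_def using assms by (subst prod.remove[of _ b]) auto
  then have "(1 + (x \<bullet> b)\<^sup>2) * wt x = (\<Prod>b\<in>Basis - {b}. 1 / (1 + (x \<bullet> b)\<^sup>2))"
    by simp
  also have "\<dots> \<le> 1" by (rule prod_le_1) auto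
  finally show *: "(1 + (x \<bullet> b)\<^sup>2) * wt x \<le> 1" .
  have "0 \<le> (\<bar>x \<bullet> b\<bar> - 1)\<^sup>2" by simp
  then have "\<bar>x \<bullet> b\<bar> \<le> 1 + (x \<bullet> b)\<^sup>2" unfolding power2_diff power2_abs using zero_le_power2[of "x \<bullet> b"] by simp
  then have "\<bar>x \<bullet> b\<bar> * wt x \<le> (1 + (x \<bullet> b)\<^sup>2) * wt x" by (intro mult_right_mono) auto
  from this * show "\<bar>x \<bullet> b\<bar> * wt x \<le> 1" by (rule order_trans)
qed

text \<open>Linear growth costs one power of the weight. This is why a potential with bounded
  gradient, recentred at \<open>x\<close>, fits under \<open>L / wt (y - x)\<close>.\<close>

lemma sum_abs_le_wt:
  fixes x :: "'a::euclidean_space"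
  shows "(1 + (\<Sum>b\<in>Basis. \<bar>x \<bullet> b\<bar>)) * wt x \<le> 1 + DIM('a)"
proof -
  have "(\<Sum>b\<in>Basis. \<bar>x \<bullet> b\<bar> * wt x) \<le> (\<Sum>b\<in>(Basis::'a set). 1)"
    by (rule sum_mono) (rule abs_inner_Basis_le_wt)
  then show ?thesis using wt_le_1[of x] by (simp add: distrib_right sum_distrib_right)
qed

lemma wt_power_mono: "j \<le> k \<Longrightarrow> wt x ^ k \<le> wt x ^ j"
  by (rule power_decreasing) (auto intro: wt_le_1)

text \<open>Tonelli splits the integral into one-dimensional integrals of 1 / (1 + x^2), each
  finite.\<close>

lemma nn_integral_wt_finite: "(\<integral>\<^sup>+(x::'a::euclidean_space). ennreal (wt x) \<partial>lborel) < \<infinity>"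
proof -
  have "integrable lborel (\<lambda>x::real. inverse (1 + x\<^sup>2))"
    using integrable_inverse_1_plus_square by (simp add: set_integrable_def)
  then have 1: "(\<integral>\<^sup>+(x::real). ennreal (1 / (1 + x\<^sup>2)) \<partial>lborel) < \<infinity>"
    by (simp add: integrable_iff_bounded inverse_eq_divide)
  have "(\<integral>\<^sup>+(x::'a). ennreal (wt x) \<partial>lborel) = (\<integral>\<^sup>+(x::'a). (\<Prod>b\<in>Basis. ennreal (1 / (1 + (x \<bullet> b)\<^sup>2))) \<partial>lborel)"
    by (simp add: wt_def prod_ennreal)
  also have "\<dots> = (\<Prod>b\<in>(Basis::'a set). \<integral>\<^sup>+(x::real). ennreal (1 / (1 + x\<^sup>2)) \<partial>lborel)"
    by (rule nn_integral_lborel_prod) auto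
  also have "\<dots> < \<infinity>" using 1 by (simp add: less_top[symmetric] power_eq_top_ennreal)
  finally show ?thesis .
qed

lemma integrable_wt [simp]: "integrable lborel (wt :: 'a::euclidean_space \<Rightarrow> real)"
  using nn_integral_wt_finite by (simp add: integrable_iff_bounded)

section \<open>Translations and reflections of Lebesgue integrals, and integrands dominated by the
  weight\<close>

lemma lborel_integral_translate:
  fixes f :: "'a::euclidean_space \<Rightarrow> 'b::{banach, second_countable_topology}"
  assumes [measurable]: "f \<in> borel_measurable borel"
  shows "integral\<^sup>L lborel (\<lambda>x. f (c + x)) = integral\<^sup>L lborel f"
    and "integrable lborel (\<lambda>x. f (c + x)) \<longleftrightarrow> integrable lborel f"
proof -
  have m: "(+) c \<in> measurable lborel borel" by simp
  show "integral\<^sup>L lborel (\<lambda>x. f (c + x)) = integral\<^sup>L lborel f"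
    using integral_distr[OF m assms] by (simp add: lborel_distr_plus)
  show "integrable lborel (\<lambda>x. f (c + x)) \<longleftrightarrow> integrable lborel f"
    using integrable_distr_eq[OF m assms] by (simp add: lborel_distr_plus)
qed

lemma lborel_nn_integral_translate:
  fixes f :: "'a::euclidean_space \<Rightarrow> ennreal"
  assumes [measurable]: "f \<in> borel_measurable borel"
  shows "(\<integral>\<^sup>+x. f (c + x) \<partial>lborel) = (\<integral>\<^sup>+x. f x \<partial>lborel)"
  using nn_integral_distr[of "(+) c" lborel borel f] by (simp add: lborel_distr_plus)

lemma lborel_distr_uminus_euclidean: "distr lborel borel uminus = (lborel :: 'a::euclidean_space measure)"
  using lborel_affine[of "-1" "0::'a"] by (simp add: density_1)

lemma lborel_reflect:
  fixes c :: "'a::euclidean_space"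
  shows "distr lborel borel (\<lambda>x. c - x) = lborel"
proof -
  have "distr (distr lborel borel uminus) borel ((+) c) = distr lborel borel (\<lambda>x. c - x)"
    by (subst distr_distr) (auto simp: o_def)
  then show ?thesis by (simp add: lborel_distr_uminus_euclidean lborel_distr_plus)
qed

lemma lborel_integral_reflect:
  fixes f :: "'a::euclidean_space \<Rightarrow> 'b::{banach, second_countable_topology}"
  assumes [measurable]: "f \<in> borel_measurable borel"
  shows "integral\<^sup>L lborel (\<lambda>x. f (c - x)) = integral\<^sup>L lborel f"
    and "integrable lborel (\<lambda>x. f (c - x)) \<longleftrightarrow> integrable lborel f"
proof -
  have m: "(\<lambda>x. c - x) \<in> measurable lborel borel" by simp
  show "integral\<^sup>L lborel (\<lambda>x. f (c - x)) = integral\<^sup>L lborel f"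
    using integral_distr[OF m assms] by (simp add: lborel_reflect)
  show "integrable lborel (\<lambda>x. f (c - x)) \<longleftrightarrow> integrable lborel f"
    using integrable_distr_eq[OF m assms] by (simp add: lborel_reflect)
qed

lemma lborel_nn_integral_reflect:
  fixes f :: "'a::euclidean_space \<Rightarrow> ennreal"
  assumes [measurable]: "f \<in> borel_measurable borel"
  shows "(\<integral>\<^sup>+x. f (c - x) \<partial>lborel) = (\<integral>\<^sup>+x. f x \<partial>lborel)"
  using nn_integral_distr[of "(\<lambda>x. c - x)" lborel borel f] by (simp add: lborel_reflect)

lemma integrable_wt_translate [simp]:
  "integrable lborel (\<lambda>x::'a::euclidean_space. wt (c + x))"
  "integrable lborel (\<lambda>x::'a::euclidean_space. wt (x - c))"
  "integrable lborel (\<lambda>x::'a::euclidean_space. wt (c - x))"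
  using lborel_integral_translate(2)[of wt c] lborel_integral_translate(2)[of wt "- c"]
    lborel_integral_reflect(2)[of wt c] by simp_all

lemma integral_wt_translate [simp]:
  "(LINT x::'a::euclidean_space|lborel. wt (x - c)) = (LINT x::'a|lborel. wt x)"
  using lborel_integral_translate(1)[of "wt :: 'a \<Rightarrow> real" "- c"] by (simp add: algebra_simps)

lemma integrable_wt_bound:
  fixes f :: "'a::euclidean_space \<Rightarrow> 'b::{banach, second_countable_topology}"
  assumes "f \<in> borel_measurable borel" "\<And>x. norm (f x) \<le> M * wt (x - c)"
  shows "integrable lborel f"
proof (rule Bochner_Integration.integrable_bound[of _ "\<lambda>x. M * wt (x - c)"])
  show "AE x in lborel. norm (f x) \<le> norm (M * wt (x - c))"
    using assms(2) by (intro AE_I2) (metis abs_ge_self order_trans real_norm_def)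
qed (use assms in auto)

lemma norm_integral_wt_bound:
  fixes f :: "'a::euclidean_space \<Rightarrow> 'b::{banach, second_countable_topology}"
  assumes "f \<in> borel_measurable borel" "\<And>x. norm (f x) \<le> M * wt (x - c)"
  shows "norm (integral\<^sup>L lborel f) \<le> M * (LINT x::'a|lborel. wt x)"
proof -
  have "norm (integral\<^sup>L lborel f) \<le> (LINT x|lborel. M * wt (x - c))"
    by (rule Bochner_Integration.integral_norm_bound_integral[OF integrable_wt_bound[OF assms]]) (use assms in auto)
  then show ?thesis by simp
qed

section \<open>Parameter integrals\<close>

text \<open>Dominated convergence along sequences. Domination is asked for only near
  \<open>p0\<close>, because the majorants used later depend on the time interval or on the centre
  of the weight.\<close>

lemma isCont_parameter_integral:
  fixes f :: "'p::metric_space \<Rightarrow> 'a \<Rightarrow> 'b::{banach, second_countable_topology}"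
  assumes [measurable]: "\<And>p. f p \<in> borel_measurable M"
    and cont: "\<And>x. isCont (\<lambda>p. f p x) p0"
    and w: "integrable M w" and e: "e > 0" and bound: "\<And>p x. dist p p0 < e \<Longrightarrow> norm (f p x) \<le> w x"
  shows "isCont (\<lambda>p. integral\<^sup>L M (f p)) p0"
  unfolding continuous_at_sequentially
proof (intro allI impI)
  fix X assume X: "X \<longlonglongrightarrow> p0"
  then obtain N where N: "\<And>n. n \<ge> N \<Longrightarrow> dist (X n) p0 < e"
    using e unfolding lim_sequentially by blast
  have "(\<lambda>n. integral\<^sup>L M (f (X (n + N)))) \<longlonglongrightarrow> integral\<^sup>L M (f p0)"
  proof (rule integral_dominated_convergence[where w=w])
    show "AE x in M. (\<lambda>n. f (X (n + N)) x) \<longlonglongrightarrow> f p0 x"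
      using cont X LIMSEQ_ignore_initial_segment[OF X, of N] by (auto simp: continuous_at_sequentially o_def)
    show "AE x in M. norm (f (X (n + N)) x) \<le> w x" for n
      using bound[OF N] by (intro AE_I2) simp
  qed (use w in auto)
  then show "((\<lambda>p. integral\<^sup>L M (f p)) \<circ> X) \<longlonglongrightarrow> integral\<^sup>L M (f p0)"
    unfolding o_def by (rule LIMSEQ_offset)
qed

lemma vector_mvt_bound:
  fixes f :: "real \<Rightarrow> 'b::real_inner"
  assumes "\<And>t. t \<in> closed_segment a b \<Longrightarrow> (f has_vector_derivative f' t) (at t)"
    and "\<And>t. t \<in> closed_segment a b \<Longrightarrow> norm (f' t) \<le> B"
  shows "norm (f b - f a) \<le> B * \<bar>b - a\<bar>"
proof -
  have *: "norm (f y - f x) \<le> B * \<bar>y - x\<bar>" if "x < y" and d: "\<And>t. t \<in> {x..y} \<Longrightarrow> (f has_vector_derivative f' t) (at t)"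
    and bd: "\<And>t. t \<in> {x..y} \<Longrightarrow> norm (f' t) \<le> B" for x y
  proof -
    have "continuous_on {x..y} f"
      using d by (meson continuous_at_imp_continuous_on has_vector_derivative_continuous)
    then obtain t where t: "t \<in> {x<..<y}" "norm (f y - f x) \<le> norm ((y - x) *\<^sub>R f' t)"
      using mvt_general[OF \<open>x < y\<close>, of f "\<lambda>t h. h *\<^sub>R f' t"] d
      unfolding has_vector_derivative_def by (metis atLeastAtMost_iff less_eq_real_def)
    have "norm ((y - x) *\<^sub>R f' t) \<le> \<bar>y - x\<bar> * B"
      using bd[of t] t(1) by (auto intro!: mult_left_mono)
    with t(2) show ?thesis by (simp add: mult.commute)
  qed
  consider "a < b" | "a = b" | "b < a" by linarith
  then show ?thesis
  proof cases
    case 1 then show ?thesis using *[OF 1] assms by (simp add: closed_segment_eq_real_ivl)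
  next
    case 3 then show ?thesis using *[OF 3] assms by (simp add: closed_segment_eq_real_ivl norm_minus_commute abs_minus_commute)
  qed simp
qed

text \<open>The normalized first-order remainder tends to zero pointwise, and the mean value
  inequality turns the bound on the derivative into a majorant for it; dominated convergence
  concludes.\<close>

lemma has_vector_derivative_parameter_integral:
  fixes f :: "real \<Rightarrow> 'a \<Rightarrow> 'b::{real_inner, banach, second_countable_topology}"
  assumes int: "\<And>r. integrable M (f r)" and [measurable]: "f' r0 \<in> borel_measurable M"
    and d: "\<And>r x. \<bar>r - r0\<bar> < 1 \<Longrightarrow> ((\<lambda>r. f r x) has_vector_derivative f' r x) (at r)"
    and bd: "\<And>r x. \<bar>r - r0\<bar> < 1 \<Longrightarrow> norm (f' r x) \<le> w x"
    and w: "integrable M w"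
  shows "((\<lambda>r. integral\<^sup>L M (f r)) has_vector_derivative integral\<^sup>L M (f' r0)) (at r0)"
proof -
  have [measurable]: "f r \<in> borel_measurable M" for r using int[of r] by simp
  have int': "integrable M (f' r0)"
    by (rule Bochner_Integration.integrable_bound[OF w]) (use bd in \<open>auto intro!: AE_I2 intro: order_trans[OF _ abs_ge_self]\<close>)
  let ?R = "\<lambda>r x. (1 / norm (r - r0)) *\<^sub>R (f r x - (f r0 x + (r - r0) *\<^sub>R f' r0 x))"
  have eq: "(1 / norm (r - r0)) *\<^sub>R (integral\<^sup>L M (f r) - (integral\<^sup>L M (f r0) + (r - r0) *\<^sub>R integral\<^sup>L M (f' r0)))
     = integral\<^sup>L M (?R r)" for r
    using int int' by simp
  have "((\<lambda>r. integral\<^sup>L M (?R r)) \<longlongrightarrow> 0) (at r0)"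
    unfolding tendsto_at_iff_sequentially o_def
  proof (intro allI impI)
    fix X :: "nat \<Rightarrow> real" assume X0: "\<forall>i. X i \<in> UNIV - {r0}" and X: "X \<longlonglongrightarrow> r0"
    obtain N where N: "\<And>n. n \<ge> N \<Longrightarrow> \<bar>X n - r0\<bar> < 1"
      using X unfolding lim_sequentially dist_real_def by (meson zero_less_one)
    have "(\<lambda>n. integral\<^sup>L M (?R (X (n + N)))) \<longlonglongrightarrow> integral\<^sup>L M (\<lambda>x. 0)"
    proof (rule integral_dominated_convergence[where w="\<lambda>x. 2 * w x"])
      show "AE x in M. (\<lambda>n. ?R (X (n + N)) x) \<longlonglongrightarrow> 0"
      proof (rule AE_I2)
        fix x
        have "((\<lambda>r. ?R r x) \<longlongrightarrow> 0) (at r0)"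
          using d[of r0 x] unfolding has_vector_derivative_def has_derivative_within by simp
        then have "(\<lambda>n. ?R (X n) x) \<longlonglongrightarrow> 0"
          using X X0 unfolding tendsto_at_iff_sequentially o_def by auto
        then show "(\<lambda>n. ?R (X (n + N)) x) \<longlonglongrightarrow> 0" by (rule LIMSEQ_ignore_initial_segment)
      qed
      \<comment> \<open>One \<open>w\<close> comes from the difference quotient through the mean
        value inequality, the other from the linear term.\<close>
      show "AE x in M. norm (?R (X (n + N)) x) \<le> 2 * w x" for n
      proof (rule AE_I2)
        fix x
        let ?r = "X (n + N)"
        have r: "\<bar>?r - r0\<bar> < 1" using N by simp
        have "?r \<noteq> r0" using X0 by auto
        have seg: "\<bar>t - r0\<bar> < 1" if "t \<in> closed_segment r0 ?r" for t
          using that r by (auto simp: closed_segment_eq_real_ivl split: if_splits)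
        have "norm (f ?r x - f r0 x) \<le> w x * \<bar>?r - r0\<bar>"
          by (rule vector_mvt_bound[where f'="\<lambda>r. f' r x"]) (use d bd seg in auto)
        moreover have "norm ((?r - r0) *\<^sub>R f' r0 x) \<le> \<bar>?r - r0\<bar> * w x"
          using bd[of r0 x] by (auto intro!: mult_left_mono)
        ultimately have "norm (f ?r x - (f r0 x + (?r - r0) *\<^sub>R f' r0 x)) \<le> \<bar>?r - r0\<bar> * (2 * w x)"
          using norm_triangle_ineq4[of "f ?r x - f r0 x" "(?r - r0) *\<^sub>R f' r0 x"]
          by (simp only: diff_diff_eq) (simp add: algebra_simps)
        then show "norm (?R ?r x) \<le> 2 * w x" using \<open>?r \<noteq> r0\<close>
          by (simp only: norm_scaleR) (simp add: divide_le_eq mult.commute)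
      qed
    qed (use w in auto)
    then have "(\<lambda>n. integral\<^sup>L M (?R (X (n + N)))) \<longlonglongrightarrow> 0" by simp
    then show "(\<lambda>n. integral\<^sup>L M (?R (X n))) \<longlonglongrightarrow> 0" by (rule LIMSEQ_offset)
  qed
  moreover have "bounded_linear (\<lambda>h::real. h *\<^sub>R integral\<^sup>L M (f' r0))"
    by (rule bounded_linear_scaleR_left)
  ultimately show ?thesis
    unfolding has_vector_derivative_def has_derivative_within eq by simp
qed

text \<open>Common shape of the derivatives taken below: of \<open>fourier\<close> in frequency, and
  of the propagator in space and in time. The parameter enters only through a unimodular
  exponential, so the modulus of \<open>a x * c x\<close> is the majorant.\<close>

lemma has_vector_derivative_oscillatory_integral:
  fixes a :: "'a \<Rightarrow> real" and c :: "'a \<Rightarrow> complex"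
  assumes [measurable]: "a \<in> borel_measurable M" and c: "integrable M c" and ac: "integrable M (\<lambda>x. a x * c x)"
  shows "((\<lambda>r::real. LINT x|M. exp (\<i> * (r * a x)) * c x) has_vector_derivative
     (LINT x|M. \<i> * exp (\<i> * (r0 * a x)) * (a x * c x))) (at r0)"
proof (rule has_vector_derivative_parameter_integral[where w="\<lambda>x. cmod (a x * c x)" and f'="\<lambda>r x. \<i> * exp (\<i> * (r * a x)) * (a x * c x)"])
  have [measurable]: "c \<in> borel_measurable M" using c by auto
  show "integrable M (\<lambda>x. exp (\<i> * (r * a x)) * c x)" for r
    by (rule Bochner_Integration.integrable_bound[OF c]) (auto simp: norm_mult)
  show "(\<lambda>x. \<i> * exp (\<i> * (r0 * a x)) * (a x * c x)) \<in> borel_measurable M" by measurable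
  show "((\<lambda>r::real. exp (\<i> * (r * a x)) * c x) has_vector_derivative \<i> * exp (\<i> * (r * a x)) * (a x * c x)) (at r)" for r :: real and x
  proof -
    have "((\<lambda>z. exp (\<i> * (z * a x)) * c x) has_field_derivative \<i> * exp (\<i> * (complex_of_real r * a x)) * (a x * c x)) (at (complex_of_real r))"
      by (auto intro!: derivative_eq_intros simp: algebra_simps)
    from has_vector_derivative_real_field[OF this] show ?thesis by simp
  qed
  show "norm (\<i> * exp (\<i> * (r * a x)) * (a x * c x)) \<le> cmod (a x * c x)" for r :: real and x
    by (simp add: norm_mult)
  show "integrable M (\<lambda>x. cmod (a x * c x))" using ac by auto
qed

lemma wt_translate_le:
  fixes x c :: "'a::euclidean_space"
  assumes b: "b \<in> Basis" and r: "\<bar>r\<bar> < 1"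
  shows "wt ((x + r *\<^sub>R b) - c) \<le> 2 ^ (DIM('a) + 1) * wt (x - c)"
proof -
  have "wt (- (r *\<^sub>R b)) = 1 / (1 + r\<^sup>2)"
  proof -
    have "wt (r *\<^sub>R b) = (\<Prod>i\<in>Basis. if i = b then 1 / (1 + r\<^sup>2) else 1)"
      unfolding wt_def by (rule prod.cong) (use b in \<open>auto simp: inner_Basis\<close>)
    then show ?thesis using b by simp
  qed
  also have "r\<^sup>2 \<le> 1" using r by (simp add: abs_square_le_1)
  then have "1 / (1 + r\<^sup>2) \<ge> 1 / 2" by (simp add: field_simps add_pos_nonneg)
  finally have "1 / 2 \<le> wt (- (r *\<^sub>R b))" .
  then have "wt ((x + r *\<^sub>R b) - c) * (1 / 2) \<le> wt ((x + r *\<^sub>R b) - c) * wt (- (r *\<^sub>R b))"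
    by (rule mult_left_mono) auto
  also have "\<dots> \<le> 2 ^ DIM('a) * wt (x - c)"
    using wt_mult_le[of "(x + r *\<^sub>R b) - c" "- (r *\<^sub>R b)"] by (simp add: algebra_simps)
  finally show ?thesis by simp
qed

text \<open>Integration by parts without boundary terms: the integral of a translate of
  \<open>G\<close> does not depend on the translation, and its derivative in the translation
  parameter is the integral of \<open>G'\<close>.\<close>

lemma integral_dir_deriv_zero:
  fixes G :: "'a::euclidean_space \<Rightarrow> complex"
  assumes G: "integrable lborel G" and b: "b \<in> Basis"
    and d: "\<And>x. ((\<lambda>s::real. G (x + s *\<^sub>R b)) has_vector_derivative G' x) (at 0)"
    and [measurable]: "G \<in> borel_measurable borel" "G' \<in> borel_measurable borel"
    and bd: "\<And>x. cmod (G' x) \<le> M * wt (x - c)"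
  shows "integral\<^sup>L lborel G' = 0"
proof -
  have M: "0 \<le> M" using bd[of c] by (smt (verit) mult_neg_pos norm_ge_zero wt_pos)
  have "((\<lambda>r. LINT x|lborel. G (x + r *\<^sub>R b)) has_vector_derivative (LINT x|lborel. G' (x + 0 *\<^sub>R b))) (at 0)"
  proof (rule has_vector_derivative_parameter_integral[where w="\<lambda>x. M * (2 ^ (DIM('a) + 1) * wt (x - c))" and f'="\<lambda>r x. G' (x + r *\<^sub>R b)"])
    show "integrable lborel (\<lambda>x. G (x + r *\<^sub>R b))" for r
      using lborel_integral_translate(2)[of G "r *\<^sub>R b"] G by (simp add: add.commute)
    show "((\<lambda>r. G (x + r *\<^sub>R b)) has_vector_derivative G' (x + r *\<^sub>R b)) (at r)" for x r
      by (rule shift_vector_derivative) (rule d)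
    show "cmod (G' (x + r *\<^sub>R b)) \<le> M * (2 ^ (DIM('a) + 1) * wt (x - c))" if "\<bar>r - 0\<bar> < 1" for r x
      using order_trans[OF bd mult_left_mono[OF wt_translate_le[OF b, of r x c] M]] that by simp
  qed auto
  moreover have "(LINT x|lborel. G (x + r *\<^sub>R b)) = integral\<^sup>L lborel G" for r
    using lborel_integral_translate(1)[of G "r *\<^sub>R b"] by (simp add: add.commute)
  ultimately have "((\<lambda>r::real. integral\<^sup>L lborel G) has_vector_derivative integral\<^sup>L lborel G') (at 0)" by simp
  then show ?thesis
    using vector_derivative_unique_at has_vector_derivative_const by blast
qed

lemma integral_lborel_prod:
  fixes f :: "'a::euclidean_space \<Rightarrow> real \<Rightarrow> complex"
  assumes f: "\<And>b. b \<in> Basis \<Longrightarrow> integrable lborel (f b)"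
  shows "(LINT x|lborel. (\<Prod>b\<in>Basis. f b (x \<bullet> b))) = (\<Prod>b\<in>Basis. integral\<^sup>L lborel (f b))"
    and "integrable lborel (\<lambda>x. \<Prod>b\<in>Basis. f b (x \<bullet> b))"
proof -
  interpret product_sigma_finite "\<lambda>b::'a. lborel :: real measure" ..
  let ?h = "\<lambda>g::'a \<Rightarrow> real. \<Sum>b\<in>Basis. g b *\<^sub>R b"
  have [measurable]: "f b \<in> borel_measurable borel" if "b \<in> Basis" for b using f[OF that] by simp
  have m: "(\<lambda>x. \<Prod>b\<in>Basis. f b (x \<bullet> b)) \<in> borel_measurable borel"
    by (intro borel_measurable_prod) (auto intro!: measurable_compose[of _ borel borel "f _"])
  have h: "?h \<in> measurable (\<Pi>\<^sub>M b\<in>Basis. lborel) borel" by measurable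
  have s: "(\<Prod>b\<in>Basis. f b (?h g \<bullet> b)) = (\<Prod>b\<in>Basis. f b (g b))" for g
    by (rule prod.cong) auto
  show "(LINT x|lborel. (\<Prod>b\<in>Basis. f b (x \<bullet> b))) = (\<Prod>b\<in>Basis. integral\<^sup>L lborel (f b))"
    by (subst lborel_eq, subst integral_distr[OF h m]) (unfold s, rule product_integral_prod, use f in auto)
  show "integrable lborel (\<lambda>x. \<Prod>b\<in>Basis. f b (x \<bullet> b))"
    by (subst lborel_eq, subst integrable_distr_eq[OF h m]) (unfold s, rule product_integrable_prod, use f in auto)
qed

section \<open>Weighted bounds on derivatives and rapidly decreasing functions\<close>

text \<open>One weight governs all derivatives up to order \<open>N\<close>. Products then multiply
  the weights and lose only a numerical factor, and a shift of the function merely shifts the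
  weight.\<close>

primrec deriv_bound :: "nat \<Rightarrow> ('a \<Rightarrow> real) \<Rightarrow> ('a::euclidean_space \<Rightarrow> 'b::real_normed_vector) \<Rightarrow> bool" where
  "deriv_bound 0 w f \<longleftrightarrow> (\<forall>x. norm (f x) \<le> w x)"
| "deriv_bound (Suc N) w f \<longleftrightarrow> (\<forall>x. norm (f x) \<le> w x) \<and> (\<forall>b\<in>Basis. deriv_bound N w (dir_deriv b f))"

lemma deriv_boundD: "deriv_bound N w f \<Longrightarrow> norm (f x) \<le> w x"
  by (cases N) auto

lemma deriv_bound_mono: "deriv_bound N w f \<Longrightarrow> (\<And>x. w x \<le> v x) \<Longrightarrow> deriv_bound N v f"
  by (induction N arbitrary: f) (auto intro: order_trans)

lemma deriv_bound_le: "deriv_bound N w f \<Longrightarrow> m \<le> N \<Longrightarrow> deriv_bound m w f"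
proof (induction m arbitrary: f N)
  case 0 then show ?case by (auto dest: deriv_boundD)
next
  case (Suc m)
  then obtain N' where "N = Suc N'" by (cases N) auto
  with Suc show ?case by auto
qed

lemma deriv_bound_iter_deriv:
  assumes "\<And>bs x. set bs \<subseteq> Basis \<Longrightarrow> length bs \<le> N \<Longrightarrow> norm (iter_deriv bs f x) \<le> w x"
  shows "deriv_bound N w f"
  using assms
proof (induction N arbitrary: f)
  case 0 then show ?case using "0"[of "[]"] by simp
next
  case (Suc N)
  have "deriv_bound N w (dir_deriv b f)" if b: "b \<in> Basis" for b
  proof (rule Suc.IH)
    fix bs :: "'a list" and x assume "set bs \<subseteq> Basis" "length bs \<le> N"
    then show "norm (iter_deriv bs (dir_deriv b f) x) \<le> w x"
      using Suc.prems[of "bs @ [b]" x] b by (simp add: iter_deriv_append)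
  qed
  then show ?case using Suc.prems[of "[]"] by simp
qed

lemma deriv_bound_add:
  fixes f g :: "'a::euclidean_space \<Rightarrow> 'b::real_normed_vector"
  assumes "smooth f" "smooth g" "deriv_bound N w f" "deriv_bound N v g"
  shows "deriv_bound N (\<lambda>x. w x + v x) (\<lambda>x. f x + g x)"
  using assms
proof (induction N arbitrary: f g)
  case 0 then show ?case by (auto intro: order_trans[OF norm_triangle_ineq] add_mono)
next
  case (Suc N)
  have "norm (f x + g x) \<le> w x + v x" for x
    using Suc.prems by (intro order_trans[OF norm_triangle_ineq] add_mono) auto
  then show ?case
    using Suc by (auto simp: smooth_add(2) intro!: Suc.IH smooth_dir_deriv)
qed

lemma deriv_bound_minus:
  fixes f :: "'a::euclidean_space \<Rightarrow> 'b::real_normed_vector"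
  assumes "smooth f" "deriv_bound N w f"
  shows "deriv_bound N w (\<lambda>x. - f x)"
  using assms by (induction N arbitrary: f) (auto simp: smooth_minus(2) smooth_dir_deriv)

text \<open>Each differentiation doubles the number of products in the Leibniz expansion, whence the
  factor \<open>2 ^ N\<close>.\<close>

lemma deriv_bound_mult:
  fixes f g :: "'a::euclidean_space \<Rightarrow> 'b::real_normed_algebra"
  assumes "smooth f" "smooth g" "deriv_bound N w f" "deriv_bound N v g"
  shows "deriv_bound N (\<lambda>x. 2 ^ N * (w x * v x)) (\<lambda>x. f x * g x)"
  using assms
proof (induction N arbitrary: f g)
  case 0 then show ?case
    by (auto intro!: order_trans[OF norm_mult_ineq] mult_mono intro: order_trans[OF norm_ge_zero])
next
  case (Suc N)
  have n: "norm (f x * g x) \<le> w x * v x" "0 \<le> w x" "0 \<le> v x" for x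
    using Suc.prems by (auto intro!: order_trans[OF norm_mult_ineq] mult_mono intro: order_trans[OF norm_ge_zero])
  have "w x * v x \<le> 2 ^ Suc N * (w x * v x)" for x
    using mult_right_mono[of 1 "2 ^ Suc N" "w x * v x"] n[of x] one_le_power[of "2::real" "Suc N"]
    by (simp only: mult_1_left mult_nonneg_nonneg)
  then have "norm (f x * g x) \<le> 2 ^ Suc N * (w x * v x)" for x using n(1) order_trans by blast
  moreover have "deriv_bound N (\<lambda>x. 2 ^ Suc N * (w x * v x)) (dir_deriv b (\<lambda>x. f x * g x))" if b: "b \<in> Basis" for b
  proof -
    have d: "deriv_bound N w f" "deriv_bound N v g" "deriv_bound N w (dir_deriv b f)" "deriv_bound N v (dir_deriv b g)"
      using Suc.prems b deriv_bound_le[of "Suc N" _ _ N] by auto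
    have s: "smooth (dir_deriv b f)" "smooth (dir_deriv b g)" using Suc.prems b by (auto intro: smooth_dir_deriv)
    have "deriv_bound N (\<lambda>x. 2 ^ N * (w x * v x) + 2 ^ N * (w x * v x)) (dir_deriv b (\<lambda>x. f x * g x))"
      unfolding dir_deriv_mult[OF Suc.prems(1,2) b]
      by (rule deriv_bound_add) (use s d Suc.prems(1,2) in \<open>auto intro!: smooth_mult Suc.IH\<close>)
    then show ?thesis by (simp only: power_Suc mult.assoc mult_2 distrib_right)
  qed
  ultimately show ?case by simp
qed

lemma deriv_bound_linear:
  fixes f :: "'a::euclidean_space \<Rightarrow> 'b::real_normed_vector"
  assumes "smooth f" "deriv_bound N w f" "bounded_linear h" "\<And>y. norm (h y) \<le> norm y"
  shows "deriv_bound N w (\<lambda>x. h (f x))"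
  using assms(1,2)
  by (induction N arbitrary: f)
     (auto simp: smooth_linear(2)[OF assms(3)] smooth_dir_deriv intro: order_trans[OF assms(4)])

lemmas deriv_bound_cnj = deriv_bound_linear[OF _ _ bounded_linear_cnj, simplified]

lemma dir_deriv_translate: "dir_deriv b (\<lambda>x. f (x - c)) = (\<lambda>x. dir_deriv b f (x - c))"
  unfolding dir_deriv_def by (simp only: add_diff_eq[symmetric] diff_add_eq[symmetric] diff_conv_add_uminus ac_simps)

lemma deriv_bound_translate:
  "deriv_bound N w f \<Longrightarrow> deriv_bound N (\<lambda>x. w (x - c)) (\<lambda>x. f (x - c))"
  by (induction N arbitrary: f) (auto simp: dir_deriv_translate)

lemma smooth_translate:
  fixes f :: "'a::euclidean_space \<Rightarrow> 'b::real_normed_vector"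
  assumes "smooth f" shows "smooth (\<lambda>x. f (x - c))"
proof (rule smooth_coinduct[where Q="\<lambda>h. \<exists>f. smooth f \<and> h = (\<lambda>x. f (x - c))"])
  fix h :: "'a \<Rightarrow> 'b" assume "\<exists>f. smooth f \<and> h = (\<lambda>x. f (x - c))"
  then obtain f where f: "smooth f" "h = (\<lambda>x. f (x - c))" by auto
  show "continuous_on UNIV h" unfolding f(2)
    by (rule continuous_on_compose2[OF smooth_continuous[OF f(1)]]) (auto intro!: continuous_intros)
  fix b :: 'a assume b: "b \<in> Basis"
  have "((\<lambda>s::real. h (x + s *\<^sub>R b)) has_vector_derivative dir_deriv b f (x - c)) (at 0)" for x
    using smooth_has_derivative0[OF f(1) b, of "x - c"] by (simp add: f(2) algebra_simps)
  then show "\<exists>g'. (\<exists>f. smooth f \<and> g' = (\<lambda>x. f (x - c))) \<and> (\<forall>x. ((\<lambda>s::real. h (x + s *\<^sub>R b)) has_vector_derivative g' x) (at 0))"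
    using smooth_dir_deriv[OF f(1) b] by blast
qed (use assms in auto)

section \<open>Rapid decay in powers of the weight and closure properties of the Schwartz
  class\<close>

definition rapid :: "('a::euclidean_space \<Rightarrow> complex) \<Rightarrow> bool" where
  "rapid f \<longleftrightarrow> (\<forall>k. \<exists>M\<ge>0. \<forall>x. cmod (f x) \<le> M * wt x ^ k)"

lemma rapid_add:
  assumes "rapid f" "rapid g" shows "rapid (\<lambda>x. f x + g x)"
  unfolding rapid_def
proof
  fix k
  obtain M1 M2 where "M1 \<ge> 0" "\<forall>x. cmod (f x) \<le> M1 * wt x ^ k" "M2 \<ge> 0" "\<forall>x. cmod (g x) \<le> M2 * wt x ^ k"
    using assms unfolding rapid_def by metis
  then show "\<exists>M\<ge>0. \<forall>x. cmod (f x + g x) \<le> M * wt x ^ k"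
    by (intro exI[of _ "M1 + M2"]) (auto simp: distrib_right intro: order_trans[OF norm_triangle_ineq] add_mono)
qed

lemma rapid_bounded_mult:
  fixes f h :: "'a::euclidean_space \<Rightarrow> complex"
  assumes "rapid f" "\<And>x. cmod (h x) \<le> K" shows "rapid (\<lambda>x. h x * f x)"
  unfolding rapid_def
proof
  fix k
  have K: "0 \<le> K" using assms(2)[of 0] norm_ge_zero order_trans by blast
  obtain M where "M \<ge> 0" "\<forall>x. cmod (f x) \<le> M * wt x ^ k"
    using assms(1) unfolding rapid_def by metis
  then show "\<exists>M\<ge>0. \<forall>x. cmod (h x * f x) \<le> M * wt x ^ k"
    using K assms(2) by (intro exI[of _ "K * M"]) (auto simp: norm_mult mult.assoc intro!: mult_mono)
qed

lemma rapid_coord: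
  fixes f :: "'a::euclidean_space \<Rightarrow> complex"
  assumes "rapid f" "b \<in> Basis" shows "rapid (\<lambda>x. (x \<bullet> b) * f x)"
  unfolding rapid_def
proof
  fix k
  obtain M where M: "M \<ge> 0" "\<forall>x. cmod (f x) \<le> M * wt x ^ Suc k"
    using assms(1) unfolding rapid_def by metis
  have "cmod ((x \<bullet> b) * f x) \<le> M * wt x ^ k" for x
  proof -
    have "cmod ((x \<bullet> b) * f x) \<le> \<bar>x \<bullet> b\<bar> * (M * wt x ^ Suc k)"
      using M by (auto simp: norm_mult simp del: power_Suc intro!: mult_left_mono)
    also have "\<dots> = (\<bar>x \<bullet> b\<bar> * wt x) * (M * wt x ^ k)" by simp
    also have "\<dots> \<le> 1 * (M * wt x ^ k)"
      using M(1) abs_inner_Basis_le_wt(2)[OF assms(2)] by (intro mult_right_mono) auto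
    finally show ?thesis by simp
  qed
  then show "\<exists>M\<ge>0. \<forall>x. cmod ((x \<bullet> b) * f x) \<le> M * wt x ^ k" using M(1) by blast
qed

text \<open>The Schwartz class phrased with lists of basis vectors and powers of \<open>wt\<close>:
  a derivative of a member is seen to be a member by appending a letter to the list, and no
  multi-index has to be chosen.\<close>

definition schw :: "('a::euclidean_space \<Rightarrow> complex) \<Rightarrow> bool" where
  "schw f \<longleftrightarrow> smooth f \<and> (\<forall>bs. set bs \<subseteq> Basis \<longrightarrow> rapid (iter_deriv bs f))"

lemma schw_smooth: "schw f \<Longrightarrow> smooth f" by (simp add: schw_def)

lemma schw_rapid: "schw f \<Longrightarrow> rapid f"
  unfolding schw_def by (metis empty_subsetI iter_deriv.simps(1) list.set(1))

lemma schw_dir_deriv: assumes "schw f" "b \<in> Basis" shows "schw (dir_deriv b f)"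
  unfolding schw_def
proof (intro conjI allI impI)
  show "smooth (dir_deriv b f)" using assms by (auto intro: smooth_dir_deriv schw_smooth)
  fix bs :: "'a list" assume "set bs \<subseteq> Basis"
  then have "rapid (iter_deriv (bs @ [b]) f)" using assms unfolding schw_def by auto
  then show "rapid (iter_deriv bs (dir_deriv b f))" by (simp add: iter_deriv_append)
qed

text \<open>The companion of \<open>smooth_coinduct\<close>: the class contains all iterated
  derivatives, so rapid decay need only be checked for its members.\<close>

lemma schw_coinduct:
  assumes "Q f"
    and "\<And>g. Q g \<Longrightarrow> continuous_on UNIV g" and r: "\<And>g. Q g \<Longrightarrow> rapid g"
    and d: "\<And>g b. Q g \<Longrightarrow> b \<in> Basis \<Longrightarrow>
      \<exists>g'. Q g' \<and> (\<forall>x. ((\<lambda>s::real. g (x + s *\<^sub>R b)) has_vector_derivative g' x) (at 0))"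
  shows "schw f"
  unfolding schw_def
proof (intro conjI allI impI)
  show "smooth f" by (rule smooth_coinduct[where Q=Q]) (use assms in auto)
  fix bs :: "'a list" assume "set bs \<subseteq> Basis"
  then have "Q (iter_deriv bs f)"
  proof (induction bs)
    case (Cons b bs)
    then obtain g' where "Q g'" "\<forall>x. ((\<lambda>s::real. iter_deriv bs f (x + s *\<^sub>R b)) has_vector_derivative g' x) (at 0)"
      using d by (metis insert_subset list.simps(15))
    then show ?case using dir_derivI[of "iter_deriv bs f" b g'] by simp
  qed (use assms(1) in simp)
  then show "rapid (iter_deriv bs f)" by (rule r)
qed

lemma schw_has_derivative:
  "schw f \<Longrightarrow> b \<in> Basis \<Longrightarrow> ((\<lambda>s::real. f (x + s *\<^sub>R b)) has_vector_derivative dir_deriv b f x) (at 0)"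
  by (rule smooth_has_derivative0[OF schw_smooth])

lemma schw_continuous: "schw f \<Longrightarrow> continuous_on UNIV f"
  by (rule smooth_continuous[OF schw_smooth])

lemma schw_add:
  assumes "schw f" "schw g" shows "schw (\<lambda>x. f x + g x)"
proof (rule schw_coinduct[where Q="\<lambda>h. \<exists>(f :: 'a \<Rightarrow> complex) (g :: 'a \<Rightarrow> complex). schw f \<and> schw g \<and> h = (\<lambda>x. f x + g x)"])
  fix h :: "'a \<Rightarrow> complex" assume "\<exists>f g. schw f \<and> schw g \<and> h = (\<lambda>x. f x + g x)"
  then obtain f g :: "'a \<Rightarrow> complex" where h: "schw f" "schw g" "h = (\<lambda>x. f x + g x)" by auto
  show "continuous_on UNIV h" unfolding h(3) by (intro continuous_on_add schw_continuous h)
  show "rapid h" unfolding h(3) by (intro rapid_add schw_rapid h)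
  fix b :: 'a assume b: "b \<in> Basis"
  have "((\<lambda>s::real. h (x + s *\<^sub>R b)) has_vector_derivative dir_deriv b f x + dir_deriv b g x) (at 0)" for x
    unfolding h(3) by (intro has_vector_derivative_add schw_has_derivative h b)
  then show "\<exists>g'. (\<exists>f g. schw f \<and> schw g \<and> g' = (\<lambda>x. f x + g x)) \<and> (\<forall>x. ((\<lambda>s::real. h (x + s *\<^sub>R b)) has_vector_derivative g' x) (at 0))"
    using schw_dir_deriv[OF h(1) b] schw_dir_deriv[OF h(2) b] by blast
qed (use assms in auto)

lemma schw_cmult:
  assumes "schw f" shows "schw (\<lambda>x. c * f x)"
proof (rule schw_coinduct[where Q="\<lambda>h. \<exists>f. schw f \<and> h = (\<lambda>x. c * f x)"])
  fix h :: "'a \<Rightarrow> complex" assume "\<exists>f. schw f \<and> h = (\<lambda>x. c * f x)"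
  then obtain f where h: "schw f" "h = (\<lambda>x. c * f x)" by auto
  show "continuous_on UNIV h" unfolding h(2) by (intro continuous_on_mult_left schw_continuous h)
  show "rapid h" unfolding h(2) by (rule rapid_bounded_mult[OF schw_rapid[OF h(1)], of _ "cmod c"]) simp
  fix b :: 'a assume b: "b \<in> Basis"
  have "((\<lambda>s::real. h (x + s *\<^sub>R b)) has_vector_derivative c * dir_deriv b f x) (at 0)" for x
    unfolding h(2) by (intro has_vector_derivative_mult_right schw_has_derivative h b)
  then show "\<exists>g'. (\<exists>f. schw f \<and> g' = (\<lambda>x. c * f x)) \<and> (\<forall>x. ((\<lambda>s::real. h (x + s *\<^sub>R b)) has_vector_derivative g' x) (at 0))"
    using schw_dir_deriv[OF h(1) b] by blast
qed (use assms in auto)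

lemma schw_zero: "schw (\<lambda>x. 0)"
  by (rule schw_coinduct[where Q="\<lambda>f. f = (\<lambda>x. 0)"]) (auto simp: rapid_def)

lemma schw_sum: "(\<And>i. i \<in> I \<Longrightarrow> schw (f i)) \<Longrightarrow> schw (\<lambda>x. \<Sum>i\<in>I. f i x)"
proof (induction I rule: infinite_finite_induct)
  case (insert i I) then show ?case by (auto intro!: schw_add)
qed (auto intro: schw_zero)

text \<open>Differentiating x_c f leaves the extra term b_c f, so the closed class consists of the
  functions x_c f + g with both f and g Schwartz.\<close>

lemma schw_coord:
  fixes f :: "'a::euclidean_space \<Rightarrow> complex"
  assumes "schw f" and c: "c \<in> Basis" shows "schw (\<lambda>x. (x \<bullet> c) * f x)"
proof (rule schw_coinduct[where Q="\<lambda>h. \<exists>(f :: 'a \<Rightarrow> complex) (g :: 'a \<Rightarrow> complex). schw f \<and> schw g \<and> h = (\<lambda>x. (x \<bullet> c) * f x + g x)"])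
  fix h :: "'a \<Rightarrow> complex" assume "\<exists>(f :: 'a \<Rightarrow> complex) (g :: 'a \<Rightarrow> complex). schw f \<and> schw g \<and> h = (\<lambda>x. (x \<bullet> c) * f x + g x)"
  then obtain f g :: "'a \<Rightarrow> complex" where h: "schw f" "schw g" "h = (\<lambda>x. (x \<bullet> c) * f x + g x)" by auto
  show "continuous_on UNIV h" unfolding h(3)
    using schw_continuous[OF h(1)] schw_continuous[OF h(2)] by (intro continuous_intros)
  show "rapid h" unfolding h(3) by (intro rapid_add rapid_coord schw_rapid h c)
  fix b :: 'a assume b: "b \<in> Basis"
  have "((\<lambda>s::real. h (x + s *\<^sub>R b)) has_vector_derivative
     (x \<bullet> c) * dir_deriv b f x + ((b \<bullet> c) * f x + dir_deriv b g x)) (at 0)" for x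
  proof -
    have "((\<lambda>s::real. (x + s *\<^sub>R b) \<bullet> c) has_real_derivative b \<bullet> c) (at 0)"
      by (auto simp: inner_add_left intro!: derivative_eq_intros)
    then have "((\<lambda>s::real. complex_of_real ((x + s *\<^sub>R b) \<bullet> c)) has_vector_derivative complex_of_real (b \<bullet> c)) (at 0)"
      by (simp add: has_real_derivative_iff_has_vector_derivative has_vector_derivative_of_real)
    from has_vector_derivative_add[OF has_vector_derivative_mult[OF this schw_has_derivative[OF h(1) b, of x]] schw_has_derivative[OF h(2) b, of x]]
    show ?thesis unfolding h(3) by (simp add: add.assoc)
  qed
  moreover have "schw (dir_deriv b f)" "schw (\<lambda>x. (b \<bullet> c) * f x + dir_deriv b g x)"
    using h b by (auto intro!: schw_add schw_cmult schw_dir_deriv)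
  ultimately show "\<exists>g'. (\<exists>(f :: 'a \<Rightarrow> complex) (g :: 'a \<Rightarrow> complex). schw f \<and> schw g \<and> g' = (\<lambda>x. (x \<bullet> c) * f x + g x)) \<and> (\<forall>x. ((\<lambda>s::real. h (x + s *\<^sub>R b)) has_vector_derivative g' x) (at 0))"
    by (intro exI[of _ "\<lambda>x. (x \<bullet> c) * dir_deriv b f x + ((b \<bullet> c) * f x + dir_deriv b g x)"]) blast
next
  show "\<exists>(f' :: 'a \<Rightarrow> complex) (g :: 'a \<Rightarrow> complex). schw f' \<and> schw g \<and> (\<lambda>x. (x \<bullet> c) * f x) = (\<lambda>x. (x \<bullet> c) * f' x + g x)"
    using assms(1) schw_zero by (intro exI[of _ f] exI[of _ "\<lambda>x. 0"]) auto
qed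

lemma schw_modulate:
  fixes f :: "'a::euclidean_space \<Rightarrow> complex"
  assumes "schw f" shows "schw (\<lambda>x. exp (\<i> * complex_of_real (x \<bullet> k)) * f x)"
proof (rule schw_coinduct[where Q="\<lambda>h. \<exists>f. schw f \<and> h = (\<lambda>x. exp (\<i> * complex_of_real (x \<bullet> k)) * f x)"])
  fix h :: "'a \<Rightarrow> complex" assume "\<exists>f. schw f \<and> h = (\<lambda>x. exp (\<i> * complex_of_real (x \<bullet> k)) * f x)"
  then obtain f where h: "schw f" "h = (\<lambda>x. exp (\<i> * complex_of_real (x \<bullet> k)) * f x)" by auto
  show "continuous_on UNIV h" unfolding h(2)
    using schw_continuous[OF h(1)] by (intro continuous_intros)
  show "rapid h" unfolding h(2) by (rule rapid_bounded_mult[OF schw_rapid[OF h(1)], of _ 1]) simp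
  fix b :: 'a assume b: "b \<in> Basis"
  have "((\<lambda>s::real. h (x + s *\<^sub>R b)) has_vector_derivative
     exp (\<i> * complex_of_real (x \<bullet> k)) * (dir_deriv b f x + \<i> * (b \<bullet> k) * f x)) (at 0)" for x
  proof -
    have "((\<lambda>z. exp (\<i> * (complex_of_real (x \<bullet> k) + z * complex_of_real (b \<bullet> k)))) has_field_derivative
       exp (\<i> * (complex_of_real (x \<bullet> k) + complex_of_real 0 * complex_of_real (b \<bullet> k))) * (\<i> * (b \<bullet> k))) (at (complex_of_real 0))"
      by (auto intro!: derivative_eq_intros)
    from has_vector_derivative_mult[OF has_vector_derivative_real_field[OF this] schw_has_derivative[OF h(1) b, of x]]
    show ?thesis unfolding h(2) by (simp add: inner_add_left algebra_simps)
  qed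
  moreover have "schw (\<lambda>x. dir_deriv b f x + \<i> * (b \<bullet> k) * f x)"
    using h b by (auto intro!: schw_add schw_cmult schw_dir_deriv)
  ultimately show "\<exists>g'. (\<exists>f. schw f \<and> g' = (\<lambda>x. exp (\<i> * complex_of_real (x \<bullet> k)) * f x)) \<and> (\<forall>x. ((\<lambda>s::real. h (x + s *\<^sub>R b)) has_vector_derivative g' x) (at 0))"
    by (intro exI[of _ "\<lambda>x. exp (\<i> * complex_of_real (x \<bullet> k)) * (dir_deriv b f x + \<i> * (b \<bullet> k) * f x)"]) blast
qed (use assms in auto)

lemma rapid_translate: assumes "rapid f" shows "rapid (\<lambda>x. f (x - c))"
  unfolding rapid_def
proof
  fix k
  obtain M where M: "M \<ge> 0" "\<forall>x. cmod (f x) \<le> M * wt x ^ k"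
    using assms unfolding rapid_def by metis
  let ?K = "2 ^ DIM('a) / wt c"
  have "cmod (f (x - c)) \<le> (M * ?K ^ k) * wt x ^ k" for x
  proof -
    have "wt (x - c) \<le> ?K * wt x" using wt_mult_le[of "x - c" c] by (simp add: field_simps)
    then have "wt (x - c) ^ k \<le> ?K ^ k * wt x ^ k" unfolding power_mult_distrib[symmetric]
      by (intro power_mono) auto
    then have "M * wt (x - c) ^ k \<le> M * (?K ^ k * wt x ^ k)" using M(1) by (intro mult_left_mono) auto
    then show ?thesis using M(2)[rule_format, of "x - c"] by (simp only: mult.assoc)
  qed
  then show "\<exists>M\<ge>0. \<forall>x. cmod (f (x - c)) \<le> M * wt x ^ k"
    using M(1) by (intro exI[of _ "M * ?K ^ k"]) auto
qed

lemma schw_translate: assumes "schw f" shows "schw (\<lambda>x. f (x - c))"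
proof (rule schw_coinduct[where Q="\<lambda>h. \<exists>f. schw f \<and> h = (\<lambda>x. f (x - c))"])
  fix h :: "'a \<Rightarrow> complex" assume "\<exists>f. schw f \<and> h = (\<lambda>x. f (x - c))"
  then obtain f where h: "schw f" "h = (\<lambda>x. f (x - c))" by auto
  show "continuous_on UNIV h" unfolding h(2) by (rule smooth_continuous[OF smooth_translate[OF schw_smooth[OF h(1)]]])
  show "rapid h" unfolding h(2) by (rule rapid_translate[OF schw_rapid[OF h(1)]])
  fix b :: 'a assume b: "b \<in> Basis"
  have "((\<lambda>s::real. h (x + s *\<^sub>R b)) has_vector_derivative dir_deriv b f (x - c)) (at 0)" for x
    using schw_has_derivative[OF h(1) b, of "x - c"] by (simp add: h(2) algebra_simps)
  then show "\<exists>g'. (\<exists>f. schw f \<and> g' = (\<lambda>x. f (x - c))) \<and> (\<forall>x. ((\<lambda>s::real. h (x + s *\<^sub>R b)) has_vector_derivative g' x) (at 0))"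
    using schw_dir_deriv[OF h(1) b] by blast
qed (use assms in auto)

lemma schw_deriv_bound:
  assumes "schw f" shows "\<exists>M\<ge>0. deriv_bound N (\<lambda>x. M * wt x ^ k) f"
  using assms
proof (induction N arbitrary: f)
  case 0 then show ?case using schw_rapid unfolding rapid_def by fastforce
next
  case (Suc N)
  obtain M0 where M0: "M0 \<ge> 0" "\<forall>x. cmod (f x) \<le> M0 * wt x ^ k"
    using schw_rapid[OF Suc.prems] unfolding rapid_def by blast
  have "\<forall>b\<in>Basis. \<exists>M\<ge>0. deriv_bound N (\<lambda>x. M * wt x ^ k) (dir_deriv b f)"
    using Suc schw_dir_deriv by blast
  then obtain M where M: "\<And>b. b \<in> Basis \<Longrightarrow> M b \<ge> 0" "\<And>b. b \<in> Basis \<Longrightarrow> deriv_bound N (\<lambda>x. M b * wt x ^ k) (dir_deriv b f)"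
    by metis
  let ?M = "M0 + (\<Sum>b\<in>Basis. M b)"
  have s: "0 \<le> (\<Sum>b\<in>Basis. M b)" using M(1) by (rule sum_nonneg)
  have "deriv_bound (Suc N) (\<lambda>x. ?M * wt x ^ k) f"
    unfolding deriv_bound.simps
  proof (intro conjI allI ballI)
    show "cmod (f x) \<le> ?M * wt x ^ k" for x
      using order_trans[OF M0(2)[rule_format, of x] mult_right_mono[of M0 ?M "wt x ^ k"]] s by simp
    fix b :: 'a assume b: "b \<in> Basis"
    have "M b \<le> ?M" using member_le_sum[of b Basis M] b M(1) M0(1) by (auto intro: add_increasing)
    then show "deriv_bound N (\<lambda>x. ?M * wt x ^ k) (dir_deriv b f)"
      by (intro deriv_bound_mono[OF M(2)[OF b]] mult_right_mono) auto
  qed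
  then show ?case using s M0(1) by (intro exI[of _ ?M]) auto
qed

lemma wt_vec: "wt (x :: real^'n::finite) = (\<Prod>i\<in>UNIV. 1 / (1 + (x $ i)\<^sup>2))"
proof -
  have "inj (\<lambda>i::'n. axis i (1::real))" by (auto simp: inj_def axis_eq_axis)
  then show ?thesis unfolding wt_def Basis_vec_axis
    by (subst prod.reindex) (auto simp: inner_axis)
qed

text \<open>Passage from monomial weights to powers of 1 + x_i^2, one coordinate at a time. A new
  coordinate j uses the induction hypothesis twice, for \<beta> and for \<beta> raised by 2k at j,
  so the induction has to keep \<beta> arbitrary.\<close>

lemma schwartz_weighted_bound:
  fixes g :: "real^'n::finite \<Rightarrow> complex"
  assumes "\<And>\<beta> :: 'n \<Rightarrow> nat. \<exists>C. \<forall>x. \<bar>\<Prod>i\<in>UNIV. (x $ i) ^ \<beta> i\<bar> * cmod (g x) \<le> C" and "finite S"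
  shows "\<exists>C. \<forall>x. (\<Prod>i\<in>S. (1 + (x $ i)\<^sup>2) ^ k) * (\<bar>\<Prod>i\<in>UNIV. (x $ i) ^ \<beta> i\<bar> * cmod (g x)) \<le> C"
  using assms(2)
proof (induction S arbitrary: \<beta>)
  case empty then show ?case using assms(1) by simp
next
  case (insert j S)
  obtain C1 where C1: "\<And>x. (\<Prod>i\<in>S. (1 + (x $ i)\<^sup>2) ^ k) * (\<bar>\<Prod>i\<in>UNIV. (x $ i) ^ \<beta> i\<bar> * cmod (g x)) \<le> C1"
    using insert.IH[of \<beta>] by blast
  let ?\<beta> = "\<beta>(j := \<beta> j + 2 * k)"
  obtain C2 where C2: "\<And>x. (\<Prod>i\<in>S. (1 + (x $ i)\<^sup>2) ^ k) * (\<bar>\<Prod>i\<in>UNIV. (x $ i) ^ ?\<beta> i\<bar> * cmod (g x)) \<le> C2"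
    using insert.IH[of ?\<beta>] by blast
  have "(\<Prod>i\<in>insert j S. (1 + (x $ i)\<^sup>2) ^ k) * (\<bar>\<Prod>i\<in>UNIV. (x $ i) ^ \<beta> i\<bar> * cmod (g x)) \<le> 2 ^ k * (C1 + C2)" for x :: "real^'n"
  proof -
    let ?P = "(\<Prod>i\<in>S. (1 + (x $ i)\<^sup>2) ^ k)" and ?R = "\<bar>\<Prod>i\<in>UNIV. (x $ i) ^ \<beta> i\<bar> * cmod (g x)"
    have e: "(\<Prod>i\<in>UNIV. (x $ i) ^ ?\<beta> i) = (x $ j) ^ (2 * k) * (\<Prod>i\<in>UNIV. (x $ i) ^ \<beta> i)"
    proof -
      have "(\<Prod>i\<in>UNIV - {j}. (x $ i) ^ ?\<beta> i) = (\<Prod>i\<in>UNIV - {j}. (x $ i) ^ \<beta> i)" by (rule prod.cong) auto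
      then show ?thesis by (simp add: prod.remove[of UNIV j] power_add)
    qed
    \<comment> \<open>Splitting at x_j^2 = 1: the larger of the two summands on the left, doubled,
      dominates the base of the power.\<close>
    have a: "(1 + (x $ j)\<^sup>2) ^ k \<le> 2 ^ k * (1 + (x $ j) ^ (2 * k))"
    proof (cases "(x $ j)\<^sup>2 \<le> 1")
      case True
      then have "(1 + (x $ j)\<^sup>2) ^ k \<le> 2 ^ k" by (intro power_mono) auto
      also have "\<dots> \<le> 2 ^ k * (1 + (x $ j) ^ (2 * k))" by simp
      finally show ?thesis .
    next
      case False
      then have "(1 + (x $ j)\<^sup>2) ^ k \<le> (2 * (x $ j)\<^sup>2) ^ k" by (intro power_mono) auto
      also have "\<dots> \<le> 2 ^ k * (1 + (x $ j) ^ (2 * k))" by (simp add: power_mult_distrib power_mult)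
      finally show ?thesis .
    qed
    have P: "0 \<le> ?P" by (rule prod_nonneg) auto
    have "(\<Prod>i\<in>insert j S. (1 + (x $ i)\<^sup>2) ^ k) * ?R = (1 + (x $ j)\<^sup>2) ^ k * (?P * ?R)"
      using insert by (simp add: mult.assoc)
    also have "\<dots> \<le> (2 ^ k * (1 + (x $ j) ^ (2 * k))) * (?P * ?R)"
      using a P by (intro mult_right_mono) auto
    also have "\<dots> = 2 ^ k * (?P * ?R + ?P * (\<bar>\<Prod>i\<in>UNIV. (x $ i) ^ ?\<beta> i\<bar> * cmod (g x)))"
      unfolding e abs_mult by (simp add: algebra_simps power_mult)
    also have "\<dots> \<le> 2 ^ k * (C1 + C2)" using C1[of x] C2[of x] by (intro mult_left_mono add_mono) auto
    finally show ?thesis .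
  qed
  then show ?case by blast
qed

lemma schwartz_imp_schw:
  fixes f :: "real^'n::finite \<Rightarrow> complex"
  assumes "schwartz f" shows "schw f"
  unfolding schw_def
proof (intro conjI allI impI)
  show s: "smooth f" using assms by (simp add: schwartz_def)
  fix bs :: "(real^'n) list" assume "set bs \<subseteq> Basis"
  then obtain \<alpha> where \<alpha>: "iter_deriv bs f = multi_deriv \<alpha> f" using iter_deriv_eq_multi_deriv[OF s] by blast
  show "rapid (iter_deriv bs f)" unfolding rapid_def \<alpha>
  proof
    fix k
    have "\<exists>C. \<forall>x. \<bar>\<Prod>i\<in>UNIV. (x $ i) ^ \<beta> i\<bar> * cmod (multi_deriv \<alpha> f x) \<le> C" for \<beta> :: "'n \<Rightarrow> nat"
      using assms unfolding schwartz_def by blast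
    from schwartz_weighted_bound[OF this, of UNIV k "\<lambda>i. 0"]
    obtain C where C: "\<And>x. (\<Prod>i\<in>UNIV. (1 + (x $ i)\<^sup>2) ^ k) * cmod (multi_deriv \<alpha> f x) \<le> C" by auto
    have "cmod (multi_deriv \<alpha> f x) \<le> C * wt x ^ k" for x
    proof -
      have w: "wt x * (\<Prod>i\<in>UNIV. (1 + (x $ i)\<^sup>2)) = 1"
        unfolding wt_vec prod.distrib[symmetric] by simp
      have "cmod (multi_deriv \<alpha> f x) = (wt x * (\<Prod>i\<in>UNIV. (1 + (x $ i)\<^sup>2))) ^ k * cmod (multi_deriv \<alpha> f x)"
        unfolding w by simp
      also have "\<dots> = wt x ^ k * ((\<Prod>i\<in>UNIV. (1 + (x $ i)\<^sup>2) ^ k) * cmod (multi_deriv \<alpha> f x))"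
        by (simp add: power_mult_distrib prod_power_distrib)
      also have "\<dots> \<le> wt x ^ k * C" using C by (intro mult_left_mono) auto
      finally show ?thesis by (simp add: mult.commute)
    qed
    moreover from this[of 0] have "0 \<le> C"
      by (smt (verit) mult_neg_pos norm_ge_zero wt_pos zero_less_power)
    ultimately show "\<exists>M\<ge>0. \<forall>x. cmod (multi_deriv \<alpha> f x) \<le> M * wt x ^ k" by blast
  qed
qed

section \<open>The Fourier transform\<close>

lemma smooth_measurable [measurable_dest]:
  "smooth (f :: 'a::euclidean_space \<Rightarrow> 'b::euclidean_space) \<Longrightarrow> f \<in> borel_measurable borel"
  by (rule borel_measurable_continuous_onI) (rule smooth_continuous)

lemma schw_measurable [measurable_dest]: "schw f \<Longrightarrow> f \<in> borel_measurable borel"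
  by (rule borel_measurable_continuous_onI) (rule schw_continuous)

lemma rapid_wt_bound: assumes "rapid f" shows "\<exists>M\<ge>0. \<forall>x. cmod (f x) \<le> M * wt x"
  using assms unfolding rapid_def by (metis power_one_right)

lemma schw_integrable: "schw f \<Longrightarrow> integrable lborel f"
  using rapid_wt_bound[OF schw_rapid] integrable_wt_bound[of f _ 0] schw_measurable by fastforce

lemma integrable_exp_times [simp]:
  fixes f :: "'a::euclidean_space \<Rightarrow> complex"
  assumes "integrable lborel f" "a \<in> borel_measurable borel"
  shows "integrable lborel (\<lambda>x. f x * exp (\<i> * complex_of_real (a x)))"
    "integrable lborel (\<lambda>x. f x * exp (- \<i> * complex_of_real (a x)))"
    "integrable lborel (\<lambda>x. exp (\<i> * complex_of_real (a x)) * f x)"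
    "integrable lborel (\<lambda>x. exp (- (\<i> * complex_of_real (a x))) * f x)"
    "integrable lborel (\<lambda>x. f x * exp (- (\<i> * complex_of_real (a x))))"
  by (rule Bochner_Integration.integrable_bound[OF assms(1)], use assms in \<open>auto simp: norm_mult\<close>)+

lemma cmod_fourier_le:
  fixes f :: "real^'n::finite \<Rightarrow> complex"
  assumes "f \<in> borel_measurable borel" "\<And>x. cmod (f x) \<le> M * wt (x - c)"
  shows "cmod (fourier f \<xi>) \<le> M * (LINT x::real^'n|lborel. wt x)"
  unfolding fourier_def
  by (rule norm_integral_wt_bound) (use assms in \<open>auto simp: norm_mult\<close>)

lemma continuous_fourier:
  fixes f :: "real^'n::finite \<Rightarrow> complex"
  assumes "integrable lborel f" shows "continuous_on UNIV (fourier f)"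
proof (rule continuous_at_imp_continuous_on, rule ballI)
  fix \<xi> show "isCont (fourier f) \<xi>"
    unfolding fourier_def
  proof (rule isCont_parameter_integral[where w="\<lambda>x. cmod (f x)" and e=1])
    show "(\<lambda>x. f x * exp (- \<i> * complex_of_real (x \<bullet> p))) \<in> borel_measurable lborel" for p
      using assms by measurable
    show "isCont (\<lambda>p. f x * exp (- \<i> * complex_of_real (x \<bullet> p))) \<xi>" for x
      by (intro continuous_intros)
  qed (use assms in \<open>auto simp: norm_mult\<close>)
qed

lemma measurable_fourier [measurable (raw)]:
  fixes f :: "real^'n::finite \<Rightarrow> complex"
  shows "integrable lborel f \<Longrightarrow> fourier f \<in> borel_measurable borel"
  by (rule borel_measurable_continuous_onI) (rule continuous_fourier)

lemma fourier_add:
  fixes f g :: "real^'n::finite \<Rightarrow> complex"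
  assumes "integrable lborel f" "integrable lborel g"
  shows "fourier (\<lambda>x. f x + g x) \<xi> = fourier f \<xi> + fourier g \<xi>"
    and "fourier (\<lambda>x. f x - g x) \<xi> = fourier f \<xi> - fourier g \<xi>"
  unfolding fourier_def distrib_right left_diff_distrib
  by (intro Bochner_Integration.integral_add Bochner_Integration.integral_diff integrable_exp_times assms; measurable)+

lemma fourier_cmult:
  fixes f :: "real^'n::finite \<Rightarrow> complex"
  shows "fourier (\<lambda>x. c * f x) \<xi> = c * fourier f \<xi>"
  unfolding fourier_def by (simp add: mult.assoc)

lemma has_vector_derivative_character:
  fixes x k b :: "'a::euclidean_space"
  shows "((\<lambda>s::real. exp (- \<i> * complex_of_real ((x + s *\<^sub>R b) \<bullet> k))) has_vector_derivative
    - \<i> * (b \<bullet> k) * exp (- \<i> * complex_of_real (x \<bullet> k))) (at 0)"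
proof -
  have "((\<lambda>z. exp (- \<i> * (complex_of_real (x \<bullet> k) + z * complex_of_real (b \<bullet> k)))) has_field_derivative
       exp (- \<i> * (complex_of_real (x \<bullet> k) + complex_of_real 0 * complex_of_real (b \<bullet> k))) * (- \<i> * (b \<bullet> k))) (at (complex_of_real 0))"
    by (auto intro!: derivative_eq_intros)
  from has_vector_derivative_real_field[OF this] show ?thesis by (simp add: inner_add_left algebra_simps)
qed

text \<open>The derivative of \<open>h\<close> times the character integrates to zero, and its two
  Leibniz terms are the two sides. The weight may be centred anywhere, as needed for windows sitting
  far from the origin.\<close>

lemma fourier_dir_deriv:
  fixes h :: "real^'n::finite \<Rightarrow> complex"
  assumes h: "smooth h" and M: "deriv_bound 1 (\<lambda>x. M * wt (x - c)) h" and b: "b \<in> Basis"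
  shows "fourier (dir_deriv b h) \<xi> = \<i> * (\<xi> \<bullet> b) * fourier h \<xi>"
proof -
  let ?e = "\<lambda>x. exp (- \<i> * complex_of_real (x \<bullet> \<xi>))"
  note [measurable] = smooth_measurable[OF h] smooth_measurable[OF smooth_dir_deriv[OF h b]]
  have b0: "cmod (h x) \<le> M * wt (x - c)" and b1: "cmod (dir_deriv b h x) \<le> M * wt (x - c)" for x
    using M b by auto
  have i0: "integrable lborel h" and i1: "integrable lborel (dir_deriv b h)"
    using b0 b1 by (auto intro!: integrable_wt_bound)
  let ?G = "\<lambda>x. h x * ?e x" and ?G' = "\<lambda>x. h x * (- \<i> * (b \<bullet> \<xi>) * ?e x) + dir_deriv b h x * ?e x"
  have "integral\<^sup>L lborel ?G' = 0"
  proof (rule integral_dir_deriv_zero[where G="?G" and b=b and M="\<bar>b \<bullet> \<xi>\<bar> * M + M" and c=c])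
    show "((\<lambda>s::real. ?G (x + s *\<^sub>R b)) has_vector_derivative ?G' x) (at 0)" for x
      using has_vector_derivative_mult[OF smooth_has_derivative0[OF h b, of x] has_vector_derivative_character[of x b \<xi>]]
      by simp
    show "cmod (?G' x) \<le> (\<bar>b \<bullet> \<xi>\<bar> * M + M) * wt (x - c)" for x
    proof -
      have "cmod (?G' x) \<le> \<bar>b \<bullet> \<xi>\<bar> * cmod (h x) + cmod (dir_deriv b h x)"
        by (rule order_trans[OF norm_triangle_ineq]) (simp add: norm_mult)
      also have "\<dots> \<le> \<bar>b \<bullet> \<xi>\<bar> * (M * wt (x - c)) + M * wt (x - c)"
        using b0 b1 by (intro add_mono mult_left_mono) auto
      finally show ?thesis by (simp add: algebra_simps)
    qed
  qed (use b in \<open>auto intro!: integrable_exp_times i0\<close>)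
  also have "integral\<^sup>L lborel ?G' = (LINT x|lborel. (- \<i> * (b \<bullet> \<xi>)) * ?G x + dir_deriv b h x * ?e x)"
    by (rule Bochner_Integration.integral_cong) auto
  also have "\<dots> = (LINT x|lborel. (- \<i> * (b \<bullet> \<xi>)) * ?G x) + (LINT x|lborel. dir_deriv b h x * ?e x)"
    using i0 i1 by (intro Bochner_Integration.integral_add integrable_mult_right integrable_exp_times) auto
  also have "\<dots> = - \<i> * (b \<bullet> \<xi>) * fourier h \<xi> + fourier (dir_deriv b h) \<xi>"
    unfolding fourier_def by (simp only: Bochner_Integration.integral_mult_right_zero)
  finally show ?thesis by (simp add: inner_commute algebra_simps)
qed

text \<open>Each letter \<open>b\<close> applies the operator 1 - d_b^2, whose symbol is 1 +
  \<xi>_b^2. It uses two derivatives and doubles the bound, which explains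
  \<open>2 * length bs\<close> and \<open>2 ^ length bs\<close>.\<close>

lemma fourier_decay:
  fixes h :: "real^'n::finite \<Rightarrow> complex"
  assumes "smooth h" "deriv_bound (2 * length bs) (\<lambda>x. M * wt (x - c)) h" "set bs \<subseteq> Basis"
  shows "prod_list (map (\<lambda>b. 1 + (\<xi> \<bullet> b)\<^sup>2) bs) * cmod (fourier h \<xi>) \<le> 2 ^ length bs * M * (LINT x::real^'n|lborel. wt x)"
  using assms
proof (induction bs arbitrary: h M)
  case Nil
  then show ?case using cmod_fourier_le[of h M c \<xi>] smooth_measurable by simp
next
  case (Cons b bs)
  have b: "b \<in> Basis" using Cons.prems by simp
  have s: "smooth h" "smooth (dir_deriv b h)" "smooth (dir_deriv b (dir_deriv b h))"
    using Cons.prems b by (auto intro: smooth_dir_deriv)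
  have d0: "deriv_bound (Suc (Suc (2 * length bs))) (\<lambda>x. M * wt (x - c)) h" using Cons.prems by simp
  then have d1: "deriv_bound (Suc (2 * length bs)) (\<lambda>x. M * wt (x - c)) (dir_deriv b h)"
    and d2: "deriv_bound (2 * length bs) (\<lambda>x. M * wt (x - c)) (dir_deriv b (dir_deriv b h))" using b by auto
  let ?k = "\<lambda>x. h x - dir_deriv b (dir_deriv b h) x"
  have "deriv_bound (2 * length bs) (\<lambda>x. M * wt (x - c) + M * wt (x - c)) (\<lambda>x. h x + - dir_deriv b (dir_deriv b h) x)"
    using deriv_bound_le[OF d0, of "2 * length bs"]
    by (intro deriv_bound_add deriv_bound_minus d2 s smooth_minus(1)) auto
  then have dk: "deriv_bound (2 * length bs) (\<lambda>x. (2 * M) * wt (x - c)) ?k" by (simp add: algebra_simps)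
  have "fourier ?k \<xi> = fourier h \<xi> - fourier (dir_deriv b (dir_deriv b h)) \<xi>"
    using deriv_boundD[OF d0] deriv_boundD[OF d2] s
    by (intro fourier_add(2) integrable_wt_bound) (auto dest: smooth_measurable)
  also have "fourier (dir_deriv b (dir_deriv b h)) \<xi> = \<i> * (\<xi> \<bullet> b) * (\<i> * (\<xi> \<bullet> b) * fourier h \<xi>)"
    using fourier_dir_deriv[OF s(2) deriv_bound_le[OF d1] b] fourier_dir_deriv[OF s(1) deriv_bound_le[OF d0] b] by simp
  finally have F: "fourier ?k \<xi> = (1 + (\<xi> \<bullet> b)\<^sup>2) * fourier h \<xi>"
    by (simp add: algebra_simps power2_eq_square)
  have "prod_list (map (\<lambda>b. 1 + (\<xi> \<bullet> b)\<^sup>2) bs) * cmod (fourier ?k \<xi>) \<le> 2 ^ length bs * (2 * M) * (LINT x::real^'n|lborel. wt x)"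
    by (rule Cons.IH) (use dk s Cons.prems in \<open>auto intro: smooth_diff\<close>)
  moreover have "cmod (fourier ?k \<xi>) = (1 + (\<xi> \<bullet> b)\<^sup>2) * cmod (fourier h \<xi>)"
    unfolding F norm_mult by (subst norm_of_real) simp
  ultimately show ?case by (simp add: mult.assoc mult.left_commute)
qed

text \<open>Only the modulus of the transform enters, so the centre \<open>c\<close> leaves no trace
  in the bound. This makes the later kernel estimates uniform in phase space.\<close>

lemma fourier_wt_decay:
  fixes h :: "real^'n::finite \<Rightarrow> complex"
  assumes "smooth h" "deriv_bound (2 * (k * CARD('n))) (\<lambda>x. M * wt (x - c)) h"
  shows "cmod (fourier h \<xi>) \<le> (2 ^ (k * CARD('n)) * (LINT x::real^'n|lborel. wt x)) * M * wt \<xi> ^ k"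
proof -
  obtain cs :: "(real^'n) list" where cs: "set cs = Basis" "distinct cs"
    using finite_distinct_list[OF finite_Basis] by blast
  then have len: "length cs = CARD('n)" by (metis DIM_cart DIM_real distinct_card mult.right_neutral)
  \<comment> \<open>Every basis vector occurs k times, so the product of the symbols is the k-th
    power of 1 / \<open>wt\<close>.\<close>
  let ?bs = "concat (replicate k cs)"
  have pl: "prod_list (map f (concat (replicate k cs))) = prod_list (map f cs) ^ k" for f :: "real^'n \<Rightarrow> real"
    by (induction k) auto
  have l: "length ?bs = k * CARD('n)" by (induction k) (auto simp: len)
  have "set ?bs \<subseteq> Basis" using cs by auto
  from fourier_decay[OF assms(1) _ this, of M c \<xi>] assms(2)
  have "prod_list (map (\<lambda>b. 1 + (\<xi> \<bullet> b)\<^sup>2) cs) ^ k * cmod (fourier h \<xi>) \<le> 2 ^ (k * CARD('n)) * M * (LINT x::real^'n|lborel. wt x)"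
    unfolding l pl .
  moreover have "prod_list (map (\<lambda>b. 1 + (\<xi> \<bullet> b)\<^sup>2) cs) = 1 / wt \<xi>"
    using cs by (simp add: wt_def prod.distinct_set_conv_list[symmetric] prod_dividef)
  ultimately show ?thesis by (simp add: power_one_over field_simps)
qed

lemma schw_fourier_bound:
  fixes g :: "real^'n::finite \<Rightarrow> complex"
  assumes "schw g" shows "\<exists>M\<ge>0. \<forall>\<xi>. cmod (fourier g \<xi>) \<le> M * wt \<xi> ^ k"
proof -
  obtain M where M: "M \<ge> 0" "deriv_bound (2 * (k * CARD('n))) (\<lambda>x. M * wt x ^ 1) g"
    using schw_deriv_bound[OF assms] by blast
  have "0 \<le> (LINT x::real^'n|lborel. wt x)" by (rule integral_nonneg_AE) simp
  then show ?thesis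
    using fourier_wt_decay[OF schw_smooth[OF assms], of k M 0] M
    by (intro exI[of _ "(2 ^ (k * CARD('n)) * (LINT x::real^'n|lborel. wt x)) * M"]) auto
qed

lemma rapid_fourier: "schw g \<Longrightarrow> rapid (fourier g)"
  using schw_fourier_bound unfolding rapid_def by blast

lemma rapid_integrable: "rapid f \<Longrightarrow> f \<in> borel_measurable borel \<Longrightarrow> integrable lborel f"
  using rapid_wt_bound[of f] integrable_wt_bound[of f _ 0] by fastforce

lemma integrable_fourier: "schw g \<Longrightarrow> integrable lborel (fourier g)"
  by (rule rapid_integrable[OF rapid_fourier]) (auto intro: measurable_fourier schw_integrable)

lemma schw_fourier_dir_deriv:
  fixes g :: "real^'n::finite \<Rightarrow> complex"
  assumes g: "schw g" and b: "b \<in> Basis"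
  shows "fourier (dir_deriv b g) \<xi> = \<i> * (\<xi> \<bullet> b) * fourier g \<xi>"
proof -
  obtain M where "deriv_bound 1 (\<lambda>x. M * wt x ^ 1) g"
    using schw_deriv_bound[OF assms(1)] by blast
  then show ?thesis using fourier_dir_deriv[OF schw_smooth[OF g], of M 0 b \<xi>] b by simp
qed

lemma fourier_has_vector_derivative:
  fixes g :: "real^'n::finite \<Rightarrow> complex"
  assumes g: "schw g" and b: "b \<in> Basis"
  shows "((\<lambda>r. fourier g (\<xi> + r *\<^sub>R b)) has_vector_derivative - \<i> * fourier (\<lambda>x. (x \<bullet> b) * g x) \<xi>) (at 0)"
proof -
  let ?c = "\<lambda>x. g x * exp (- \<i> * complex_of_real (x \<bullet> \<xi>))"
  note [measurable] = schw_measurable[OF g]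
  have "((\<lambda>r::real. LINT x|lborel. exp (\<i> * (r * (- (x \<bullet> b)))) * ?c x) has_vector_derivative
     (LINT x|lborel. \<i> * exp (\<i> * ((0::real) * (- (x \<bullet> b)))) * ((- (x \<bullet> b)) * ?c x))) (at 0)"
  proof (rule has_vector_derivative_oscillatory_integral)
    show "integrable lborel ?c" by (rule integrable_exp_times(2)) (auto intro: schw_integrable g)
    have "integrable lborel (\<lambda>x. - ((x \<bullet> b) * g x) * exp (- \<i> * complex_of_real (x \<bullet> \<xi>)))"
      by (rule integrable_exp_times(2)) (auto intro!: schw_integrable schw_coord g b)
    then show "integrable lborel (\<lambda>x. complex_of_real (- (x \<bullet> b)) * ?c x)" by (simp add: mult.assoc)
  qed measurable
  moreover have "(\<lambda>r::real. LINT x|lborel. exp (\<i> * (r * (- (x \<bullet> b)))) * ?c x) = (\<lambda>r. fourier g (\<xi> + r *\<^sub>R b))"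
    unfolding fourier_def
    by (intro ext Bochner_Integration.integral_cong) (auto simp: inner_add_right exp_add[symmetric] algebra_simps exp_minus[symmetric] mult_exp_exp)
  moreover have "(LINT x|lborel. \<i> * exp (\<i> * ((0::real) * (- (x \<bullet> b)))) * ((- (x \<bullet> b)) * ?c x)) = - \<i> * fourier (\<lambda>x. (x \<bullet> b) * g x) \<xi>"
    unfolding fourier_def integral_mult_right_zero[symmetric]
    by (intro Bochner_Integration.integral_cong) auto
  ultimately show ?thesis by simp
qed

section \<open>Fubini with product majorants, scaling, and Gaussian integrals\<close>

lemma fubini_product_bound:
  fixes F :: "'a::euclidean_space \<Rightarrow> 'b::euclidean_space \<Rightarrow> complex"
  assumes m [measurable]: "(\<lambda>(x, y). F x y) \<in> borel_measurable (borel \<Otimes>\<^sub>M borel)"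
    and A: "integrable lborel A" and B: "integrable lborel B"
    and bd: "\<And>x y. cmod (F x y) \<le> A x * B y"
  shows "(LINT x|lborel. LINT y|lborel. F x y) = (LINT y|lborel. LINT x|lborel. F x y)"
    and "integrable lborel (\<lambda>x. LINT y|lborel. F x y)"
proof -
  have AB: "integrable (lborel \<Otimes>\<^sub>M lborel) (\<lambda>(x, y). A x * B y :: real)"
  proof (rule lborel_pair.Fubini_integrable)
    have [measurable]: "A \<in> borel_measurable borel" "B \<in> borel_measurable borel" using A B by auto
    show "(\<lambda>(x, y). A x * B y) \<in> borel_measurable (lborel \<Otimes>\<^sub>M lborel)" by measurable
    show "integrable lborel (\<lambda>x. LINT y|lborel. norm (case (x, y) of (x, y) \<Rightarrow> A x * B y))"
      using A B by (simp add: abs_mult)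
  qed (use A B in auto)
  have i: "integrable (lborel \<Otimes>\<^sub>M lborel) (\<lambda>(x, y). F x y)"
    by (rule Bochner_Integration.integrable_bound[OF AB])
      (use m in \<open>auto intro!: order_trans[OF bd] simp: lborel_prod borel_prod\<close>)
  show "(LINT x|lborel. LINT y|lborel. F x y) = (LINT y|lborel. LINT x|lborel. F x y)"
    using lborel_pair.Fubini_integral[OF i] by simp
  show "integrable lborel (\<lambda>x. LINT y|lborel. F x y)"
    using lborel_pair.integrable_fst'[OF i] by simp
qed

lemma lborel_integral_scale:
  fixes f :: "'a::euclidean_space \<Rightarrow> 'b::{banach, second_countable_topology}"
  assumes [measurable]: "f \<in> borel_measurable borel" and c: "c \<noteq> 0"
  shows "integral\<^sup>L lborel f = (\<bar>c\<bar> ^ DIM('a)) *\<^sub>R (LINT x|lborel. f (t + c *\<^sub>R x))"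
proof -
  have "integral\<^sup>L lborel f = integral\<^sup>L (density (distr lborel borel (\<lambda>x. t + c *\<^sub>R x)) (\<lambda>_. ennreal (\<bar>c\<bar> ^ DIM('a)))) f"
    using lborel_affine[OF c, of t] by simp
  also have "\<dots> = (LINT x|distr lborel borel (\<lambda>x. t + c *\<^sub>R x). (\<bar>c\<bar> ^ DIM('a)) *\<^sub>R f x)"
    by (rule integral_density) auto
  also have "\<dots> = (LINT x|lborel. (\<bar>c\<bar> ^ DIM('a)) *\<^sub>R f (t + c *\<^sub>R x))"
    by (rule integral_distr) auto
  finally show ?thesis by simp
qed

lemma lborel_integral_scale_complex:
  fixes f :: "'a::euclidean_space \<Rightarrow> complex"
  assumes "f \<in> borel_measurable borel" "c \<noteq> 0"
  shows "integral\<^sup>L lborel f = complex_of_real (\<bar>c\<bar> ^ DIM('a)) * (LINT x|lborel. f (t + c *\<^sub>R x))"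
  using lborel_integral_scale[OF assms, of t] unfolding scaleR_conv_of_real[of _ "integral\<^sup>L _ _"] .

definition gauss :: "'a::euclidean_space \<Rightarrow> real" where "gauss x = exp (- (norm x)\<^sup>2 / 2)"

lemma gauss_prod: "gauss x = (\<Prod>b\<in>Basis. exp (- (x \<bullet> b)\<^sup>2 / 2))"
proof -
  have "- (norm x)\<^sup>2 / 2 = (\<Sum>b\<in>Basis. - (x \<bullet> b)\<^sup>2 / 2)"
    unfolding power2_norm_eq_inner euclidean_inner[of x x]
    by (simp add: power2_eq_square sum_negf sum_divide_distrib)
  then show ?thesis unfolding gauss_def by (simp add: exp_sum)
qed

lemma gauss_measurable [measurable]: "gauss \<in> borel_measurable borel"
  unfolding gauss_def by measurable

lemma fourier_gauss_real:
  "(LINT x|lborel. exp (\<i> * complex_of_real (z * x)) * complex_of_real (exp (- x\<^sup>2 / 2))) = sqrt (2 * pi) * exp (- z\<^sup>2 / 2)"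
  "integrable lborel (\<lambda>x. exp (\<i> * complex_of_real (z * x)) * complex_of_real (exp (- x\<^sup>2 / 2)))"
proof -
  have d: "std_normal_density x = exp (- x\<^sup>2 / 2) / sqrt (2 * pi)" for x
    by (simp add: std_normal_density_def)
  \<comment> \<open>The Gaussian integral is read off from the characteristic function of the
    standard normal distribution, after undoing the normalization by sqrt (2 pi).\<close>
  have "complex_of_real (exp (- (z^2) / 2)) = char std_normal_distribution z"
    by (simp add: char_std_normal_distribution)
  also have "\<dots> = (LINT x|lborel. std_normal_density x *\<^sub>R exp (\<i> * complex_of_real (z * x)))"
    unfolding char_def by (subst integral_density) auto
  also have "\<dots> = (LINT x|lborel. (1 / sqrt (2 * pi)) * (exp (\<i> * complex_of_real (z * x)) * complex_of_real (exp (- x\<^sup>2 / 2))))"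
    by (rule Bochner_Integration.integral_cong) (auto simp: d scaleR_conv_of_real)
  finally show "(LINT x|lborel. exp (\<i> * complex_of_real (z * x)) * complex_of_real (exp (- x\<^sup>2 / 2))) = sqrt (2 * pi) * exp (- z\<^sup>2 / 2)"
    by (simp add: field_simps)
  have "integrable lborel (\<lambda>x. sqrt (2 * pi) * std_normal_density x)"
    by (intro integrable_mult_right integrable_normal_density) simp
  then have "integrable lborel (\<lambda>x::real. exp (- x\<^sup>2 / 2))" by (simp add: d)
  then show "integrable lborel (\<lambda>x. exp (\<i> * complex_of_real (z * x)) * complex_of_real (exp (- x\<^sup>2 / 2)))"
    by (intro integrable_exp_times(3)) (auto simp: complex_of_real_integrable_eq)
qed

lemma integral_gauss:
  fixes z :: "'a::euclidean_space"
  shows "(LINT x|lborel. exp (\<i> * complex_of_real (x \<bullet> z)) * complex_of_real (gauss x)) = sqrt (2 * pi) ^ DIM('a) * gauss z"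
    and "integrable lborel (gauss :: 'a \<Rightarrow> real)"
proof -
  let ?f = "\<lambda>z (b::'a) x. exp (\<i> * complex_of_real ((z \<bullet> b) * x)) * complex_of_real (exp (- x\<^sup>2 / 2))"
  have p: "exp (\<i> * complex_of_real (x \<bullet> z)) * complex_of_real (gauss x) = (\<Prod>b\<in>Basis. ?f z b (x \<bullet> b))" for x z :: 'a
    unfolding prod.distrib gauss_prod of_real_prod
    by (subst exp_sum[symmetric]) (auto simp: euclidean_inner[of x z] sum_distrib_left mult.commute)
  have "(LINT x|lborel. exp (\<i> * complex_of_real (x \<bullet> z)) * complex_of_real (gauss x)) = (\<Prod>b\<in>Basis. integral\<^sup>L lborel (?f z b))"
    unfolding p by (rule integral_lborel_prod) (rule fourier_gauss_real)
  also have "\<dots> = (\<Prod>b\<in>Basis. complex_of_real (sqrt (2 * pi) * exp (- (z \<bullet> b)\<^sup>2 / 2)))"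
    unfolding fourier_gauss_real ..
  finally show "(LINT x|lborel. exp (\<i> * complex_of_real (x \<bullet> z)) * complex_of_real (gauss x)) = sqrt (2 * pi) ^ DIM('a) * gauss z"
    unfolding of_real_prod[symmetric] prod.distrib gauss_prod by simp
  have "integrable lborel (\<lambda>x::'a. exp (\<i> * complex_of_real (x \<bullet> 0)) * complex_of_real (gauss x))"
    unfolding p by (rule integral_lborel_prod(2)) (rule fourier_gauss_real)
  then show "integrable lborel (gauss :: 'a \<Rightarrow> real)" by (simp add: complex_of_real_integrable_eq)
qed

subsection \<open>Inversion\<close>

lemma lborel_integrable_scale:
  fixes f :: "'a::euclidean_space \<Rightarrow> real"
  assumes f: "integrable lborel f" and c: "c \<noteq> 0"
  shows "integrable lborel (\<lambda>x. f (c *\<^sub>R x))"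
proof -
  have [measurable]: "f \<in> borel_measurable borel" using f by simp
  have "integrable (density (distr lborel borel (\<lambda>x. 0 + c *\<^sub>R x)) (\<lambda>_. ennreal (\<bar>c\<bar> ^ DIM('a)))) f"
    using f lborel_affine[OF c, of "0::'a"] by simp
  then have "integrable lborel (\<lambda>x. (\<bar>c\<bar> ^ DIM('a)) *\<^sub>R f (c *\<^sub>R x))"
    by (subst (asm) integrable_density) (auto simp: integrable_distr_eq)
  then show ?thesis using c by simp
qed

lemma gauss_le_1: "gauss x \<le> 1" and gauss_pos: "0 < gauss x" and abs_gauss_le_1: "\<bar>gauss x\<bar> \<le> 1" and gauss_0 [simp]: "gauss 0 = 1"
  by (auto simp: gauss_def)

text \<open>The double integral behind Fourier inversion does not converge absolutely; the Gaussian
  factor in \<xi> makes it converge, so the order can be exchanged, and the inner integral becomes a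
  Gaussian concentrated at scale e around \<open>y\<close>.\<close>

lemma gauss_regularization:
  fixes f :: "real^'n::finite \<Rightarrow> complex"
  assumes c: "continuous_on UNIV f" and f: "\<And>x. cmod (f x) \<le> M * wt x" and e: "e > 0"
  shows "(LINT \<xi>|lborel. fourier f \<xi> * exp (\<i> * complex_of_real (y \<bullet> \<xi>)) * gauss (e *\<^sub>R \<xi>)) =
    sqrt (2 * pi) ^ CARD('n) * (LINT z|lborel. f (y - e *\<^sub>R z) * gauss z)"
proof -
  have [measurable]: "f \<in> borel_measurable borel" by (rule borel_measurable_continuous_onI[OF c])
  let ?F = "\<lambda>\<xi> x. f x * exp (- \<i> * complex_of_real (x \<bullet> \<xi>)) * (exp (\<i> * complex_of_real (y \<bullet> \<xi>)) * gauss (e *\<^sub>R \<xi>))"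
  let ?H = "\<lambda>z::real^'n. LINT \<xi>|lborel. exp (\<i> * complex_of_real (\<xi> \<bullet> (e *\<^sub>R z))) * complex_of_real (gauss (e *\<^sub>R \<xi>))"
  have H: "e ^ CARD('n) * ?H z = sqrt (2 * pi) ^ CARD('n) * gauss z" for z
  proof -
    have "(LINT x|lborel. exp (\<i> * complex_of_real (x \<bullet> z)) * complex_of_real (gauss x))
      = complex_of_real (\<bar>e\<bar> ^ DIM(real^'n)) * (LINT x|lborel. exp (\<i> * complex_of_real ((0 + e *\<^sub>R x) \<bullet> z)) * complex_of_real (gauss (0 + e *\<^sub>R x)))"
      by (rule lborel_integral_scale_complex) (use e in auto)
    then show ?thesis using e integral_gauss(1)[of z] by simp
  qed
  have "(LINT \<xi>|lborel. fourier f \<xi> * exp (\<i> * complex_of_real (y \<bullet> \<xi>)) * gauss (e *\<^sub>R \<xi>)) =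
    (LINT \<xi>|lborel. LINT x|lborel. ?F \<xi> x)"
    unfolding fourier_def integral_mult_left_zero[symmetric] by (simp add: mult.assoc)
  also have "\<dots> = (LINT x|lborel. LINT \<xi>|lborel. ?F \<xi> x)"
  proof (rule fubini_product_bound(1)[where A="\<lambda>\<xi>. gauss (e *\<^sub>R \<xi>)" and B="\<lambda>x. M * wt x"])
    show "integrable lborel (\<lambda>\<xi>::real^'n. gauss (e *\<^sub>R \<xi>))"
      by (rule lborel_integrable_scale[OF integral_gauss(2)]) (use e in auto)
    show "cmod (?F \<xi> x) \<le> gauss (e *\<^sub>R \<xi>) * (M * wt x)" for \<xi> x
      using f[of x] gauss_pos[of "e *\<^sub>R \<xi>"] by (simp add: norm_mult mult.commute)
  qed auto
  also have "\<dots> = (LINT x|lborel. f x * (LINT \<xi>|lborel. exp (\<i> * complex_of_real (\<xi> \<bullet> (y - x))) * complex_of_real (gauss (e *\<^sub>R \<xi>))))"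
    unfolding integral_mult_right_zero[symmetric]
    by (intro Bochner_Integration.integral_cong refl) (simp add: mult_exp_exp inner_diff_right inner_commute algebra_simps)
  \<comment> \<open>Substitution x = y - e z; the Jacobian e^n is exactly the factor that cancels
    against \<open>H\<close>.\<close>
  also have "\<dots> = complex_of_real (\<bar>- e\<bar> ^ DIM(real^'n)) * (LINT z|lborel. f (y + (- e) *\<^sub>R z) * (LINT \<xi>|lborel. exp (\<i> * complex_of_real (\<xi> \<bullet> (y - (y + (- e) *\<^sub>R z)))) * complex_of_real (gauss (e *\<^sub>R \<xi>))))"
    by (rule lborel_integral_scale_complex) (use e in auto)
  also have "\<dots> = (LINT z|lborel. complex_of_real (\<bar>- e\<bar> ^ DIM(real^'n)) * (f (y + (- e) *\<^sub>R z) * (LINT \<xi>|lborel. exp (\<i> * complex_of_real (\<xi> \<bullet> (y - (y + (- e) *\<^sub>R z)))) * complex_of_real (gauss (e *\<^sub>R \<xi>)))))"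
    by (rule integral_mult_right_zero[symmetric])
  also have "\<dots> = (LINT z|lborel. f (y - e *\<^sub>R z) * (e ^ CARD('n) * ?H z))"
    by (rule Bochner_Integration.integral_cong) (use e in \<open>simp_all add: mult.left_commute\<close>)
  also have "\<dots> = (LINT z|lborel. sqrt (2 * pi) ^ CARD('n) * (f (y - e *\<^sub>R z) * gauss z))"
    unfolding H of_real_mult by (simp only: ac_simps)
  also have "\<dots> = sqrt (2 * pi) ^ CARD('n) * (LINT z|lborel. f (y - e *\<^sub>R z) * gauss z)"
    by (rule integral_mult_right_zero)
  finally show ?thesis .
qed

text \<open>Let e tend to 0 in \<open>gauss_regularization\<close>. The left side is dominated by
  the modulus of \<open>fourier f\<close>, the right side by a multiple of \<open>gauss\<close>;
  both limits exist and must agree.\<close>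

lemma fourier_inversion:
  fixes f :: "real^'n::finite \<Rightarrow> complex"
  assumes c: "continuous_on UNIV f" and f: "\<And>x. cmod (f x) \<le> M * wt x" and i: "integrable lborel (fourier f)"
  shows "inv_fourier (fourier f) y = f y"
proof -
  have [measurable]: "f \<in> borel_measurable borel" by (rule borel_measurable_continuous_onI[OF c])
  note [measurable] = measurable_fourier[OF integrable_wt_bound[of f M 0]]
  have mf [measurable]: "fourier f \<in> borel_measurable borel" using i by simp
  have M: "0 \<le> M" using f[of 0] by (smt (verit) mult_neg_pos norm_ge_zero wt_pos)
  define e where "e m = inverse (real (Suc m))" for m
  have e: "e m > 0" for m by (simp add: e_def)
  have e0: "e \<longlonglongrightarrow> 0" unfolding e_def by (rule LIMSEQ_inverse_real_of_nat)
  let ?J = "\<lambda>m. LINT \<xi>|lborel. fourier f \<xi> * exp (\<i> * complex_of_real (y \<bullet> \<xi>)) * gauss (e m *\<^sub>R \<xi>)"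
  have cg: "isCont (gauss :: real^'n \<Rightarrow> real) x" for x
    unfolding gauss_def by (intro continuous_intros) auto
  have l1: "?J \<longlonglongrightarrow> (LINT \<xi>|lborel. fourier f \<xi> * exp (\<i> * complex_of_real (y \<bullet> \<xi>)))"
  proof (rule integral_dominated_convergence[where w="\<lambda>\<xi>. cmod (fourier f \<xi>)"])
    show "AE \<xi> in lborel. (\<lambda>m. fourier f \<xi> * exp (\<i> * complex_of_real (y \<bullet> \<xi>)) * gauss (e m *\<^sub>R \<xi>)) \<longlonglongrightarrow> fourier f \<xi> * exp (\<i> * complex_of_real (y \<bullet> \<xi>))"
    proof (rule AE_I2)
      fix \<xi> :: "real^'n"
      have "(\<lambda>m. e m *\<^sub>R \<xi>) \<longlonglongrightarrow> 0 *\<^sub>R \<xi>" by (intro tendsto_intros e0)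
      then have "(\<lambda>m. gauss (e m *\<^sub>R \<xi>)) \<longlonglongrightarrow> gauss (0::real^'n)"
        using cg isCont_tendsto_compose by fastforce
      then have "(\<lambda>m. fourier f \<xi> * exp (\<i> * complex_of_real (y \<bullet> \<xi>)) * gauss (e m *\<^sub>R \<xi>)) \<longlonglongrightarrow>
         fourier f \<xi> * exp (\<i> * complex_of_real (y \<bullet> \<xi>)) * complex_of_real (gauss (0::real^'n))"
        by (intro tendsto_intros)
      then show "(\<lambda>m. fourier f \<xi> * exp (\<i> * complex_of_real (y \<bullet> \<xi>)) * gauss (e m *\<^sub>R \<xi>)) \<longlonglongrightarrow> fourier f \<xi> * exp (\<i> * complex_of_real (y \<bullet> \<xi>))"
        by simp
    qed
    show "AE \<xi> in lborel. cmod (fourier f \<xi> * exp (\<i> * complex_of_real (y \<bullet> \<xi>)) * gauss (e m *\<^sub>R \<xi>)) \<le> cmod (fourier f \<xi>)" for m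
      using abs_gauss_le_1 by (intro AE_I2) (auto simp: norm_mult intro!: mult_left_le)
  qed (use i in auto)
  have l2: "(\<lambda>m. LINT z|lborel. f (y - e m *\<^sub>R z) * gauss z) \<longlonglongrightarrow> (LINT z::real^'n|lborel. f y * gauss z)"
  proof (rule integral_dominated_convergence[where w="\<lambda>z. M * gauss z"])
    show "integrable lborel (\<lambda>z::real^'n. M * gauss z)" by (intro integrable_mult_right integral_gauss)
    show "AE z in lborel. (\<lambda>m. f (y - e m *\<^sub>R z) * gauss z) \<longlonglongrightarrow> f y * gauss z"
    proof (rule AE_I2)
      fix z :: "real^'n"
      have "(\<lambda>m. y - e m *\<^sub>R z) \<longlonglongrightarrow> y - 0 *\<^sub>R z" by (intro tendsto_intros e0)
      then have "(\<lambda>m. f (y - e m *\<^sub>R z)) \<longlonglongrightarrow> f y"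
        using continuous_on_tendsto_compose[OF c] by fastforce
      then show "(\<lambda>m. f (y - e m *\<^sub>R z) * gauss z) \<longlonglongrightarrow> f y * gauss z" by (intro tendsto_intros)
    qed
    show "AE z in lborel. cmod (f (y - e m *\<^sub>R z) * gauss z) \<le> M * gauss z" for m
    proof (rule AE_I2)
      fix z :: "real^'n"
      have "cmod (f (y - e m *\<^sub>R z)) \<le> M" using f[of "y - e m *\<^sub>R z"] mult_left_mono[OF wt_le_1 M, of "y - e m *\<^sub>R z"] by simp
      then show "cmod (f (y - e m *\<^sub>R z) * gauss z) \<le> M * gauss z"
        using gauss_pos[of z] by (auto simp: norm_mult)
    qed
  qed measurable
  have G: "(LINT z::real^'n|lborel. complex_of_real (gauss z)) = sqrt (2 * pi) ^ CARD('n)"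
    using integral_gauss(1)[of "0::real^'n"] by simp
  have "?J \<longlonglongrightarrow> sqrt (2 * pi) ^ CARD('n) * (LINT z::real^'n|lborel. f y * gauss z)"
    unfolding gauss_regularization[OF c f e] by (intro tendsto_mult tendsto_const l2)
  from LIMSEQ_unique[OF l1 this] G
  have "(LINT \<xi>|lborel. fourier f \<xi> * exp (\<i> * complex_of_real (y \<bullet> \<xi>)))
     = complex_of_real (sqrt (2 * pi) ^ CARD('n)) * (f y * complex_of_real (sqrt (2 * pi) ^ CARD('n)))"
    by (simp only: integral_mult_right_zero)
  also have "\<dots> = complex_of_real (sqrt (2 * pi) ^ CARD('n) * sqrt (2 * pi) ^ CARD('n)) * f y"
    unfolding of_real_mult by (simp only: ac_simps)
  also have "sqrt (2 * pi) ^ CARD('n) * sqrt (2 * pi) ^ CARD('n) = (2 * pi) ^ CARD('n)"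
    by (simp only: power_mult_distrib[symmetric]) (simp del: real_sqrt_mult)
  finally show ?thesis by (simp add: inv_fourier_def)
qed

lemma inv_fourier_eq_fourier:
  fixes a :: "real^'n::finite \<Rightarrow> complex"
  shows "inv_fourier a x = complex_of_real (1 / (2 * pi) ^ CARD('n)) * fourier a (- x)"
  unfolding inv_fourier_def fourier_def by (simp add: inner_commute)

text \<open>The inverse transform is the reflected forward transform up to a constant, so the claim
  reduces to \<open>fourier_inversion\<close> for \<open>a\<close> after a reflection of the
  integration variable.\<close>

lemma fourier_inv_fourier:
  fixes a :: "real^'n::finite \<Rightarrow> complex"
  assumes c: "continuous_on UNIV a" and a: "\<And>x. cmod (a x) \<le> M * wt x" and i: "integrable lborel (inv_fourier a)"
  shows "fourier (inv_fourier a) \<xi> = a \<xi>"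
proof -
  have [measurable]: "a \<in> borel_measurable borel" by (rule borel_measurable_continuous_onI[OF c])
  have ia: "integrable lborel a" by (rule integrable_wt_bound[of a M 0]) (use a in auto)
  note [measurable] = measurable_fourier[OF ia]
  let ?c = "complex_of_real (1 / (2 * pi) ^ CARD('n))"
  have "integrable lborel (\<lambda>x. ?c * fourier a (0 - x))"
    using i by (simp add: inv_fourier_eq_fourier[abs_def])
  then have "integrable lborel (\<lambda>x. inverse ?c * (?c * fourier a (0 - x)))" by (rule integrable_mult_right)
  moreover have "inverse ?c * (?c * z) = z" for z by simp
  ultimately have "integrable lborel (\<lambda>x. fourier a (0 - x))" by (simp only:)
  then have i': "integrable lborel (fourier a)"
    using lborel_integral_reflect(2)[of "fourier a" 0] by simp
  have "fourier (inv_fourier a) \<xi> = (LINT x|lborel. ?c * (fourier a (0 - x) * exp (\<i> * complex_of_real ((0 - x) \<bullet> \<xi>))))"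
    unfolding inv_fourier_eq_fourier[abs_def] fourier_def[of "\<lambda>x. ?c * fourier a (- x)"]
    by (simp only: mult.assoc diff_0 inner_minus_left of_real_minus mult_minus_right mult_minus_left minus_minus)
  also have "\<dots> = ?c * (LINT x|lborel. fourier a (0 - x) * exp (\<i> * complex_of_real ((0 - x) \<bullet> \<xi>)))"
    by (rule integral_mult_right_zero)
  also have "(LINT x|lborel. fourier a (0 - x) * exp (\<i> * complex_of_real ((0 - x) \<bullet> \<xi>))) = (LINT x|lborel. fourier a x * exp (\<i> * complex_of_real (x \<bullet> \<xi>)))"
    by (rule lborel_integral_reflect(1)[where f="\<lambda>x. fourier a x * exp (\<i> * complex_of_real (x \<bullet> \<xi>))"]) measurable
  also have "?c * (LINT x|lborel. fourier a x * exp (\<i> * complex_of_real (x \<bullet> \<xi>))) = inv_fourier (fourier a) \<xi>"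
    by (simp add: inv_fourier_def inner_commute)
  also have "\<dots> = a \<xi>" by (rule fourier_inversion[OF c a i'])
  finally show ?thesis .
qed

section \<open>The free propagator\<close>

definition phase :: "real \<Rightarrow> real^'n::finite \<Rightarrow> complex" where
  "phase s \<xi> = exp (- (\<i> * complex_of_real (s * (norm \<xi>)\<^sup>2 / 2)))"

lemma cmod_phase [simp]: "cmod (phase s \<xi>) = 1" by (simp add: phase_def)

lemma phase_measurable [measurable]: "phase s \<in> borel_measurable borel"
  unfolding phase_def by measurable

lemma continuous_phase [continuous_intros]:
  "continuous_on A f \<Longrightarrow> continuous_on A g \<Longrightarrow> continuous_on A (\<lambda>x. phase (f x) (g x))"
  unfolding phase_def by (intro continuous_intros) auto

lemma free_propagator_alt:
  fixes g :: "real^'n::finite \<Rightarrow> complex"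
  shows "free_propagator s g y = complex_of_real (1 / (2 * pi) ^ CARD('n)) *
     (LINT \<xi>|lborel. phase s \<xi> * fourier g \<xi> * exp (\<i> * complex_of_real (y \<bullet> \<xi>)))"
  unfolding free_propagator_def inv_fourier_def phase_def ..

lemma integrable_propagator_integrand:
  fixes g :: "real^'n::finite \<Rightarrow> complex"
  assumes "schw g" shows "integrable lborel (\<lambda>\<xi>. phase s \<xi> * fourier g \<xi> * exp (\<i> * complex_of_real (y \<bullet> \<xi>)))"
proof -
  have i: "integrable lborel (fourier g)" by (rule integrable_fourier[OF assms])
  then have [measurable]: "fourier g \<in> borel_measurable borel" by simp
  show ?thesis by (rule Bochner_Integration.integrable_bound[OF i]) (auto simp: norm_mult)
qed

lemma propagator_zero: assumes "schw g" shows "free_propagator 0 g = g"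
proof
  fix y
  obtain M where "\<And>x. cmod (g x) \<le> M * wt x" using rapid_wt_bound[OF schw_rapid[OF assms]] by blast
  then show "free_propagator 0 g y = g y"
    using fourier_inversion[OF schw_continuous[OF assms] _ integrable_fourier[OF assms], of M y]
    by (simp add: free_propagator_def)
qed

lemma propagator_add:
  assumes "schw f" "schw g"
  shows "free_propagator s (\<lambda>x. f x + g x) y = free_propagator s f y + free_propagator s g y"
    "free_propagator s (\<lambda>x. f x - g x) y = free_propagator s f y - free_propagator s g y"
  unfolding free_propagator_alt distrib_left[symmetric] right_diff_distrib[symmetric]
    fourier_add[OF schw_integrable[OF assms(1)] schw_integrable[OF assms(2)]]
    Bochner_Integration.integral_add[OF integrable_propagator_integrand[OF assms(1)] integrable_propagator_integrand[OF assms(2)], of s y s y, symmetric]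
    Bochner_Integration.integral_diff[OF integrable_propagator_integrand[OF assms(1)] integrable_propagator_integrand[OF assms(2)], of s y s y, symmetric]
  by (simp_all only: distrib_left distrib_right left_diff_distrib right_diff_distrib)

lemma propagator_cmult: "free_propagator s (\<lambda>x. c * f x) y = c * free_propagator s f y"
proof -
  have "(LINT \<xi>|lborel. phase s \<xi> * (c * fourier f \<xi>) * exp (\<i> * complex_of_real (y \<bullet> \<xi>))) =
    (LINT \<xi>|lborel. c * (phase s \<xi> * fourier f \<xi> * exp (\<i> * complex_of_real (y \<bullet> \<xi>))))"
    by (simp add: ac_simps)
  then show ?thesis unfolding free_propagator_alt fourier_cmult by simp
qed

lemma propagator_bounded:
  fixes g :: "real^'n::finite \<Rightarrow> complex"
  shows "cmod (free_propagator s g y) \<le> 1 / (2 * pi) ^ CARD('n) * (LINT \<xi>|lborel. cmod (fourier g \<xi>))"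
proof -
  have "cmod (LINT \<xi>|lborel. phase s \<xi> * fourier g \<xi> * exp (\<i> * complex_of_real (y \<bullet> \<xi>))) \<le> (LINT \<xi>|lborel. cmod (fourier g \<xi>))"
    by (rule order_trans[OF integral_norm_bound]) (simp add: norm_mult)
  moreover have "cmod (complex_of_real (1 / (2 * pi) ^ CARD('n))) = 1 / (2 * pi) ^ CARD('n)"
    unfolding norm_of_real by simp
  ultimately show ?thesis unfolding free_propagator_alt norm_mult
    by (simp only:) (rule mult_left_mono, auto)
qed

lemma continuous_propagator:
  fixes g :: "real^'n::finite \<Rightarrow> complex"
  assumes "schw g" shows "continuous_on UNIV (\<lambda>(s, y). free_propagator s g y)"
proof (rule continuous_at_imp_continuous_on, rule ballI)
  fix p0 :: "real \<times> (real^'n)"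
  have i: "integrable lborel (fourier g)" by (rule integrable_fourier[OF assms])
  then have [measurable]: "fourier g \<in> borel_measurable borel" by simp
  have "isCont (\<lambda>p. LINT \<xi>|lborel. phase (fst p) \<xi> * fourier g \<xi> * exp (\<i> * complex_of_real (snd p \<bullet> \<xi>))) p0"
  proof (rule isCont_parameter_integral[where w="\<lambda>x. cmod (fourier g x)" and e=1])
    show "isCont (\<lambda>p. phase (fst p) \<xi> * fourier g \<xi> * exp (\<i> * complex_of_real (snd p \<bullet> \<xi>))) p0" for \<xi>
      unfolding phase_def by (intro continuous_intros) auto
  qed (use i in \<open>auto simp: norm_mult\<close>)
  then show "isCont (\<lambda>(s, y). free_propagator s g y) p0"
    unfolding free_propagator_alt case_prod_beta by (intro continuous_intros)
qed

lemma propagator_has_derivative_space: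
  fixes g :: "real^'n::finite \<Rightarrow> complex"
  assumes g: "schw g" and b: "b \<in> Basis"
  shows "((\<lambda>r::real. free_propagator s g (y + r *\<^sub>R b)) has_vector_derivative free_propagator s (dir_deriv b g) y) (at 0)"
proof -
  let ?c = "\<lambda>\<xi>. phase s \<xi> * fourier g \<xi> * exp (\<i> * complex_of_real (y \<bullet> \<xi>))"
  have A: "((\<lambda>r::real. LINT \<xi>|lborel. exp (\<i> * (r * (\<xi> \<bullet> b))) * ?c \<xi>) has_vector_derivative
     (LINT \<xi>|lborel. \<i> * exp (\<i> * ((0::real) * (\<xi> \<bullet> b))) * ((\<xi> \<bullet> b) * ?c \<xi>))) (at 0)"
  proof (rule has_vector_derivative_oscillatory_integral)
    show "integrable lborel ?c" by (rule integrable_propagator_integrand[OF g])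
    have "integrable lborel (\<lambda>\<xi>. phase s \<xi> * fourier (dir_deriv b g) \<xi> * exp (\<i> * complex_of_real (y \<bullet> \<xi>)))"
      by (rule integrable_propagator_integrand[OF schw_dir_deriv[OF g b]])
    then have "integrable lborel (\<lambda>\<xi>. \<i> * (complex_of_real (\<xi> \<bullet> b) * ?c \<xi>))"
      unfolding schw_fourier_dir_deriv[OF g b] by (simp add: ac_simps)
    from integrable_mult_right[OF this, of "- \<i>"]
    show "integrable lborel (\<lambda>\<xi>. complex_of_real (\<xi> \<bullet> b) * ?c \<xi>)" by simp
  qed measurable
  have e1: "(\<lambda>r::real. LINT \<xi>|lborel. exp (\<i> * (r * (\<xi> \<bullet> b))) * ?c \<xi>) = (\<lambda>r. LINT \<xi>|lborel. phase s \<xi> * fourier g \<xi> * exp (\<i> * complex_of_real ((y + r *\<^sub>R b) \<bullet> \<xi>)))"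
    by (intro ext Bochner_Integration.integral_cong) (auto simp: inner_add_left exp_add algebra_simps inner_commute)
  have e2: "(LINT \<xi>|lborel. \<i> * exp (\<i> * ((0::real) * (\<xi> \<bullet> b))) * ((\<xi> \<bullet> b) * ?c \<xi>)) =
     (LINT \<xi>|lborel. phase s \<xi> * fourier (dir_deriv b g) \<xi> * exp (\<i> * complex_of_real (y \<bullet> \<xi>)))"
    unfolding schw_fourier_dir_deriv[OF g b] by (intro Bochner_Integration.integral_cong) auto
  show ?thesis
    unfolding free_propagator_alt
    using A unfolding e1 e2 by (rule has_vector_derivative_mult_right)
qed

lemma schw_laplacian: "schw g \<Longrightarrow> schw (laplacian g)"
  unfolding laplacian_def[abs_def] by (intro schw_sum schw_dir_deriv) auto

lemma fourier_sum:
  fixes f :: "'i \<Rightarrow> real^'n::finite \<Rightarrow> complex"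
  assumes "\<And>i. i \<in> I \<Longrightarrow> integrable lborel (f i)"
  shows "fourier (\<lambda>x. \<Sum>i\<in>I. f i x) \<xi> = (\<Sum>i\<in>I. fourier (f i) \<xi>)"
  unfolding fourier_def sum_distrib_right
  by (rule Bochner_Integration.integral_sum) (use assms in \<open>auto intro!: integrable_exp_times\<close>)

lemma fourier_laplacian:
  assumes g: "schw g" shows "fourier (laplacian g) \<xi> = - complex_of_real ((norm \<xi>)\<^sup>2) * fourier g \<xi>"
proof -
  have "fourier (laplacian g) \<xi> = (\<Sum>i\<in>UNIV. fourier (dir_deriv (axis i 1) (dir_deriv (axis i 1) g)) \<xi>)"
    unfolding laplacian_def[abs_def] by (rule fourier_sum) (auto intro!: schw_integrable schw_dir_deriv g)
  also have "\<dots> = (\<Sum>i\<in>UNIV. \<i> * (\<xi> \<bullet> axis i 1) * (\<i> * (\<xi> \<bullet> axis i 1) * fourier g \<xi>))"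
    by (simp only: schw_fourier_dir_deriv[OF schw_dir_deriv[OF g axis_in_Basis] axis_in_Basis] schw_fourier_dir_deriv[OF g axis_in_Basis])
  also have "\<dots> = (\<Sum>i\<in>UNIV. - complex_of_real ((\<xi> $ i)\<^sup>2)) * fourier g \<xi>"
    by (simp add: inner_axis sum_distrib_right power2_eq_square mult.assoc[symmetric])
       (simp add: mult.assoc mult.left_commute sum_negf[symmetric] del: sum_negf)
  also have "(\<Sum>i\<in>UNIV. - complex_of_real ((\<xi> $ i)\<^sup>2)) = - complex_of_real ((norm \<xi>)\<^sup>2)"
    unfolding power2_norm_eq_inner inner_vec_def by (simp add: sum_negf power2_eq_square)
  finally show ?thesis .
qed

lemma propagator_has_derivative_time:
  fixes g :: "real^'n::finite \<Rightarrow> complex"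
  assumes g: "schw g"
  shows "((\<lambda>r. free_propagator r g y) has_vector_derivative \<i> / 2 * free_propagator s (laplacian g) y) (at s)"
proof -
  let ?c = "\<lambda>\<xi>. fourier g \<xi> * exp (\<i> * complex_of_real (y \<bullet> \<xi>))" and ?a = "\<lambda>\<xi>::real^'n. - (norm \<xi>)\<^sup>2 / 2"
  have A: "((\<lambda>r::real. LINT \<xi>|lborel. exp (\<i> * (r * ?a \<xi>)) * ?c \<xi>) has_vector_derivative
     (LINT \<xi>|lborel. \<i> * exp (\<i> * (s * ?a \<xi>)) * (?a \<xi> * ?c \<xi>))) (at s)"
  proof (rule has_vector_derivative_oscillatory_integral)
    show "integrable lborel ?c" using integrable_propagator_integrand[OF g, of 0 y] by (simp add: phase_def)
    have "integrable lborel (\<lambda>\<xi>. phase 0 \<xi> * fourier (laplacian g) \<xi> * exp (\<i> * complex_of_real (y \<bullet> \<xi>)))"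
      by (rule integrable_propagator_integrand[OF schw_laplacian[OF g]])
    then have "integrable lborel (\<lambda>\<xi>. (1/2) * (- complex_of_real ((norm \<xi>)\<^sup>2) * ?c \<xi>))"
      by (intro integrable_mult_right) (simp add: phase_def fourier_laplacian[OF g] mult.assoc)
    then show "integrable lborel (\<lambda>\<xi>. complex_of_real (?a \<xi>) * ?c \<xi>)" by simp
  qed measurable
  have e1: "(\<lambda>r::real. LINT \<xi>|lborel. exp (\<i> * (r * ?a \<xi>)) * ?c \<xi>) = (\<lambda>r. LINT \<xi>|lborel. phase r \<xi> * fourier g \<xi> * exp (\<i> * complex_of_real (y \<bullet> \<xi>)))"
    by (intro ext Bochner_Integration.integral_cong) (auto simp: phase_def mult.assoc)
  have e2: "(LINT \<xi>|lborel. \<i> * exp (\<i> * (s * ?a \<xi>)) * (?a \<xi> * ?c \<xi>)) =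
     \<i> / 2 * (LINT \<xi>|lborel. phase s \<xi> * fourier (laplacian g) \<xi> * exp (\<i> * complex_of_real (y \<bullet> \<xi>)))"
    unfolding integral_mult_right_zero[symmetric]
    by (intro Bochner_Integration.integral_cong) (auto simp: phase_def fourier_laplacian[OF g] mult.assoc)
  show ?thesis
    unfolding free_propagator_alt mult.left_commute[of "\<i> / 2"]
    using A unfolding e1 e2 by (rule has_vector_derivative_mult_right)
qed

text \<open>Free evolutions of Schwartz functions form a class closed under all basis derivatives of
  spacetime: a time derivative replaces g by (i/2) times its Laplacian, a space derivative replaces
  g by its derivative.\<close>

lemma smooth_propagator_joint:
  fixes g :: "real^'n::finite \<Rightarrow> complex"
  assumes g: "schw g"
  shows "smooth (\<lambda>(s, y). free_propagator s g y)"
proof (rule smooth_coinduct[where Q="\<lambda>h. \<exists>g. schw g \<and> h = (\<lambda>(s, y). free_propagator s g y)"])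
  fix h :: "real \<times> (real^'n) \<Rightarrow> complex" and b :: "real \<times> (real^'n)"
  assume "\<exists>g. schw g \<and> h = (\<lambda>(s, y). free_propagator s g y)" and b: "b \<in> Basis"
  then obtain g where h: "schw g" "h = (\<lambda>(s, y). free_propagator s g y)" by auto
  consider "b = (1, 0)" | c where "c \<in> Basis" "b = (0, c)" using b by (auto simp: Basis_prod_def)
  then show "\<exists>g'. (\<exists>g. schw g \<and> g' = (\<lambda>(s, y). free_propagator s g y)) \<and> (\<forall>x. ((\<lambda>s::real. h (x + s *\<^sub>R b)) has_vector_derivative g' x) (at 0))"
  proof cases
    case 1
    have "((\<lambda>r::real. h (x + r *\<^sub>R b)) has_vector_derivative free_propagator (fst x) (\<lambda>x. \<i> / 2 * laplacian g x) (snd x)) (at 0)" for x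
    proof -
      have "((\<lambda>r. free_propagator ((fst x + 0 *\<^sub>R 1) + r *\<^sub>R 1) g (snd x)) has_vector_derivative \<i> / 2 * free_propagator (fst x) (laplacian g) (snd x)) (at 0)"
      proof -
        have "((\<lambda>r::real. fst x + r) has_vector_derivative 1) (at 0)"
          unfolding has_real_derivative_iff_has_vector_derivative[symmetric] by (auto intro!: derivative_eq_intros)
        from vector_diff_chain_at[OF this, of "\<lambda>r. free_propagator r g (snd x)"] propagator_has_derivative_time[OF h(1), of "snd x" "fst x"]
        show ?thesis by (simp add: o_def)
      qed
      then show ?thesis unfolding propagator_cmult by (simp add: h(2) 1 case_prod_beta)
    qed
    moreover have "schw (\<lambda>x. \<i> / 2 * laplacian g x)" by (intro schw_cmult schw_laplacian h)
    ultimately show ?thesis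
      by (intro exI[of _ "\<lambda>(s, y). free_propagator s (\<lambda>x. \<i> / 2 * laplacian g x) y"]) (auto simp: case_prod_beta)
  next
    case (2 c)
    have "((\<lambda>r::real. h (x + r *\<^sub>R b)) has_vector_derivative free_propagator (fst x) (dir_deriv c g) (snd x)) (at 0)" for x
      using propagator_has_derivative_space[OF h(1) 2(1), of "fst x" "snd x"]
      by (simp add: h(2) 2 case_prod_beta)
    moreover have "schw (dir_deriv c g)" by (intro schw_dir_deriv h 2)
    ultimately show ?thesis
      by (intro exI[of _ "\<lambda>(s, y). free_propagator s (dir_deriv c g) y"]) (auto simp: case_prod_beta)
  qed
qed (use g continuous_propagator in auto)

lemma dir_deriv_propagator:
  "schw g \<Longrightarrow> b \<in> Basis \<Longrightarrow> dir_deriv b (free_propagator s g) = free_propagator s (dir_deriv b g)"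
  by (rule dir_derivI) (rule propagator_has_derivative_space)

lemma smooth_propagator:
  fixes g :: "real^'n::finite \<Rightarrow> complex"
  assumes g: "schw g"
  shows "smooth (free_propagator s g)"
proof (rule smooth_coinduct[where Q="\<lambda>h. \<exists>g. schw g \<and> h = free_propagator s g"])
  fix h :: "real^'n \<Rightarrow> complex"
  assume "\<exists>g. schw g \<and> h = free_propagator s g"
  then obtain g where h: "schw g" "h = free_propagator s g" by auto
  have "continuous_on UNIV (\<lambda>y. (\<lambda>(s, y). free_propagator s g y) (s, y))"
    by (rule continuous_on_compose2[OF continuous_propagator[OF h(1)]]) (auto intro!: continuous_intros)
  then show "continuous_on UNIV h" by (simp add: h(2))
  fix b :: "real^'n" assume b: "b \<in> Basis"
  then show "\<exists>g'. (\<exists>g. schw g \<and> g' = free_propagator s g) \<and> (\<forall>x. ((\<lambda>s::real. h (x + s *\<^sub>R b)) has_vector_derivative g' x) (at 0))"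
    using propagator_has_derivative_space[OF h(1) b, of s] schw_dir_deriv[OF h(1) b] h(2) by blast
qed (use g in auto)

lemma laplacian_propagator:
  assumes g: "schw g" shows "laplacian (free_propagator s g) y = free_propagator s (laplacian g) y"
proof -
  have "free_propagator s (\<lambda>x. \<Sum>i\<in>I. dir_deriv (axis i 1) (dir_deriv (axis i 1) g) x) y =
     (\<Sum>i\<in>I. free_propagator s (dir_deriv (axis i 1) (dir_deriv (axis i 1) g)) y)" if "finite I" for I
    using that
  proof (induction I)
    case empty
    show ?case using propagator_cmult[of s 0 "\<lambda>x. 0" y] by simp
  next
    case (insert i I)
    then show ?case
      by (simp add: propagator_add(1) schw_sum schw_dir_deriv g)
  qed
  from this[of UNIV] show ?thesis
    by (simp add: laplacian_def[abs_def] dir_deriv_propagator schw_dir_deriv g)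
qed

section \<open>Decay, unitarity and Galilei covariance of the free propagator\<close>

lemma measurable_cnj [measurable (raw)]: "f \<in> borel_measurable M \<Longrightarrow> (\<lambda>x. cnj (f x)) \<in> borel_measurable M"
  by (rule borel_measurable_continuous_on[OF continuous_on_cnj[OF continuous_on_id]])

text \<open>The Galilei vector field x + i s d_b conjugates to multiplication by the coordinate
  under the free flow. The proof integrates the total \<xi>-derivative of the oscillatory integrand,
  which gives zero; the phase contributes the term with s.\<close>

lemma propagator_coord:
  fixes g :: "real^'n::finite \<Rightarrow> complex"
  assumes g: "schw g" and b: "b \<in> Basis"
  shows "(y \<bullet> b) * free_propagator s g y =
    free_propagator s (\<lambda>x. (x \<bullet> b) * g x) y - \<i> * s * free_propagator s (dir_deriv b g) y"
proof -
  let ?e = "\<lambda>\<xi>. exp (\<i> * complex_of_real (y \<bullet> \<xi>))"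
  let ?xg = "\<lambda>x. (x \<bullet> b) * g x"
  have xg: "schw ?xg" by (rule schw_coord[OF g b])
  have dg: "schw (dir_deriv b g)" by (rule schw_dir_deriv[OF g b])
  have [measurable]: "fourier g \<in> borel_measurable borel" "fourier ?xg \<in> borel_measurable borel"
    using g xg by (auto intro: measurable_fourier schw_integrable)
  let ?G = "\<lambda>\<xi>. phase s \<xi> * fourier g \<xi> * ?e \<xi>"
  let ?G1 = "\<lambda>\<xi>. phase s \<xi> * fourier ?xg \<xi> * ?e \<xi>"
  let ?G2 = "\<lambda>\<xi>. phase s \<xi> * fourier (dir_deriv b g) \<xi> * ?e \<xi>"
  let ?G' = "\<lambda>\<xi>. \<i> * (y \<bullet> b) * ?G \<xi> - \<i> * ?G1 \<xi> - s * ?G2 \<xi>"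
  have F2: "fourier (dir_deriv b g) \<xi> = \<i> * (\<xi> \<bullet> b) * fourier g \<xi>" for \<xi>
    by (rule schw_fourier_dir_deriv[OF g b])
  have [measurable]: "fourier (dir_deriv b g) \<in> borel_measurable borel" using dg by (auto intro: measurable_fourier schw_integrable)
  obtain M0 where M0: "\<And>\<xi>. cmod (fourier g \<xi>) \<le> M0 * wt \<xi>" using rapid_wt_bound[OF rapid_fourier[OF g]] by blast
  obtain M1 where M1: "\<And>\<xi>. cmod (fourier ?xg \<xi>) \<le> M1 * wt \<xi>" using rapid_wt_bound[OF rapid_fourier[OF xg]] by blast
  obtain M2 where M2: "\<And>\<xi>. cmod (fourier (dir_deriv b g) \<xi>) \<le> M2 * wt \<xi>" using rapid_wt_bound[OF rapid_fourier[OF dg]] by blast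
  have z0: "integral\<^sup>L lborel ?G' = 0"
  proof (rule integral_dir_deriv_zero[where G="?G" and b=b and M="\<bar>y \<bullet> b\<bar> * M0 + M1 + \<bar>s\<bar> * M2" and c=0])
    show "integrable lborel ?G" by (rule integrable_propagator_integrand[OF g])
    show "((\<lambda>r::real. ?G (\<xi> + r *\<^sub>R b)) has_vector_derivative ?G' \<xi>) (at 0)" for \<xi>
    proof -
      have d1: "((\<lambda>r::real. fourier g (\<xi> + r *\<^sub>R b)) has_vector_derivative - \<i> * fourier ?xg \<xi>) (at 0)"
        by (rule fourier_has_vector_derivative[OF g b])
      have d2: "((\<lambda>r::real. ?e (\<xi> + r *\<^sub>R b)) has_vector_derivative \<i> * (y \<bullet> b) * ?e \<xi>) (at 0)"
        using has_vector_derivative_character[of \<xi> b "- y"] by (simp add: inner_commute)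
      have d3: "((\<lambda>r::real. phase s (\<xi> + r *\<^sub>R b)) has_vector_derivative - \<i> * s * (\<xi> \<bullet> b) * phase s \<xi>) (at 0)"
      proof -
        have n: "(norm (\<xi> + r *\<^sub>R b))\<^sup>2 = (norm \<xi>)\<^sup>2 + 2 * r * (\<xi> \<bullet> b) + r\<^sup>2" for r
          unfolding power2_norm_eq_inner using b
          by (simp add: inner_add_left inner_add_right inner_commute algebra_simps power2_eq_square inner_Basis)
        \<comment> \<open>The exponent is quadratic in r, with leading coefficient taken from the
          unit length of \<open>b\<close>; replacing r by a complex z makes the field derivative
          rules applicable.\<close>
        let ?p = "\<lambda>z. exp (- (\<i> * (complex_of_real s * (complex_of_real ((norm \<xi>)\<^sup>2) + 2 * z * complex_of_real (\<xi> \<bullet> b) + z\<^sup>2) / 2)))"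
        have "(?p has_field_derivative ?p (complex_of_real 0) * (- (\<i> * (complex_of_real s * (2 * complex_of_real (\<xi> \<bullet> b)) / 2)))) (at (complex_of_real 0))"
          by (auto intro!: derivative_eq_intros)
        from has_vector_derivative_real_field[OF this] show ?thesis
          by (simp add: phase_def n algebra_simps)
      qed
      have d: "((\<lambda>r::real. phase s (\<xi> + r *\<^sub>R b) * fourier g (\<xi> + r *\<^sub>R b) * ?e (\<xi> + r *\<^sub>R b)) has_vector_derivative
         phase s \<xi> * fourier g \<xi> * (\<i> * (y \<bullet> b) * ?e \<xi>) + (phase s \<xi> * (- \<i> * fourier ?xg \<xi>) + - \<i> * s * (\<xi> \<bullet> b) * phase s \<xi> * fourier g \<xi>) * ?e \<xi>) (at 0)"
        using has_vector_derivative_mult[OF has_vector_derivative_mult[OF d3 d1] d2] by simp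
      have "phase s \<xi> * fourier g \<xi> * (\<i> * (y \<bullet> b) * ?e \<xi>) + (phase s \<xi> * (- \<i> * fourier ?xg \<xi>) + - \<i> * s * (\<xi> \<bullet> b) * phase s \<xi> * fourier g \<xi>) * ?e \<xi> = ?G' \<xi>"
        unfolding F2 by (simp add: algebra_simps)
      with d show ?thesis by (simp only:)
    qed
    show "cmod (?G' \<xi>) \<le> (\<bar>y \<bullet> b\<bar> * M0 + M1 + \<bar>s\<bar> * M2) * wt (\<xi> - 0)" for \<xi>
    proof -
      have "cmod (?G' \<xi>) \<le> cmod (\<i> * (y \<bullet> b) * ?G \<xi>) + cmod (\<i> * ?G1 \<xi>) + cmod (s * ?G2 \<xi>)"
        by (intro order_trans[OF norm_triangle_ineq4] add_mono order_refl)
      also have "\<dots> = \<bar>y \<bullet> b\<bar> * cmod (fourier g \<xi>) + cmod (fourier ?xg \<xi>) + \<bar>s\<bar> * cmod (fourier (dir_deriv b g) \<xi>)"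
        by (simp add: norm_mult)
      also have "\<dots> \<le> \<bar>y \<bullet> b\<bar> * (M0 * wt \<xi>) + M1 * wt \<xi> + \<bar>s\<bar> * (M2 * wt \<xi>)"
        by (intro add_mono mult_left_mono M0 M1 M2) auto
      finally show ?thesis by (simp add: algebra_simps)
    qed
  qed (use b in auto)
  have "integral\<^sup>L lborel ?G' = \<i> * (y \<bullet> b) * (LINT \<xi>|lborel. ?G \<xi>) - \<i> * (LINT \<xi>|lborel. ?G1 \<xi>) - s * (LINT \<xi>|lborel. ?G2 \<xi>)"
  proof -
    have "integrable lborel (\<lambda>\<xi>. \<i> * (y \<bullet> b) * ?G \<xi>)" "integrable lborel (\<lambda>\<xi>. \<i> * ?G1 \<xi>)" "integrable lborel (\<lambda>\<xi>. s * ?G2 \<xi>)"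
      by (intro integrable_mult_right integrable_propagator_integrand g xg dg)+
    then show ?thesis
      by (simp only: Bochner_Integration.integral_diff Bochner_Integration.integrable_diff integral_mult_right_zero)
  qed
  then have z: "\<i> * (y \<bullet> b) * (LINT \<xi>|lborel. ?G \<xi>) - \<i> * (LINT \<xi>|lborel. ?G1 \<xi>) - s * (LINT \<xi>|lborel. ?G2 \<xi>) = 0"
    using z0 by (simp only:)
  have "(y \<bullet> b) * (LINT \<xi>|lborel. ?G \<xi>) = (LINT \<xi>|lborel. ?G1 \<xi>) - \<i> * s * (LINT \<xi>|lborel. ?G2 \<xi>)"
  proof -
    have "- \<i> * (\<i> * (y \<bullet> b) * A - \<i> * B - s * C) = (y \<bullet> b) * A - (B - \<i> * s * C)" for A B C :: complex
      by (simp add: algebra_simps)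
    from this[of "integral\<^sup>L lborel ?G" "integral\<^sup>L lborel ?G1" "integral\<^sup>L lborel ?G2"] show ?thesis unfolding z by simp
  qed
  then show ?thesis unfolding free_propagator_alt
    by (simp only: mult.left_commute[of "complex_of_real (y \<bullet> b)"] mult.left_commute[of "\<i> * complex_of_real s"] right_diff_distrib[symmetric])
qed

text \<open>Two uses of \<open>propagator_coord\<close> express multiplication by 1 + y_b^2 through
  evolutions of other Schwartz functions, with coefficients at most quadratic in s. The induction
  therefore ranges over all Schwartz data, and the bound is uniform for |s| <= T.\<close>

lemma propagator_decay_list:
  fixes g :: "real^'n::finite \<Rightarrow> complex"
  assumes "schw g" "set bs \<subseteq> Basis" "0 \<le> T"
  shows "\<exists>C\<ge>0. \<forall>s y. \<bar>s\<bar> \<le> T \<longrightarrow> prod_list (map (\<lambda>b. 1 + (y \<bullet> b)\<^sup>2) bs) * cmod (free_propagator s g y) \<le> C"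
  using assms(1,2)
proof (induction bs arbitrary: g)
  case Nil
  have "0 \<le> 1 / (2 * pi) ^ CARD('n) * (LINT \<xi>|lborel. cmod (fourier g \<xi>))"
    by (intro mult_nonneg_nonneg integral_nonneg_AE) auto
  then show ?case using propagator_bounded[of _ g] by (intro exI[of _ "1 / (2 * pi) ^ CARD('n) * (LINT \<xi>|lborel. cmod (fourier g \<xi>))"]) auto
next
  case (Cons b bs)
  have b: "b \<in> Basis" and bs: "set bs \<subseteq> Basis" using Cons.prems by auto
  note g = Cons.prems(1)
  let ?x = "\<lambda>g x. complex_of_real (x \<bullet> b) * g x"
  let ?P = "\<lambda>y. prod_list (map (\<lambda>b. 1 + (y \<bullet> b)\<^sup>2) bs)"
  have sg: "schw (?x g)" "schw (?x (?x g))" "schw (dir_deriv b (?x g))" "schw (?x (dir_deriv b g))" "schw (dir_deriv b (dir_deriv b g))" "schw (dir_deriv b g)"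
    using g b by (auto intro!: schw_coord schw_dir_deriv)
  obtain C0 where C0: "C0 \<ge> 0" "\<And>s y. \<bar>s\<bar> \<le> T \<Longrightarrow> ?P y * cmod (free_propagator s g y) \<le> C0" using Cons.IH[OF g bs] by blast
  obtain C1 where C1: "C1 \<ge> 0" "\<And>s y. \<bar>s\<bar> \<le> T \<Longrightarrow> ?P y * cmod (free_propagator s (?x (?x g)) y) \<le> C1" using Cons.IH[OF sg(2) bs] by blast
  obtain C2 where C2: "C2 \<ge> 0" "\<And>s y. \<bar>s\<bar> \<le> T \<Longrightarrow> ?P y * cmod (free_propagator s (dir_deriv b (?x g)) y) \<le> C2" using Cons.IH[OF sg(3) bs] by blast
  obtain C3 where C3: "C3 \<ge> 0" "\<And>s y. \<bar>s\<bar> \<le> T \<Longrightarrow> ?P y * cmod (free_propagator s (?x (dir_deriv b g)) y) \<le> C3" using Cons.IH[OF sg(4) bs] by blast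
  obtain C4 where C4: "C4 \<ge> 0" "\<And>s y. \<bar>s\<bar> \<le> T \<Longrightarrow> ?P y * cmod (free_propagator s (dir_deriv b (dir_deriv b g)) y) \<le> C4" using Cons.IH[OF sg(5) bs] by blast
  let ?C = "C0 + C1 + T * C2 + T * C3 + T * T * C4"
  have "prod_list (map (\<lambda>b. 1 + (y \<bullet> b)\<^sup>2) (b # bs)) * cmod (free_propagator s g y) \<le> ?C" if s: "\<bar>s\<bar> \<le> T" for s y
  proof -
    let ?U = "\<lambda>g. free_propagator s g y"
    have P: "0 \<le> ?P y" by (induction bs) auto
    have "(1 + complex_of_real ((y \<bullet> b)\<^sup>2)) * ?U g = ?U g + (y \<bullet> b) * ((y \<bullet> b) * ?U g)"
      by (simp add: algebra_simps power2_eq_square)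
    also have "\<dots> = ?U g + ?U (?x (?x g)) - \<i> * s * ?U (dir_deriv b (?x g)) - \<i> * s * ?U (?x (dir_deriv b g)) - s * s * ?U (dir_deriv b (dir_deriv b g))"
    proof -
      have "(y \<bullet> b) * ((y \<bullet> b) * ?U g) = (y \<bullet> b) * ?U (?x g) - \<i> * s * ((y \<bullet> b) * ?U (dir_deriv b g))"
        unfolding propagator_coord[OF g b] by (simp add: algebra_simps)
      then show ?thesis unfolding propagator_coord[OF sg(1) b] propagator_coord[OF sg(6) b]
        by (simp add: algebra_simps)
    qed
    finally have e: "(1 + complex_of_real ((y \<bullet> b)\<^sup>2)) * ?U g = \<dots>" .
    have "(1 + (y \<bullet> b)\<^sup>2) * cmod (?U g) = cmod ((1 + complex_of_real ((y \<bullet> b)\<^sup>2)) * ?U g)"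
    proof -
      have "1 + complex_of_real ((y \<bullet> b)\<^sup>2) = complex_of_real (1 + (y \<bullet> b)\<^sup>2)" by simp
      then show ?thesis unfolding norm_mult by (simp only: norm_of_real) simp
    qed
    also have "\<dots> \<le> cmod (?U g) + cmod (?U (?x (?x g))) + cmod (\<i> * s * ?U (dir_deriv b (?x g))) + cmod (\<i> * s * ?U (?x (dir_deriv b g))) + cmod (s * s * ?U (dir_deriv b (dir_deriv b g)))"
      unfolding e by (intro order_trans[OF norm_triangle_ineq4] order_trans[OF norm_triangle_ineq] add_mono order_refl)
    also have "\<dots> = cmod (?U g) + cmod (?U (?x (?x g))) + \<bar>s\<bar> * cmod (?U (dir_deriv b (?x g))) + \<bar>s\<bar> * cmod (?U (?x (dir_deriv b g))) + \<bar>s\<bar> * \<bar>s\<bar> * cmod (?U (dir_deriv b (dir_deriv b g)))"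
      by (simp add: norm_mult)
    finally have "?P y * ((1 + (y \<bullet> b)\<^sup>2) * cmod (?U g)) \<le> ?P y * \<dots>" by (rule mult_left_mono[OF _ P])
    also have "\<dots> = ?P y * cmod (?U g) + ?P y * cmod (?U (?x (?x g))) + \<bar>s\<bar> * (?P y * cmod (?U (dir_deriv b (?x g)))) + \<bar>s\<bar> * (?P y * cmod (?U (?x (dir_deriv b g)))) + \<bar>s\<bar> * \<bar>s\<bar> * (?P y * cmod (?U (dir_deriv b (dir_deriv b g))))"
      by (simp add: algebra_simps)
    also have "\<dots> \<le> ?C"
      using C0 C1 C2 C3 C4 s assms(3) P by (intro add_mono mult_mono) auto
    finally show ?thesis by (simp add: ac_simps)
  qed
  moreover have "0 \<le> ?C" using C0 C1 C2 C3 C4 assms(3) by auto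
  ultimately show ?case by blast
qed

lemma propagator_decay:
  fixes g :: "real^'n::finite \<Rightarrow> complex"
  assumes "schw g" "0 \<le> T"
  shows "\<exists>M\<ge>0. \<forall>s y. \<bar>s\<bar> \<le> T \<longrightarrow> cmod (free_propagator s g y) \<le> M * wt y ^ k"
proof -
  obtain cs :: "(real^'n) list" where cs: "set cs = Basis" "distinct cs"
    using finite_distinct_list[OF finite_Basis] by blast
  let ?bs = "concat (replicate k cs)"
  have pl: "prod_list (map f (concat (replicate k cs))) = prod_list (map f cs) ^ k" for f :: "real^'n \<Rightarrow> real"
    by (induction k) auto
  have "set ?bs \<subseteq> Basis" using cs by auto
  from propagator_decay_list[OF assms(1) this assms(2)]
  obtain C where C: "C \<ge> 0" "\<And>s y. \<bar>s\<bar> \<le> T \<Longrightarrow> prod_list (map (\<lambda>b. 1 + (y \<bullet> b)\<^sup>2) cs) ^ k * cmod (free_propagator s g y) \<le> C"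
    unfolding pl by blast
  have "prod_list (map (\<lambda>b. 1 + (y \<bullet> b)\<^sup>2) cs) = 1 / wt y" for y
    using cs by (simp add: wt_def prod.distinct_set_conv_list[symmetric] prod_dividef)
  with C show ?thesis by (intro exI[of _ C]) (simp add: power_one_over field_simps)
qed

text \<open>Basis derivatives commute with the propagator, so \<open>propagator_decay\<close> for
  the differentiated data controls all derivatives, with one constant for |s| <= T.\<close>

lemma propagator_deriv_bound:
  fixes g :: "real^'n::finite \<Rightarrow> complex"
  assumes "schw g" "0 \<le> T"
  shows "\<exists>M\<ge>0. \<forall>s. \<bar>s\<bar> \<le> T \<longrightarrow> deriv_bound N (\<lambda>y. M * wt y ^ k) (free_propagator s g)"
  using assms(1)
proof (induction N arbitrary: g)
  case 0 then show ?case using propagator_decay[OF 0 assms(2), of k] by auto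
next
  case (Suc N)
  obtain M0 where M0: "M0 \<ge> 0" "\<And>s y. \<bar>s\<bar> \<le> T \<Longrightarrow> cmod (free_propagator s g y) \<le> M0 * wt y ^ k"
    using propagator_decay[OF Suc.prems assms(2), of k] by blast
  have "\<forall>b\<in>Basis. \<exists>M\<ge>0. \<forall>s. \<bar>s\<bar> \<le> T \<longrightarrow> deriv_bound N (\<lambda>y. M * wt y ^ k) (free_propagator s (dir_deriv b g))"
    using Suc schw_dir_deriv by blast
  then obtain M where M: "\<And>b. b \<in> Basis \<Longrightarrow> M b \<ge> 0"
    "\<And>b s. b \<in> Basis \<Longrightarrow> \<bar>s\<bar> \<le> T \<Longrightarrow> deriv_bound N (\<lambda>y. M b * wt y ^ k) (free_propagator s (dir_deriv b g))"
    by metis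
  let ?M = "M0 + (\<Sum>b\<in>Basis. M b)"
  have s0: "0 \<le> (\<Sum>b\<in>Basis. M b)" using M(1) by (rule sum_nonneg)
  have "deriv_bound (Suc N) (\<lambda>y. ?M * wt y ^ k) (free_propagator s g)" if s: "\<bar>s\<bar> \<le> T" for s
    unfolding deriv_bound.simps
  proof (intro conjI allI ballI)
    show "cmod (free_propagator s g y) \<le> ?M * wt y ^ k" for y
      using order_trans[OF M0(2)[OF s, of y] mult_right_mono[of M0 ?M "wt y ^ k"]] s0 by simp
    fix b :: "real^'n" assume b: "b \<in> Basis"
    have "M b \<le> ?M" using member_le_sum[of b Basis M] b M(1) M0(1) by (auto intro: add_increasing)
    then show "deriv_bound N (\<lambda>y. ?M * wt y ^ k) (dir_deriv b (free_propagator s g))"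
      unfolding dir_deriv_propagator[OF Suc.prems b]
      by (intro deriv_bound_mono[OF M(2)[OF b s]] mult_right_mono) auto
  qed
  then show ?case using s0 M0(1) by (intro exI[of _ ?M]) auto
qed

lemma propagator_measurable: "schw g \<Longrightarrow> free_propagator s g \<in> borel_measurable borel"
  by (rule smooth_measurable[OF smooth_propagator])

lemma propagator_wt_bound:
  fixes g :: "real^'n::finite \<Rightarrow> complex"
  assumes "schw g" shows "\<exists>M\<ge>0. \<forall>y. cmod (free_propagator s g y) \<le> M * wt y"
  using propagator_decay[OF assms, of "\<bar>s\<bar>" 1] by auto

text \<open>Unitarity makes the normalization constant of the moving window independent of time; the
  kernel estimate divides by it.\<close>

lemma propagator_L2_norm:
  fixes g :: "real^'n::finite \<Rightarrow> complex"
  assumes g: "schw g"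
  shows "(LINT y|lborel. (cmod (free_propagator s g y))\<^sup>2) = (LINT y|lborel. (cmod (g y))\<^sup>2)"
proof -
  let ?c = "1 / (2 * pi) ^ CARD('n)"
  \<comment> \<open>The right-hand side is free of s because the phase is unimodular. Comparing the
    identity at s with the identity at 0 then finishes the proof.\<close>
  have P: "complex_of_real (LINT y|lborel. (cmod (free_propagator s g y))\<^sup>2) = complex_of_real ?c * (LINT \<xi>|lborel. fourier g \<xi> * cnj (fourier g \<xi>))" for s
  proof -
    let ?a = "\<lambda>\<xi>. phase s \<xi> * fourier g \<xi>"
    obtain M where M: "M \<ge> 0" "\<And>\<xi>. cmod (fourier g \<xi>) \<le> M * wt \<xi>" using rapid_wt_bound[OF rapid_fourier[OF g]] by blast
    obtain M' where M': "M' \<ge> 0" "\<And>y. cmod (free_propagator s g y) \<le> M' * wt y" using propagator_wt_bound[OF g] by blast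
    have [measurable]: "fourier g \<in> borel_measurable borel" by (intro measurable_fourier schw_integrable g)
    have mU [measurable]: "free_propagator s g \<in> borel_measurable borel" by (rule propagator_measurable[OF g])
    have U: "free_propagator s g = inv_fourier ?a" by (simp add: free_propagator_def phase_def)
    have cg: "continuous_on UNIV (fourier g)" by (rule continuous_fourier[OF schw_integrable[OF g]])
    have FU: "fourier (free_propagator s g) \<xi> = ?a \<xi>" for \<xi>
      unfolding U
    proof (rule fourier_inv_fourier[where M=M])
      show "continuous_on UNIV ?a" by (intro continuous_intros cg)
      show "cmod (?a x) \<le> M * wt x" for x using M(2)[of x] by (simp add: norm_mult)
      show "integrable lborel (inv_fourier ?a)" unfolding U[symmetric]
        by (rule integrable_wt_bound[of _ M' 0]) (use M' in auto)
    qed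
    have "complex_of_real (LINT y|lborel. (cmod (free_propagator s g y))\<^sup>2) = (LINT y|lborel. free_propagator s g y * cnj (free_propagator s g y))"
      unfolding integral_complex_of_real[symmetric] by (simp only: complex_norm_square)
    also have "\<dots> = (LINT y|lborel. LINT \<xi>|lborel. complex_of_real ?c * (free_propagator s g y * exp (- \<i> * complex_of_real (y \<bullet> \<xi>)) * cnj (?a \<xi>)))"
    proof (rule Bochner_Integration.integral_cong[OF refl])
      fix y
      have "cnj (free_propagator s g y) = complex_of_real ?c * (LINT \<xi>|lborel. exp (- \<i> * complex_of_real (y \<bullet> \<xi>)) * cnj (?a \<xi>))"
        unfolding free_propagator_alt complex_cnj_mult
        by (subst Bochner_Integration.integral_cnj[symmetric]) (simp add: exp_cnj mult.commute del: Bochner_Integration.integral_cnj)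
      then show "free_propagator s g y * cnj (free_propagator s g y) = (LINT \<xi>|lborel. complex_of_real ?c * (free_propagator s g y * exp (- \<i> * complex_of_real (y \<bullet> \<xi>)) * cnj (?a \<xi>)))"
        unfolding mult.assoc integral_mult_right_zero by (simp only: mult.left_commute)
    qed
    also have "\<dots> = (LINT \<xi>|lborel. LINT y|lborel. complex_of_real ?c * (free_propagator s g y * exp (- \<i> * complex_of_real (y \<bullet> \<xi>)) * cnj (?a \<xi>)))"
    proof (rule fubini_product_bound(1)[where A="\<lambda>y. ?c * (M' * wt y)" and B="\<lambda>\<xi>. M * wt \<xi>"])
      show "cmod (complex_of_real ?c * (free_propagator s g y * exp (- \<i> * complex_of_real (y \<bullet> \<xi>)) * cnj (?a \<xi>))) \<le> ?c * (M' * wt y) * (M * wt \<xi>)" for y \<xi>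
      proof -
        have "cmod (free_propagator s g y) * cmod (fourier g \<xi>) \<le> (M' * wt y) * (M * wt \<xi>)"
          using M M' by (intro mult_mono) auto
        then have "?c * (cmod (free_propagator s g y) * cmod (fourier g \<xi>)) \<le> ?c * ((M' * wt y) * (M * wt \<xi>))"
          by (intro mult_left_mono) auto
        moreover have "cmod (complex_of_real ?c) = ?c" unfolding norm_of_real by simp
        ultimately show ?thesis unfolding norm_mult by (simp only: complex_mod_cnj norm_mult cmod_phase) (simp add: mult.assoc)
      qed
    qed auto
    also have "\<dots> = (LINT \<xi>|lborel. complex_of_real ?c * (fourier (free_propagator s g) \<xi> * cnj (?a \<xi>)))"
      unfolding fourier_def integral_mult_left_zero[symmetric] integral_mult_right_zero[symmetric] ..
    also have "\<dots> = (LINT \<xi>|lborel. complex_of_real ?c * (fourier g \<xi> * cnj (fourier g \<xi>)))"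
    proof (rule Bochner_Integration.integral_cong[OF refl])
      fix \<xi> :: "real^'n"
      have "phase s \<xi> * cnj (phase s \<xi>) = 1" by (simp add: complex_norm_square[symmetric])
      then have "phase s \<xi> * fourier g \<xi> * cnj (phase s \<xi> * fourier g \<xi>) = fourier g \<xi> * cnj (fourier g \<xi>)"
        by (simp add: ac_simps)
      then show "complex_of_real ?c * (fourier (free_propagator s g) \<xi> * cnj (?a \<xi>)) = complex_of_real ?c * (fourier g \<xi> * cnj (fourier g \<xi>))"
        unfolding FU by (simp only:)
    qed
    finally show ?thesis by (simp only: integral_mult_right_zero)
  qed
  have "complex_of_real (LINT y|lborel. (cmod (free_propagator s g y))\<^sup>2) = complex_of_real (LINT y|lborel. (cmod (free_propagator 0 g y))\<^sup>2)"
    unfolding P ..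
  then show ?thesis unfolding propagator_zero[OF g] of_real_eq_iff .
qed

text \<open>This is why the window must evolve freely: the evolution of a packet at (c, k) is again
  a packet of frequency k, with the evolved window, centred at c + s k. Only a unimodular phase is
  left over.\<close>

lemma propagator_galilei:
  fixes g :: "real^'n::finite \<Rightarrow> complex"
  assumes g: "schw g"
  shows "free_propagator s (\<lambda>z. exp (\<i> * complex_of_real (z \<bullet> k)) * g (z - c)) y =
    exp (\<i> * complex_of_real (y \<bullet> k)) * phase s k * free_propagator s g (y - c - s *\<^sub>R k)"
proof -
  have [measurable]: "g \<in> borel_measurable borel" using g by (rule schw_measurable)
  note [measurable] = measurable_fourier[OF schw_integrable[OF g]]
  have F: "fourier (\<lambda>z. exp (\<i> * complex_of_real (z \<bullet> k)) * g (z - c)) \<eta> = exp (- \<i> * complex_of_real (c \<bullet> (\<eta> - k))) * fourier g (\<eta> - k)" for \<eta>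
  proof -
    have "fourier (\<lambda>z. exp (\<i> * complex_of_real (z \<bullet> k)) * g (z - c)) \<eta> = (LINT z|lborel. g (z - c) * exp (- \<i> * complex_of_real (z \<bullet> (\<eta> - k))))"
      unfolding fourier_def by (rule Bochner_Integration.integral_cong) (simp_all add: mult_exp_exp inner_diff_right algebra_simps)
    also have "\<dots> = (LINT z|lborel. g ((c + z) - c) * exp (- \<i> * complex_of_real ((c + z) \<bullet> (\<eta> - k))))"
      by (rule lborel_integral_translate(1)[symmetric]) measurable
    also have "\<dots> = (LINT z|lborel. exp (- \<i> * complex_of_real (c \<bullet> (\<eta> - k))) * (g z * exp (- \<i> * complex_of_real (z \<bullet> (\<eta> - k)))))"
      by (rule Bochner_Integration.integral_cong) (simp_all add: inner_add_left exp_add algebra_simps exp_diff)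
    finally show ?thesis unfolding fourier_def integral_mult_right_zero .
  qed
  let ?f = "\<lambda>\<eta>. phase s \<eta> * (exp (- \<i> * complex_of_real (c \<bullet> (\<eta> - k))) * fourier g (\<eta> - k)) * exp (\<i> * complex_of_real (y \<bullet> \<eta>))"
  have "(LINT \<eta>|lborel. ?f \<eta>) = (LINT \<eta>|lborel. ?f (k + \<eta>))"
    by (rule lborel_integral_translate(1)[symmetric]) measurable
  also have "\<dots> = (LINT \<eta>|lborel. (exp (\<i> * complex_of_real (y \<bullet> k)) * phase s k) * (phase s \<eta> * fourier g \<eta> * exp (\<i> * complex_of_real ((y - c - s *\<^sub>R k) \<bullet> \<eta>))))"
  proof (rule Bochner_Integration.integral_cong[OF refl])
    fix \<eta> :: "real^'n"
    \<comment> \<open>The cross term of the square, multiplied by s, is linear in \<eta> and becomes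
      the translation of the window by s k.\<close>
    have n: "(norm (k + \<eta>))\<^sup>2 = (norm k)\<^sup>2 + 2 * (k \<bullet> \<eta>) + (norm \<eta>)\<^sup>2"
      unfolding power2_norm_eq_inner by (simp add: inner_add_left inner_add_right inner_commute)
    have h: "phase s (k + \<eta>) * exp (- \<i> * complex_of_real (c \<bullet> \<eta>)) * exp (\<i> * complex_of_real (y \<bullet> (k + \<eta>))) =
      exp (\<i> * complex_of_real (y \<bullet> k)) * phase s k * phase s \<eta> * exp (\<i> * complex_of_real ((y - c - s *\<^sub>R k) \<bullet> \<eta>))"
      unfolding phase_def mult_exp_exp n
      by (rule arg_cong[where f=exp]) (simp add: inner_diff_left inner_add_right algebra_simps add_divide_distrib)
    have "?f (k + \<eta>) = (phase s (k + \<eta>) * exp (- \<i> * complex_of_real (c \<bullet> \<eta>)) * exp (\<i> * complex_of_real (y \<bullet> (k + \<eta>)))) * fourier g \<eta>"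
      unfolding add_diff_cancel_left' by (simp only: ac_simps)
    then show "?f (k + \<eta>) = (exp (\<i> * complex_of_real (y \<bullet> k)) * phase s k) * (phase s \<eta> * fourier g \<eta> * exp (\<i> * complex_of_real ((y - c - s *\<^sub>R k) \<bullet> \<eta>)))"
      unfolding h by (simp only: ac_simps)
  qed
  finally show ?thesis
    unfolding free_propagator_alt F integral_mult_right_zero by (simp only: ac_simps)
qed

section \<open>Almost diagonalization of multiplication operators\<close>

text \<open>A non-integrable function has integral 0 by convention, so the bound holds in every case
  and integrability need not be carried along.\<close>

lemma norm_integral_le_nn_integral:
  fixes f :: "'a \<Rightarrow> 'b::{banach, second_countable_topology}"
  shows "ennreal (norm (integral\<^sup>L M f)) \<le> (\<integral>\<^sup>+x. ennreal (norm (f x)) \<partial>M)"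
  by (cases "integrable M f") (auto simp: integral_norm_bound_ennreal not_integrable_integral_eq)

text \<open>Inserting Fourier inversion for \<open>h\<close> and exchanging the integrals turns the
  product into a convolution of transforms.\<close>

lemma fourier_mult:
  fixes f h :: "real^'n::finite \<Rightarrow> complex"
  assumes f: "integrable lborel f" and c: "continuous_on UNIV h" and h: "\<And>x. cmod (h x) \<le> M * wt x"
    and i: "integrable lborel (fourier h)"
  shows "fourier (\<lambda>y. f y * h y) \<xi> = complex_of_real (1 / (2 * pi) ^ CARD('n)) * (LINT \<eta>|lborel. fourier h \<eta> * fourier f (\<xi> - \<eta>))"
proof -
  let ?c = "complex_of_real (1 / (2 * pi) ^ CARD('n))"
  have [measurable]: "f \<in> borel_measurable borel" "fourier h \<in> borel_measurable borel" using f i by auto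
  have "fourier (\<lambda>y. f y * h y) \<xi> = (LINT y|lborel. f y * inv_fourier (fourier h) y * exp (- \<i> * complex_of_real (y \<bullet> \<xi>)))"
    unfolding fourier_inversion[OF c h i] by (rule fourier_def)
  also have "\<dots> = (LINT y|lborel. ?c * (LINT \<eta>|lborel. fourier h \<eta> * (f y * exp (- \<i> * complex_of_real (y \<bullet> (\<xi> - \<eta>))))))"
  proof (rule Bochner_Integration.integral_cong[OF refl])
    fix y :: "real^'n"
    have e: "exp (- \<i> * complex_of_real (y \<bullet> \<xi>)) * exp (\<i> * complex_of_real (y \<bullet> \<eta>)) = exp (- \<i> * complex_of_real (y \<bullet> (\<xi> - \<eta>)))" for \<eta>
      unfolding mult_exp_exp by (rule arg_cong[where f=exp]) (simp add: inner_diff_right algebra_simps)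
    have "f y * inv_fourier (fourier h) y * exp (- \<i> * complex_of_real (y \<bullet> \<xi>)) =
      ?c * ((f y * exp (- \<i> * complex_of_real (y \<bullet> \<xi>))) * (LINT \<eta>|lborel. fourier h \<eta> * exp (\<i> * complex_of_real (y \<bullet> \<eta>))))"
      unfolding inv_fourier_def by (simp only: ac_simps)
    also have "\<dots> = ?c * (LINT \<eta>|lborel. (f y * exp (- \<i> * complex_of_real (y \<bullet> \<xi>))) * (fourier h \<eta> * exp (\<i> * complex_of_real (y \<bullet> \<eta>))))"
      by (simp only: integral_mult_right_zero)
    also have "\<dots> = ?c * (LINT \<eta>|lborel. fourier h \<eta> * (f y * exp (- \<i> * complex_of_real (y \<bullet> (\<xi> - \<eta>)))))"
      unfolding e[symmetric] by (simp only: ac_simps)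
    finally show "f y * inv_fourier (fourier h) y * exp (- \<i> * complex_of_real (y \<bullet> \<xi>)) = \<dots>" .
  qed
  also have "\<dots> = ?c * (LINT y|lborel. LINT \<eta>|lborel. fourier h \<eta> * (f y * exp (- \<i> * complex_of_real (y \<bullet> (\<xi> - \<eta>)))))"
    by (rule integral_mult_right_zero)
  also have "(LINT y|lborel. LINT \<eta>|lborel. fourier h \<eta> * (f y * exp (- \<i> * complex_of_real (y \<bullet> (\<xi> - \<eta>)))))
    = (LINT \<eta>|lborel. LINT y|lborel. fourier h \<eta> * (f y * exp (- \<i> * complex_of_real (y \<bullet> (\<xi> - \<eta>)))))"
    by (rule fubini_product_bound(1)[where A="\<lambda>y. cmod (f y)" and B="\<lambda>\<eta>. cmod (fourier h \<eta>)"])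
      (use f i in \<open>auto simp: norm_mult\<close>)
  also have "\<dots> = (LINT \<eta>|lborel. fourier h \<eta> * fourier f (\<xi> - \<eta>))"
    unfolding fourier_def[of f] by (simp only: integral_mult_right_zero)
  finally show ?thesis .
qed

lemma in_L2_wt_integrable:
  assumes "in_L2 u" shows "integrable lborel (\<lambda>y. cmod (u y) * wt (y - c))"
proof (rule Bochner_Integration.integrable_bound[where f="\<lambda>y. (cmod (u y))\<^sup>2 + wt (y - c)"])
  show "integrable lborel (\<lambda>y. (cmod (u y))\<^sup>2 + wt (y - c))"
    using assms unfolding in_L2_def by auto
  show "(\<lambda>y. cmod (u y) * wt (y - c)) \<in> borel_measurable lborel" using assms unfolding in_L2_def by auto
  show "AE y in lborel. norm (cmod (u y) * wt (y - c)) \<le> norm ((cmod (u y))\<^sup>2 + wt (y - c))"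
  proof (rule AE_I2)
    fix y
    let ?w = "wt (y - c)"
    have "?w * ?w \<le> ?w" using mult_left_mono[OF wt_le_1, of ?w "y - c"] by simp
    moreover have "2 * (cmod (u y) * ?w) \<le> (cmod (u y))\<^sup>2 + ?w\<^sup>2" using sum_squares_bound[of "cmod (u y)" ?w] by simp
    moreover have "0 \<le> cmod (u y) * ?w" by simp
    ultimately have "cmod (u y) * ?w \<le> (cmod (u y))\<^sup>2 + ?w" unfolding power2_eq_square by linarith
    then show "norm (cmod (u y) * ?w) \<le> norm ((cmod (u y))\<^sup>2 + ?w)" by simp
  qed
qed

lemma wave_packet_eq_fourier: "wave_packet \<phi> u x \<xi> = fourier (\<lambda>y. u y * cnj (\<phi> (y - x))) \<xi>"
  unfolding wave_packet_def fourier_def by (simp only: mult.commute mult.left_commute)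

lemma wt_center: "wt (x - c) \<le> 2 ^ DIM('a) / wt c * wt (x :: 'a::euclidean_space)"
  using wt_mult_le[of "x - c" c] by (simp add: field_simps)

text \<open>Multiplication by \<open>m\<close> is nearly diagonal in wave packets. The constant n0,
  the squared norm of the window, is written as the integral of |\<phi>(y - x')|^2 over x'. For
  fixed x' the integrand is the windowed \<open>u\<close> times a smooth function whose transform
  decays in \<eta>, because it has enough derivatives, and in x' - x, because the two windows must
  overlap. The symbol may grow like 1 / wt(y - x), as the recentred potential does.\<close>

lemma almost_diagonalization:
  "\<exists>C0>0. \<forall>(\<phi> :: real^'n::finite \<Rightarrow> complex) u m x \<xi> M L. in_L2 u \<longrightarrow> smooth \<phi> \<longrightarrow>
     0 \<le> M \<longrightarrow> deriv_bound (2 * (3 * CARD('n))) (\<lambda>y. M * wt y ^ 4) \<phi> \<longrightarrow> smooth m \<longrightarrow> 0 \<le> L \<longrightarrow>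
     deriv_bound (2 * (3 * CARD('n))) (\<lambda>y. L / wt (y - x)) m \<longrightarrow>
     ennreal ((LINT y|lborel. (cmod (\<phi> y))\<^sup>2) * cmod (LINT y|lborel. u y * (cnj (\<phi> (y - x)) * m y) * exp (- \<i> * complex_of_real (y \<bullet> \<xi>)))) \<le>
     (\<integral>\<^sup>+x'. (\<integral>\<^sup>+\<eta>. ennreal (C0 * M\<^sup>2 * L * (wt (x' - x) ^ 2 * wt \<eta> ^ 3 * cmod (wave_packet \<phi> u x' (\<xi> - \<eta>)))) \<partial>lborel) \<partial>lborel)"
proof -
  let ?N = "2 * (3 * CARD('n))"
  let ?d = "CARD('n)"
  \<comment> \<open>\<open>K\<close> is the constant of \<open>fourier_wt_decay\<close> for three
    powers. \<open>D\<close> collects two Leibniz factors and the squared Peetre constant.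
    \<open>C0\<close> adds the Fourier normalization, and 1 to make it positive.\<close>
  define K where "K = 2 ^ (3 * CARD('n)) * (LINT x::real^'n|lborel. wt x)"
  define D where "D = (2::real) ^ ?N * 2 ^ ?N * (2 ^ ?d)\<^sup>2"
  define C0 where "C0 = 1 / (2 * pi) ^ CARD('n) * (K * D) + 1"
  have K0: "0 \<le> K" unfolding K_def by (intro mult_nonneg_nonneg integral_nonneg_AE) auto
  have D0: "0 \<le> D" unfolding D_def by simp
  have C0: "0 < C0" unfolding C0_def using K0 D0 by (simp add: add_nonneg_pos)
  show ?thesis
  proof (intro exI[of _ C0] conjI allI impI)
    show "0 < C0" by (rule C0)
    fix \<phi> u m :: "real^'n \<Rightarrow> complex" and x \<xi> :: "real^'n" and M L :: real
    assume u: "in_L2 u" and \<phi>: "smooth \<phi>" and M: "0 \<le> M" and db\<phi>: "deriv_bound ?N (\<lambda>y. M * wt y ^ 4) \<phi>"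
      and m: "smooth m" and L: "0 \<le> L" and dbm: "deriv_bound ?N (\<lambda>y. L / wt (y - x)) m"
    have [measurable]: "u \<in> borel_measurable borel" using u by (simp add: in_L2_def)
    have [measurable]: "\<phi> \<in> borel_measurable borel" "m \<in> borel_measurable borel" using \<phi> m by (auto intro: smooth_measurable)
    have b\<phi>: "cmod (\<phi> y) \<le> M * wt y ^ 4" for y by (rule deriv_boundD[OF db\<phi>])
    have b\<phi>1: "cmod (\<phi> y) \<le> M * wt y" for y
      using order_trans[OF b\<phi> mult_left_mono[OF wt_power_mono[of 1 4] M]] by simp
    have bm: "cmod (m y) \<le> L / wt (y - x)" for y by (rule deriv_boundD[OF dbm])
    let ?e = "\<lambda>y. exp (- \<i> * complex_of_real (y \<bullet> \<xi>))"
    let ?f = "\<lambda>x' y. u y * cnj (\<phi> (y - x'))"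
    let ?h = "\<lambda>x' y. \<phi> (y - x') * (cnj (\<phi> (y - x)) * m y)"
    let ?G = "\<lambda>y x'. ?f x' y * ?h x' y * ?e y"
    have fi: "integrable lborel (?f x')" for x'
    proof (rule Bochner_Integration.integrable_bound[where f="\<lambda>y. M * (cmod (u y) * wt (y - x'))"])
      show "integrable lborel (\<lambda>y. M * (cmod (u y) * wt (y - x')))" by (intro integrable_mult_right in_L2_wt_integrable u)
      show "AE y in lborel. norm (?f x' y) \<le> norm (M * (cmod (u y) * wt (y - x')))"
        using mult_left_mono[OF b\<phi>1 norm_ge_zero] M by (intro AE_I2) (simp add: norm_mult mult.left_commute)
    qed measurable
    have bh: "cmod (cnj (\<phi> (y - x)) * m y) \<le> M * L * wt (y - x)" for y
    proof -
      have "cmod (cnj (\<phi> (y - x)) * m y) \<le> (M * wt (y - x) ^ 4) * (L / wt (y - x))"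
        unfolding norm_mult complex_mod_cnj by (intro mult_mono b\<phi> bm) (use M in auto)
      also have "\<dots> = M * L * wt (y - x) ^ 3" by (simp add: power4_eq_xxxx power3_eq_cube)
      also have "\<dots> \<le> M * L * wt (y - x) ^ 1" using M L by (intro mult_left_mono wt_power_mono) auto
      finally show ?thesis by simp
    qed
    have fub: "(\<lambda>(y, x'). ?G y x') \<in> borel_measurable (borel \<Otimes>\<^sub>M borel)" by measurable
    \<comment> \<open>Product majorant for Fubini: one factor depends on y through \<open>u\<close>,
      the other only on x'. One power of the overlap of the two windows supplies integrability in
      x'.\<close>
    have Gb2: "cmod (?G y x') \<le> (cmod (u y) * wt (y - x)) * (M * L * (M * M) * (2 ^ ?d * wt (x' - x)))" for y x'
    proof -
      have b2: "cmod (cnj (\<phi> (y - x)) * m y) \<le> M * L * (wt (y - x) * wt (y - x))"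
      proof -
        have "cmod (cnj (\<phi> (y - x)) * m y) \<le> (M * wt (y - x) ^ 4) * (L / wt (y - x))"
          unfolding norm_mult complex_mod_cnj by (intro mult_mono b\<phi> bm) (use M in auto)
        also have "\<dots> = M * L * wt (y - x) ^ 3" by (simp add: power4_eq_xxxx power3_eq_cube)
        also have "\<dots> \<le> M * L * wt (y - x) ^ 2" using M L by (intro mult_left_mono wt_power_mono) auto
        finally show ?thesis by (simp add: power2_eq_square)
      qed
      have "cmod (?G y x') = cmod (u y) * (cmod (\<phi> (y - x')) * (cmod (\<phi> (y - x')) * cmod (cnj (\<phi> (y - x)) * m y)))"
        by (simp add: norm_mult mult.assoc mult.left_commute)
      also have "\<dots> \<le> cmod (u y) * ((M * wt (y - x')) * ((M * 1) * (M * L * (wt (y - x) * wt (y - x)))))"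
      proof (intro mult_left_mono mult_mono b\<phi>1 b2)
        show "cmod (\<phi> (y - x')) \<le> M * 1" using order_trans[OF b\<phi>1 mult_left_mono[OF wt_le_1 M]] .
      qed (use M L in auto)
      also have "\<dots> = (cmod (u y) * wt (y - x)) * (M * L * (M * M)) * (wt (y - x) * wt (x' - y))"
        by (simp add: wt_commute[of x' y] ac_simps)
      also have "\<dots> \<le> (cmod (u y) * wt (y - x)) * (M * L * (M * M)) * (2 ^ ?d * wt (x' - x))"
        using M L wt_mult_diff_le[of x y x'] by (intro mult_left_mono) (auto simp: wt_commute[of x y] wt_commute[of x x'])
      finally show ?thesis by (simp only: ac_simps)
    qed
    have iA: "integrable lborel (\<lambda>y. cmod (u y) * wt (y - x))" by (rule in_L2_wt_integrable[OF u])
    have iB: "integrable lborel (\<lambda>x'. M * L * (M * M) * (2 ^ ?d * wt (x' - x)))" by (intro integrable_mult_right integrable_wt_translate)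
    let ?n0 = "LINT y|lborel. (cmod (\<phi> y))\<^sup>2"
    let ?X = "LINT y|lborel. u y * (cnj (\<phi> (y - x)) * m y) * ?e y"
    \<comment> \<open>The reflection of x' at y makes the integral independent of y; this is the
      resolution of the identity.\<close>
    have n0: "(LINT x'|lborel. \<phi> (y - x') * cnj (\<phi> (y - x'))) = complex_of_real ?n0" for y
    proof -
      have "(LINT x'|lborel. \<phi> (y - x') * cnj (\<phi> (y - x'))) = (LINT x'|lborel. \<phi> x' * cnj (\<phi> x'))"
        by (rule lborel_integral_reflect(1)[where f="\<lambda>z. \<phi> z * cnj (\<phi> z)"]) measurable
      then show ?thesis unfolding integral_complex_of_real[symmetric] complex_norm_square .
    qed
    have "complex_of_real ?n0 * ?X = (LINT y|lborel. u y * (cnj (\<phi> (y - x)) * m y) * ?e y * complex_of_real ?n0)"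
      unfolding integral_mult_left_zero by (rule mult.commute)
    also have "\<dots> = (LINT y|lborel. LINT x'|lborel. ?G y x')"
    proof (rule Bochner_Integration.integral_cong[OF refl])
      fix y
      let ?A = "u y * (cnj (\<phi> (y - x)) * m y) * ?e y"
      have "?A * complex_of_real ?n0 = (LINT x'|lborel. ?A * (\<phi> (y - x') * cnj (\<phi> (y - x'))))"
        unfolding integral_mult_right_zero n0 ..
      also have "\<dots> = (LINT x'|lborel. ?G y x')" by (simp only: ac_simps)
      finally show "?A * complex_of_real ?n0 = \<dots>" .
    qed
    also have "\<dots> = (LINT x'|lborel. LINT y|lborel. ?G y x')"
      by (rule fubini_product_bound(1)[OF fub iA iB Gb2])
    finally have X: "complex_of_real ?n0 * ?X = (LINT x'|lborel. fourier (\<lambda>y. ?f x' y * ?h x' y) \<xi>)"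
      unfolding fourier_def .
    have "ennreal (?n0 * cmod ?X) = ennreal (cmod (complex_of_real ?n0 * ?X))"
      by (simp add: norm_mult abs_of_nonneg)
    also have "\<dots> \<le> (\<integral>\<^sup>+x'. ennreal (cmod (fourier (\<lambda>y. ?f x' y * ?h x' y) \<xi>)) \<partial>lborel)"
      unfolding X by (rule norm_integral_le_nn_integral)
    also have "\<dots> \<le> (\<integral>\<^sup>+x'. (\<integral>\<^sup>+\<eta>. ennreal (C0 * M\<^sup>2 * L * (wt (x' - x) ^ 2 * wt \<eta> ^ 3 * cmod (wave_packet \<phi> u x' (\<xi> - \<eta>)))) \<partial>lborel) \<partial>lborel)"
    proof (rule nn_integral_mono)
      fix x'
      have sh: "smooth (?h x')" by (intro smooth_mult smooth_translate smooth_cnj \<phi> m)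
      let ?B = "D * M\<^sup>2 * L * wt (x' - x) ^ 2"
      \<comment> \<open>Four powers in y - x' and, after the loss to the symbol, three in y - x. Two
        of each merge into wt(x' - x)^2 by Peetre's inequality, and one power in y - x remains to
        make the transform absolutely convergent.\<close>
      have dbh: "deriv_bound ?N (\<lambda>y. ?B * wt (y - x)) (?h x')"
      proof (rule deriv_bound_mono)
        show "deriv_bound ?N (\<lambda>y. 2 ^ ?N * (M * wt (y - x') ^ 4 * (2 ^ ?N * (M * wt (y - x) ^ 4 * (L / wt (y - x)))))) (?h x')"
          by (intro deriv_bound_mult deriv_bound_cnj deriv_bound_translate[OF db\<phi>] dbm smooth_mult smooth_translate smooth_cnj \<phi> m)
        show "2 ^ ?N * (M * wt (y - x') ^ 4 * (2 ^ ?N * (M * wt (y - x) ^ 4 * (L / wt (y - x))))) \<le> ?B * wt (y - x)" for y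
        proof -
          have w: "(wt (y - x') * wt (y - x))\<^sup>2 \<le> (2 ^ ?d * wt (x' - x))\<^sup>2"
            using wt_mult_diff_le[of x' y x] wt_commute[of x' y] wt_commute[of x y] by (intro power_mono) auto
          have "2 ^ ?N * (M * wt (y - x') ^ 4 * (2 ^ ?N * (M * wt (y - x) ^ 4 * (L / wt (y - x))))) = (2 ^ ?N * 2 ^ ?N * M\<^sup>2 * L) * (wt (y - x') ^ 4 * wt (y - x) ^ 3)"
            by (simp add: power4_eq_xxxx power3_eq_cube power2_eq_square)
          also have "\<dots> \<le> (2 ^ ?N * 2 ^ ?N * M\<^sup>2 * L) * (wt (y - x') ^ 2 * wt (y - x) ^ 3)"
            using L by (intro mult_left_mono mult_right_mono wt_power_mono) auto
          also have "\<dots> = (2 ^ ?N * 2 ^ ?N * M\<^sup>2 * L) * ((wt (y - x') * wt (y - x))\<^sup>2 * wt (y - x))"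
            by (simp add: power3_eq_cube power2_eq_square)
          also have "\<dots> \<le> (2 ^ ?N * 2 ^ ?N * M\<^sup>2 * L) * ((2 ^ ?d * wt (x' - x))\<^sup>2 * wt (y - x))"
            using L w by (intro mult_left_mono mult_right_mono) auto
          also have "\<dots> = ?B * wt (y - x)" unfolding D_def by (simp only: power_mult_distrib ac_simps)
          finally show ?thesis .
        qed
      qed
      have B0: "0 \<le> ?B" using D0 L by simp
      have Fh: "cmod (fourier (?h x') \<eta>) \<le> K * ?B * wt \<eta> ^ 3" for \<eta>
        using fourier_wt_decay[OF sh dbh, of \<eta>] unfolding K_def .
      have hm: "?h x' \<in> borel_measurable borel" by (rule smooth_measurable[OF sh])
      have ih: "integrable lborel (?h x')"
        by (rule integrable_wt_bound[OF hm deriv_boundD[OF dbh]])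
      have iF: "integrable lborel (fourier (?h x'))"
      proof (rule integrable_wt_bound[where M="K * ?B" and c=0])
        show "fourier (?h x') \<in> borel_measurable borel" by (rule measurable_fourier[OF ih])
        show "cmod (fourier (?h x') \<eta>) \<le> K * ?B * wt (\<eta> - 0)" for \<eta>
          using order_trans[OF Fh[of \<eta>] mult_left_mono[OF wt_power_mono[of 1 3], of "K * ?B"]] K0 B0 by simp
      qed
      have hb: "cmod (?h x' y) \<le> ?B * (2 ^ DIM(real^'n) / wt x) * wt y" for y
        using order_trans[OF deriv_boundD[OF dbh, of y] mult_left_mono[OF wt_center[of y x] B0]] by (simp only: mult.assoc)
      have "ennreal (cmod (fourier (\<lambda>y. ?f x' y * ?h x' y) \<xi>)) = ennreal (cmod (LINT \<eta>|lborel. complex_of_real (1 / (2 * pi) ^ CARD('n)) * (fourier (?h x') \<eta> * fourier (?f x') (\<xi> - \<eta>))))"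
        unfolding fourier_mult[OF fi smooth_continuous[OF sh] hb iF] integral_mult_right_zero ..
      also have "\<dots> \<le> (\<integral>\<^sup>+\<eta>. ennreal (cmod (complex_of_real (1 / (2 * pi) ^ CARD('n)) * (fourier (?h x') \<eta> * fourier (?f x') (\<xi> - \<eta>)))) \<partial>lborel)"
        by (rule norm_integral_le_nn_integral)
      also have "\<dots> \<le> (\<integral>\<^sup>+\<eta>. ennreal (C0 * M\<^sup>2 * L * (wt (x' - x) ^ 2 * wt \<eta> ^ 3 * cmod (wave_packet \<phi> u x' (\<xi> - \<eta>)))) \<partial>lborel)"
      proof (rule nn_integral_mono, rule ennreal_leI)
        fix \<eta>
        have cc: "cmod (complex_of_real (1 / (2 * pi) ^ CARD('n))) = 1 / (2 * pi) ^ CARD('n)" unfolding norm_of_real by simp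
        have "cmod (complex_of_real (1 / (2 * pi) ^ CARD('n)) * (fourier (?h x') \<eta> * fourier (?f x') (\<xi> - \<eta>)))
           = 1 / (2 * pi) ^ CARD('n) * (cmod (fourier (?h x') \<eta>) * cmod (wave_packet \<phi> u x' (\<xi> - \<eta>)))"
          unfolding norm_mult cc wave_packet_eq_fourier ..
        also have "\<dots> \<le> 1 / (2 * pi) ^ CARD('n) * ((K * ?B * wt \<eta> ^ 3) * cmod (wave_packet \<phi> u x' (\<xi> - \<eta>)))"
          by (intro mult_left_mono mult_right_mono Fh) auto
        also have "\<dots> = (1 / (2 * pi) ^ CARD('n) * (K * D)) * (M\<^sup>2 * L * (wt (x' - x) ^ 2 * wt \<eta> ^ 3 * cmod (wave_packet \<phi> u x' (\<xi> - \<eta>))))"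
          by (simp only: ac_simps)
        also have "\<dots> \<le> C0 * (M\<^sup>2 * L * (wt (x' - x) ^ 2 * wt \<eta> ^ 3 * cmod (wave_packet \<phi> u x' (\<xi> - \<eta>))))"
          unfolding C0_def using L by (intro mult_right_mono) auto
        finally show "cmod (complex_of_real (1 / (2 * pi) ^ CARD('n)) * (fourier (?h x') \<eta> * fourier (?f x') (\<xi> - \<eta>)))
           \<le> C0 * M\<^sup>2 * L * (wt (x' - x) ^ 2 * wt \<eta> ^ 3 * cmod (wave_packet \<phi> u x' (\<xi> - \<eta>)))" by (simp only: mult.assoc)
      qed
      finally show "ennreal (cmod (fourier (\<lambda>y. ?f x' y * ?h x' y) \<xi>)) \<le> (\<integral>\<^sup>+\<eta>. ennreal (C0 * M\<^sup>2 * L * (wt (x' - x) ^ 2 * wt \<eta> ^ 3 * cmod (wave_packet \<phi> u x' (\<xi> - \<eta>)))) \<partial>lborel)" .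
    qed
    finally show "ennreal (?n0 * cmod ?X) \<le> (\<integral>\<^sup>+x'. (\<integral>\<^sup>+\<eta>. ennreal (C0 * M\<^sup>2 * L * (wt (x' - x) ^ 2 * wt \<eta> ^ 3 * cmod (wave_packet \<phi> u x' (\<xi> - \<eta>)))) \<partial>lborel) \<partial>lborel)" .
  qed
qed

section \<open>Potentials of linear growth\<close>

lemma smooth_slice:
  fixes F :: "real \<times> 'a::euclidean_space \<Rightarrow> 'b::real_normed_vector"
  assumes "smooth F"
  shows "smooth (\<lambda>x. F (t, x))"
proof (rule smooth_coinduct[where Q="\<lambda>h. \<exists>F. smooth F \<and> h = (\<lambda>x. F (t, x))"])
  fix h :: "'a \<Rightarrow> 'b" assume "\<exists>F. smooth F \<and> h = (\<lambda>x. F (t, x))"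
  then obtain F :: "real \<times> 'a \<Rightarrow> 'b" where F: "smooth F" "h = (\<lambda>x. F (t, x))" by auto
  show "continuous_on UNIV h" unfolding F(2)
    by (rule continuous_on_compose2[OF smooth_continuous[OF F(1)]]) (auto intro!: continuous_intros)
  fix b :: 'a assume b: "b \<in> Basis"
  then have b': "(0::real, b) \<in> Basis" by (auto simp: Basis_prod_def)
  have "((\<lambda>s::real. h (x + s *\<^sub>R b)) has_vector_derivative dir_deriv (0, b) F (t, x)) (at 0)" for x
    using smooth_has_derivative0[OF F(1) b', of "(t, x)"] by (simp add: F(2))
  then show "\<exists>g'. (\<exists>F. smooth F \<and> g' = (\<lambda>x. F (t, x))) \<and> (\<forall>x. ((\<lambda>s::real. h (x + s *\<^sub>R b)) has_vector_derivative g' x) (at 0))"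
    using smooth_dir_deriv[OF F(1) b'] by blast
qed (use assms in auto)

text \<open>Walking from x to y one coordinate at a time gives the l1 distance, the form that
  \<open>sum_abs_le_wt\<close> can absorb.\<close>

lemma coordinatewise_mvt:
  fixes f :: "'a::euclidean_space \<Rightarrow> real"
  assumes f: "smooth f" and D: "\<And>b y. b \<in> Basis \<Longrightarrow> \<bar>dir_deriv b f y\<bar> \<le> D"
  shows "\<bar>f y - f x\<bar> \<le> D * (\<Sum>b\<in>Basis. \<bar>(y - x) \<bullet> b\<bar>)"
proof -
  have "\<bar>f (x + (\<Sum>b\<in>S. d b *\<^sub>R b)) - f x\<bar> \<le> D * (\<Sum>b\<in>S. \<bar>d b\<bar>)" if "finite S" "S \<subseteq> Basis" for S and d :: "'a \<Rightarrow> real"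
    using that
  proof (induction S)
    case (insert b S)
    let ?z = "x + (\<Sum>b\<in>S. d b *\<^sub>R b)"
    have "norm (f (?z + d b *\<^sub>R b) - f (?z + 0 *\<^sub>R b)) \<le> D * \<bar>d b - 0\<bar>"
      by (rule vector_mvt_bound[where f="\<lambda>s. f (?z + s *\<^sub>R b)" and f'="\<lambda>s. dir_deriv b f (?z + s *\<^sub>R b)"])
        (use insert f D in \<open>auto intro: smooth_has_derivative\<close>)
    moreover have "\<bar>f ?z - f x\<bar> \<le> D * (\<Sum>b\<in>S. \<bar>d b\<bar>)" using insert by auto
    ultimately show ?case using insert by (simp add: algebra_simps)
  qed simp
  from this[of Basis "\<lambda>b. (y - x) \<bullet> b"] show ?thesis
    by (simp add: euclidean_representation)
qed

text \<open>Order zero is controlled by the bounded gradient and grows linearly away from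
  \<open>x\<close>; higher orders do not see the subtracted constant and are bounded outright. The
  constant depends neither on t nor on the centre x.\<close>

lemma potential_deriv_bound:
  fixes V :: "real \<Rightarrow> real^'n::finite \<Rightarrow> real"
  assumes V: "smooth (\<lambda>(t, x). V t x)"
    and bd: "\<forall>\<alpha> :: 'n \<Rightarrow> nat. (\<Sum>i\<in>UNIV. \<alpha> i) \<ge> 1 \<longrightarrow> (\<exists>C>0. \<forall>t x. \<bar>multi_deriv \<alpha> (V t) x\<bar> \<le> C)"
  shows "\<exists>L>0. \<forall>t x. deriv_bound N (\<lambda>y. L / wt (y - x)) (\<lambda>y. complex_of_real (V t y - V t x))"
proof -
  have sV: "smooth (V t)" for t using smooth_slice[OF V, of t] by simp
  \<comment> \<open>Lengths up to \<open>Suc N\<close>, so that single letters belong to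
    \<open>B\<close> even for N = 0: the gradient is needed to bound the function itself. The empty
    list carries no bound.\<close>
  define B where "B = {bs :: (real^'n) list. set bs \<subseteq> Basis \<and> length bs \<le> Suc N}"
  have fB: "finite B" unfolding B_def by (rule finite_lists_length_le) simp
  have "\<forall>bs\<in>B. \<exists>C\<ge>0. \<forall>t x. bs \<noteq> [] \<longrightarrow> \<bar>iter_deriv bs (V t) x\<bar> \<le> C"
  proof
    fix bs assume bs: "bs \<in> B"
    show "\<exists>C\<ge>0. \<forall>t x. bs \<noteq> [] \<longrightarrow> \<bar>iter_deriv bs (V t) x\<bar> \<le> C"
    proof (cases "bs = []")
      case False
      have sb: "set bs \<subseteq> Basis" using bs by (simp add: B_def)
      have "\<exists>\<alpha>. (\<Sum>i\<in>UNIV. \<alpha> i) = length bs \<and> (\<forall>t. iter_deriv bs (V t) = multi_deriv \<alpha> (V t))"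
        by (rule iter_deriv_eq_multi_deriv_uniform[OF sV sb])
      then obtain \<alpha> where \<alpha>: "(\<Sum>i\<in>UNIV. \<alpha> i) = length bs" "\<And>t. iter_deriv bs (V t) = multi_deriv \<alpha> (V t)" by blast
      have "1 \<le> (\<Sum>i\<in>UNIV. \<alpha> i)" using \<alpha>(1) False by (cases bs) auto
      then obtain C where "C > 0" "\<forall>t x. \<bar>multi_deriv \<alpha> (V t) x\<bar> \<le> C" using bd by blast
      then show ?thesis using \<alpha>(2) by (intro exI[of _ C]) auto
    qed auto
  qed
  then obtain C where C: "\<And>bs. bs \<in> B \<Longrightarrow> 0 \<le> C bs" "\<And>bs t x. bs \<in> B \<Longrightarrow> bs \<noteq> [] \<Longrightarrow> \<bar>iter_deriv bs (V t) x\<bar> \<le> C bs"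
    by metis
  define D where "D = (\<Sum>bs\<in>B. C bs)"
  have D: "\<bar>iter_deriv bs (V t) x\<bar> \<le> D" if "bs \<in> B" "bs \<noteq> []" for bs t x
    using C(2)[OF that, of t x] member_le_sum[OF that(1), of C] C(1) fB unfolding D_def by fastforce
  have D0: "0 \<le> D" unfolding D_def by (rule sum_nonneg) (use C(1) in auto)
  let ?L = "(D + 1) * (1 + DIM(real^'n))"
  have L: "?L > 0" using D0 by (intro mult_pos_pos) auto
  have "deriv_bound N (\<lambda>y. ?L / wt (y - x)) (\<lambda>y. complex_of_real (V t y - V t x))" for t x
  proof (rule deriv_bound_linear[OF _ _ bounded_linear_of_real])
    show "cmod (complex_of_real r) \<le> norm r" for r :: real by simp
    show sm: "smooth (\<lambda>y. V t y - V t x)" by (intro smooth_diff(1) sV smooth_const)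
    show "deriv_bound N (\<lambda>y. ?L / wt (y - x)) (\<lambda>y. V t y - V t x)"
    proof (rule deriv_bound_iter_deriv)
      fix bs :: "(real^'n) list" and y :: "real^'n" assume bs: "set bs \<subseteq> Basis" "length bs \<le> N"
      show "norm (iter_deriv bs (\<lambda>y. V t y - V t x) y) \<le> ?L / wt (y - x)"
      proof (cases bs rule: rev_cases)
        case Nil
        have "\<bar>dir_deriv b (V t) z\<bar> \<le> D" if "b \<in> Basis" for b z
          using D[of "[b]" t z] that by (simp add: B_def)
        then have "\<bar>V t y - V t x\<bar> \<le> D * (\<Sum>b\<in>Basis. \<bar>(y - x) \<bullet> b\<bar>)"
          by (rule coordinatewise_mvt[OF sV])
        also have "\<dots> \<le> (D + 1) * (1 + (\<Sum>b\<in>Basis. \<bar>(y - x) \<bullet> b\<bar>))"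
          using D0 by (intro mult_mono) (auto intro!: sum_nonneg)
        also have "\<dots> \<le> (D + 1) * ((1 + DIM(real^'n)) / wt (y - x))"
          using D0 sum_abs_le_wt[of "y - x"] by (intro mult_left_mono) (auto simp: pos_le_divide_eq)
        finally show ?thesis using Nil by simp
      next
        case (snoc cs b)
        have b: "b \<in> Basis" using bs snoc by auto
        have "iter_deriv bs (\<lambda>y. V t y - V t x) = iter_deriv bs (V t)"
          unfolding snoc iter_deriv_append using smooth_diff(2)[OF sV smooth_const b] by simp
        then have "norm (iter_deriv bs (\<lambda>y. V t y - V t x) y) \<le> D"
          using D[of bs t y] bs snoc by (simp add: B_def)
        also have "D \<le> ?L * 1" using D0 by (simp add: algebra_simps add_increasing)
        also have "\<dots> \<le> ?L * (1 / wt (y - x))" using L wt_le_1[of "y - x"] by (intro mult_left_mono) (auto simp: field_simps)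
        finally show ?thesis by simp
      qed
    qed
  qed
  then show ?thesis using L by blast
qed

section \<open>Cutoff functions\<close>

text \<open>The classical flat function exp(-1/s), with polynomial coefficients in 1/s so that the
  family is closed under differentiation: p goes to (p - p') X^2, where X stands for 1/s.\<close>

definition flat_exp :: "real poly \<Rightarrow> real \<Rightarrow> real" where
  "flat_exp p s = (if s > 0 then poly p (1 / s) * exp (- (1 / s)) else 0)"

lemma poly_exp_tendsto_0: "((\<lambda>x. poly p x * x * exp (- x)) \<longlongrightarrow> (0::real)) at_top"
proof -
  have "((\<lambda>x. \<Sum>i\<le>degree p. coeff p i * (x ^ Suc i / exp x)) \<longlongrightarrow> (\<Sum>i\<le>degree p. coeff p i * 0)) at_top"
    by (intro tendsto_sum tendsto_mult tendsto_const tendsto_power_div_exp_0)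
  moreover have "(\<Sum>i\<le>degree p. coeff p i * (x ^ Suc i / exp x)) = poly p x * x * exp (- x)" for x
    unfolding poly_altdef sum_distrib_right exp_minus by (rule sum.cong) (auto simp: field_simps)
  ultimately show ?thesis by simp
qed

lemma flat_exp_derivative:
  "(flat_exp p has_real_derivative flat_exp ((p - pderiv p) * [:0, 0, 1:]) x) (at x)"
proof -
  consider "x > 0" | "x < 0" | "x = 0" by linarith
  then show ?thesis
  proof cases
    case 1
    have "((\<lambda>s. poly p (1 / s) * exp (- (1 / s))) has_real_derivative flat_exp ((p - pderiv p) * [:0, 0, 1:]) x) (at x)"
      using 1 by (auto intro!: derivative_eq_intros simp: flat_exp_def field_simps power2_eq_square)
    then show ?thesis
      by (rule has_field_derivative_transform_within_open[of _ _ _ "{0<..}"]) (use 1 in \<open>auto simp: flat_exp_def\<close>)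
  next
    case 2
    have "((\<lambda>s. 0) has_real_derivative flat_exp ((p - pderiv p) * [:0, 0, 1:]) x) (at x)"
      using 2 by (auto simp: flat_exp_def)
    then show ?thesis
      by (rule has_field_derivative_transform_within_open[of _ _ _ "{..<0}"]) (use 2 in \<open>auto simp: flat_exp_def\<close>)
  next
    case 3
    \<comment> \<open>With x = 1/h the quotient becomes p(x) x exp(-x), which vanishes as x tends to
      infinity. So the derivative at 0 is 0.\<close>
    have r: "((\<lambda>h. flat_exp p h / h) \<longlongrightarrow> 0) (at_right 0)"
    proof (rule Lim_transform_eventually)
      show "((\<lambda>h. poly p (inverse h) * inverse h * exp (- inverse h)) \<longlongrightarrow> 0) (at_right (0::real))"
        by (rule filterlim_compose[OF poly_exp_tendsto_0 filterlim_inverse_at_top_right])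
      show "\<forall>\<^sub>F h in at_right 0. poly p (inverse h) * inverse h * exp (- inverse h) = flat_exp p h / h"
        by (rule eventually_at_right_less[THEN eventually_mono]) (auto simp: flat_exp_def divide_simps)
    qed
    have l: "((\<lambda>h. flat_exp p h / h) \<longlongrightarrow> 0) (at_left 0)"
    proof (rule Lim_transform_eventually)
      show "((\<lambda>h::real. 0::real) \<longlongrightarrow> 0) (at_left 0)" by simp
      show "\<forall>\<^sub>F h in at_left 0. 0 = flat_exp p h / h"
        unfolding eventually_at_filter by (rule always_eventually) (auto simp: flat_exp_def)
    qed
    have "((\<lambda>h. flat_exp p h / h) \<longlongrightarrow> 0) (at 0)" by (rule filterlim_split_at[OF l r])
    then show ?thesis unfolding 3 DERIV_def by (simp add: flat_exp_def)
  qed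
qed

lemma smooth_flat_exp: "smooth (flat_exp p)"
proof (rule smooth_coinduct[where Q="\<lambda>h. \<exists>p. h = flat_exp p"])
  fix h assume "\<exists>p. h = flat_exp p"
  then obtain p where h: "h = flat_exp p" by auto
  show "continuous_on UNIV h" unfolding h
    using flat_exp_derivative DERIV_isCont continuous_at_imp_continuous_on by blast
  fix b :: real assume "b \<in> Basis"
  then have b: "b = 1" by simp
  have "((\<lambda>s::real. h (x + s *\<^sub>R b)) has_vector_derivative flat_exp ((p - pderiv p) * [:0, 0, 1:]) x) (at 0)" for x
  proof -
    have "((\<lambda>s::real. x + s) has_real_derivative 1) (at 0)" by (auto intro!: derivative_eq_intros)
    from DERIV_chain2[of h "flat_exp ((p - pderiv p) * [:0, 0, 1:]) x" "\<lambda>s. x + s" 0, OF _ this]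
    show ?thesis using flat_exp_derivative[of p x]
      by (simp add: h b has_real_derivative_iff_has_vector_derivative)
  qed
  then show "\<exists>g'. (\<exists>p. g' = flat_exp p) \<and> (\<forall>x. ((\<lambda>s::real. h (x + s *\<^sub>R b)) has_vector_derivative g' x) (at 0))"
    by blast
qed auto

abbreviation flat :: "real \<Rightarrow> real" where "flat \<equiv> flat_exp 1"

lemma flat_nonneg: "0 \<le> flat s" and flat_le_1: "flat s \<le> 1" and flat_pos: "0 < s \<Longrightarrow> 0 < flat s"
  and flat_zero: "s \<le> 0 \<Longrightarrow> flat s = 0"
  by (auto simp: flat_exp_def)

lemma smooth_ident: "smooth (\<lambda>s::real. s)"
  using smooth_inner_left(1)[of "1::real"] by simp

text \<open>A smooth step \<open>B\<close> together with its derivative \<beta>, a nonnegative bump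
  on the unit interval. Differences of rescaled steps approximate indicators of intervals, and
  rescalings of \<beta> approximate point evaluations.\<close>

lemma smooth_step_exists:
  "\<exists>B \<beta>. smooth B \<and> continuous_on UNIV \<beta> \<and> (\<forall>s. (B has_real_derivative \<beta> s) (at s)) \<and>
    (\<forall>s::real. 0 \<le> \<beta> s) \<and> (\<forall>s. s \<notin> {0..1} \<longrightarrow> \<beta> s = 0) \<and> (\<forall>s\<le>0. B s = 0) \<and> (\<forall>s\<ge>1. B s = (1::real)) \<and> (\<forall>s. 0 \<le> B s \<and> B s \<le> 1)"
proof -
  \<comment> \<open>Flat at both ends of the unit interval; the normalized primitive of this bump is
    the step.\<close>
  define b where "b s = flat s * flat (1 - s)" for s
  have sb: "smooth b" unfolding b_def[abs_def]
    by (intro smooth_mult smooth_flat_exp smooth_compose_real[OF smooth_flat_exp] smooth_diff(1) smooth_const smooth_ident)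
  have cb: "continuous_on A b" for A using smooth_continuous[OF sb] continuous_on_subset by blast
  have b0: "0 \<le> b s" for s unfolding b_def by (intro mult_nonneg_nonneg flat_nonneg)
  have bz: "b s = 0" if "s \<le> 0 \<or> 1 \<le> s" for s using that flat_zero by (auto simp: b_def)
  define I where "I u = (LBINT y=ereal 0..ereal u. b y)" for u
  have dI: "(I has_real_derivative b x) (at x)" for x
  proof -
    have "((\<lambda>u. LBINT y=ereal 0..ereal u. b y) has_vector_derivative b x) (at x within {min 0 x - 1..max 0 x + 1})"
      by (rule interval_integral_FTC2) (auto intro: cb)
    moreover have "at x within {min 0 x - 1..max 0 x + 1} = at x"
      by (rule at_within_interior) auto
    ultimately show ?thesis unfolding I_def[abs_def] has_real_derivative_iff_has_vector_derivative by simp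
  qed
  have mono: "I s \<le> I t" if "s \<le> t" for s t
    by (rule DERIV_nonneg_imp_nondecreasing[OF that]) (use dI b0 in blast)
  have I0: "I 0 = 0" by (simp add: I_def)
  have Ineg: "I s = 0" if "s \<le> 0" for s
  proof (cases "s = 0")
    case False
    then have "s < 0" using that by simp
    from MVT2[OF this, of I b] dI obtain z where "s < z" "z < 0" "I 0 - I s = (0 - s) * b z" by blast
    then show ?thesis using bz[of z] I0 by simp
  qed (simp add: I0)
  have Ige: "I s = I 1" if "1 \<le> s" for s
  proof (cases "s = 1")
    case False
    then have "1 < s" using that by simp
    from MVT2[OF this, of I b] dI obtain z where "1 < z" "z < s" "I s - I 1 = (s - 1) * b z" by blast
    then show ?thesis using bz[of z] by simp
  qed simp
  have I1: "0 < I 1"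
  proof -
    from MVT2[of "0::real" 1 I b] dI obtain z where "0 < z" "z < 1" "I 1 - I 0 = (1 - 0) * b z" by auto
    then show ?thesis using flat_pos I0 by (simp add: b_def)
  qed
  define B where "B s = inverse (I 1) * I s" for s
  define \<beta> where "\<beta> s = inverse (I 1) * b s" for s
  have dB: "(B has_real_derivative \<beta> s) (at s)" for s unfolding B_def[abs_def] \<beta>_def by (rule DERIV_cmult[OF dI])
  have s\<beta>: "smooth \<beta>" unfolding \<beta>_def[abs_def] by (rule smooth_cmult(1)[OF sb])
  have 1: "smooth B"
    by (rule smooth_real_iff_deriv(1)[OF _ s\<beta>]) (unfold has_real_derivative_iff_has_vector_derivative[symmetric], rule dB)
  have 2: "0 \<le> B s \<and> B s \<le> 1" for s
  proof -
    have "0 \<le> I s" using mono[of 0 s] Ineg[of s] I0 by (cases "s \<le> 0") auto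
    moreover have "I s \<le> I 1" using mono[of s 1] Ige[of s] by (cases "s \<le> 1") auto
    ultimately show ?thesis using I1 by (simp add: B_def field_simps)
  qed
  have 3: "continuous_on UNIV \<beta>" by (rule smooth_continuous[OF s\<beta>])
  have 4: "0 \<le> \<beta> s" "s \<notin> {0..1} \<Longrightarrow> \<beta> s = 0" for s
    using b0[of s] bz[of s] I1 by (auto simp: \<beta>_def)
  have 5: "s \<le> 0 \<Longrightarrow> B s = 0" "1 \<le> s \<Longrightarrow> B s = 1" for s
    using Ineg[of s] Ige[of s] I1 by (auto simp: B_def)
  show ?thesis
    by (rule exI[of _ B], rule exI[of _ \<beta>], intro conjI allI impI) (rule 1 3 dB 4 5 2[THEN conjunct1] 2[THEN conjunct2]; assumption)+
qed

lemma smooth_scale: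
  fixes f :: "'a::euclidean_space \<Rightarrow> 'b::real_normed_vector"
  assumes "smooth f"
  shows "smooth (\<lambda>y. f (c *\<^sub>R y))" and "b \<in> Basis \<Longrightarrow> dir_deriv b (\<lambda>y. f (c *\<^sub>R y)) = (\<lambda>y. c *\<^sub>R dir_deriv b f (c *\<^sub>R y))"
proof -
  have d: "((\<lambda>s::real. f (c *\<^sub>R (x + s *\<^sub>R b))) has_vector_derivative c *\<^sub>R dir_deriv b f (c *\<^sub>R x)) (at 0)"
    if "smooth f" "b \<in> Basis" for f :: "'a \<Rightarrow> 'b" and b x
  proof -
    have "((\<lambda>s::real. c * s) has_vector_derivative c) (at 0)"
      unfolding has_real_derivative_iff_has_vector_derivative[symmetric] by (auto intro!: derivative_eq_intros)
    from vector_diff_chain_at[OF this, of "\<lambda>r. f (c *\<^sub>R x + r *\<^sub>R b)"] smooth_has_derivative0[OF that, of "c *\<^sub>R x"]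
    show ?thesis by (simp add: o_def scaleR_add_right)
  qed
  show "smooth (\<lambda>y. f (c *\<^sub>R y))"
  proof (rule smooth_coinduct[where Q="\<lambda>h. \<exists>f. smooth f \<and> h = (\<lambda>y. f (c *\<^sub>R y))"])
    fix h :: "'a \<Rightarrow> 'b" assume "\<exists>f. smooth f \<and> h = (\<lambda>y. f (c *\<^sub>R y))"
    then obtain f where f: "smooth f" "h = (\<lambda>y. f (c *\<^sub>R y))" by auto
    show "continuous_on UNIV h" unfolding f(2)
      by (rule continuous_on_compose2[OF smooth_continuous[OF f(1)]]) (auto intro!: continuous_intros)
    fix b :: 'a assume b: "b \<in> Basis"
    have "smooth (\<lambda>y. c *\<^sub>R dir_deriv b f y)"
      by (rule smooth_linear(1)[OF bounded_linear_scaleR_right smooth_dir_deriv[OF f(1) b]])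
    then show "\<exists>g'. (\<exists>f. smooth f \<and> g' = (\<lambda>y. f (c *\<^sub>R y))) \<and> (\<forall>x. ((\<lambda>s::real. h (x + s *\<^sub>R b)) has_vector_derivative g' x) (at 0))"
      using d[OF f(1) b] unfolding f(2) by (intro exI[of _ "\<lambda>y. c *\<^sub>R dir_deriv b f (c *\<^sub>R y)"]) blast
  qed (use assms in auto)
  show "b \<in> Basis \<Longrightarrow> dir_deriv b (\<lambda>y. f (c *\<^sub>R y)) = (\<lambda>y. c *\<^sub>R dir_deriv b f (c *\<^sub>R y))"
    by (rule dir_derivI) (use d assms in blast)
qed

text \<open>The factor \<open>exp 1\<close> normalizes the value at the origin to 1, so the rescaled
  cutoffs tend to 1 pointwise.\<close>

definition bump :: "'a::euclidean_space \<Rightarrow> complex" where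
  "bump y = complex_of_real (exp 1 * flat (1 - y \<bullet> y))"

lemma smooth_bump: "smooth (bump :: 'a::euclidean_space \<Rightarrow> complex)"
proof -
  have "smooth (\<lambda>y::'a. \<Sum>b\<in>Basis. (y \<bullet> b) * (y \<bullet> b))" by (intro smooth_sum smooth_mult smooth_inner_left)
  then have "smooth (\<lambda>y::'a. y \<bullet> y)" unfolding euclidean_inner[symmetric] .
  then show ?thesis unfolding bump_def[abs_def]
    by (intro smooth_of_real smooth_cmult(1) smooth_compose_real[OF smooth_flat_exp] smooth_diff(1) smooth_const)
qed

lemma bump_0 [simp]: "bump 0 = 1"
  by (simp add: bump_def flat_exp_def exp_minus flip: of_real_mult exp_add)

lemma bump_zero: "1 \<le> norm y \<Longrightarrow> bump y = 0"
  using one_le_power[of "norm y" 2] by (simp add: bump_def flat_exp_def power2_norm_eq_inner[symmetric] not_less)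

text \<open>The condition is strict so that it persists nearby and the induction can differentiate a
  function that vanishes locally. The closed unit ball, sphere included, is then handled by
  compactness.\<close>

lemma bump_deriv_zero:
  assumes "1 < norm (y :: 'a::euclidean_space)" and bs: "set bs \<subseteq> Basis"
  shows "iter_deriv bs bump y = 0"
  using bs assms(1)
proof (induction bs arbitrary: y)
  case Nil then show ?case by (simp add: bump_zero)
next
  case (Cons b bs)
  have "\<forall>\<^sub>F s in at (0::real). iter_deriv bs bump (y + s *\<^sub>R b) = 0"
  proof -
    have "((\<lambda>s. norm (y + s *\<^sub>R b)) \<longlongrightarrow> norm (y + 0 *\<^sub>R b)) (at (0::real))" by (intro tendsto_intros)
    then have "\<forall>\<^sub>F s in at (0::real). 1 < norm (y + s *\<^sub>R b)" using Cons.prems by (auto dest: order_tendstoD(1))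
    then show ?thesis by (rule eventually_mono) (use Cons in auto)
  qed
  moreover have z: "iter_deriv bs bump y = 0" using Cons by auto
  ultimately have "((\<lambda>s::real. iter_deriv bs bump (y + s *\<^sub>R b)) has_vector_derivative 0) (at 0)"
    by (subst has_vector_derivative_cong_ev[where g="\<lambda>_. 0"])
       (auto simp: eventually_nhds_conv_at elim: eventually_mono)
  then show ?case by (simp add: dir_deriv_def vector_derivative_at)
qed

lemma bump_bounded:
  assumes bs: "set bs \<subseteq> Basis"
  shows "\<exists>C\<ge>0. \<forall>y :: 'a::euclidean_space. cmod (iter_deriv bs bump y) \<le> C"
proof -
  have "continuous_on (cball (0::'a) 1) (iter_deriv bs bump :: 'a \<Rightarrow> complex)"
    by (rule continuous_on_subset[OF smooth_continuous[OF smooth_iter_deriv[OF smooth_bump bs]]]) simp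
  from compact_imp_bounded[OF compact_continuous_image[OF this compact_cball]]
  obtain C where "\<forall>r\<in>iter_deriv bs bump ` cball (0::'a) 1. norm r \<le> C"
    unfolding bounded_iff ..
  then have C: "cmod (iter_deriv bs bump y) \<le> C" if "norm y \<le> 1" for y :: 'a using that by simp
  have "0 \<le> C" using C[of 0] by (smt (verit) norm_ge_zero norm_zero)
  then have "cmod (iter_deriv bs bump y) \<le> C" for y :: 'a
    using C[of y] bump_deriv_zero[OF _ bs, of y] by (cases "norm y \<le> 1") auto
  then show ?thesis using \<open>0 \<le> C\<close> by blast
qed

section \<open>Pairings with curves in \<open>L\<^sup>2\<close>\<close>

lemma in_L2_measurable [measurable_dest]: "in_L2 f \<Longrightarrow> f \<in> borel_measurable borel"
  by (simp add: in_L2_def)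

lemma cmod_diff_sq: "(cmod (a - b))\<^sup>2 \<le> 2 * (cmod a)\<^sup>2 + 2 * (cmod b)\<^sup>2"
proof -
  have "(cmod (a - b))\<^sup>2 \<le> (cmod a + cmod b)\<^sup>2" by (intro power_mono norm_triangle_ineq4) auto
  also have "\<dots> \<le> 2 * (cmod a)\<^sup>2 + 2 * (cmod b)\<^sup>2"
    using sum_squares_bound[of "cmod a" "cmod b"] by (simp add: power2_sum)
  finally show ?thesis .
qed

lemma in_L2_diff:
  assumes "in_L2 f" "in_L2 g" shows "in_L2 (\<lambda>x. f x - g x)"
proof -
  have [measurable]: "f \<in> borel_measurable borel" "g \<in> borel_measurable borel" using assms by (auto simp: in_L2_def)
  have "integrable lborel (\<lambda>x. 2 * (cmod (f x))\<^sup>2 + 2 * (cmod (g x))\<^sup>2)" using assms by (auto simp: in_L2_def)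
  then have "integrable lborel (\<lambda>x. (cmod (f x - g x))\<^sup>2)"
    by (rule Bochner_Integration.integrable_bound) (use cmod_diff_sq in auto)
  then show ?thesis by (simp add: in_L2_def)
qed

lemma in_L2_wt:
  fixes A :: "real^'n::finite \<Rightarrow> complex"
  assumes [measurable]: "A \<in> borel_measurable borel" and A: "\<And>y. cmod (A y) \<le> M * wt y"
  shows "in_L2 A" and "(LINT y|lborel. (cmod (A y))\<^sup>2) \<le> M\<^sup>2 * (LINT y::real^'n|lborel. wt y)"
proof -
  have b: "(cmod (A y))\<^sup>2 \<le> M\<^sup>2 * wt y" for y
  proof -
    have "(cmod (A y))\<^sup>2 \<le> (M * wt y)\<^sup>2" by (intro power_mono A) auto
    also have "\<dots> = M\<^sup>2 * (wt y)\<^sup>2" by (rule power_mult_distrib)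
    also have "\<dots> \<le> M\<^sup>2 * (wt y) ^ 1" by (intro mult_left_mono wt_power_mono) auto
    finally show ?thesis by simp
  qed
  have i: "integrable lborel (\<lambda>y. (cmod (A y))\<^sup>2)"
    by (rule integrable_wt_bound[where M="M\<^sup>2" and c=0]) (use b in auto)
  then show "in_L2 A" by (simp add: in_L2_def)
  have "(LINT y|lborel. (cmod (A y))\<^sup>2) \<le> (LINT y::real^'n|lborel. M\<^sup>2 * wt y)"
    by (rule integral_mono[OF i]) (use b in auto)
  then show "(LINT y|lborel. (cmod (A y))\<^sup>2) \<le> M\<^sup>2 * (LINT y::real^'n|lborel. wt y)" by simp
qed

lemma integrable_L2_wt:
  fixes A :: "real^'n::finite \<Rightarrow> complex"
  assumes f: "in_L2 f" and [measurable]: "A \<in> borel_measurable borel" and A: "\<And>y. cmod (A y) \<le> M * wt (y - c)"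
  shows "integrable lborel (\<lambda>y. f y * A y)"
proof (rule Bochner_Integration.integrable_bound[where f="\<lambda>y. M * (cmod (f y) * wt (y - c))"])
  have [measurable]: "f \<in> borel_measurable borel" using f by (rule in_L2_measurable)
  show "(\<lambda>y. f y * A y) \<in> borel_measurable lborel" by measurable
  show "integrable lborel (\<lambda>y. M * (cmod (f y) * wt (y - c)))" by (intro integrable_mult_right in_L2_wt_integrable f)
  show "AE y in lborel. norm (f y * A y) \<le> norm (M * (cmod (f y) * wt (y - c)))"
  proof (rule AE_I2)
    fix y
    have "cmod (f y) * cmod (A y) \<le> cmod (f y) * (M * wt (y - c))" by (intro mult_left_mono A) auto
    also have "\<dots> \<le> norm (M * (cmod (f y) * wt (y - c)))" by (simp add: abs_mult mult.left_commute mult_right_mono)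
    finally show "norm (f y * A y) \<le> norm (M * (cmod (f y) * wt (y - c)))" by (simp add: norm_mult)
  qed
qed

lemma L2_cauchy_schwarz:
  fixes f g :: "real^'n::finite \<Rightarrow> complex"
  assumes f: "in_L2 f" and g: "in_L2 g"
  shows "cmod (LINT y|lborel. f y * g y) \<le> sqrt (LINT y|lborel. (cmod (f y))\<^sup>2) * sqrt (LINT y|lborel. (cmod (g y))\<^sup>2)"
proof -
  have [measurable]: "f \<in> borel_measurable borel" "g \<in> borel_measurable borel" using f g by (auto simp: in_L2_def)
  have n: "(\<integral>\<^sup>+y. ennreal (cmod (h y)) ^ 2 \<partial>lborel) = ennreal (LINT y|lborel. (cmod (h y))\<^sup>2)" if "in_L2 h" for h :: "real^'n \<Rightarrow> complex"
    using that by (simp add: ennreal_power nn_integral_eq_integral in_L2_def)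
  have "ennreal (cmod (LINT y|lborel. f y * g y)) \<le> (\<integral>\<^sup>+y. ennreal (cmod (f y)) * ennreal (cmod (g y)) \<partial>lborel)"
    using norm_integral_le_nn_integral[of lborel "\<lambda>y. f y * g y"] by (simp add: norm_mult ennreal_mult)
  then have "ennreal (cmod (LINT y|lborel. f y * g y)) ^ 2 \<le> (\<integral>\<^sup>+y. ennreal (cmod (f y)) * ennreal (cmod (g y)) \<partial>lborel) ^ 2"
    by (rule power_mono) simp
  also have "\<dots> \<le> (\<integral>\<^sup>+y. ennreal (cmod (f y)) ^ 2 \<partial>lborel) * (\<integral>\<^sup>+y. ennreal (cmod (g y)) ^ 2 \<partial>lborel)"
    by (rule Cauchy_Schwarz_nn_integral) measurable
  finally have "(cmod (LINT y|lborel. f y * g y))\<^sup>2 \<le> (LINT y|lborel. (cmod (f y))\<^sup>2) * (LINT y|lborel. (cmod (g y))\<^sup>2)"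
    unfolding n[OF f] n[OF g] by (simp add: ennreal_power flip: ennreal_mult')
  then show ?thesis
    by (simp add: real_le_rsqrt flip: real_sqrt_mult)
qed

text \<open>The elementary inequality 2ab <= a^2 + b^2 gives a bound linear in \<open>M\<close>,
  uniform over the centre \<open>c\<close> and over any set of times on which the norm of
  \<open>f\<close> is bounded.\<close>

lemma pairing_bound:
  fixes A :: "real^'n::finite \<Rightarrow> complex"
  assumes f: "in_L2 f" and [measurable]: "A \<in> borel_measurable borel" and A: "\<And>y. cmod (A y) \<le> M * wt (y - c)" and M: "0 \<le> M"
  shows "cmod (LINT y|lborel. f y * A y) \<le> M * ((LINT y|lborel. (cmod (f y))\<^sup>2) + (LINT y::real^'n|lborel. wt y))"
proof -
  have b: "cmod (f y * A y) \<le> M * ((cmod (f y))\<^sup>2 + wt (y - c))" for y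
  proof -
    let ?w = "wt (y - c)"
    have "?w * ?w \<le> ?w" using mult_left_mono[OF wt_le_1, of ?w "y - c"] by simp
    moreover have "2 * (cmod (f y) * ?w) \<le> (cmod (f y))\<^sup>2 + ?w\<^sup>2" using sum_squares_bound[of "cmod (f y)" ?w] by simp
    moreover have "0 \<le> cmod (f y) * ?w" by simp
    ultimately have w: "cmod (f y) * ?w \<le> (cmod (f y))\<^sup>2 + ?w" unfolding power2_eq_square by linarith
    have "cmod (f y * A y) \<le> cmod (f y) * (M * ?w)" unfolding norm_mult by (intro mult_left_mono A) auto
    also have "\<dots> = M * (cmod (f y) * ?w)" by simp
    also have "\<dots> \<le> M * ((cmod (f y))\<^sup>2 + ?w)" by (intro mult_left_mono w M)
    finally show ?thesis .
  qed
  have i: "integrable lborel (\<lambda>y. (cmod (f y))\<^sup>2)" using f by (simp add: in_L2_def)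
  have "cmod (LINT y|lborel. f y * A y) \<le> (LINT y|lborel. M * ((cmod (f y))\<^sup>2 + wt (y - c)))"
    by (rule Bochner_Integration.integral_norm_bound_integral[OF integrable_L2_wt[OF f _ A]]) (use b i in auto)
  also have "\<dots> = M * ((LINT y|lborel. (cmod (f y))\<^sup>2) + (LINT y::real^'n|lborel. wt y))"
    using i by simp
  finally show ?thesis .
qed

lemma continuous_L2_in_L2: "continuous_L2 u \<Longrightarrow> in_L2 (u t)"
  by (simp add: continuous_L2_def)

text \<open>Times with unbounded norms would accumulate at some t0 of the compact interval; near t0
  continuity bounds the norm by twice a small distance plus twice the norm at t0.\<close>

lemma continuous_L2_bounded:
  fixes u :: "real \<Rightarrow> real^'n::finite \<Rightarrow> complex"
  assumes u: "continuous_L2 u"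
  shows "\<exists>K\<ge>0. \<forall>t\<in>{c..d}. (LINT y|lborel. (cmod (u t y))\<^sup>2) \<le> K"
proof (rule ccontr)
  let ?N = "\<lambda>t. LINT y|lborel. (cmod (u t y))\<^sup>2"
  assume n: "\<not> ?thesis"
  have "\<forall>k::nat. \<exists>t\<in>{c..d}. real k < ?N t"
  proof
    fix k :: nat
    show "\<exists>t\<in>{c..d}. real k < ?N t" using n by (auto simp: not_le dest!: spec[of _ "real k"])
  qed
  then obtain t where t: "\<And>k::nat. t k \<in> {c..d}" "\<And>k::nat. real k < ?N (t k)" by metis
  obtain t0 r where r: "strict_mono (r :: nat \<Rightarrow> nat)" "(t \<circ> r) \<longlonglongrightarrow> t0"
    using compact_Icc[of c d] t(1) unfolding compact_eq_seq_compact_metric seq_compact_def by metis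
  have "(\<lambda>s. LINT x|lborel. (cmod (u s x - u t0 x))\<^sup>2) \<midarrow>t0\<rightarrow> (LINT x|lborel. (cmod (u t0 x - u t0 x))\<^sup>2)"
    using u by (simp add: continuous_L2_def)
  then have "isCont (\<lambda>s. LINT x|lborel. (cmod (u s x - u t0 x))\<^sup>2) t0" by (simp add: isCont_def)
  from isCont_tendsto_compose[OF this r(2)]
  have "(\<lambda>k. LINT x|lborel. (cmod (u (t (r k)) x - u t0 x))\<^sup>2) \<longlonglongrightarrow> 0" by simp
  then have ev: "\<forall>\<^sub>F k in sequentially. (LINT x|lborel. (cmod (u (t (r k)) x - u t0 x))\<^sup>2) < 1"
    by (rule order_tendstoD) simp
  have le: "?N s \<le> 2 * (LINT x|lborel. (cmod (u s x - u t0 x))\<^sup>2) + 2 * ?N t0" for s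
  proof -
    have i: "integrable lborel (\<lambda>x. (cmod (u s x))\<^sup>2)" "integrable lborel (\<lambda>x. (cmod (u t0 x))\<^sup>2)"
      "integrable lborel (\<lambda>x. (cmod (u s x - u t0 x))\<^sup>2)"
      using continuous_L2_in_L2[OF u] in_L2_diff[OF continuous_L2_in_L2[OF u] continuous_L2_in_L2[OF u]] by (auto simp: in_L2_def)
    have "?N s \<le> (LINT x|lborel. 2 * (cmod (u s x - u t0 x))\<^sup>2 + 2 * (cmod (u t0 x))\<^sup>2)"
    proof (rule integral_mono)
      show "(cmod (u s x))\<^sup>2 \<le> 2 * (cmod (u s x - u t0 x))\<^sup>2 + 2 * (cmod (u t0 x))\<^sup>2" for x
        using cmod_diff_sq[of "u s x - u t0 x" "- u t0 x"] by simp
    qed (use i in auto)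
    then show ?thesis using i by simp
  qed
  have "\<forall>\<^sub>F k in sequentially. real k < 2 + 2 * ?N t0"
    using ev
  proof eventually_elim
    case (elim k)
    have "real k \<le> real (r k)" using seq_suble[OF r(1), of k] by simp
    also have "\<dots> < ?N (t (r k))" by (rule t(2))
    also have "\<dots> \<le> 2 * (LINT x|lborel. (cmod (u (t (r k)) x - u t0 x))\<^sup>2) + 2 * ?N t0" by (rule le)
    finally show ?case using elim by simp
  qed
  moreover have "\<forall>\<^sub>F k in sequentially. 2 + 2 * ?N t0 < real k"
    using filterlim_real_sequentially unfolding filterlim_at_top_dense by blast
  ultimately have "\<forall>\<^sub>F k::nat in sequentially. False" by eventually_elim simp
  then show False by simp
qed

text \<open>The pairing is split into one with u(t) - u(t0), small by Cauchy-Schwarz, and one with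
  the fixed u(t0), handled by dominated convergence. Only measurability in y at each time is
  used.\<close>

lemma isCont_pairing:
  fixes u :: "real \<Rightarrow> real^'n::finite \<Rightarrow> complex"
  assumes u: "continuous_L2 u" and cont: "\<And>y. isCont (\<lambda>t. A t y) t0"
    and [measurable]: "\<And>t. A t \<in> borel_measurable borel"
    and e: "0 < e" and A: "\<And>t y. dist t t0 < e \<Longrightarrow> cmod (A t y) \<le> M * wt y"
  shows "isCont (\<lambda>t. LINT y|lborel. u t y * A t y) t0"
proof -
  have [measurable]: "u t \<in> borel_measurable borel" for t using continuous_L2_in_L2[OF u] by (rule in_L2_measurable)
  have uL: "in_L2 (u t)" for t by (rule continuous_L2_in_L2[OF u])
  have M: "0 \<le> M" using A[of t0 0] e by (smt (verit) dist_self mult_neg_pos norm_ge_zero wt_pos)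
  have c2: "isCont (\<lambda>t. LINT y|lborel. u t0 y * A t y) t0"
  proof (rule isCont_parameter_integral[where w="\<lambda>y. M * (cmod (u t0 y) * wt (y - 0))" and e=e])
    show "integrable lborel (\<lambda>y. M * (cmod (u t0 y) * wt (y - 0)))" by (intro integrable_mult_right in_L2_wt_integrable uL)
    show "isCont (\<lambda>p. u t0 x * A p x) t0" for x by (intro continuous_intros cont)
    show "cmod (u t0 x * A p x) \<le> M * (cmod (u t0 x) * wt (x - 0))" if "dist p t0 < e" for p x
      using mult_left_mono[OF A[OF that, of x], of "cmod (u t0 x)"] by (simp add: norm_mult mult.left_commute)
  qed (use e in auto)
  let ?W = "LINT y::real^'n|lborel. wt y"
  have z: "((\<lambda>t. LINT y|lborel. (u t y - u t0 y) * A t y) \<longlongrightarrow> 0) (at t0)"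
  proof (rule Lim_null_comparison)
    show "((\<lambda>t. sqrt (LINT x|lborel. (cmod (u t x - u t0 x))\<^sup>2) * sqrt (M\<^sup>2 * ?W)) \<longlongrightarrow> 0) (at t0)"
    proof -
      have "((\<lambda>t. LINT x|lborel. (cmod (u t x - u t0 x))\<^sup>2) \<longlongrightarrow> 0) (at t0)" using u by (simp add: continuous_L2_def)
      then have "((\<lambda>t. sqrt (LINT x|lborel. (cmod (u t x - u t0 x))\<^sup>2) * sqrt (M\<^sup>2 * ?W)) \<longlongrightarrow> sqrt 0 * sqrt (M\<^sup>2 * ?W)) (at t0)"
        by (intro tendsto_intros)
      then show ?thesis by simp
    qed
    show "\<forall>\<^sub>F t in at t0. norm (LINT y|lborel. (u t y - u t0 y) * A t y) \<le> sqrt (LINT x|lborel. (cmod (u t x - u t0 x))\<^sup>2) * sqrt (M\<^sup>2 * ?W)"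
      unfolding eventually_at
    proof (intro exI[of _ e] conjI e ballI impI)
      fix t assume "t \<noteq> t0 \<and> dist t t0 < e"
      then have At: "cmod (A t y) \<le> M * wt y" for y using A by simp
      have "norm (LINT y|lborel. (u t y - u t0 y) * A t y) \<le> sqrt (LINT x|lborel. (cmod (u t x - u t0 x))\<^sup>2) * sqrt (LINT x|lborel. (cmod (A t x))\<^sup>2)"
        by (rule L2_cauchy_schwarz[OF in_L2_diff[OF uL uL] in_L2_wt(1)[OF _ At]]) measurable
      also have "\<dots> \<le> sqrt (LINT x|lborel. (cmod (u t x - u t0 x))\<^sup>2) * sqrt (M\<^sup>2 * ?W)"
        using in_L2_wt(2)[OF _ At] by (intro mult_left_mono) (auto intro!: integral_nonneg_AE)
      finally show "norm (LINT y|lborel. (u t y - u t0 y) * A t y) \<le> sqrt (LINT x|lborel. (cmod (u t x - u t0 x))\<^sup>2) * sqrt (M\<^sup>2 * ?W)" .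
    qed
  qed
  have "((\<lambda>t. (LINT y|lborel. (u t y - u t0 y) * A t y) + (LINT y|lborel. u t0 y * A t y)) \<longlongrightarrow> 0 + (LINT y|lborel. u t0 y * A t0 y)) (at t0)"
    using z c2 unfolding isCont_def by (rule tendsto_add)
  moreover have "\<forall>\<^sub>F t in at t0. (LINT y|lborel. (u t y - u t0 y) * A t y) + (LINT y|lborel. u t0 y * A t y) = (LINT y|lborel. u t y * A t y)"
    unfolding eventually_at
  proof (intro exI[of _ e] conjI e ballI impI)
    fix t assume "t \<noteq> t0 \<and> dist t t0 < e"
    then have At: "cmod (A t y) \<le> M * wt (y - 0)" for y using A by simp
    have "integrable lborel (\<lambda>y. u t y * A t y)" "integrable lborel (\<lambda>y. u t0 y * A t y)"
      using integrable_L2_wt[OF uL _ At] by auto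
    then show "(LINT y|lborel. (u t y - u t0 y) * A t y) + (LINT y|lborel. u t0 y * A t y) = (LINT y|lborel. u t y * A t y)"
      by (simp add: left_diff_distrib)
  qed
  ultimately show ?thesis unfolding isCont_def by (simp add: Lim_transform_eventually)
qed

text \<open>What dominated convergence in the iterated integral requires of a sequence of
  multipliers and its limit. Continuity in t makes the inner pairings continuous in time, hence
  measurable, although \<open>u\<close> need not be jointly measurable.\<close>

definition admissible :: "real \<Rightarrow> real \<Rightarrow> (nat \<Rightarrow> real \<Rightarrow> real^'n::finite \<Rightarrow> complex) \<Rightarrow> (real \<Rightarrow> real^'n \<Rightarrow> complex) \<Rightarrow> bool" where
  "admissible c d A A' \<longleftrightarrow> (\<forall>m y. continuous_on UNIV (\<lambda>t. A m t y)) \<and> (\<forall>m t. A m t \<in> borel_measurable borel) \<and>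
     (\<exists>M\<ge>0. \<forall>m t y. cmod (A m t y) \<le> M * wt y) \<and> (\<forall>m t y. t \<notin> {c..d} \<longrightarrow> A m t y = 0) \<and>
     (\<forall>t y. (\<lambda>m. A m t y) \<longlonglongrightarrow> A' t y)"

text \<open>Dominated convergence twice: in y with a multiple of |u| times the weight, then in t
  with a constant on {c..d} furnished by \<open>continuous_L2_bounded\<close>.\<close>

lemma admissible_pairing_limit:
  fixes u :: "real \<Rightarrow> real^'n::finite \<Rightarrow> complex"
  assumes u: "continuous_L2 u" and adm: "admissible c d A A'"
  shows "(\<lambda>m. LINT t|lborel. LINT y|lborel. u t y * A m t y) \<longlonglongrightarrow> (LINT t|lborel. LINT y|lborel. u t y * A' t y)"
proof -
  have uL: "in_L2 (u t)" for t by (rule continuous_L2_in_L2[OF u])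
  have [measurable]: "u t \<in> borel_measurable borel" for t using uL by (rule in_L2_measurable)
  have mA [measurable]: "A m t \<in> borel_measurable borel" for m t using adm by (simp add: admissible_def)
  have lim: "(\<lambda>m. A m t y) \<longlonglongrightarrow> A' t y" for t y using adm by (simp add: admissible_def)
  have [measurable]: "A' t \<in> borel_measurable borel" for t
    by (rule borel_measurable_LIMSEQ_metric[of "\<lambda>m. A m t"]) (use lim in auto)
  obtain M where M: "0 \<le> M" "\<And>m t y. cmod (A m t y) \<le> M * wt y" using adm unfolding admissible_def by blast
  have M': "cmod (A m t y) \<le> M * wt (y - 0)" for m t y using M(2) by simp
  have z: "A m t y = 0" if "t \<notin> {c..d}" for m t y using adm that by (simp add: admissible_def)
  obtain K where K: "0 \<le> K" "\<And>t. t \<in> {c..d} \<Longrightarrow> (LINT y|lborel. (cmod (u t y))\<^sup>2) \<le> K"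
    using continuous_L2_bounded[OF u] by blast
  let ?W = "LINT y::real^'n|lborel. wt y"
  have W: "0 \<le> ?W" by (rule integral_nonneg_AE) auto
  have in1: "(\<lambda>m. LINT y|lborel. u t y * A m t y) \<longlonglongrightarrow> (LINT y|lborel. u t y * A' t y)" for t
  proof (rule integral_dominated_convergence[where w="\<lambda>y. M * (cmod (u t y) * wt (y - 0))"])
    show "integrable lborel (\<lambda>y. M * (cmod (u t y) * wt (y - 0)))" by (intro integrable_mult_right in_L2_wt_integrable uL)
    show "AE y in lborel. (\<lambda>m. u t y * A m t y) \<longlonglongrightarrow> u t y * A' t y" by (intro AE_I2 tendsto_intros lim)
    show "AE y in lborel. cmod (u t y * A m t y) \<le> M * (cmod (u t y) * wt (y - 0))" for m
      using mult_left_mono[OF M(2), of "cmod (u t _)"] by (intro AE_I2) (simp add: norm_mult mult.left_commute)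
  qed measurable
  \<comment> \<open>Source of measurability in time; the limiting inner integral is measurable as a
    pointwise limit of these continuous functions.\<close>
  have cont: "continuous_on UNIV (\<lambda>t. LINT y|lborel. u t y * A m t y)" for m
  proof (rule continuous_at_imp_continuous_on, rule ballI)
    fix t show "isCont (\<lambda>t. LINT y|lborel. u t y * A m t y) t"
    proof (rule isCont_pairing[OF u _ _ zero_less_one M(2)])
      show "isCont (\<lambda>t. A m t y) t" for y
        using adm by (auto simp: admissible_def continuous_on_eq_continuous_at)
    qed auto
  qed
  have mI [measurable]: "(\<lambda>t. LINT y|lborel. u t y * A m t y) \<in> borel_measurable lborel" for m
    using borel_measurable_continuous_onI[OF cont] by simp
  show ?thesis
  proof (rule integral_dominated_convergence[where w="\<lambda>t. indicator {c..d} t * (M * (K + ?W))"])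
    show "(\<lambda>t. LINT y|lborel. u t y * A' t y) \<in> borel_measurable lborel"
      by (rule borel_measurable_LIMSEQ_metric[OF mI]) (use in1 in auto)
    show "integrable lborel (\<lambda>t. indicator {c..d} t * (M * (K + ?W)))"
      by (intro integrable_mult_left integrable_real_indicator) (auto simp: emeasure_lborel_Icc_eq)
    show "AE t in lborel. (\<lambda>m. LINT y|lborel. u t y * A m t y) \<longlonglongrightarrow> (LINT y|lborel. u t y * A' t y)" using in1 by auto
    show "AE t in lborel. cmod (LINT y|lborel. u t y * A m t y) \<le> indicator {c..d} t * (M * (K + ?W))" for m
    proof (rule AE_I2)
      fix t
      show "cmod (LINT y|lborel. u t y * A m t y) \<le> indicator {c..d} t * (M * (K + ?W))"
      proof (cases "t \<in> {c..d}")
        case True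
        have "cmod (LINT y|lborel. u t y * A m t y) \<le> M * ((LINT y|lborel. (cmod (u t y))\<^sup>2) + ?W)"
          by (rule pairing_bound[OF uL mA M' M(1)])
        also have "\<dots> \<le> M * (K + ?W)" using K(2)[OF True] M(1) by (intro mult_left_mono) auto
        finally show ?thesis using True by simp
      next
        case False
        then show ?thesis using z by simp
      qed
    qed
  qed (rule mI)
qed

lemma admissible_base:
  assumes X: "continuous_on UNIV X" "\<And>t. t \<notin> {c..d} \<Longrightarrow> X t = (0::real)"
    and P: "\<And>y. continuous_on UNIV (\<lambda>t. P t y)" "\<And>t. P t \<in> borel_measurable borel"
    and M: "\<And>t y. t \<in> {c..d} \<Longrightarrow> cmod (P t y) \<le> M * wt y" and M0: "0 \<le> M"
  shows "admissible c d (\<lambda>m t y. X t * P t y) (\<lambda>t y. X t * P t y)"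
proof -
  have "continuous_on {c..d} X" by (rule continuous_on_subset[OF X(1)]) simp
  from compact_imp_bounded[OF compact_continuous_image[OF this compact_Icc]]
  obtain K where K: "\<forall>r\<in>X ` {c..d}. norm r \<le> K" unfolding bounded_iff ..
  have "cmod (X t * P t y) \<le> \<bar>K\<bar> * M * wt y" for t y
  proof (cases "t \<in> {c..d}")
    case True
    then have "\<bar>X t\<bar> \<le> \<bar>K\<bar>" using K by force
    then have "\<bar>X t\<bar> * cmod (P t y) \<le> \<bar>K\<bar> * (M * wt y)" using M[OF True] by (intro mult_mono) auto
    then show ?thesis by (simp add: norm_mult mult.assoc)
  next
    case False then show ?thesis using X(2) M0 by simp
  qed
  moreover have "0 \<le> \<bar>K\<bar> * M" using M0 by simp
  ultimately show ?thesis unfolding admissible_def using X P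
    by (intro conjI allI exI[of _ "\<bar>K\<bar> * M"] impI) (auto intro!: continuous_intros borel_measurable_times)
qed

lemma admissible_add:
  assumes "admissible c d A A'" "admissible c d B B'"
  shows "admissible c d (\<lambda>m t y. A m t y + B m t y) (\<lambda>t y. A' t y + B' t y)"
proof -
  obtain M1 M2 where M: "0 \<le> M1" "\<And>m t y. cmod (A m t y) \<le> M1 * wt y" "0 \<le> M2" "\<And>m t y. cmod (B m t y) \<le> M2 * wt y"
    using assms unfolding admissible_def by metis
  have "cmod (A m t y + B m t y) \<le> (M1 + M2) * wt y" for m t y
    unfolding distrib_right by (intro order_trans[OF norm_triangle_ineq] add_mono M)
  then show ?thesis using assms M(1,3) unfolding admissible_def
    by (intro conjI allI exI[of _ "M1 + M2"] impI) (auto intro!: continuous_intros tendsto_intros borel_measurable_add)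
qed

lemma admissible_sum:
  assumes "finite I" "\<And>i. i \<in> I \<Longrightarrow> admissible c d (A i) (A' i)"
  shows "admissible c d (\<lambda>m t y. \<Sum>i\<in>I. A i m t y) (\<lambda>t y. \<Sum>i\<in>I. A' i t y)"
  using assms
proof (induction I)
  case empty
  show ?case unfolding admissible_def by (auto intro!: exI[of _ 0])
next
  case (insert i I) then show ?case by (auto intro!: admissible_add)
qed

lemma admissible_mult:
  assumes A: "admissible c d A A'" and B: "\<And>m. B m \<in> borel_measurable borel" "\<And>m y. cmod (B m y) \<le> K"
    and lim: "\<And>y. (\<lambda>m. B m y) \<longlonglongrightarrow> B' y"
  shows "admissible c d (\<lambda>m t y. B m y * A m t y) (\<lambda>t y. B' y * A' t y)"
proof -
  obtain M where M: "0 \<le> M" "\<And>m t y. cmod (A m t y) \<le> M * wt y" using A unfolding admissible_def by metis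
  have K: "0 \<le> K" using B(2) norm_ge_zero order_trans by blast
  have "cmod (B m y * A m t y) \<le> (K * M) * wt y" for m t y
    unfolding norm_mult mult.assoc by (intro mult_mono B M K) auto
  then show ?thesis using A lim B(1) M K unfolding admissible_def
    by (intro conjI allI exI[of _ "K * M"] impI) (auto intro!: continuous_intros tendsto_intros borel_measurable_times)
qed

section \<open>Testing the equation with free wave packets\<close>

lemma smooth_fst:
  fixes h :: "real \<Rightarrow> 'b::real_normed_vector"
  assumes "smooth h" shows "smooth (\<lambda>(t, y::'a::euclidean_space). h t)"
proof -
  have "smooth (\<lambda>p::real \<times> 'a. h (p \<bullet> (1, 0)))"
    by (rule smooth_compose_real[OF assms smooth_inner_left(1)])
  then show ?thesis by (simp add: inner_prod_def case_prod_unfold)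
qed

lemma smooth_snd:
  fixes f :: "'a::euclidean_space \<Rightarrow> 'b::real_normed_vector"
  assumes "smooth f" shows "smooth (\<lambda>(t::real, y). f y)"
proof (rule smooth_coinduct[where Q="\<lambda>h. \<exists>f. smooth f \<and> h = (\<lambda>(t::real, y). f y)"])
  fix h :: "real \<times> 'a \<Rightarrow> 'b" assume "\<exists>f. smooth f \<and> h = (\<lambda>(t::real, y). f y)"
  then obtain f where f: "smooth f" "h = (\<lambda>(t::real, y). f y)" by auto
  show "continuous_on UNIV h" unfolding f(2) case_prod_unfold
    by (rule continuous_on_compose2[OF smooth_continuous[OF f(1)]]) (auto intro!: continuous_intros)
  fix b :: "real \<times> 'a" assume "b \<in> Basis"
  then consider "b = (1, 0)" | c where "c \<in> Basis" "b = (0, c)" by (auto simp: Basis_prod_def)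
  then show "\<exists>g'. (\<exists>f. smooth f \<and> g' = (\<lambda>(t::real, y). f y)) \<and> (\<forall>x. ((\<lambda>s::real. h (x + s *\<^sub>R b)) has_vector_derivative g' x) (at 0))"
  proof cases
    case 1
    then show ?thesis by (intro exI[of _ "\<lambda>_. 0"] conjI exI[of _ "\<lambda>_. 0"]) (auto simp: f(2) case_prod_unfold)
  next
    case (2 c)
    have "((\<lambda>s::real. h (x + s *\<^sub>R b)) has_vector_derivative dir_deriv c f (snd x)) (at 0)" for x
      using smooth_has_derivative0[OF f(1) 2(1), of "snd x"] by (simp add: f(2) 2(2) case_prod_unfold)
    then show ?thesis using smooth_dir_deriv[OF f(1) 2(1)]
      by (intro exI[of _ "\<lambda>(t, y). dir_deriv c f y"]) (auto simp: case_prod_unfold)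
  qed
qed (use assms in auto)

text \<open>Multipliers that decay in y uniformly on bounded time intervals: enough for continuous
  pairings, and after multiplication by a time cutoff for \<open>admissible\<close>.\<close>

definition locally_dominated :: "(real \<Rightarrow> real^'n::finite \<Rightarrow> complex) \<Rightarrow> bool" where
  "locally_dominated P \<longleftrightarrow> (\<forall>y. continuous_on UNIV (\<lambda>t. P t y)) \<and> (\<forall>t. P t \<in> borel_measurable borel) \<and>
     (\<forall>T. \<exists>M\<ge>0. \<forall>t y. \<bar>t\<bar> \<le> T \<longrightarrow> cmod (P t y) \<le> M * wt y)"

lemma locally_dominated_cmult:
  assumes "locally_dominated P" shows "locally_dominated (\<lambda>t y. c * P t y)"
  unfolding locally_dominated_def
proof (intro conjI allI)
  fix T
  obtain M where M: "0 \<le> M" "\<And>t y. \<bar>t\<bar> \<le> T \<Longrightarrow> cmod (P t y) \<le> M * wt y"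
    using assms unfolding locally_dominated_def by metis
  then show "\<exists>M\<ge>0. \<forall>t y. \<bar>t\<bar> \<le> T \<longrightarrow> cmod (c * P t y) \<le> M * wt y"
    by (intro exI[of _ "cmod c * M"]) (auto simp: norm_mult mult.assoc intro!: mult_left_mono)
qed (use assms in \<open>auto simp: locally_dominated_def intro!: continuous_intros borel_measurable_times\<close>)

lemma propagator_continuous_time:
  fixes g :: "real^'n::finite \<Rightarrow> complex"
  assumes "schw g" shows "continuous_on UNIV (\<lambda>t. free_propagator t g y)"
proof -
  have "continuous_on UNIV (\<lambda>t. (\<lambda>(s, y). free_propagator s g y) (t, y))"
    by (rule continuous_on_compose2[OF continuous_propagator[OF assms]]) (auto intro!: continuous_intros)
  then show ?thesis by simp
qed

lemma locally_dominated_propagator: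
  fixes g :: "real^'n::finite \<Rightarrow> complex"
  assumes g: "schw g" shows "locally_dominated (\<lambda>t y. cnj (free_propagator t g y))"
  unfolding locally_dominated_def
proof (intro conjI allI)
  show "continuous_on UNIV (\<lambda>t. cnj (free_propagator t g y))" for y
    by (intro continuous_intros propagator_continuous_time g)
  show "(\<lambda>y. cnj (free_propagator t g y)) \<in> borel_measurable borel" for t
    by (intro measurable_cnj propagator_measurable g)
  show "\<exists>M\<ge>0. \<forall>t y. \<bar>t\<bar> \<le> T \<longrightarrow> cmod (cnj (free_propagator t g y)) \<le> M * wt y" for T
  proof -
    obtain M where "M \<ge> 0" "\<forall>s y. \<bar>s\<bar> \<le> \<bar>T\<bar> \<longrightarrow> cmod (free_propagator s g y) \<le> M * wt y ^ 1"
      using propagator_decay[OF g, of "\<bar>T\<bar>" 1] by auto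
    then show ?thesis by (intro exI[of _ M]) auto
  qed
qed

text \<open>The evolved packet is taken with two powers of decay; one pays for the linear growth of
  the potential, the other remains.\<close>

lemma locally_dominated_potential:
  fixes g :: "real^'n::finite \<Rightarrow> complex" and V :: "real \<Rightarrow> real^'n \<Rightarrow> real"
  assumes g: "schw g" and V: "smooth (\<lambda>(t, x). V t x)" and L: "\<And>t y. \<bar>V t y - V t 0\<bar> \<le> L / wt y"
  shows "locally_dominated (\<lambda>t y. V t y * cnj (free_propagator t g y))"
  unfolding locally_dominated_def
proof (intro conjI allI)
  have cV: "continuous_on UNIV (\<lambda>(t, x). V t x)" by (rule smooth_continuous[OF V])
  have ct: "continuous_on UNIV (\<lambda>t. V t y)" for y
  proof -
    have "continuous_on UNIV (\<lambda>t. (\<lambda>(t, x). V t x) (t, y))"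
      by (rule continuous_on_compose2[OF cV]) (auto intro!: continuous_intros)
    then show ?thesis by simp
  qed
  have [measurable]: "V t \<in> borel_measurable borel" for t
    using smooth_measurable[OF smooth_slice[OF V, of t]] by simp
  note [measurable] = propagator_measurable[OF g]
  show "continuous_on UNIV (\<lambda>t. V t y * cnj (free_propagator t g y))" for y
    by (intro continuous_intros propagator_continuous_time g ct)
  show "(\<lambda>y. V t y * cnj (free_propagator t g y)) \<in> borel_measurable borel" for t
    by measurable
  show "\<exists>M\<ge>0. \<forall>t y. \<bar>t\<bar> \<le> T \<longrightarrow> cmod (V t y * cnj (free_propagator t g y)) \<le> M * wt y" for T
  proof -
    obtain M where M: "M \<ge> 0" "\<And>s y. \<bar>s\<bar> \<le> \<bar>T\<bar> \<Longrightarrow> cmod (free_propagator s g y) \<le> M * wt y ^ 2"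
      using propagator_decay[OF g, of "\<bar>T\<bar>" 2] by auto
    have "continuous_on {- \<bar>T\<bar>..\<bar>T\<bar>} (\<lambda>t. V t 0)" by (rule continuous_on_subset[OF ct]) simp
    from compact_imp_bounded[OF compact_continuous_image[OF this compact_Icc]]
    \<comment> \<open>Only the differences of the potential are bounded uniformly in time; its value
      at the origin is bounded by continuity on a compact time interval, which is why domination is
      local in t.\<close>
    obtain K where K: "\<forall>r\<in>(\<lambda>t. V t 0) ` {- \<bar>T\<bar>..\<bar>T\<bar>}. norm r \<le> K" unfolding bounded_iff ..
    have L0: "0 \<le> L" using L[of 0 0] wt_pos[of "0::real^'n"] by (auto simp: zero_le_divide_iff dest: leD)
    have K0: "0 \<le> K" using K by force
    have "cmod (V t y * cnj (free_propagator t g y)) \<le> ((K + L) * M) * wt y" if t: "\<bar>t\<bar> \<le> T" for t y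
    proof -
      have "\<bar>V t 0\<bar> \<le> K" using K t by force
      also have "K \<le> K / wt y" using K0 wt_le_1[of y] by (simp add: pos_le_divide_eq mult_left_le)
      finally have "\<bar>V t y\<bar> \<le> (K + L) / wt y" using L[of t y] by (simp add: add_divide_distrib)
      then have "\<bar>V t y\<bar> * cmod (free_propagator t g y) \<le> ((K + L) / wt y) * (M * wt y ^ 2)"
        using M(2)[of t y] t K0 L0 by (intro mult_mono) auto
      then show ?thesis by (simp add: norm_mult power2_eq_square)
    qed
    moreover have "0 \<le> (K + L) * M" using K0 L0 M(1) by simp
    ultimately show ?thesis by blast
  qed
qed

lemma continuous_locally_dominated_pairing:
  assumes u: "continuous_L2 u" and P: "locally_dominated P"
  shows "continuous_on UNIV (\<lambda>t. LINT y|lborel. u t y * P t y)"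
proof (rule continuous_at_imp_continuous_on, rule ballI)
  fix t0
  obtain M where M: "0 \<le> M" "\<And>t y. \<bar>t\<bar> \<le> \<bar>t0\<bar> + 1 \<Longrightarrow> cmod (P t y) \<le> M * wt y"
    using P unfolding locally_dominated_def by metis
  show "isCont (\<lambda>t. LINT y|lborel. u t y * P t y) t0"
  proof (rule isCont_pairing[OF u _ _ zero_less_one])
    show "isCont (\<lambda>t. P t y) t0" for y using P by (auto simp: locally_dominated_def continuous_on_eq_continuous_at)
    show "P t \<in> borel_measurable borel" for t using P by (simp add: locally_dominated_def)
    show "cmod (P t y) \<le> M * wt y" if "dist t t0 < 1" for t y
      by (rule M(2)) (use that in \<open>simp add: dist_real_def\<close>)
  qed
qed

lemma integrable_locally_dominated:
  assumes u: "in_L2 f" and P: "locally_dominated P"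
  shows "integrable lborel (\<lambda>y. f y * P t y)"
proof -
  obtain M where M: "0 \<le> M" "\<And>s y. \<bar>s\<bar> \<le> \<bar>t\<bar> \<Longrightarrow> cmod (P s y) \<le> M * wt y"
    using P unfolding locally_dominated_def by metis
  show ?thesis
    by (rule integrable_L2_wt[OF u, of _ M 0]) (use P M in \<open>auto simp: locally_dominated_def\<close>)
qed

lemma admissible_locally_dominated:
  assumes X: "continuous_on UNIV X" "\<And>t. t \<notin> {c..d} \<Longrightarrow> X t = (0::real)" and P: "locally_dominated P"
  shows "admissible c d (\<lambda>m t y. X t * P t y) (\<lambda>t y. X t * P t y)"
proof -
  obtain M where M: "0 \<le> M" "\<And>s y. \<bar>s\<bar> \<le> max \<bar>c\<bar> \<bar>d\<bar> \<Longrightarrow> cmod (P s y) \<le> M * wt y"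
    using P unfolding locally_dominated_def by metis
  show ?thesis
    by (rule admissible_base[OF X, where M=M]) (use P M in \<open>auto simp: locally_dominated_def\<close>)
qed

lemma integrable_compact_support:
  fixes g :: "real \<Rightarrow> complex"
  assumes "continuous_on UNIV X" "\<And>t. t \<notin> {c..d} \<Longrightarrow> X t = (0::real)" "continuous_on UNIV g"
  shows "integrable lborel (\<lambda>t. X t * g t)"
proof -
  have "integrable lborel (\<lambda>t. indicator {c..d} t *\<^sub>R (X t * g t))"
    by (rule borel_integrable_compact) (auto intro!: continuous_intros continuous_on_subset[OF assms(1)] continuous_on_subset[OF assms(3)])
  moreover have "(\<lambda>t. indicator {c..d} t *\<^sub>R (X t * g t)) = (\<lambda>t. X t * g t)"
    using assms(2) by (auto simp: fun_eq_iff indicator_def)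
  ultimately show ?thesis by simp
qed

text \<open>The conjugate of a free solution, cut off in time by \<theta> and in space by a slowly
  varying bump, is a test function. Removing the space cutoff leaves only the potential: the
  Laplacian cancels against the time derivative of the free solution. The conjugate appears because
  the equation uses a bilinear pairing.\<close>

lemma weak_equation_free_wave:
  fixes V :: "real \<Rightarrow> real^'n::finite \<Rightarrow> real" and G :: "real^'n \<Rightarrow> complex"
  assumes sol: "schroedinger_solution V u0 u" and V: "smooth (\<lambda>(t, x). V t x)"
    and L: "\<And>t y. \<bar>V t y - V t 0\<bar> \<le> L / wt y" and G: "schw G"
    and \<theta>: "smooth \<theta>" "\<And>t. (\<theta> has_real_derivative \<theta>' t) (at t)" "continuous_on UNIV \<theta>'"
    and supp: "\<And>t. t \<notin> {c..d} \<Longrightarrow> \<theta> t = 0" "\<And>t. t \<notin> {c..d} \<Longrightarrow> \<theta>' t = 0"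
  shows "(LINT t|lborel. \<theta>' t * (LINT y|lborel. u t y * cnj (free_propagator t G y))) =
    \<i> * (LINT t|lborel. \<theta> t * (LINT y|lborel. u t y * (V t y * cnj (free_propagator t G y))))"
proof -
  have u: "continuous_L2 u" using sol by (simp add: schroedinger_solution_def)
  let ?\<Phi> = "\<lambda>t. free_propagator t G" and ?\<Phi>2 = "\<lambda>t. free_propagator t (laplacian G)"
  let ?\<Phi>1 = "\<lambda>i t. free_propagator t (dir_deriv (axis i 1) G)"
  \<comment> \<open>Inverse radius of the space cutoff; each derivative falling on the cutoff
    produces one factor \<open>e m\<close>.\<close>
  define e where "e m = inverse (real (Suc m))" for m
  have e0: "e \<longlonglongrightarrow> 0" unfolding e_def by (rule LIMSEQ_inverse_real_of_nat)
  have e1: "0 < e m" "e m \<le> 1" for m by (auto simp: e_def inverse_le_1_iff)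
  let ?b = "\<lambda>m y::real^'n. bump (e m *\<^sub>R y)"
  let ?b1 = "\<lambda>i m y::real^'n. e m *\<^sub>R dir_deriv (axis i 1) bump (e m *\<^sub>R y)"
  let ?b2 = "\<lambda>i m y::real^'n. e m *\<^sub>R (e m *\<^sub>R dir_deriv (axis i 1) (dir_deriv (axis i 1) bump) (e m *\<^sub>R y))"
  let ?\<psi> = "\<lambda>m t y. complex_of_real (\<theta> t) * (?b m y * cnj (?\<Phi> t y))"
  have sb: "smooth (?b m)" for m by (rule smooth_scale(1)[OF smooth_bump])
  have db: "dir_deriv (axis i 1) (?b m) = ?b1 i m" for i m
    by (rule smooth_scale(2)[OF smooth_bump]) simp
  have sdb: "smooth (dir_deriv (axis i (1::real)) bump :: real^'n \<Rightarrow> complex)" for i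
    by (intro smooth_dir_deriv smooth_bump) simp
  have sb1: "smooth (?b1 i m)" for i m
    by (rule smooth_linear(1)[OF bounded_linear_scaleR_right smooth_scale(1)[OF sdb]])
  have db2: "dir_deriv (axis i 1) (?b1 i m) = ?b2 i m" for i m
    by (subst smooth_linear(2)[OF bounded_linear_scaleR_right smooth_scale(1)[OF sdb]]) (simp_all add: smooth_scale(2)[OF sdb])
  have sPhi: "smooth (\<lambda>y. cnj (?\<Phi> t y))" "smooth (\<lambda>y. cnj (?\<Phi>1 i t y))" for t i
    by (intro smooth_cnj smooth_propagator schw_dir_deriv G axis_in_Basis)+
  have dPhi: "dir_deriv (axis i 1) (\<lambda>y. cnj (?\<Phi> t y)) = (\<lambda>y. cnj (?\<Phi>1 i t y))" for t i
    by (simp add: dir_deriv_cnj[OF smooth_propagator[OF G]] dir_deriv_propagator[OF G])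
  have test: "test_function (?\<psi> m)" for m
    unfolding test_function_def
  proof
    have "smooth (\<lambda>p::real \<times> (real^'n). complex_of_real ((\<lambda>(t, y). \<theta> t) p) * ((\<lambda>(t, y). ?b m y) p * cnj ((\<lambda>(t, y). ?\<Phi> t y) p)))"
      by (intro smooth_mult smooth_of_real smooth_cnj smooth_fst \<theta> smooth_snd sb smooth_propagator_joint G)
    then show "smooth (\<lambda>(t, x). ?\<psi> m t x)" by (simp add: case_prod_unfold)
    have "{(t, x). ?\<psi> m t x \<noteq> 0} \<subseteq> {c..d} \<times> cball 0 (real (Suc m))"
    proof clarify
      fix t x assume n: "?\<psi> m t x \<noteq> 0"
      then have "\<theta> t \<noteq> 0" "bump (e m *\<^sub>R x) \<noteq> 0" by auto
      then have "t \<in> {c..d}" "norm (e m *\<^sub>R x) < 1" using supp(1) bump_zero[of "e m *\<^sub>R x"] by fastforce+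
      then show "t \<in> {c..d} \<and> x \<in> cball 0 (real (Suc m))"
        using e1(1)[of m] by (auto simp: e_def divide_simps simp del: of_nat_Suc)
    qed
    then have "bounded {(t, x). ?\<psi> m t x \<noteq> 0}"
      by (rule bounded_subset[rotated]) (intro bounded_Times bounded_cball bounded_closed_interval)
    then show "compact (closure {(t, x). ?\<psi> m t x \<noteq> 0})" by (simp add: compact_closure)
  qed
  let ?A = "\<lambda>m t y. ?b m y * (\<theta>' t * (- \<i> * cnj (?\<Phi> t y))) + ?b m y * (\<theta> t * (- (1 / 2) * cnj (?\<Phi>2 t y)))"
  let ?A' = "\<lambda>t y. 1 * (\<theta>' t * (- \<i> * cnj (?\<Phi> t y))) + 1 * (\<theta> t * (- (1 / 2) * cnj (?\<Phi>2 t y)))"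
  \<comment> \<open>Three groups: both derivatives on the cutoff, one derivative on each factor
    (doubled, so 1/2 becomes 1), and both on the free wave together with the potential. The first
    two groups vanish in the limit.\<close>
  let ?B = "\<lambda>m t y. (\<Sum>i\<in>UNIV. ?b2 i m y * (\<theta> t * (- (1 / 2) * cnj (?\<Phi> t y)))) + (\<Sum>i\<in>UNIV. ?b1 i m y * (\<theta> t * (- 1 * cnj (?\<Phi>1 i t y))))
     + (?b m y * (\<theta> t * (- (1 / 2) * cnj (?\<Phi>2 t y))) + ?b m y * (\<theta> t * (V t y * cnj (?\<Phi> t y))))"
  let ?B' = "\<lambda>t y. (\<Sum>i\<in>(UNIV::'n set). 0 * (\<theta> t * (- (1 / 2) * cnj (?\<Phi> t y)))) + (\<Sum>i\<in>UNIV. 0 * (\<theta> t * (- 1 * cnj (?\<Phi>1 i t y))))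
     + (1 * (\<theta> t * (- (1 / 2) * cnj (?\<Phi>2 t y))) + 1 * (\<theta> t * (V t y * cnj (?\<Phi> t y))))"
  have timed: "- \<i> * vector_derivative (\<lambda>s. ?\<psi> m s y) (at t) = ?A m t y" for m t y
  proof -
    have "((\<lambda>s. complex_of_real (\<theta> s)) has_vector_derivative complex_of_real (\<theta>' t)) (at t)"
      using \<theta>(2) by (simp add: has_real_derivative_iff_has_vector_derivative has_vector_derivative_of_real)
    \<comment> \<open>Conjugation turns the factor i/2 into -i/2; multiplied by the -i of the
      equation it becomes -1/2, the coefficient of the Laplacian on the other side.\<close>
    moreover have "((\<lambda>s. ?b m y * cnj (?\<Phi> s y)) has_vector_derivative ?b m y * cnj (\<i> / 2 * ?\<Phi>2 t y)) (at t)"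
      by (intro has_vector_derivative_mult_right bounded_linear.has_vector_derivative[OF bounded_linear_cnj] propagator_has_derivative_time G)
    ultimately have "((\<lambda>s. ?\<psi> m s y) has_vector_derivative complex_of_real (\<theta> t) * (?b m y * cnj (\<i> / 2 * ?\<Phi>2 t y)) + complex_of_real (\<theta>' t) * (?b m y * cnj (?\<Phi> t y))) (at t)"
      by (rule has_vector_derivative_mult)
    then show ?thesis by (simp add: vector_derivative_at algebra_simps)
  qed
  have lap: "laplacian (?\<psi> m t) y = complex_of_real (\<theta> t) * ((\<Sum>i\<in>UNIV. ?b2 i m y * cnj (?\<Phi> t y)) + (\<Sum>i\<in>UNIV. 2 * (?b1 i m y * cnj (?\<Phi>1 i t y))) + ?b m y * cnj (?\<Phi>2 t y))" for m t y
  proof -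
    have d1: "dir_deriv (axis i 1) (?\<psi> m t) = (\<lambda>y. complex_of_real (\<theta> t) * (?b m y * cnj (?\<Phi>1 i t y) + ?b1 i m y * cnj (?\<Phi> t y)))" for i
      by (simp add: smooth_cmult(2)[OF smooth_mult[OF sb sPhi(1)]] dir_deriv_mult[OF sb sPhi(1)] db dPhi)
    have d2: "dir_deriv (axis i 1) (dir_deriv (axis i 1) (?\<psi> m t)) y = complex_of_real (\<theta> t) *
      (?b m y * cnj (free_propagator t (dir_deriv (axis i 1) (dir_deriv (axis i 1) G)) y) + 2 * (?b1 i m y * cnj (?\<Phi>1 i t y)) + ?b2 i m y * cnj (?\<Phi> t y))" for i
    proof -
      have dP1: "dir_deriv (axis i 1) (\<lambda>y. cnj (?\<Phi>1 i t y)) = (\<lambda>y. cnj (free_propagator t (dir_deriv (axis i 1) (dir_deriv (axis i 1) G)) y))"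
        using schw_dir_deriv[OF G axis_in_Basis] by (simp add: dir_deriv_cnj[OF smooth_propagator] dir_deriv_propagator)
      have "dir_deriv (axis i 1) (\<lambda>y. complex_of_real (\<theta> t) * (?b m y * cnj (?\<Phi>1 i t y) + ?b1 i m y * cnj (?\<Phi> t y))) =
        (\<lambda>y. complex_of_real (\<theta> t) * ((?b m y * cnj (free_propagator t (dir_deriv (axis i 1) (dir_deriv (axis i 1) G)) y) + ?b1 i m y * cnj (?\<Phi>1 i t y))
          + (?b1 i m y * cnj (?\<Phi>1 i t y) + ?b2 i m y * cnj (?\<Phi> t y))))"
        unfolding smooth_cmult(2)[OF smooth_add(1)[OF smooth_mult[OF sb sPhi(2)] smooth_mult[OF sb1 sPhi(1)]] axis_in_Basis]
          smooth_add(2)[OF smooth_mult[OF sb sPhi(2)] smooth_mult[OF sb1 sPhi(1)] axis_in_Basis]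
          dir_deriv_mult[OF sb sPhi(2) axis_in_Basis] dir_deriv_mult[OF sb1 sPhi(1) axis_in_Basis] db db2 dPhi dP1 ..
      then show ?thesis unfolding d1 by (simp add: algebra_simps)
    qed
    have "(\<Sum>i\<in>UNIV. ?b m y * cnj (free_propagator t (dir_deriv (axis i 1) (dir_deriv (axis i 1) G)) y)) = ?b m y * cnj (?\<Phi>2 t y)"
      unfolding sum_distrib_left[symmetric] laplacian_propagator[OF G, symmetric] laplacian_def
      by (simp add: dir_deriv_propagator G schw_dir_deriv)
    then show ?thesis unfolding laplacian_def d2 sum_distrib_left[symmetric] sum.distrib
      by (simp add: add.commute add.left_commute)
  qed
  have spaced: "- (1 / 2) * laplacian (?\<psi> m t) y + complex_of_real (V t y) * ?\<psi> m t y = ?B m t y" for m t y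
    unfolding lap by (simp add: algebra_simps sum_distrib_left sum_distrib_right sum_negf sum_divide_distrib)
  have mb: "?b m \<in> borel_measurable borel" "?b1 i m \<in> borel_measurable borel" "?b2 i m \<in> borel_measurable borel" for i m
  proof -
    show "?b m \<in> borel_measurable borel" by (rule smooth_measurable[OF sb])
    show "?b1 i m \<in> borel_measurable borel" by (rule smooth_measurable[OF sb1])
    show "?b2 i m \<in> borel_measurable borel" unfolding db2[symmetric] by (intro smooth_measurable smooth_dir_deriv sb1 axis_in_Basis)
  qed
  obtain C0 where C0: "0 \<le> C0" "\<And>y::real^'n. cmod (bump y) \<le> C0" using bump_bounded[of "[]"] by auto
  have "\<forall>i. \<exists>C\<ge>0. \<forall>y::real^'n. cmod (dir_deriv (axis i 1) bump y) \<le> C"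
  proof
    fix i :: 'n show "\<exists>C\<ge>0. \<forall>y::real^'n. cmod (dir_deriv (axis i 1) bump y) \<le> C"
      using bump_bounded[of "[axis i (1::real)]"] by simp
  qed
  then obtain C1 where C1: "\<And>i. 0 \<le> C1 i" "\<And>i (y::real^'n). cmod (dir_deriv (axis i 1) bump y) \<le> C1 i" by metis
  have "\<forall>i. \<exists>C\<ge>0. \<forall>y::real^'n. cmod (dir_deriv (axis i 1) (dir_deriv (axis i 1) bump) y) \<le> C"
  proof
    fix i :: 'n show "\<exists>C\<ge>0. \<forall>y::real^'n. cmod (dir_deriv (axis i 1) (dir_deriv (axis i 1) bump) y) \<le> C"
      using bump_bounded[of "[axis i (1::real), axis i 1]"] by simp
  qed
  then obtain C2 where C2: "\<And>i. 0 \<le> C2 i" "\<And>i (y::real^'n). cmod (dir_deriv (axis i 1) (dir_deriv (axis i 1) bump) y) \<le> C2 i" by metis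
  have bb1: "cmod (?b1 i m y) \<le> e m * C1 i" for i m y
    using e1[of m] C1 by (auto intro!: mult_left_mono)
  have bb2: "cmod (?b2 i m y) \<le> e m * C2 i" for i m y
  proof -
    have "cmod (?b2 i m y) \<le> e m * (1 * C2 i)"
      unfolding norm_scaleR using e1[of m] C2 by (intro mult_mono) (auto intro!: mult_nonneg_nonneg)
    then show ?thesis by simp
  qed
  have lb: "(\<lambda>m. ?b m y) \<longlonglongrightarrow> 1" for y
  proof -
    have "(\<lambda>m. e m *\<^sub>R y) \<longlonglongrightarrow> 0 *\<^sub>R y" by (intro tendsto_intros e0)
    from continuous_on_tendsto_compose[OF smooth_continuous[OF smooth_bump] this] show ?thesis by simp
  qed
  have lb1: "(\<lambda>m. ?b1 i m y) \<longlonglongrightarrow> 0" for i y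
  proof (rule Lim_null_comparison)
    show "(\<lambda>m. e m * C1 i) \<longlonglongrightarrow> 0" using tendsto_mult_left_zero[OF e0] .
  qed (use bb1 in auto)
  have lb2: "(\<lambda>m. ?b2 i m y) \<longlonglongrightarrow> 0" for i y
  proof (rule Lim_null_comparison)
    show "(\<lambda>m. e m * C2 i) \<longlonglongrightarrow> 0" using tendsto_mult_left_zero[OF e0] .
  qed (use bb2 in auto)
  have bb1': "cmod (?b1 i m y) \<le> C1 i" and bb2': "cmod (?b2 i m y) \<le> C2 i" for i m y
    using order_trans[OF bb1 mult_right_mono[OF e1(2) C1(1)]] order_trans[OF bb2 mult_right_mono[OF e1(2) C2(1)]] by auto
  have sG: "schw (laplacian G)" "\<And>i. schw (dir_deriv (axis i 1) G)"
    by (intro schw_laplacian schw_dir_deriv G axis_in_Basis)+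
  have c\<theta>: "continuous_on UNIV \<theta>" by (rule smooth_continuous[OF \<theta>(1)])
  have ld: "locally_dominated (\<lambda>t y. cnj (?\<Phi> t y))" "locally_dominated (\<lambda>t y. cnj (?\<Phi>2 t y))" "\<And>i. locally_dominated (\<lambda>t y. cnj (?\<Phi>1 i t y))"
    "locally_dominated (\<lambda>t y. V t y * cnj (?\<Phi> t y))"
    by (rule locally_dominated_propagator[OF G] locally_dominated_propagator[OF sG(1)]
        locally_dominated_propagator[OF sG(2)] locally_dominated_potential[OF G V L])+
  have admA: "admissible c d ?A ?A'"
    by (intro admissible_add admissible_mult[OF admissible_locally_dominated[OF \<theta>(3) supp(2) locally_dominated_cmult[OF ld(1)]] mb(1) C0(2) lb]
      admissible_mult[OF admissible_locally_dominated[OF c\<theta> supp(1) locally_dominated_cmult[OF ld(2)]] mb(1) C0(2) lb])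
  have admB: "admissible c d ?B ?B'"
    by (intro admissible_add admissible_sum
      admissible_mult[OF admissible_locally_dominated[OF c\<theta> supp(1) locally_dominated_cmult[OF ld(2)]] mb(1) C0(2) lb]
      admissible_mult[OF admissible_locally_dominated[OF c\<theta> supp(1) ld(4)] mb(1) C0(2) lb]
      admissible_mult[OF admissible_locally_dominated[OF c\<theta> supp(1) locally_dominated_cmult[OF ld(1)]] mb(3) bb2' lb2]
      admissible_mult[OF admissible_locally_dominated[OF c\<theta> supp(1) locally_dominated_cmult[OF ld(3)]] mb(2) bb1' lb1]) simp_all
  have "(LINT t|lborel. LINT y|lborel. u t y * ?A m t y) = (LINT t|lborel. LINT y|lborel. u t y * ?B m t y)" for m
    using sol test[of m] unfolding schroedinger_solution_def timed[symmetric] spaced[symmetric] by blast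
  then have eq: "(LINT t|lborel. LINT y|lborel. u t y * ?A' t y) = (LINT t|lborel. LINT y|lborel. u t y * ?B' t y)"
    using LIMSEQ_unique[OF admissible_pairing_limit[OF u admA]] admissible_pairing_limit[OF u admB] by simp
  let ?g = "\<lambda>t. LINT y|lborel. u t y * cnj (?\<Phi> t y)" and ?k = "\<lambda>t. LINT y|lborel. u t y * cnj (?\<Phi>2 t y)"
    and ?h = "\<lambda>t. LINT y|lborel. u t y * (V t y * cnj (?\<Phi> t y))"
  have uL: "in_L2 (u t)" for t by (rule continuous_L2_in_L2[OF u])
  note il = integrable_locally_dominated[OF uL ld(1)] integrable_locally_dominated[OF uL ld(2)] integrable_locally_dominated[OF uL ld(4)]
  have iA: "(LINT y|lborel. u t y * ?A' t y) = - \<i> * (\<theta>' t * ?g t) + - (1/2) * (\<theta> t * ?k t)" for t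
  proof -
    have "(LINT y|lborel. u t y * ?A' t y) = (LINT y|lborel. (- \<i> * \<theta>' t) * (u t y * cnj (?\<Phi> t y)) + (- (1/2) * \<theta> t) * (u t y * cnj (?\<Phi>2 t y)))"
      by (rule Bochner_Integration.integral_cong) (auto simp: algebra_simps)
    also have "\<dots> = (- \<i> * \<theta>' t) * ?g t + (- (1/2) * \<theta> t) * ?k t"
      by (subst Bochner_Integration.integral_add) (intro integrable_mult_right il, intro integrable_mult_right il, simp only: integral_mult_right_zero)
    finally show ?thesis by (simp only: mult.assoc of_real_mult of_real_minus of_real_divide of_real_1 of_real_numeral)
  qed
  have iB: "(LINT y|lborel. u t y * ?B' t y) = - (1/2) * (\<theta> t * ?k t) + \<theta> t * ?h t" for t
  proof -
    have "(LINT y|lborel. u t y * ?B' t y) = (LINT y|lborel. (- (1/2) * \<theta> t) * (u t y * cnj (?\<Phi>2 t y)) + \<theta> t * (u t y * (V t y * cnj (?\<Phi> t y))))"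
      by (rule Bochner_Integration.integral_cong) (auto simp: algebra_simps)
    also have "\<dots> = (- (1/2) * \<theta> t) * ?k t + \<theta> t * ?h t"
      by (subst Bochner_Integration.integral_add) (intro integrable_mult_right il, intro integrable_mult_right il, simp only: integral_mult_right_zero)
    finally show ?thesis by (simp only: mult.assoc of_real_mult of_real_minus of_real_divide of_real_1 of_real_numeral)
  qed
  have i1: "integrable lborel (\<lambda>t. \<theta>' t * ?g t)"
    by (rule integrable_compact_support[OF \<theta>(3) supp(2) continuous_locally_dominated_pairing[OF u ld(1)]])
  have i2: "integrable lborel (\<lambda>t. \<theta> t * ?k t)"
    by (rule integrable_compact_support[OF c\<theta> supp(1) continuous_locally_dominated_pairing[OF u ld(2)]])
  have i3: "integrable lborel (\<lambda>t. \<theta> t * ?h t)"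
    by (rule integrable_compact_support[OF c\<theta> supp(1) continuous_locally_dominated_pairing[OF u ld(4)]])
  \<comment> \<open>Both sides contain the same integral of \<open>?k\<close>, finite by compact
    support in time; it cancels, and multiplication by i gives the claim.\<close>
  have "- \<i> * (LINT t|lborel. \<theta>' t * ?g t) + - (1/2) * (LINT t|lborel. \<theta> t * ?k t) = (LINT t|lborel. - \<i> * (\<theta>' t * ?g t) + - (1/2) * (\<theta> t * ?k t))"
    by (subst Bochner_Integration.integral_add) (intro integrable_mult_right i1, intro integrable_mult_right i2, simp only: integral_mult_right_zero)
  also have "\<dots> = (LINT t|lborel. - (1/2) * (\<theta> t * ?k t) + \<theta> t * ?h t)"
    using eq unfolding iA iB .
  also have "\<dots> = - (1/2) * (LINT t|lborel. \<theta> t * ?k t) + (LINT t|lborel. \<theta> t * ?h t)"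
    by (subst Bochner_Integration.integral_add) (intro integrable_mult_right i2, rule i3, simp only: integral_mult_right_zero)
  finally have "- \<i> * (LINT t|lborel. \<theta>' t * ?g t) = (LINT t|lborel. \<theta> t * ?h t)" by simp
  then have "\<i> * (- \<i> * (LINT t|lborel. \<theta>' t * ?g t)) = \<i> * (LINT t|lborel. \<theta> t * ?h t)" by (simp only:)
  then show ?thesis by simp
qed

section \<open>From the weak to the strong form in time\<close>

text \<open>The weak identity is tested with smoothed indicators of the interval: their derivatives
  converge to point evaluations at a and b, and continuity of \<open>g\<close> and \<open>h\<close>
  allows the limit.\<close>

lemma fundamental_lemma:
  fixes g h :: "real \<Rightarrow> complex"
  assumes g: "continuous_on UNIV g" and h: "continuous_on UNIV h" and ab: "a < b"
    and weak: "\<And>\<theta> \<theta>' c d. smooth \<theta> \<Longrightarrow> (\<And>t. (\<theta> has_real_derivative \<theta>' t) (at t)) \<Longrightarrow> continuous_on UNIV \<theta>' \<Longrightarrow>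
      (\<And>t. t \<notin> {c..d} \<Longrightarrow> \<theta> t = 0) \<Longrightarrow> (\<And>t. t \<notin> {c..d} \<Longrightarrow> \<theta>' t = 0) \<Longrightarrow>
      (LINT t|lborel. \<theta>' t * g t) = \<i> * (LINT t|lborel. \<theta> t * h t)"
  shows "g b - g a = - \<i> * integral {a..b} h"
proof -
  obtain B \<beta> where B: "smooth B" "continuous_on UNIV \<beta>" "\<And>s. (B has_real_derivative \<beta> s) (at s)"
    "\<And>s::real. 0 \<le> \<beta> s" "\<And>s. s \<notin> {0..1} \<Longrightarrow> \<beta> s = 0" "\<And>s. s \<le> 0 \<Longrightarrow> B s = 0" "\<And>s. 1 \<le> s \<Longrightarrow> B s = (1::real)" "\<And>s. 0 \<le> B s" "\<And>s. B s \<le> 1"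
    using smooth_step_exists by blast
  define e where "e m = inverse (real (Suc m))" for m
  have e0: "e \<longlonglongrightarrow> 0" unfolding e_def by (rule LIMSEQ_inverse_real_of_nat)
  have e1: "0 < e m" "e m \<le> 1" for m by (auto simp: e_def inverse_le_1_iff)
  have [measurable]: "g \<in> borel_measurable borel" "h \<in> borel_measurable borel" "\<beta> \<in> borel_measurable borel" "B \<in> borel_measurable borel"
    using g h B(2) smooth_continuous[OF B(1)] by (auto intro: borel_measurable_continuous_onI)
  have bd: "\<exists>K\<ge>0. \<forall>s\<in>{a - 1..b + 2}. cmod (f s) \<le> K" if "continuous_on UNIV f" for f :: "real \<Rightarrow> complex"
  proof -
    have "continuous_on {a - 1..b + 2} f" by (rule continuous_on_subset[OF that]) simp
    from compact_imp_bounded[OF compact_continuous_image[OF this compact_Icc]]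
    obtain K where K: "\<forall>r\<in>f ` {a - 1..b + 2}. norm r \<le> K" unfolding bounded_iff ..
    then show ?thesis by (intro exI[of _ "\<bar>K\<bar>"]) force
  qed
  obtain Kg where Kg: "0 \<le> Kg" "\<And>s. s \<in> {a - 1..b + 2} \<Longrightarrow> cmod (g s) \<le> Kg" using bd[OF g] by blast
  obtain Kh where Kh: "0 \<le> Kh" "\<And>s. s \<in> {a - 1..b + 2} \<Longrightarrow> cmod (h s) \<le> Kh" using bd[OF h] by blast
  \<comment> \<open>The mass of \<beta> is the total rise B(1) - B(0) = 1, so its rescalings are an
    approximate identity.\<close>
  have "has_bochner_integral lborel (\<lambda>x. \<beta> x * indicator {0..1} x) (B 1 - B 0)"
    by (rule has_bochner_integral_FTC_Icc_real) (use B(2,3) in \<open>auto simp: continuous_on_eq_continuous_at\<close>)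
  moreover have "(\<lambda>x. \<beta> x * indicator {0..1} x) = \<beta>" using B(5) by (auto simp: fun_eq_iff indicator_def)
  ultimately have i\<beta>: "integrable lborel \<beta>" "(LINT x|lborel. \<beta> x) = 1"
    using B(6)[of 0] B(7)[of 1] by (auto simp: has_bochner_integral_iff)
  have avg: "(\<lambda>m. LINT r|lborel. \<beta> r * g (q + e m * r)) \<longlonglongrightarrow> g q" if q: "q \<in> {a..b}" for q
  proof -
    have "(\<lambda>m. LINT r|lborel. \<beta> r * g (q + e m * r)) \<longlonglongrightarrow> (LINT r|lborel. \<beta> r * g q)"
    proof (rule integral_dominated_convergence[where w="\<lambda>r. Kg * \<beta> r"])
      show "integrable lborel (\<lambda>r. Kg * \<beta> r)" by (intro integrable_mult_right i\<beta>)
      show "AE r in lborel. (\<lambda>m. \<beta> r * g (q + e m * r)) \<longlonglongrightarrow> \<beta> r * g q"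
      proof (rule AE_I2)
        fix r
        have "(\<lambda>m. q + e m * r) \<longlonglongrightarrow> q + 0 * r" by (intro tendsto_intros e0)
        from continuous_on_tendsto_compose[OF g this] show "(\<lambda>m. \<beta> r * g (q + e m * r)) \<longlonglongrightarrow> \<beta> r * g q"
          by (intro tendsto_intros) simp
      qed
      show "AE r in lborel. cmod (\<beta> r * g (q + e m * r)) \<le> Kg * \<beta> r" for m
      proof (rule AE_I2)
        fix r
        show "cmod (\<beta> r * g (q + e m * r)) \<le> Kg * \<beta> r"
        proof (cases "r \<in> {0..1}")
          case True
          then have "0 \<le> e m * r" "e m * r \<le> 1" using e1[of m] by (auto intro!: mult_le_one)
          then have "q + e m * r \<in> {a - 1..b + 2}" using q by auto
          then have "\<beta> r * cmod (g (q + e m * r)) \<le> \<beta> r * Kg" by (intro mult_left_mono Kg(2) B(4))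
          then show ?thesis using B(4)[of r] by (simp add: norm_mult mult.commute)
        next
          case False then show ?thesis using B(5) by simp
        qed
      qed
    qed measurable
    also have "(LINT r|lborel. complex_of_real (\<beta> r) * g q) = g q"
    proof -
      have "(LINT r|lborel. complex_of_real (\<beta> r)) = 1" using i\<beta>(2) by simp
      then show ?thesis by (simp only: integral_mult_left_zero mult_1_left)
    qed
    finally show ?thesis .
  qed
  \<comment> \<open>A rise just to the right of a and a fall just to the right of b, both within
    length \<open>e m\<close> <= 1; hence support in {a..b + 1} for every m.\<close>
  let ?\<theta> = "\<lambda>m s. B ((s - a) / e m) - B ((s - b) / e m)"
  let ?\<theta>' = "\<lambda>m s. inverse (e m) * \<beta> ((s - a) / e m) - inverse (e m) * \<beta> ((s - b) / e m)"
  have w: "(LINT t|lborel. ?\<theta>' m t * g t) = \<i> * (LINT t|lborel. ?\<theta> m t * h t)" for m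
  proof (rule weak[where c=a and d="b + 1"])
    have "smooth (\<lambda>s. (s - q) / e m)" for q
      using smooth_cmult(1)[OF smooth_diff(1)[OF smooth_ident smooth_const[of q]], of "inverse (e m)"] by (simp add: divide_inverse mult.commute)
    then show "smooth (?\<theta> m)" by (intro smooth_diff(1) smooth_compose_real[OF B(1)])
    have d: "((\<lambda>s. B ((s - q) / e m)) has_real_derivative inverse (e m) * \<beta> ((t - q) / e m)) (at t)" for q t
    proof -
      have "((\<lambda>s. (s - q) / e m) has_real_derivative inverse (e m)) (at t)"
        using e1(1)[of m] by (auto intro!: derivative_eq_intros simp: field_simps)
      from DERIV_chain2[OF B(3) this] show ?thesis by (simp add: mult.commute)
    qed
    show "(?\<theta> m has_real_derivative ?\<theta>' m t) (at t)" for t by (intro DERIV_diff d)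
    show "continuous_on UNIV (?\<theta>' m)"
      using e1(1)[of m] by (intro continuous_intros continuous_on_compose2[OF B(2)]) auto
    show "?\<theta> m t = 0" "?\<theta>' m t = 0" if t: "t \<notin> {a..b + 1}" for t
    proof -
      consider "t < a" | "b + 1 < t" using t by force
      then have "?\<theta> m t = 0 \<and> ?\<theta>' m t = 0"
      proof cases
        case 1
        then have "(t - a) / e m < 0" "(t - b) / e m < 0" using e1[of m] ab by (auto simp: divide_less_0_iff)
        then show ?thesis using B(5,6) by auto
      next
        case 2
        have x: "1 < (t - q) / e m" if "q \<le> b" for q
          using 2 that e1[of m] by (simp add: pos_less_divide_eq)
        show ?thesis using B(5,7) ab x[of a] x[of b] by auto
      qed
      then show "?\<theta> m t = 0" "?\<theta>' m t = 0" by auto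
    qed
  qed
  have sc: "(LINT t|lborel. (inverse (e m) * \<beta> ((t - q) / e m)) * g t) = (LINT r|lborel. \<beta> r * g (q + e m * r))" for m q
  proof -
    have "(LINT t|lborel. (inverse (e m) * \<beta> ((t - q) / e m)) * g t) = complex_of_real (\<bar>e m\<bar> ^ DIM(real)) * (LINT r|lborel. (inverse (e m) * \<beta> ((q + e m *\<^sub>R r - q) / e m)) * g (q + e m *\<^sub>R r))"
      by (rule lborel_integral_scale_complex) (use e1(1)[of m] in auto)
    also have "\<dots> = (LINT r|lborel. complex_of_real (\<bar>e m\<bar> ^ DIM(real)) * ((inverse (e m) * \<beta> ((q + e m *\<^sub>R r - q) / e m)) * g (q + e m *\<^sub>R r)))"
      by (rule integral_mult_right_zero[symmetric])
    also have "\<dots> = (LINT r|lborel. \<beta> r * g (q + e m * r))"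
      using e1(1)[of m] by (intro Bochner_Integration.integral_cong refl) simp
    finally show ?thesis .
  qed
  have lhs: "(LINT t|lborel. ?\<theta>' m t * g t) = (LINT r|lborel. \<beta> r * g (a + e m * r)) - (LINT r|lborel. \<beta> r * g (b + e m * r))" for m
  proof -
    have i: "integrable lborel (\<lambda>t. (inverse (e m) * \<beta> ((t - q) / e m)) * g t)" for q
    proof (rule integrable_compact_support[where c=q and d="q + 1"])
      show "continuous_on UNIV (\<lambda>t. inverse (e m) * \<beta> ((t - q) / e m))"
        using e1(1)[of m] by (intro continuous_intros continuous_on_compose2[OF B(2)]) auto
      fix t assume t: "t \<notin> {q..q + 1}"
      have "(t - q) / e m \<notin> {0..1}"
      proof (cases "t < q")
        case True then show ?thesis using e1[of m] by (auto simp: zero_le_divide_iff)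
      next
        case False
        then have "1 < t - q" using t by auto
        then show ?thesis using e1[of m] by (auto simp: pos_divide_le_eq)
      qed
      then show "inverse (e m) * \<beta> ((t - q) / e m) = 0" using B(5) by simp
    qed (rule g)
    show ?thesis unfolding sc[symmetric] Bochner_Integration.integral_diff[OF i i, symmetric]
      by (rule Bochner_Integration.integral_cong) (auto simp: algebra_simps)
  qed
  have "(\<lambda>m. LINT t|lborel. ?\<theta>' m t * g t) \<longlonglongrightarrow> g a - g b"
    unfolding lhs using ab by (intro tendsto_diff avg) auto
  moreover have "(\<lambda>m. \<i> * (LINT t|lborel. ?\<theta> m t * h t)) \<longlonglongrightarrow> \<i> * (LINT t|lborel. indicator {a..b} t *\<^sub>R h t)"
  proof (intro tendsto_mult tendsto_const integral_dominated_convergence[where w="\<lambda>t. Kh * indicator {a..b + 1} t"])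
    show "integrable lborel (\<lambda>t. Kh * indicator {a..b + 1} t)"
      by (intro integrable_mult_right integrable_real_indicator) (auto simp: emeasure_lborel_Icc_eq)
    \<comment> \<open>At t = a the approximants are 0 while the indicator of {a..b} is 1; this
      single point is null.\<close>
    show "AE t in lborel. (\<lambda>m. ?\<theta> m t * h t) \<longlonglongrightarrow> indicator {a..b} t *\<^sub>R h t"
      using AE_lborel_singleton[of a]
    proof eventually_elim
      case (elim t)
      have big: "\<forall>\<^sub>F m in sequentially. B ((t - q) / e m) = 1" if "q < t" for q
      proof -
        have "\<forall>\<^sub>F m in sequentially. e m < t - q" using order_tendstoD(2)[OF e0, of "t - q"] that by simp
        then show ?thesis
        proof eventually_elim
          case (elim m) then show ?case using e1(1)[of m] by (intro B(7)) (simp add: pos_le_divide_eq)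
        qed
      qed
      have small: "B ((t - q) / e m) = 0" if "t \<le> q" for q m
        using that e1(1)[of m] by (intro B(6)) (simp add: divide_le_0_iff)
      have "\<forall>\<^sub>F m in sequentially. ?\<theta> m t * h t = indicator {a..b} t *\<^sub>R h t"
      proof (cases "t \<le> a")
        case True
        then show ?thesis using elim ab small[of a] small[of b] by (intro always_eventually) auto
      next
        case ta: False
        then have A: "\<forall>\<^sub>F m in sequentially. B ((t - a) / e m) = 1" by (intro big) simp
        show ?thesis
        proof (cases "t \<le> b")
          case True
          from A show ?thesis by eventually_elim (use True ta small[of b] in auto)
        next
          case False
          then have "\<forall>\<^sub>F m in sequentially. B ((t - b) / e m) = 1" by (intro big) simp
          with A show ?thesis by eventually_elim (use False in auto)
        qed
      qed
      then show ?case by (rule tendsto_eventually)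
    qed
    show "AE t in lborel. cmod (?\<theta> m t * h t) \<le> Kh * indicator {a..b + 1} t" for m
    proof (rule AE_I2)
      fix t
      show "cmod (?\<theta> m t * h t) \<le> Kh * indicator {a..b + 1} t"
      proof (cases "t \<in> {a..b + 1}")
        case True
        have "\<bar>?\<theta> m t\<bar> \<le> 1" using B(8,9)[of "(t - a) / e m"] B(8,9)[of "(t - b) / e m"] by (auto simp: abs_le_iff intro: order_trans)
        then have "\<bar>?\<theta> m t\<bar> * cmod (h t) \<le> 1 * Kh" using Kh True by (intro mult_mono) auto
        moreover have "cmod (?\<theta> m t * h t) = \<bar>?\<theta> m t\<bar> * cmod (h t)" unfolding norm_mult norm_of_real ..
        ultimately show ?thesis using True by simp
      next
        case False
        have "?\<theta> m t = 0"
        proof (cases "t < a")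
          case True
          then have "(t - a) / e m \<le> 0" "(t - b) / e m \<le> 0" using e1[of m] ab by (auto simp: divide_le_0_iff)
          then show ?thesis using B(6) by simp
        next
          case F: False
          have "1 \<le> (t - q) / e m" if "q \<le> b" for q
            using F False that e1[of m] by (simp add: pos_le_divide_eq)
          then show ?thesis using B(7) ab by simp
        qed
        then show ?thesis using False by (simp only:) simp
      qed
    qed
  qed measurable
  ultimately have "g a - g b = \<i> * (LINT t|lborel. indicator {a..b} t *\<^sub>R h t)"
    unfolding w by (rule LIMSEQ_unique)
  also have "(LINT t|lborel. indicator {a..b} t *\<^sub>R h t) = integral {a..b} h"
  proof -
    have "set_integrable lborel {a..b} h" unfolding set_integrable_def
      by (rule borel_integrable_compact) (auto intro: continuous_on_subset[OF h])
    from set_borel_integral_eq_integral(2)[OF this] show ?thesis by (simp add: set_lebesgue_integral_def)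
  qed
  finally show ?thesis by (simp add: algebra_simps)
qed

text \<open>The primitive is based at t - 1, so that t is interior to the interval and the
  derivative is two-sided.\<close>

lemma weak_imp_derivative:
  fixes g h :: "real \<Rightarrow> complex"
  assumes h: "continuous_on UNIV h" and D: "\<And>a b. a < b \<Longrightarrow> g b - g a = - \<i> * integral {a..b} h"
  shows "(g has_vector_derivative - \<i> * h t) (at t)"
proof -
  have "((\<lambda>s. integral {t - 1..s} h) has_vector_derivative h t) (at t within {t - 1..t + 1})"
    by (rule integral_has_vector_derivative) (auto intro: continuous_on_subset[OF h])
  then have "((\<lambda>s. g (t - 1) + - \<i> * integral {t - 1..s} h) has_vector_derivative 0 + - \<i> * h t) (at t within {t - 1..t + 1})"
    by (intro has_vector_derivative_add has_vector_derivative_const has_vector_derivative_mult_right)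
  then have "((\<lambda>s. g (t - 1) + - \<i> * integral {t - 1..s} h) has_vector_derivative - \<i> * h t) (at t)"
    by (simp add: at_within_interior[of t "{t - 1..t + 1}"])
  moreover have "\<forall>\<^sub>F s in nhds t. s \<in> UNIV \<longrightarrow> g (t - 1) + - \<i> * integral {t - 1..s} h = g s"
  proof -
    have "\<forall>\<^sub>F s in nhds t. s \<in> {t - 1<..}" by (rule eventually_nhds_in_open) auto
    then show ?thesis
    proof eventually_elim
      case (elim s) then show ?case using D[of "t - 1" s] by (simp add: algebra_simps)
    qed
  qed
  moreover have "g (t - 1) + - \<i> * integral {t - 1..t} h = g t" using D[of "t - 1" t] by (simp add: algebra_simps)
  ultimately show ?thesis by (simp add: has_vector_derivative_cong_ev)
qed

text \<open>The real coefficient \<open>c\<close> only rotates the phase of \<open>g\<close> and is removed by an integrating factor.\<close>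

lemma phase_removal_growth_forward:
  fixes g r :: "real \<Rightarrow> complex" and c :: "real \<Rightarrow> real"
  assumes c: "continuous_on {0..t} c" and d: "\<And>s. s \<in> {0..t} \<Longrightarrow> (g has_vector_derivative - \<i> * (c s * g s + r s)) (at s)"
    and t: "0 \<le> t" and r: "\<And>s. s \<in> {0..t} \<Longrightarrow> cmod (r s) \<le> l * (K * exp (l * s))"
  shows "cmod (g t) \<le> cmod (g 0) + (K * exp (l * t) - K)"
proof (cases "t = 0")
  case False
  then have t0: "0 < t" using t by simp
  obtain C where C: "\<And>s. s \<in> {0..t} \<Longrightarrow> (C has_vector_derivative c s) (at s within {0..t})"
    using antiderivative_continuous[OF c] by blast
  \<comment> \<open>\<open>C\<close> is a real primitive of \<open>c\<close>, so the integrating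
    factor is unimodular: it removes the term with \<open>c\<close> and does not change the modulus
    of \<open>g\<close>.\<close>
  let ?G = "\<lambda>s. exp (\<i> * complex_of_real (C s)) * g s"
  have dC: "((\<lambda>s. complex_of_real (C s)) has_vector_derivative complex_of_real (c s)) (at s within {0..t})" if "s \<in> {0..t}" for s
    by (rule has_vector_derivative_of_real, unfold has_real_derivative_iff_has_vector_derivative) (rule C[OF that])
  have dG: "(?G has_vector_derivative exp (\<i> * complex_of_real (C s)) * (- \<i> * r s)) (at s within {0..t})" if s: "s \<in> {0..t}" for s
  proof -
    have "((\<lambda>z. exp (\<i> * z)) has_field_derivative exp (\<i> * complex_of_real (C s)) * \<i>) (at (complex_of_real (C s)) within ((\<lambda>s. complex_of_real (C s)) ` {0..t}))"
      by (auto intro!: derivative_eq_intros)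
    from field_vector_diff_chain_within[OF dC[OF s] this]
    have e: "((\<lambda>s. exp (\<i> * complex_of_real (C s))) has_vector_derivative complex_of_real (c s) * (exp (\<i> * complex_of_real (C s)) * \<i>)) (at s within {0..t})"
      by (simp add: o_def)
    have "(?G has_vector_derivative exp (\<i> * complex_of_real (C s)) * (- \<i> * (c s * g s + r s)) + complex_of_real (c s) * (exp (\<i> * complex_of_real (C s)) * \<i>) * g s) (at s within {0..t})"
      by (rule has_vector_derivative_mult[OF e has_vector_derivative_at_within[OF d[OF s]]])
    then show ?thesis by (simp add: algebra_simps)
  qed
  \<comment> \<open>The comparison function K exp(l s) has derivative l K exp(l s), exactly the
    assumed bound on the remainder; its increment is what appears in the conclusion.\<close>
  have "norm (?G t - ?G 0) \<le> K * exp (l * t) - K * exp (l * 0)"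
  proof (rule differentiable_bound_general[OF t0])
    show "continuous_on {0..t} ?G"
      unfolding continuous_on_eq_continuous_within by (intro ballI has_vector_derivative_continuous[OF dG])
    show "continuous_on {0..t} (\<lambda>s. K * exp (l * s))" by (intro continuous_intros)
    fix s assume s: "0 < s" "s < t"
    have "at s within {0..t} = at s" by (rule at_within_interior) (use s in auto)
    then show "(?G has_vector_derivative exp (\<i> * complex_of_real (C s)) * (- \<i> * r s)) (at s)"
      using dG[of s] s by simp
    show "((\<lambda>s. K * exp (l * s)) has_vector_derivative l * (K * exp (l * s))) (at s)"
      unfolding has_real_derivative_iff_has_vector_derivative[symmetric] by (auto intro!: derivative_eq_intros)
    show "norm (exp (\<i> * complex_of_real (C s)) * (- \<i> * r s)) \<le> l * (K * exp (l * s))"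
      using r[of s] s by (simp add: norm_mult)
  qed
  moreover have "cmod (?G t) = cmod (g t)" "cmod (?G 0) = cmod (g 0)" by (simp_all add: norm_mult)
  ultimately show ?thesis using norm_triangle_ineq2[of "?G t" "?G 0"] by simp
qed simp

text \<open>Negative times reduce to the forward case by reversing time, which changes the sign of
  both \<open>c\<close> and \<open>r\<close> and of nothing else.\<close>

lemma phase_removal_growth:
  fixes g r :: "real \<Rightarrow> complex" and c :: "real \<Rightarrow> real"
  assumes c: "continuous_on UNIV c" and d: "\<And>s. (g has_vector_derivative - \<i> * (c s * g s + r s)) (at s)"
    and t: "\<bar>t\<bar> \<le> T" and r: "\<And>s. \<bar>s\<bar> \<le> T \<Longrightarrow> cmod (r s) \<le> l * (K * exp (l * \<bar>s\<bar>))"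
  shows "cmod (g t) \<le> cmod (g 0) + (K * exp (l * \<bar>t\<bar>) - K)"
proof (cases "0 \<le> t")
  case True
  have "cmod (g t) \<le> cmod (g 0) + (K * exp (l * t) - K)"
  proof (rule phase_removal_growth_forward[where c=c and r=r, OF continuous_on_subset[OF c] d True])
    show "cmod (r s) \<le> l * (K * exp (l * s))" if "s \<in> {0..t}" for s
      using r[of s] that t True by auto
  qed simp
  then show ?thesis using True by simp
next
  case False
  have dn: "((\<lambda>s. g (- s)) has_vector_derivative - \<i> * (- c (- s) * g (- s) + - r (- s))) (at s)" for s
  proof -
    have "((\<lambda>s::real. - s) has_vector_derivative - 1) (at s)"
      unfolding has_real_derivative_iff_has_vector_derivative[symmetric] by (auto intro!: derivative_eq_intros)
    from vector_diff_chain_at[OF this d] show ?thesis by (simp add: o_def algebra_simps)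
  qed
  have "cmod (g (- (- t))) \<le> cmod (g (- 0)) + (K * exp (l * (- t)) - K)"
  proof (rule phase_removal_growth_forward[where c="\<lambda>s. - c (- s)" and r="\<lambda>s. - r (- s)" and g="\<lambda>s. g (- s)"])
    show "continuous_on {0..- t} (\<lambda>s. - c (- s))"
      by (intro continuous_intros continuous_on_compose2[OF c]) auto
    show "((\<lambda>s. g (- s)) has_vector_derivative - \<i> * (complex_of_real (- c (- s)) * g (- s) + - r (- s))) (at s)" for s
      using dn[of s] by simp
    show "cmod (- r (- s)) \<le> l * (K * exp (l * s))" if "s \<in> {0..- t}" for s
      using r[of "- s"] that t False by auto
  qed (use False in auto)
  then show ?thesis using False by simp
qed

section \<open>Minkowski's integral inequality\<close>

lemma measurable_enn2real [measurable]: "enn2real \<in> borel_measurable borel"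
  by (rule borel_measurable_enn2real) measurable

lemma measurable_ennpowr [measurable (raw)]:
  assumes [measurable]: "f \<in> borel_measurable M" shows "(\<lambda>x. ennpowr (f x) r) \<in> borel_measurable M"
  unfolding ennpowr_def by measurable

lemma ennpowr_top [simp]: "ennpowr top r = top" by (simp add: ennpowr_def)

lemma ennpowr_ennreal: "0 \<le> x \<Longrightarrow> ennpowr (ennreal x) r = ennreal (x powr r)"
  by (simp add: ennpowr_def)

lemma ennpowr_mono: assumes "x \<le> y" "0 \<le> r" shows "ennpowr x r \<le> ennpowr y r"
proof (cases "y = \<infinity>")
  case False
  then have "x \<noteq> \<infinity>" using assms by (auto simp: top_unique)
  with False assms show ?thesis
    by (auto simp: ennpowr_def intro!: ennreal_leI powr_mono2 enn2real_mono simp: less_top)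
qed simp

lemma ennpowr_ennpowr: assumes "r \<noteq> 0" shows "ennpowr (ennpowr x r) (1 / r) = x"
  using assms by (cases x) (auto simp: ennpowr_ennreal powr_powr)

lemma ennpowr_ennpowr': assumes "r \<noteq> 0" shows "ennpowr (ennpowr x (1 / r)) r = x"
  using ennpowr_ennpowr[of "1 / r" x] assms by simp

lemma ennpowr_mult:
  assumes c: "0 < c" shows "ennpowr (ennreal c * x) r = ennreal (c powr r) * ennpowr x r"
proof (cases x)
  case (real y)
  then show ?thesis using c by (simp add: ennpowr_ennreal powr_mult flip: ennreal_mult)
next
  case top
  then show ?thesis using c by (simp add: ennreal_mult_top)
qed

text \<open>The tangent to x^r at x = 1, obtained from Young's inequality with one factor equal to
  1. It is stated as a sum since subtraction of extended nonnegative reals is truncated.\<close>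

lemma ennpowr_bernoulli:
  assumes r: "1 \<le> r" shows "ennreal r * x \<le> ennpowr x r + ennreal (r - 1)"
proof (cases x)
  case (real y)
  have "r * y \<le> y powr r + (r - 1)"
  proof (cases "r = 1")
    case False
    then have r1: "1 < r" using r by simp
    then have "y * 1 \<le> y powr r / r + 1 powr (r / (r - 1)) / (r / (r - 1))"
      using real by (intro Youngs_inequality) (auto simp: field_simps)
    then have "r * y \<le> r * (y powr r / r + (r - 1) / r)" using r1 by (intro mult_left_mono) auto
    also have "\<dots> = y powr r + (r - 1)" using r1 by (simp add: distrib_left)
    finally show ?thesis .
  qed (use real in simp)
  then show ?thesis using real r by (simp add: ennpowr_ennreal flip: ennreal_mult ennreal_plus)
qed simp

text \<open>After dividing by the mean, the tangent inequality at 1 integrates to the claim; means 0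
  and infinity are treated apart.\<close>

lemma nn_integral_jensen:
  assumes r: "1 \<le> r" and [measurable]: "Y \<in> borel_measurable M" and M: "emeasure M (space M) = 1"
  shows "ennpowr (\<integral>\<^sup>+w. Y w \<partial>M) r \<le> (\<integral>\<^sup>+w. ennpowr (Y w) r \<partial>M)"
proof -
  have B: "ennreal r * (\<integral>\<^sup>+w. Z w \<partial>M) \<le> (\<integral>\<^sup>+w. ennpowr (Z w) r \<partial>M) + ennreal (r - 1)"
    if [measurable]: "Z \<in> borel_measurable M" for Z
  proof -
    have "ennreal r * (\<integral>\<^sup>+w. Z w \<partial>M) = (\<integral>\<^sup>+w. ennreal r * Z w \<partial>M)" by (simp add: nn_integral_cmult)
    also have "\<dots> \<le> (\<integral>\<^sup>+w. ennpowr (Z w) r + ennreal (r - 1) \<partial>M)" by (intro nn_integral_mono ennpowr_bernoulli r)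
    also have "\<dots> = (\<integral>\<^sup>+w. ennpowr (Z w) r \<partial>M) + ennreal (r - 1)" using M by (simp add: nn_integral_add)
    finally show ?thesis .
  qed
  let ?a = "\<integral>\<^sup>+w. Y w \<partial>M"
  consider "?a = 0" | "?a = \<infinity>" | a where "0 < a" "?a = ennreal a"
  proof (cases "?a")
    case (real a)
    then show thesis using that(1) that(3)[of a] by (cases "a = 0") auto
  next
    case top then show thesis using that(2) by simp
  qed
  then show ?thesis
  proof cases
    case 1 then show ?thesis by (simp add: ennpowr_def)
  next
    case 2
    have "(\<infinity>::ennreal) \<le> (\<integral>\<^sup>+w. ennpowr (Y w) r \<partial>M) + ennreal (r - 1)"
      using B[of Y] r unfolding 2 by (simp add: ennreal_mult_top)
    then have "(\<integral>\<^sup>+w. ennpowr (Y w) r \<partial>M) = \<infinity>" by (simp add: top_unique)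
    then show ?thesis by simp
  next
    case (3 a)
    let ?Z = "\<lambda>w. ennreal (inverse a) * Y w"
    have "(\<integral>\<^sup>+w. ?Z w \<partial>M) = 1"
      using 3 by (simp add: nn_integral_cmult flip: ennreal_mult)
    then have "ennreal r \<le> (\<integral>\<^sup>+w. ennpowr (?Z w) r \<partial>M) + ennreal (r - 1)" using B[of ?Z] by simp
    moreover have "ennreal r = 1 + ennreal (r - 1)" using r by (simp flip: ennreal_plus ennreal_1)
    ultimately have Z: "1 \<le> (\<integral>\<^sup>+w. ennpowr (?Z w) r \<partial>M)"
      by (simp add: ennreal_add_left_cancel_le add.commute)
    have "ennpowr ?a r = ennreal (a powr r) * 1" using 3 by (simp add: ennpowr_ennreal)
    also have "\<dots> \<le> ennreal (a powr r) * (\<integral>\<^sup>+w. ennpowr (?Z w) r \<partial>M)" by (intro mult_left_mono Z) simp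
    also have "\<dots> = (\<integral>\<^sup>+w. ennreal (a powr r) * (ennreal (inverse a powr r) * ennpowr (Y w) r) \<partial>M)"
      using 3 by (subst nn_integral_cmult) (auto simp: ennpowr_mult)
    also have "\<dots> = (\<integral>\<^sup>+w. ennpowr (Y w) r \<partial>M)"
      using 3 by (simp add: mult.assoc[symmetric] powr_mult[symmetric] flip: ennreal_mult)
    finally show ?thesis .
  qed
qed

section \<open>Monotonicity, translation and Minkowski's inequality for the norms\<close>

lemma Lp_norm_mono:
  assumes f: "f \<in> borel_measurable borel" and le: "\<And>x. f x \<le> g x"
  shows "Lp_norm p f \<le> Lp_norm p g"
  unfolding Lp_norm_def using le f
  by (auto intro!: esssup_mono ennpowr_mono nn_integral_mono simp: measurable_lborel1)

lemma Lp_norm_translate: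
  assumes [measurable]: "g \<in> borel_measurable borel"
  shows "Lp_norm p (\<lambda>x. g (x - c)) \<le> Lp_norm p (g :: 'a::euclidean_space \<Rightarrow> ennreal)"
proof (cases "p = \<infinity>")
  case True
  have "AE x in distr lborel borel ((+) (- c)). g x \<le> esssup lborel g"
    unfolding lborel_distr_plus by (rule esssup_AE)
  then have "AE x in lborel. g (- c + x) \<le> esssup lborel g"
    by (subst (asm) AE_distr_iff) measurable
  then show ?thesis using True unfolding Lp_norm_def by (auto intro!: esssup_I)
next
  case False
  have "(\<integral>\<^sup>+x. ennpowr (g (- c + x)) (enn2real p) \<partial>lborel) = (\<integral>\<^sup>+x. ennpowr (g x) (enn2real p) \<partial>lborel)"
    by (rule lborel_nn_integral_translate[where f="\<lambda>x. ennpowr (g x) (enn2real p)"]) measurable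
  then show ?thesis using False by (simp add: Lp_norm_def)
qed

lemma Lp_norm_zero_AE:
  fixes f :: "'a::euclidean_space \<Rightarrow> ennreal"
  assumes [measurable]: "f \<in> borel_measurable borel" and z: "\<And>x. f x = 0"
  shows "Lp_norm p f = 0"
proof (cases "p = \<infinity>")
  case True
  have "esssup lborel f \<le> 0" by (rule esssup_I) (use z in auto)
  then show ?thesis using True by (simp add: Lp_norm_def)
next
  case False
  then show ?thesis using z by (simp add: Lp_norm_def ennpowr_def)
qed

text \<open>No duality: \<open>k\<close> times \<open>b\<close>, divided by its integral, is a
  probability density, and Jensen's inequality is applied to H / b, whose norm in x is at most 1 for
  each w. Fubini then bounds the r-th power by 1.\<close>

lemma Lp_norm_minkowski_aux:
  fixes H :: "'a::euclidean_space \<Rightarrow> 'b \<Rightarrow> ennreal"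
  assumes p: "1 \<le> p" "p \<noteq> \<infinity>" and M: "sigma_finite_measure M"
    and mH [measurable]: "(\<lambda>(x, w). H x w) \<in> borel_measurable (borel \<Otimes>\<^sub>M M)"
    and [measurable]: "k \<in> borel_measurable M" "b \<in> borel_measurable M"
    and Hb: "\<And>w. w \<in> space M \<Longrightarrow> Lp_norm p (\<lambda>x. H x w) \<le> b w" and b0: "\<And>w. w \<in> space M \<Longrightarrow> 0 < b w"
    and fin: "(\<integral>\<^sup>+w. k w * b w \<partial>M) < \<infinity>"
  shows "Lp_norm p (\<lambda>x. \<integral>\<^sup>+w. k w * H x w \<partial>M) \<le> (\<integral>\<^sup>+w. k w * b w \<partial>M)"
proof -
  interpret M: sigma_finite_measure M by fact
  define r where "r = enn2real p"
  have r: "1 \<le> r" using p by (cases p) (auto simp: r_def)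
  let ?A = "\<integral>\<^sup>+w. k w * b w \<partial>M"
  have mHw [measurable]: "(\<lambda>w. H x w) \<in> borel_measurable M" for x
    using measurable_Pair2[OF mH, of x] by simp
  have mHx [measurable]: "(\<lambda>x. H x w) \<in> borel_measurable borel" if "w \<in> space M" for w
    using measurable_Pair1[OF mH that] by simp
  have Lp: "Lp_norm p f = ennpowr (\<integral>\<^sup>+x. ennpowr (f x) r \<partial>lborel) (1 / r)" for f :: "'a \<Rightarrow> ennreal"
    using p by (simp add: Lp_norm_def r_def)
  \<comment> \<open>Infinite values of \<open>b\<close> can occur, up to a null set, only where
    \<open>k\<close> vanishes, so dividing by \<open>b\<close> and multiplying back is harmless
    under the integral.\<close>
  have ae: "AE w in M. k w = 0 \<or> b w < \<infinity>"
  proof -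
    have "AE w in M. k w * b w \<noteq> \<infinity>" by (rule nn_integral_PInf_AE) (use fin in auto)
    then show ?thesis
    proof eventually_elim
      case (elim w) then show ?case by (cases "b w = \<infinity>") (auto simp: ennreal_mult_eq_top_iff less_top)
    qed
  qed
  have mI [measurable]: "(\<lambda>x. \<integral>\<^sup>+w. k w * H x w \<partial>M) \<in> borel_measurable borel"
    by (rule M.borel_measurable_nn_integral) measurable
  consider "?A = 0" | A where "0 < A" "?A = ennreal A"
  proof (cases "?A")
    case (real a)
    then show thesis using that(1) that(2)[of a] by (cases "a = 0") auto
  next
    case top then show thesis using fin by simp
  qed
  then show ?thesis
  proof cases
    case 1
    then have "AE w in M. k w * b w = 0" by (subst (asm) nn_integral_0_iff_AE) auto
    moreover have "AE w in M. w \<in> space M" by auto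
    ultimately have k0: "AE w in M. k w = 0" 
    proof eventually_elim
      case (elim w) then show ?case using b0[of w] by auto
    qed
    have "(\<integral>\<^sup>+w. k w * H x w \<partial>M) = 0" for x
      by (subst nn_integral_0_iff_AE) (use k0 in auto)
    then show ?thesis using Lp_norm_zero_AE[OF mI] by simp
  next
    case (2 A)
    let ?\<kappa> = "\<lambda>w. ennreal (inverse A) * (k w * b w)"
    \<comment> \<open>The probability measure for Jensen's inequality; \<open>A\<close> is its
      normalizing constant.\<close>
    let ?Q = "density M ?\<kappa>"
    let ?Y = "\<lambda>x w. H x w / b w"
    have Q1: "emeasure ?Q (space ?Q) = 1"
    proof -
      have "emeasure ?Q (space ?Q) = (\<integral>\<^sup>+w. ?\<kappa> w \<partial>M)"
        by (subst emeasure_density) (auto intro!: nn_integral_cong)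
      also have "\<dots> = 1" using 2 by (simp add: nn_integral_cmult flip: ennreal_mult)
      finally show ?thesis .
    qed
    interpret Q: prob_space ?Q by (rule prob_spaceI) (rule Q1)
    interpret LQ: pair_sigma_finite "lborel :: 'a measure" ?Q ..
    have mY: "(\<lambda>(x, w). ?Y x w) \<in> borel_measurable (lborel \<Otimes>\<^sub>M ?Q)"
    proof -
      have "(\<lambda>(x, w). ?Y x w) \<in> borel_measurable (borel \<Otimes>\<^sub>M M)" by measurable
      then show ?thesis by (simp cong: measurable_cong_sets sets_pair_measure_cong)
    qed
    have h: "(\<integral>\<^sup>+w. k w * H x w \<partial>M) = ennreal A * (\<integral>\<^sup>+w. ?Y x w \<partial>?Q)" for x
    proof -
      have "(\<integral>\<^sup>+w. k w * H x w \<partial>M) = (\<integral>\<^sup>+w. ennreal A * (?\<kappa> w * ?Y x w) \<partial>M)"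
      proof (rule nn_integral_cong_AE)
        show "AE w in M. k w * H x w = ennreal A * (?\<kappa> w * ?Y x w)"
          using ae AE_space
        proof eventually_elim
          case (elim w)
          show ?case
          proof (cases "k w = 0")
            case False
            then have "b w < \<infinity>" "0 < b w" using elim b0 by auto
            then have "b w * (H x w / b w) = H x w"
              unfolding ennreal_times_divide mult.commute[of "b w"] by (intro ennreal_mult_divide_eq) auto
            moreover have "ennreal A * (ennreal (inverse A) * z) = z" for z
              using 2 by (simp add: mult.assoc[symmetric] flip: ennreal_mult)
            ultimately show ?thesis by (simp add: mult.assoc)
          qed simp
        qed
      qed
      also have "\<dots> = ennreal A * (\<integral>\<^sup>+w. ?\<kappa> w * ?Y x w \<partial>M)" by (rule nn_integral_cmult) measurable
      also have "(\<integral>\<^sup>+w. ?\<kappa> w * ?Y x w \<partial>M) = (\<integral>\<^sup>+w. ?Y x w \<partial>?Q)" by (subst nn_integral_density) auto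
      finally show ?thesis .
    qed
    have Yw: "(\<integral>\<^sup>+x. ennpowr (?Y x w) r \<partial>lborel) \<le> 1" if w: "w \<in> space M" for w
    proof (cases "b w")
      case (real c)
      then have c: "0 < c" using b0[OF w] by simp
      have d: "z / b w = ennreal (inverse c) * z" for z
        using real c by (simp add: divide_ennreal_def inverse_ennreal mult.commute)
      have "ennpowr (\<integral>\<^sup>+x. ennpowr (H x w) r \<partial>lborel) (1 / r) \<le> ennreal c" using Hb[OF w] real by (simp add: Lp)
      then have "ennpowr (ennpowr (\<integral>\<^sup>+x. ennpowr (H x w) r \<partial>lborel) (1 / r)) r \<le> ennpowr (ennreal c) r"
        using r by (intro ennpowr_mono) auto
      then have i: "(\<integral>\<^sup>+x. ennpowr (H x w) r \<partial>lborel) \<le> ennreal (c powr r)"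
        using r c by (simp add: ennpowr_ennpowr' ennpowr_ennreal)
      note [measurable] = mHx[OF w]
      have "(\<integral>\<^sup>+x. ennpowr (?Y x w) r \<partial>lborel) = ennreal (inverse c powr r) * (\<integral>\<^sup>+x. ennpowr (H x w) r \<partial>lborel)"
        unfolding d using c by (simp add: ennpowr_mult nn_integral_cmult)
      also have "\<dots> \<le> ennreal (inverse c powr r) * ennreal (c powr r)" by (intro mult_left_mono i) simp
      also have "\<dots> = 1" using c by (simp add: powr_mult[symmetric] flip: ennreal_mult)
      finally show ?thesis .
    next
      case top
      then show ?thesis by (simp add: ennpowr_def)
    qed
    have "(\<integral>\<^sup>+x. ennpowr (\<integral>\<^sup>+w. ?Y x w \<partial>?Q) r \<partial>lborel) \<le> (\<integral>\<^sup>+x. (\<integral>\<^sup>+w. ennpowr (?Y x w) r \<partial>?Q) \<partial>lborel)"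
      by (intro nn_integral_mono nn_integral_jensen r Q1) measurable
    also have "\<dots> = (\<integral>\<^sup>+w. (\<integral>\<^sup>+x. ennpowr (?Y x w) r \<partial>lborel) \<partial>?Q)"
      by (rule LQ.Fubini'[symmetric]) (use mY in measurable)
    also have "\<dots> \<le> (\<integral>\<^sup>+w. 1 \<partial>?Q)" by (rule nn_integral_mono) (use Yw in auto)
    also have "\<dots> = 1" using Q1 by simp
    finally have h1: "(\<integral>\<^sup>+x. ennpowr (\<integral>\<^sup>+w. ?Y x w \<partial>?Q) r \<partial>lborel) \<le> 1" .
    have mYI: "(\<lambda>x. \<integral>\<^sup>+w. ?Y x w \<partial>?Q) \<in> borel_measurable borel"
      using Q.borel_measurable_nn_integral[OF mY] by simp
    have "Lp_norm p (\<lambda>x. \<integral>\<^sup>+w. k w * H x w \<partial>M) = ennpowr (ennreal (A powr r) * (\<integral>\<^sup>+x. ennpowr (\<integral>\<^sup>+w. ?Y x w \<partial>?Q) r \<partial>lborel)) (1 / r)"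
      unfolding Lp h ennpowr_mult[OF 2(1)] using mYI by (subst nn_integral_cmult) auto
    also have "\<dots> \<le> ennpowr (ennreal (A powr r) * 1) (1 / r)"
      using r h1 by (intro ennpowr_mono mult_left_mono) auto
    also have "\<dots> = ennreal A" using r 2 by (simp add: ennpowr_ennreal powr_powr)
    finally show ?thesis using 2 by simp
  qed
qed

text \<open>A measurable majorant \<open>b\<close> stands in for the norm of the section at w, so
  measurability of that norm in w is not an issue. For p infinite the pointwise bound is exchanged
  between the two variables almost everywhere.\<close>

lemma Lp_norm_minkowski:
  fixes H :: "'a::euclidean_space \<Rightarrow> 'b \<Rightarrow> ennreal"
  assumes p: "1 \<le> p" and M: "sigma_finite_measure M"
    and mH [measurable]: "(\<lambda>(x, w). H x w) \<in> borel_measurable (borel \<Otimes>\<^sub>M M)"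
    and mk [measurable]: "k \<in> borel_measurable M" "b \<in> borel_measurable M"
    and Hb: "\<And>w. w \<in> space M \<Longrightarrow> Lp_norm p (\<lambda>x. H x w) \<le> b w"
    and k: "(\<integral>\<^sup>+w. k w \<partial>M) < \<infinity>"
  shows "Lp_norm p (\<lambda>x. \<integral>\<^sup>+w. k w * H x w \<partial>M) \<le> (\<integral>\<^sup>+w. k w * b w \<partial>M)"
proof (cases "p = \<infinity>")
  case True
  interpret M: sigma_finite_measure M by fact
  interpret P: pair_sigma_finite "lborel :: 'a measure" M ..
  have mI: "(\<lambda>x. \<integral>\<^sup>+w. k w * H x w \<partial>M) \<in> borel_measurable borel"
    by (rule M.borel_measurable_nn_integral) measurable
  have "AE w in M. AE x in lborel. H x w \<le> b w"
  proof (rule AE_I2)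
    fix w assume w: "w \<in> space M"
    have "AE x in lborel. H x w \<le> esssup lborel (\<lambda>x. H x w)" by (rule esssup_AE)
    then show "AE x in lborel. H x w \<le> b w"
      using Hb[OF w] True by (auto simp: Lp_norm_def elim: eventually_mono)
  qed
  moreover have "{z \<in> space (lborel \<Otimes>\<^sub>M M). H (fst z) (snd z) \<le> b (snd z)} \<in> sets (lborel \<Otimes>\<^sub>M M)"
  proof -
    have "(\<lambda>z. H (fst z) (snd z)) \<in> borel_measurable (lborel \<Otimes>\<^sub>M M)"
      using mH by (simp add: case_prod_unfold cong: measurable_cong_sets sets_pair_measure_cong)
    moreover have "(\<lambda>z. b (snd z)) \<in> borel_measurable (lborel \<Otimes>\<^sub>M M)" by measurable
    ultimately show ?thesis by (rule borel_measurable_le)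
  qed
  ultimately have "AE x in lborel. AE w in M. H x w \<le> b w" by (subst P.AE_commute)
  then have "AE x in lborel. (\<integral>\<^sup>+w. k w * H x w \<partial>M) \<le> (\<integral>\<^sup>+w. k w * b w \<partial>M)"
  proof eventually_elim
    case (elim x)
    then have "AE w in M. k w * H x w \<le> k w * b w" by eventually_elim (rule mult_left_mono, auto)
    then show ?case by (rule nn_integral_mono_AE)
  qed
  then show ?thesis using True mI by (auto simp: Lp_norm_def intro!: esssup_I)
next
  case False
  show ?thesis
  proof (cases "(\<integral>\<^sup>+w. k w * b w \<partial>M) = \<infinity>")
    case b: False
    \<comment> \<open>Finite mass of \<open>k\<close> allows \<open>b\<close> to be raised by d > 0,
      which makes it positive, at the cost K d; d is later taken as \<epsilon> / (K + 1).\<close>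
    obtain K where K: "0 \<le> K" "(\<integral>\<^sup>+w. k w \<partial>M) = ennreal K" using k by (cases "\<integral>\<^sup>+w. k w \<partial>M") auto
    have e: "(\<integral>\<^sup>+w. k w * (b w + ennreal d) \<partial>M) = (\<integral>\<^sup>+w. k w * b w \<partial>M) + ennreal (K * d)" if "0 \<le> d" for d
    proof -
      have "(\<integral>\<^sup>+w. k w * (b w + ennreal d) \<partial>M) = (\<integral>\<^sup>+w. k w * b w \<partial>M) + (\<integral>\<^sup>+w. k w * ennreal d \<partial>M)"
        unfolding distrib_left by (rule nn_integral_add) measurable
      also have "(\<integral>\<^sup>+w. k w * ennreal d \<partial>M) = ennreal (K * d)"
        using K that by (simp add: nn_integral_multc ennreal_mult)
      finally show ?thesis .
    qed
    have d: "Lp_norm p (\<lambda>x. \<integral>\<^sup>+w. k w * H x w \<partial>M) \<le> (\<integral>\<^sup>+w. k w * b w \<partial>M) + ennreal (K * d)" if d: "0 < d" for d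
    proof -
      have "Lp_norm p (\<lambda>x. \<integral>\<^sup>+w. k w * H x w \<partial>M) \<le> (\<integral>\<^sup>+w. k w * (b w + ennreal d) \<partial>M)"
      proof (rule Lp_norm_minkowski_aux[OF p False M mH mk(1)])
        show "Lp_norm p (\<lambda>x. H x w) \<le> b w + ennreal d" if "w \<in> space M" for w
          using Hb[OF that] by (simp add: add_increasing2)
        show "0 < b w + ennreal d" for w using d by (simp add: add_nonneg_pos)
        show "(\<integral>\<^sup>+w. k w * (b w + ennreal d) \<partial>M) < \<infinity>"
          using b d by (subst e) (auto simp: less_top)
      qed measurable
      then show ?thesis using d by (simp add: e)
    qed
    show ?thesis
    proof (rule ennreal_le_epsilon)
      fix \<epsilon> :: real assume \<epsilon>: "0 < \<epsilon>"
      have "Lp_norm p (\<lambda>x. \<integral>\<^sup>+w. k w * H x w \<partial>M) \<le> (\<integral>\<^sup>+w. k w * b w \<partial>M) + ennreal (K * (\<epsilon> / (K + 1)))"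
        by (rule d) (use \<epsilon> K in auto)
      also have "\<dots> \<le> (\<integral>\<^sup>+w. k w * b w \<partial>M) + ennreal \<epsilon>"
        using \<epsilon> K by (intro add_left_mono ennreal_leI) (auto simp: field_simps)
      finally show "Lp_norm p (\<lambda>x. \<integral>\<^sup>+w. k w * H x w \<partial>M) \<le> (\<integral>\<^sup>+w. k w * b w \<partial>M) + ennreal \<epsilon>" .
    qed
  qed simp
qed

text \<open>A larger value at one point would persist on an open neighbourhood, which is not a null
  set.\<close>

lemma continuous_le_esssup:
  fixes f :: "'a::euclidean_space \<Rightarrow> real"
  assumes f: "continuous_on UNIV f"
  shows "ennreal (f x) \<le> esssup lborel (\<lambda>x. ennreal (f x))"
proof (rule ccontr)
  let ?c = "esssup lborel (\<lambda>x. ennreal (f x))"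
  assume "\<not> ?thesis"
  then have x: "?c < ennreal (f x)" by simp
  then obtain c where c: "0 \<le> c" "?c = ennreal c" by (cases "?c") (auto simp: top_unique)
  let ?S = "{y. c < f y}"
  have "open ?S" using f by (intro open_Collect_less) auto
  moreover have "x \<in> ?S" using x c by (auto simp: ennreal_less_iff)
  ultimately have "\<not> negligible ?S" using open_not_negligible by blast
  moreover have "AE y in lborel. ennreal (f y) \<le> ?c" by (rule esssup_AE)
  then have "AE y in lborel. \<not> c < f y"
    by eventually_elim (use c in \<open>auto simp: ennreal_le_iff2 split: if_splits\<close>)
  then have "emeasure lborel ?S = 0"
    using \<open>open ?S\<close> by (subst (asm) AE_iff_measurable[where N="?S"]) auto
  then have "?S \<in> null_sets lebesgue" using \<open>open ?S\<close> by (auto intro!: null_sets_completionI)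
  then have "negligible ?S" by (simp add: negligible_iff_null_sets)
  ultimately show False by blast
qed

text \<open>Iterated norms need the inner norm to be measurable. For finite exponents this is
  Tonelli; for the supremum, continuity reduces it to countably many points.\<close>

lemma measurable_Lp_norm_continuous:
  fixes W :: "'a::euclidean_space \<Rightarrow> 'b::euclidean_space \<Rightarrow> real"
  assumes W: "continuous_on UNIV (\<lambda>(x, \<xi>). W x \<xi>)"
  shows "(\<lambda>\<xi>. Lp_norm p (\<lambda>x. ennreal (W x \<xi>))) \<in> borel_measurable borel"
proof -
  have Wx: "continuous_on UNIV (\<lambda>x. W x \<xi>)" and W\<xi>: "continuous_on UNIV (\<lambda>\<xi>. W x \<xi>)" for x \<xi>
  proof -
    show "continuous_on UNIV (\<lambda>x. W x \<xi>)"
    proof -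
      have "continuous_on UNIV (\<lambda>x. (\<lambda>(x, \<xi>). W x \<xi>) (x, \<xi>))"
        by (rule continuous_on_compose2[OF W]) (auto intro!: continuous_intros)
      then show ?thesis by simp
    qed
    show "continuous_on UNIV (\<lambda>\<xi>. W x \<xi>)"
    proof -
      have "continuous_on UNIV (\<lambda>\<xi>. (\<lambda>(x, \<xi>). W x \<xi>) (x, \<xi>))"
        by (rule continuous_on_compose2[OF W]) (auto intro!: continuous_intros)
      then show ?thesis by simp
    qed
  qed
  have [measurable]: "(\<lambda>x. W x \<xi>) \<in> borel_measurable borel" "(\<lambda>\<xi>. W x \<xi>) \<in> borel_measurable borel" for x \<xi>
    by (intro borel_measurable_continuous_onI Wx W\<xi>)+
  show ?thesis
  proof (cases "p = \<infinity>")
    case False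
    have "(\<lambda>(\<xi>, x). W x \<xi>) \<in> borel_measurable (borel \<Otimes>\<^sub>M borel)"
    proof -
      have "continuous_on UNIV (\<lambda>z::'b \<times> 'a. (\<lambda>(x, \<xi>). W x \<xi>) (snd z, fst z))"
        by (rule continuous_on_compose2[OF W]) (auto intro!: continuous_intros)
      from borel_measurable_continuous_onI[OF this] show ?thesis
        by (simp add: borel_prod case_prod_unfold)
    qed
    then have "(\<lambda>(\<xi>, x). ennpowr (ennreal (W x \<xi>)) (enn2real p)) \<in> borel_measurable (borel \<Otimes>\<^sub>M lborel)"
      by (simp add: case_prod_unfold cong: measurable_cong_sets sets_pair_measure_cong) measurable
    from lborel.borel_measurable_nn_integral[OF this]
    show ?thesis using False by (simp add: Lp_norm_def) measurable
  next
    case True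
    \<comment> \<open>By continuity the essential supremum is the supremum over this countable dense
      set, whose members do not depend on \<xi>.\<close>
    obtain D :: "'a set" where D: "countable D" "\<And>X. open X \<Longrightarrow> X \<noteq> {} \<Longrightarrow> \<exists>d\<in>D. d \<in> X"
      using countable_dense_setE by blast
    have "esssup lborel (\<lambda>x. ennreal (W x \<xi>)) = (SUP x\<in>D. ennreal (W x \<xi>))" for \<xi>
    proof (rule antisym)
      show "(SUP x\<in>D. ennreal (W x \<xi>)) \<le> esssup lborel (\<lambda>x. ennreal (W x \<xi>))"
        by (intro SUP_least continuous_le_esssup Wx)
      have "ennreal (W x \<xi>) \<le> (SUP x\<in>D. ennreal (W x \<xi>))" for x
      proof (rule ccontr)
        assume "\<not> ?thesis"
        then have x: "(SUP x\<in>D. ennreal (W x \<xi>)) < ennreal (W x \<xi>)" by simp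
        then obtain c where c: "0 \<le> c" "(SUP x\<in>D. ennreal (W x \<xi>)) = ennreal c"
          by (cases "SUP x\<in>D. ennreal (W x \<xi>)") (auto simp: top_unique)
        have "open {y. c < W y \<xi>}" using Wx by (intro open_Collect_less) auto
        moreover have "x \<in> {y. c < W y \<xi>}" using x c by (auto simp: ennreal_less_iff)
        ultimately obtain d where "d \<in> D" "c < W d \<xi>" using D(2) by blast
        then have "ennreal c < ennreal (W d \<xi>)" using c by (simp add: ennreal_less_iff)
        also have "\<dots> \<le> ennreal c" unfolding c(2)[symmetric] by (rule SUP_upper) fact
        finally show False by simp
      qed
      then show "esssup lborel (\<lambda>x. ennreal (W x \<xi>)) \<le> (SUP x\<in>D. ennreal (W x \<xi>))"
        by (intro esssup_I) auto
    qed
    then have "(\<lambda>\<xi>. Lp_norm p (\<lambda>x. ennreal (W x \<xi>))) = (\<lambda>\<xi>. SUP x\<in>D. ennreal (W x \<xi>))"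
      using True by (simp add: Lp_norm_def)
    moreover have "(\<lambda>\<xi>. SUP x\<in>D. ennreal (W x \<xi>)) \<in> borel_measurable borel"
      by (intro borel_measurable_SUP D) measurable
    ultimately show ?thesis by simp
  qed
qed

section \<open>The wave packet transform along the flow\<close>

lemma wt_lower: assumes "norm z \<le> 1" shows "(1 / 2) ^ DIM('a) \<le> wt (z :: 'a::euclidean_space)"
proof -
  have "(1 / 2) ^ DIM('a) = (\<Prod>b\<in>(Basis::'a set). 1 / 2 :: real)" by simp
  also have "\<dots> \<le> (\<Prod>b\<in>Basis. 1 / (1 + (z \<bullet> b)\<^sup>2))"
  proof (rule prod_mono, rule conjI)
    fix b :: 'a assume "b \<in> Basis"
    then have "\<bar>z \<bullet> b\<bar> \<le> 1" using Basis_le_norm[of b z] assms by linarith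
    then have "(z \<bullet> b)\<^sup>2 \<le> 1" by (simp add: abs_square_le_1)
    then show "1 / 2 \<le> 1 / (1 + (z \<bullet> b)\<^sup>2)" by (simp add: field_simps add_pos_nonneg)
  qed simp
  finally show ?thesis by (simp only: wt_def)
qed

text \<open>Moving the centre of the window by at most 1 changes the weight by a bounded factor
  (\<open>wt_lower\<close>), which gives a majorant common to all parameters near
  \<open>p0\<close>.\<close>

lemma continuous_wave_packet:
  fixes \<phi> f :: "real^'n::finite \<Rightarrow> complex"
  assumes f: "in_L2 f" and \<phi>: "continuous_on UNIV \<phi>" and M: "\<And>y. cmod (\<phi> y) \<le> M * wt y" and M0: "0 \<le> M"
  shows "continuous_on UNIV (\<lambda>(x, \<xi>). wave_packet \<phi> f x \<xi>)"
proof (rule continuous_at_imp_continuous_on, rule ballI)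
  fix p0 :: "(real^'n) \<times> (real^'n)"
  have [measurable]: "f \<in> borel_measurable borel" "\<phi> \<in> borel_measurable borel"
    using f \<phi> by (auto simp: in_L2_def intro: borel_measurable_continuous_onI)
  let ?D = "2 ^ DIM(real^'n) / (1 / 2) ^ DIM(real^'n) :: real"
  have "isCont (\<lambda>p. LINT y|lborel. cnj (\<phi> (y - fst p)) * f y * exp (- \<i> * complex_of_real (y \<bullet> snd p))) p0"
  proof (rule isCont_parameter_integral[where w="\<lambda>y. (M * ?D) * (cmod (f y) * wt (y - fst p0))" and e=1])
    show "(\<lambda>y. cnj (\<phi> (y - fst p)) * f y * exp (- \<i> * complex_of_real (y \<bullet> snd p))) \<in> borel_measurable lborel" for p
      by measurable
    show "isCont (\<lambda>p. cnj (\<phi> (y - fst p)) * f y * exp (- \<i> * complex_of_real (y \<bullet> snd p))) p0" for y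
    proof -
      have "isCont (\<lambda>p. y - fst p) p0" by (intro continuous_intros)
      then have "isCont (\<lambda>p. \<phi> (y - fst p)) p0"
        by (rule isCont_o2) (use \<phi> in \<open>simp add: continuous_on_eq_continuous_at\<close>)
      then show ?thesis by (intro continuous_intros)
    qed
    show "integrable lborel (\<lambda>y. (M * ?D) * (cmod (f y) * wt (y - fst p0)))"
      by (intro integrable_mult_right in_L2_wt_integrable f)
    show "cmod (cnj (\<phi> (y - fst p)) * f y * exp (- \<i> * complex_of_real (y \<bullet> snd p))) \<le> (M * ?D) * (cmod (f y) * wt (y - fst p0))"
      if d: "dist p p0 < 1" for p y
    proof -
      have "dist (fst p) (fst p0) \<le> 1" using dist_fst_le[of p p0] d by simp
      then have l: "(1 / 2) ^ DIM(real^'n) \<le> wt (fst p - fst p0)" by (intro wt_lower) (simp add: dist_norm)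
      have "wt (y - fst p) * (1 / 2) ^ DIM(real^'n) \<le> wt (y - fst p) * wt (fst p - fst p0)"
        using l by (intro mult_left_mono) auto
      also have "\<dots> \<le> 2 ^ DIM(real^'n) * wt (y - fst p0)"
        using wt_mult_le[of "y - fst p" "fst p - fst p0"] by simp
      finally have w: "wt (y - fst p) \<le> ?D * wt (y - fst p0)" by (simp add: field_simps)
      have "cmod (\<phi> (y - fst p)) \<le> M * (?D * wt (y - fst p0))"
        by (rule order_trans[OF M mult_left_mono[OF w M0]])
      then have "cmod (\<phi> (y - fst p)) * cmod (f y) \<le> (M * (?D * wt (y - fst p0))) * cmod (f y)" by (intro mult_right_mono) auto
      then show ?thesis by (simp add: norm_mult ac_simps)
    qed
  qed simp
  then show "isCont (\<lambda>(x, \<xi>). wave_packet \<phi> f x \<xi>) p0"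
    unfolding wave_packet_def case_prod_unfold .
qed

text \<open>The initial window shifted to \<open>x\<close> and modulated to frequency
  \<open>\<xi>\<close>; pairing with its conjugate gives the wave packet transform.\<close>

definition packet :: "(real^'n::finite \<Rightarrow> complex) \<Rightarrow> real^'n \<Rightarrow> real^'n \<Rightarrow> real^'n \<Rightarrow> complex" where
  "packet \<phi> x \<xi> z = exp (\<i> * complex_of_real (z \<bullet> \<xi>)) * \<phi> (z - x)"

lemma schw_packet: "schw \<phi> \<Longrightarrow> schw (packet \<phi> x \<xi>)"
  unfolding packet_def[abs_def] by (intro schw_modulate schw_translate)

text \<open>By Galilei covariance the evolved packet is a modulated evolved window at x + s \<xi>,
  up to a unimodular phase. The multiplier \<open>m\<close> is kept so that the same identity serves
  for the potential term.\<close>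

lemma cmod_pairing_packet:
  fixes \<phi> f m :: "real^'n::finite \<Rightarrow> complex"
  assumes \<phi>: "schw \<phi>"
  shows "cmod (LINT y|lborel. f y * (m y * cnj (free_propagator s (packet \<phi> x \<xi>) y))) =
    cmod (LINT y|lborel. f y * (cnj (free_propagator s \<phi> (y - (x + s *\<^sub>R \<xi>))) * m y) * exp (- \<i> * complex_of_real (y \<bullet> \<xi>)))"
proof -
  have "(LINT y|lborel. f y * (m y * cnj (free_propagator s (packet \<phi> x \<xi>) y))) =
    (LINT y|lborel. cnj (phase s \<xi>) * (f y * (cnj (free_propagator s \<phi> (y - (x + s *\<^sub>R \<xi>))) * m y) * exp (- \<i> * complex_of_real (y \<bullet> \<xi>))))"
    unfolding packet_def[abs_def] propagator_galilei[OF \<phi>]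
    by (rule Bochner_Integration.integral_cong) (simp_all add: exp_cnj ac_simps diff_diff_eq)
  then show ?thesis by (simp only: integral_mult_right_zero norm_mult complex_mod_cnj cmod_phase mult_1_left)
qed

lemma cmod_pairing_packet_1:
  fixes \<phi> f :: "real^'n::finite \<Rightarrow> complex"
  assumes \<phi>: "schw \<phi>"
  shows "cmod (LINT y|lborel. f y * cnj (free_propagator s (packet \<phi> x \<xi>) y)) = cmod (wave_packet (free_propagator s \<phi>) f (x + s *\<^sub>R \<xi>) \<xi>)"
  using cmod_pairing_packet[OF \<phi>, of f "\<lambda>_. 1" s x \<xi>]
  by (simp add: wave_packet_def mult.commute)

lemma wave_packet_bound:
  fixes \<phi> f :: "real^'n::finite \<Rightarrow> complex"
  assumes f: "in_L2 f" and [measurable]: "\<phi> \<in> borel_measurable borel" and M: "\<And>y. cmod (\<phi> y) \<le> M * wt y" and M0: "0 \<le> M"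
  shows "cmod (wave_packet \<phi> f x \<xi>) \<le> M * ((LINT y|lborel. (cmod (f y))\<^sup>2) + (LINT y::real^'n|lborel. wt y))"
proof -
  have "wave_packet \<phi> f x \<xi> = (LINT y|lborel. f y * (cnj (\<phi> (y - x)) * exp (- \<i> * complex_of_real (y \<bullet> \<xi>))))"
    unfolding wave_packet_def by (simp only: ac_simps)
  then show ?thesis
    using pairing_bound[OF f, of "\<lambda>y. cnj (\<phi> (y - x)) * exp (- \<i> * complex_of_real (y \<bullet> \<xi>))" M x] M M0
    by (simp add: norm_mult)
qed

lemma wt_quotient_shift:
  fixes x0 x p :: "'a::euclidean_space"
  shows "wt (x0 - x) * wt p \<le> 2 ^ DIM('a) * wt (x0 - (x - p))"
  using wt_mult_le[of "x0 - x" p] by (simp add: algebra_simps)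

lemma nn_integral_cmult2:
  fixes f :: "'a::euclidean_space \<Rightarrow> 'b::euclidean_space \<Rightarrow> ennreal"
  assumes [measurable]: "(\<lambda>(x, y). f x y) \<in> borel_measurable (borel \<Otimes>\<^sub>M borel)"
  shows "c * (\<integral>\<^sup>+x. (\<integral>\<^sup>+y. f x y \<partial>lborel) \<partial>lborel) = (\<integral>\<^sup>+x. (\<integral>\<^sup>+y. c * f x y \<partial>lborel) \<partial>lborel)"
proof -
  have "(\<lambda>(x, y). f x y) \<in> borel_measurable (borel \<Otimes>\<^sub>M lborel)"
    using assms by (simp cong: measurable_cong_sets sets_pair_measure_cong)
  from lborel.borel_measurable_nn_integral[OF this]
  have [measurable]: "(\<lambda>x. \<integral>\<^sup>+y. f x y \<partial>lborel) \<in> borel_measurable borel" .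
  have [measurable]: "f x \<in> borel_measurable borel" for x
    using measurable_Pair2[OF assms, of x] by simp
  show ?thesis by (simp add: nn_integral_cmult)
qed

lemma nn_integral_wt_product:
  fixes X :: "real^'n::finite"
  assumes "0 \<le> c"
  shows "(\<integral>\<^sup>+x'. (\<integral>\<^sup>+(\<eta>::real^'n). ennreal (c * (wt (x' - X) * wt \<eta>)) \<partial>lborel) \<partial>lborel) = ennreal (c * (LINT x::real^'n|lborel. wt x)\<^sup>2)"
    (is "?l = _")
proof -
  let ?I = "LINT x::real^'n|lborel. wt x"
  have I: "0 \<le> ?I" by (rule integral_nonneg_AE) auto
  have n: "(\<integral>\<^sup>+x. ennreal (wt (x - X)) \<partial>lborel) = ennreal ?I" "(\<integral>\<^sup>+(x::real^'n). ennreal (wt x) \<partial>lborel) = ennreal ?I" for X :: "real^'n"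
    by (subst nn_integral_eq_integral; simp)+
  have "?l = (\<integral>\<^sup>+x'. (\<integral>\<^sup>+(\<eta>::real^'n). ennreal (c * wt (x' - X)) * ennreal (wt \<eta>) \<partial>lborel) \<partial>lborel)"
    using assms by (simp add: mult.assoc flip: ennreal_mult)
  also have "\<dots> = (\<integral>\<^sup>+x'. ennreal (c * ?I) * ennreal (wt (x' - X)) \<partial>lborel)"
  proof (rule nn_integral_cong)
    fix x' :: "real^'n"
    have "(\<integral>\<^sup>+(\<eta>::real^'n). ennreal (c * wt (x' - X)) * ennreal (wt \<eta>) \<partial>lborel) = ennreal (c * wt (x' - X)) * ennreal ?I"
      by (subst nn_integral_cmult) (simp_all add: n)
    also have "\<dots> = ennreal (c * ?I) * ennreal (wt (x' - X))"
      using assms I by (simp add: ac_simps flip: ennreal_mult)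
    finally show "(\<integral>\<^sup>+(\<eta>::real^'n). ennreal (c * wt (x' - X)) * ennreal (wt \<eta>) \<partial>lborel) = ennreal (c * ?I) * ennreal (wt (x' - X))" .
  qed
  also have "\<dots> = ennreal (c * ?I) * ennreal ?I" by (subst nn_integral_cmult) (simp_all add: n)
  also have "\<dots> = ennreal (c * ?I\<^sup>2)"
    using assms I by (simp add: power2_eq_square mult.assoc flip: ennreal_mult)
  finally show ?thesis .
qed

section \<open>The pointwise estimate\<close>

text \<open>The Gronwall argument runs on the weighted supremum
  \<open>sup exp (- l \<bar>s\<bar>) |F(s, x, \<xi>)| wt (x0 - x) wt (\<xi>0 - \<xi>)\<close> over all \<open>s\<close>, \<open>x\<close>, \<open>\<xi>\<close>, where \<open>F\<close> is the transform in coordinates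
  moving with the free flow. It is finite for every \<open>u \<in> C(\<real>; L\<^sup>2)\<close>, so that no a priori bound
  on the modulation norm of \<open>u(t)\<close> is needed.\<close>

lemma wave_packet_pointwise_bound:
  fixes V :: "real \<Rightarrow> real^'n::finite \<Rightarrow> real" and \<phi>0 :: "real^'n \<Rightarrow> complex"
  assumes \<phi>0: "schw \<phi>0" "\<phi>0 \<noteq> (\<lambda>x. 0)" and T: "0 < T" and V: "smooth (\<lambda>(t, x). V t x)"
    and Vb: "\<forall>\<alpha> :: 'n \<Rightarrow> nat. (\<Sum>i\<in>UNIV. \<alpha> i) \<ge> 1 \<longrightarrow> (\<exists>C>0. \<forall>t x. \<bar>multi_deriv \<alpha> (V t) x\<bar> \<le> C)"
  shows "\<exists>C>0. \<forall>u0 u t x \<xi>. schroedinger_solution V u0 u \<longrightarrow> \<bar>t\<bar> \<le> T \<longrightarrow>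
    ennreal (cmod (wave_packet (free_propagator t \<phi>0) (u t) (x + t *\<^sub>R \<xi>) \<xi>)) \<le>
    ennreal C * (\<integral>\<^sup>+x'. (\<integral>\<^sup>+\<xi>'. ennreal (wt (x - x') * wt (\<xi> - \<xi>') * cmod (wave_packet \<phi>0 (u 0) x' \<xi>')) \<partial>lborel) \<partial>lborel)"
proof -
  let ?N = "2 * (3 * CARD('n))" and ?d = "DIM(real^'n)"
  let ?\<phi> = "\<lambda>s. free_propagator s \<phi>0"
  define I where "I = (LINT x::real^'n|lborel. wt x)"
  have I0: "0 \<le> I" unfolding I_def by (rule integral_nonneg_AE) auto
  obtain L where L: "0 < L" "\<And>t x. deriv_bound ?N (\<lambda>y. L / wt (y - x)) (\<lambda>y. complex_of_real (V t y - V t x))"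
    using potential_deriv_bound[OF V Vb] by blast
  have VL: "\<bar>V t y - V t 0\<bar> \<le> L / wt y" for t y
    using deriv_boundD[OF L(2)[where t=t and x=0], of y] by (simp flip: of_real_diff)
  obtain M where M: "0 \<le> M" "\<And>s. \<bar>s\<bar> \<le> T \<Longrightarrow> deriv_bound ?N (\<lambda>y. M * wt y ^ 4) (?\<phi> s)"
    using propagator_deriv_bound[OF \<phi>0(1), of T ?N 4] T by auto
  have Mw: "cmod (?\<phi> s y) \<le> M * wt y" if "\<bar>s\<bar> \<le> T" for s y
    using order_trans[OF deriv_boundD[OF M(2)[OF that]] mult_left_mono[OF wt_power_mono[of 1 4] M(1)], of y] by simp
  obtain C0 where C0: "0 < C0" and diag: "\<And>(\<phi> :: real^'n \<Rightarrow> complex) u m x \<xi> M L. in_L2 u \<Longrightarrow> smooth \<phi> \<Longrightarrow>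
     0 \<le> M \<Longrightarrow> deriv_bound ?N (\<lambda>y. M * wt y ^ 4) \<phi> \<Longrightarrow> smooth m \<Longrightarrow> 0 \<le> L \<Longrightarrow>
     deriv_bound ?N (\<lambda>y. L / wt (y - x)) m \<Longrightarrow>
     ennreal ((LINT y|lborel. (cmod (\<phi> y))\<^sup>2) * cmod (LINT y|lborel. u y * (cnj (\<phi> (y - x)) * m y) * exp (- \<i> * complex_of_real (y \<bullet> \<xi>)))) \<le>
     (\<integral>\<^sup>+x'. (\<integral>\<^sup>+\<eta>. ennreal (C0 * M\<^sup>2 * L * (wt (x' - x) ^ 2 * wt \<eta> ^ 3 * cmod (wave_packet \<phi> u x' (\<xi> - \<eta>)))) \<partial>lborel) \<partial>lborel)"
    using almost_diagonalization[where 'n='n] by blast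
  define n0 where "n0 = (LINT y|lborel. (cmod (\<phi>0 y))\<^sup>2)"
  have n0s: "(LINT y|lborel. (cmod (?\<phi> s y))\<^sup>2) = n0" for s
    unfolding n0_def by (rule propagator_L2_norm[OF \<phi>0(1)])
  \<comment> \<open>A nonzero continuous window is nonzero on an open set, which has positive
    measure.\<close>
  have n0: "0 < n0"
  proof -
    obtain K where K: "\<And>y. cmod (\<phi>0 y) \<le> K * wt y" using rapid_wt_bound[OF schw_rapid[OF \<phi>0(1)]] by blast
    have i: "integrable lborel (\<lambda>y. (cmod (\<phi>0 y))\<^sup>2)"
      using in_L2_wt(1)[OF schw_measurable[OF \<phi>0(1)] K] by (simp add: in_L2_def)
    have "n0 \<noteq> 0"
    proof
      assume "n0 = 0"
      then have "AE y in lborel. (cmod (\<phi>0 y))\<^sup>2 = 0"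
        unfolding n0_def using integral_nonneg_eq_0_iff_AE[OF i] by simp
      then have ae: "AE y in lborel. \<phi>0 y = 0" by simp
      obtain z where z: "\<phi>0 z \<noteq> 0" using \<phi>0(2) by auto
      let ?S = "{y. 0 < cmod (\<phi>0 y)}"
      have "open ?S" by (intro open_Collect_less continuous_intros schw_continuous \<phi>0)
      moreover have "z \<in> ?S" using z by simp
      ultimately have "\<not> negligible ?S" using open_not_negligible by blast
      moreover have "emeasure lborel ?S = 0"
        using ae \<open>open ?S\<close> by (subst (asm) AE_iff_measurable[where N="?S"]) auto
      then have "?S \<in> null_sets lebesgue" using \<open>open ?S\<close> by (auto intro!: null_sets_completionI)
      then have "negligible ?S" by (simp add: negligible_iff_null_sets)
      ultimately show False by blast
    qed
    moreover have "0 \<le> n0" unfolding n0_def by (rule integral_nonneg_AE) auto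
    ultimately show ?thesis by simp
  qed
  define DT where "DT = (2 * (1 + T\<^sup>2)) ^ ?d"
  have DT: "0 < DT" unfolding DT_def by (intro zero_less_power mult_pos_pos) auto
  \<comment> \<open>Kernel constant for the potential difference: two Peetre factors, the shear
    factor \<open>DT\<close>, and one integral of the weight for each of the two variables.\<close>
  define Q where "Q = C0 * M\<^sup>2 * L * (2 ^ ?d * 2 ^ ?d * DT) * I\<^sup>2"
  have Q: "0 \<le> Q" unfolding Q_def using C0 L DT by (intro mult_nonneg_nonneg) auto
  \<comment> \<open>The factor 2 is what makes the remainder contribute only half of the weighted
    supremum.\<close>
  define l where "l = 2 * Q / n0"
  have l: "0 \<le> l" unfolding l_def using Q n0 by simp
  \<comment> \<open>Constant of the reproducing estimate at time 0, where the symbol is 1 and no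
    shear occurs.\<close>
  define c1 where "c1 = C0 * M\<^sup>2 * (2 ^ ?d * 2 ^ ?d) / n0"
  have c1: "0 \<le> c1" unfolding c1_def using C0 n0 by simp
  define C where "C = exp (l * T) * (2 * c1) + 1"
  have C: "0 < C" unfolding C_def using c1 by (simp add: add_nonneg_pos)
  show ?thesis
  proof (intro exI[of _ C] conjI allI impI)
    show "0 < C" by (rule C)
    fix u0 :: "real^'n \<Rightarrow> complex" and u t and x0 \<xi>0 :: "real^'n"
    assume sol: "schroedinger_solution V u0 u" and t: "\<bar>t\<bar> \<le> T"
    have u: "continuous_L2 u" using sol by (simp add: schroedinger_solution_def)
    have uL: "in_L2 (u s)" for s by (rule continuous_L2_in_L2[OF u])
    define F where "F s x \<xi> = cmod (wave_packet (?\<phi> s) (u s) (x + s *\<^sub>R \<xi>) \<xi>)" for s x \<xi>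
    have F0: "F 0 x \<xi> = cmod (wave_packet \<phi>0 (u 0) x \<xi>)" for x \<xi> by (simp add: F_def propagator_zero[OF \<phi>0(1)])
    have Fg: "F s x \<xi> = cmod (LINT y|lborel. u s y * cnj (free_propagator s (packet \<phi>0 x \<xi>) y))" for s x \<xi>
      unfolding F_def cmod_pairing_packet_1[OF \<phi>0(1)] ..
    let ?J = "\<integral>\<^sup>+x'. (\<integral>\<^sup>+\<xi>'. ennreal (wt (x0 - x') * wt (\<xi>0 - \<xi>') * F 0 x' \<xi>') \<partial>lborel) \<partial>lborel"
    \<comment> \<open>The weight is centred at the fixed point (x0, \<xi>0) where the bound is
      wanted, and equals 1 there. The decay away from it is what finally appears as the convolution
      kernel.\<close>
    define om where "om x \<xi> = wt (x0 - x) * wt (\<xi>0 - \<xi>)" for x \<xi>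
    have om: "0 < om x \<xi>" "om x \<xi> \<le> 1" for x \<xi> unfolding om_def by (auto intro: mult_le_one wt_le_1)
    obtain K where K: "0 \<le> K" "\<And>s. s \<in> {- T..T} \<Longrightarrow> (LINT y|lborel. (cmod (u s y))\<^sup>2) \<le> K"
      using continuous_L2_bounded[OF u, of "- T" T] by blast
    \<comment> \<open>This bound depends on \<open>u\<close>; it only serves to make the supremum
      finite, and does not enter \<open>C\<close>.\<close>
    define FB where "FB = M * (K + I)"
    have FB: "F s x \<xi> \<le> FB" if s: "\<bar>s\<bar> \<le> T" for s x \<xi>
    proof -
      have "F s x \<xi> \<le> M * ((LINT y|lborel. (cmod (u s y))\<^sup>2) + I)"
        unfolding F_def I_def by (rule wave_packet_bound[OF uL propagator_measurable[OF \<phi>0(1)] Mw[OF s] M(1)])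
      also have "\<dots> \<le> FB" unfolding FB_def using K(2)[of s] s M(1) by (intro mult_left_mono) (auto simp: abs_le_iff)
      finally show ?thesis .
    qed
    \<comment> \<open>The damping exp(- l |s|) makes the integrated remainder comparable to the
      supremum itself, so no time-local iteration is required.\<close>
    define S where "S = {exp (- l * \<bar>s\<bar>) * (F s x \<xi> * om x \<xi>) | s x \<xi>. \<bar>s\<bar> \<le> T}"
    have Fn: "0 \<le> F s x \<xi>" for s x \<xi> by (simp add: F_def)
    have Sb: "bdd_above S"
    proof (rule bdd_aboveI[of _ FB])
      fix z assume "z \<in> S"
      then obtain s x \<xi> where z: "z = exp (- l * \<bar>s\<bar>) * (F s x \<xi> * om x \<xi>)" "\<bar>s\<bar> \<le> T" unfolding S_def by blast
      have "exp (- l * \<bar>s\<bar>) * (F s x \<xi> * om x \<xi>) \<le> 1 * (F s x \<xi> * 1)"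
        using l om[of x \<xi>] Fn[of s x \<xi>] by (intro mult_mono mult_left_mono) (auto simp: less_imp_le)
      then show "z \<le> FB" using FB[OF z(2), of x \<xi>] z(1) by simp
    qed
    define B where "B = Sup S"
    have BF: "F s x \<xi> * om x \<xi> \<le> exp (l * \<bar>s\<bar>) * B" if s: "\<bar>s\<bar> \<le> T" for s x \<xi>
    proof -
      have "exp (- l * \<bar>s\<bar>) * (F s x \<xi> * om x \<xi>) \<le> B"
        unfolding B_def by (rule cSup_upper[OF _ Sb]) (use s in \<open>auto simp: S_def\<close>)
      then have "exp (l * \<bar>s\<bar>) * (exp (- l * \<bar>s\<bar>) * (F s x \<xi> * om x \<xi>)) \<le> exp (l * \<bar>s\<bar>) * B" by (intro mult_left_mono) auto
      then show ?thesis by (simp add: mult.assoc[symmetric] exp_add[symmetric])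
    qed
    have B0: "0 \<le> B"
    proof -
      have "0 \<le> F 0 0 0 * om 0 0" using om[of 0 0] Fn[of 0 0 0] by simp
      then show ?thesis using BF[of 0 0 0] T by simp
    qed
    \<comment> \<open>The constant symbol 1 qualifies with L = 1 because the weight is at most 1; it
      is the symbol used at time 0.\<close>
    have Lp: "deriv_bound ?N (\<lambda>y. 1 / wt (y - X)) (\<lambda>y::real^'n. 1::complex)" for X
    proof (rule deriv_bound_iter_deriv)
      fix bs :: "(real^'n) list" and y
      have "iter_deriv bs (\<lambda>y::real^'n. 1::complex) = (\<lambda>y. if bs = [] then 1 else 0)" by (induction bs) auto
      then show "norm (iter_deriv bs (\<lambda>y::real^'n. 1::complex) y) \<le> 1 / wt (y - X)"
        using wt_le_1[of "y - X"] by (simp add: pos_le_divide_eq)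
    qed
    \<comment> \<open>The remainder after recentring the potential, estimated through the kernel:
      every value of the transform under the integral is bounded by the weighted supremum, and the
      weight is carried back to (x, \<xi>).\<close>
    have rem: "n0 * cmod (LINT y|lborel. u s y * (complex_of_real (V s y - V s (x + s *\<^sub>R \<xi>)) * cnj (free_propagator s (packet \<phi>0 x \<xi>) y)))
      \<le> Q * (exp (l * \<bar>s\<bar>) * (B / om x \<xi>))" if s: "\<bar>s\<bar> \<le> T" for s x \<xi>
    proof -
      let ?X = "x + s *\<^sub>R \<xi>" and ?R = "exp (l * \<bar>s\<bar>) * (B / om x \<xi>)"
      have R1: "0 \<le> B / om x \<xi>" using B0 om[of x \<xi>] by simp
      have R0: "0 \<le> ?R" by (rule mult_nonneg_nonneg[OF exp_ge_zero R1])
      have sm: "smooth (\<lambda>y. complex_of_real (V s y - V s ?X))"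
        using smooth_slice[OF V, of s] by (intro smooth_of_real smooth_diff(1) smooth_const) simp
      have "ennreal (n0 * cmod (LINT y|lborel. u s y * (complex_of_real (V s y - V s ?X) * cnj (free_propagator s (packet \<phi>0 x \<xi>) y)))) \<le>
        (\<integral>\<^sup>+x'. (\<integral>\<^sup>+\<eta>. ennreal (C0 * M\<^sup>2 * L * (wt (x' - ?X) ^ 2 * wt \<eta> ^ 3 * cmod (wave_packet (?\<phi> s) (u s) x' (\<xi> - \<eta>)))) \<partial>lborel) \<partial>lborel)"
        unfolding cmod_pairing_packet[OF \<phi>0(1)]
        using diag[OF uL smooth_propagator[OF \<phi>0(1)] M(1) M(2)[OF s] sm less_imp_le[OF L(1)] L(2)]
        unfolding n0s .
      also have "\<dots> \<le> (\<integral>\<^sup>+x'. (\<integral>\<^sup>+(\<eta>::real^'n). ennreal ((C0 * M\<^sup>2 * L * (2 ^ ?d * 2 ^ ?d * DT) * ?R) * (wt (x' - ?X) * wt \<eta>)) \<partial>lborel) \<partial>lborel)"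
      proof (intro nn_integral_mono ennreal_leI)
        fix x' \<eta>
        \<comment> \<open>\<open>?w\<close> is the starting point of the trajectory with frequency
          \<xi> - \<eta> that reaches x' at time s, and \<open>?p\<close> is the displacement x -
          \<open>?w\<close>.\<close>
        let ?p = "(?X - x') - s *\<^sub>R \<eta>" and ?w = "x' - s *\<^sub>R (\<xi> - \<eta>)"
        have W: "cmod (wave_packet (?\<phi> s) (u s) x' (\<xi> - \<eta>)) = F s ?w (\<xi> - \<eta>)" by (simp add: F_def)
        have e1: "wt (x0 - x) * wt ?p \<le> 2 ^ ?d * wt (x0 - ?w)"
        proof -
          have w: "x - ?p = ?w" by (simp add: algebra_simps)
          show ?thesis using wt_quotient_shift[of x0 x ?p] unfolding w .
        qed
        have e2: "wt (x' - ?X) * wt \<eta> \<le> DT * wt ?p"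
          using wt_shear[OF s, of "?X - x'" \<eta>] unfolding DT_def by (simp add: wt_commute[of x'])
        have e3: "wt (\<xi>0 - \<xi>) * wt \<eta> \<le> 2 ^ ?d * wt (\<xi>0 - (\<xi> - \<eta>))"
          by (rule wt_quotient_shift)
        \<comment> \<open>One wt(x' - X) and one wt(\<eta>) pay for the shear, a second wt(\<eta>)
          moves the frequency weight; of the kernel wt^2 wt^3 exactly one factor of each remains for
          integration.\<close>
        have "om x \<xi> * (wt (x' - ?X) * wt \<eta> * wt \<eta>) = (wt (x0 - x) * (wt (x' - ?X) * wt \<eta>)) * (wt (\<xi>0 - \<xi>) * wt \<eta>)"
          by (simp add: om_def)
        also have "\<dots> \<le> (wt (x0 - x) * (DT * wt ?p)) * (2 ^ ?d * wt (\<xi>0 - (\<xi> - \<eta>)))"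
          using DT by (intro mult_mono mult_left_mono e2 e3) auto
        also have "\<dots> = DT * (wt (x0 - x) * wt ?p) * (2 ^ ?d * wt (\<xi>0 - (\<xi> - \<eta>)))" by simp
        also have "\<dots> \<le> DT * (2 ^ ?d * wt (x0 - ?w)) * (2 ^ ?d * wt (\<xi>0 - (\<xi> - \<eta>)))"
          using DT by (intro mult_right_mono mult_left_mono e1) auto
        also have "\<dots> = (2 ^ ?d * 2 ^ ?d * DT) * om ?w (\<xi> - \<eta>)" by (simp add: om_def)
        finally have k: "om x \<xi> * (wt (x' - ?X) * wt \<eta> * wt \<eta>) \<le> (2 ^ ?d * 2 ^ ?d * DT) * om ?w (\<xi> - \<eta>)" .
        have "om x \<xi> * (wt (x' - ?X) * wt \<eta> * wt \<eta> * F s ?w (\<xi> - \<eta>)) \<le> ((2 ^ ?d * 2 ^ ?d * DT) * om ?w (\<xi> - \<eta>)) * F s ?w (\<xi> - \<eta>)"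
          using mult_right_mono[OF k Fn] by (simp only: mult.assoc)
        also have "\<dots> = (2 ^ ?d * 2 ^ ?d * DT) * (F s ?w (\<xi> - \<eta>) * om ?w (\<xi> - \<eta>))" by simp
        also have "\<dots> \<le> (2 ^ ?d * 2 ^ ?d * DT) * (exp (l * \<bar>s\<bar>) * B)" using DT by (intro mult_left_mono BF[OF s]) auto
        finally have "wt (x' - ?X) * wt \<eta> * wt \<eta> * F s ?w (\<xi> - \<eta>) \<le> (2 ^ ?d * 2 ^ ?d * DT) * (exp (l * \<bar>s\<bar>) * B) / om x \<xi>"
          using om(1)[of x \<xi>] by (simp add: pos_le_divide_eq mult.commute)
        then have k2: "wt (x' - ?X) * wt \<eta> * wt \<eta> * F s ?w (\<xi> - \<eta>) \<le> (2 ^ ?d * 2 ^ ?d * DT) * ?R" by simp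
        have "C0 * M\<^sup>2 * L * (wt (x' - ?X) ^ 2 * wt \<eta> ^ 3 * F s ?w (\<xi> - \<eta>)) = (C0 * M\<^sup>2 * L * (wt (x' - ?X) * wt \<eta>)) * (wt (x' - ?X) * wt \<eta> * wt \<eta> * F s ?w (\<xi> - \<eta>))"
          by (simp add: power2_eq_square power3_eq_cube)
        also have "\<dots> \<le> (C0 * M\<^sup>2 * L * (wt (x' - ?X) * wt \<eta>)) * ((2 ^ ?d * 2 ^ ?d * DT) * ?R)"
          using C0 L by (intro mult_left_mono k2) auto
        also have "\<dots> = (C0 * M\<^sup>2 * L * (2 ^ ?d * 2 ^ ?d * DT) * ?R) * (wt (x' - ?X) * wt \<eta>)" by (simp only: ac_simps)
        finally show "C0 * M\<^sup>2 * L * (wt (x' - ?X) ^ 2 * wt \<eta> ^ 3 * cmod (wave_packet (?\<phi> s) (u s) x' (\<xi> - \<eta>))) \<le> (C0 * M\<^sup>2 * L * (2 ^ ?d * 2 ^ ?d * DT) * ?R) * (wt (x' - ?X) * wt \<eta>)"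
          unfolding W .
      qed
      also have "\<dots> = ennreal ((C0 * M\<^sup>2 * L * (2 ^ ?d * 2 ^ ?d * DT) * ?R) * I\<^sup>2)"
        unfolding I_def by (rule nn_integral_wt_product) (use C0 L(1) DT R1 in \<open>intro mult_nonneg_nonneg; simp\<close>)
      also have "(C0 * M\<^sup>2 * L * (2 ^ ?d * 2 ^ ?d * DT) * ?R) * I\<^sup>2 = Q * ?R" unfolding Q_def by (simp only: ac_simps)
      finally show ?thesis by (subst (asm) ennreal_le_iff[OF mult_nonneg_nonneg[OF Q R0]])
    qed
    \<comment> \<open>The comparison constant of the phase removal is B / (2 om): multiplied by
      \<open>l\<close> it equals the bound \<open>rem\<close> divided by \<open>n0\<close>.\<close>
    have grow: "F s x \<xi> \<le> F 0 x \<xi> + (B / (2 * om x \<xi>)) * exp (l * \<bar>s\<bar>)" if s: "\<bar>s\<bar> \<le> T" for s x \<xi>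
    proof -
      let ?G = "packet \<phi>0 x \<xi>"
      have sG: "schw ?G" by (rule schw_packet[OF \<phi>0(1)])
      let ?g = "\<lambda>s. LINT y|lborel. u s y * cnj (free_propagator s ?G y)"
      let ?h = "\<lambda>s. LINT y|lborel. u s y * (V s y * cnj (free_propagator s ?G y))"
      let ?r = "\<lambda>s. LINT y|lborel. u s y * (complex_of_real (V s y - V s (x + s *\<^sub>R \<xi>)) * cnj (free_propagator s ?G y))"
      have ld: "locally_dominated (\<lambda>t y. cnj (free_propagator t ?G y))" "locally_dominated (\<lambda>t y. V t y * cnj (free_propagator t ?G y))"
        by (rule locally_dominated_propagator[OF sG] locally_dominated_potential[OF sG V VL])+
      have cg: "continuous_on UNIV ?g" "continuous_on UNIV ?h"
        by (rule continuous_locally_dominated_pairing[OF u ld(1)] continuous_locally_dominated_pairing[OF u ld(2)])+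
      have dg: "(?g has_vector_derivative - \<i> * ?h s) (at s)" for s
      proof (rule weak_imp_derivative[OF cg(2)])
        fix a b :: real assume "a < b"
        then show "?g b - ?g a = - \<i> * integral {a..b} ?h"
        proof (rule fundamental_lemma[OF cg])
          fix \<theta> \<theta>' c d
          assume "smooth \<theta>" "\<And>t. (\<theta> has_real_derivative \<theta>' t) (at t)" "continuous_on UNIV \<theta>'"
            "\<And>t. t \<notin> {c..d} \<Longrightarrow> \<theta> t = 0" "\<And>t. t \<notin> {c..d} \<Longrightarrow> \<theta>' t = 0"
          then show "(LINT t|lborel. \<theta>' t * ?g t) = \<i> * (LINT t|lborel. \<theta> t * ?h t)"
            by (rule weak_equation_free_wave[OF sol V VL sG])
        qed
      qed
      \<comment> \<open>The potential is split into its value on the classical trajectory, real and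
        hence a pure phase rotation, and the difference treated in \<open>rem\<close>.\<close>
      have hr: "?h s = complex_of_real (V s (x + s *\<^sub>R \<xi>)) * ?g s + ?r s" for s
      proof -
        have "?r s = (LINT y|lborel. u s y * (V s y * cnj (free_propagator s ?G y)) - complex_of_real (V s (x + s *\<^sub>R \<xi>)) * (u s y * cnj (free_propagator s ?G y)))"
          by (rule Bochner_Integration.integral_cong) (auto simp: algebra_simps)
        also have "\<dots> = ?h s - complex_of_real (V s (x + s *\<^sub>R \<xi>)) * ?g s"
          by (subst Bochner_Integration.integral_diff) (intro integrable_locally_dominated[OF uL ld(2)], intro integrable_mult_right integrable_locally_dominated[OF uL ld(1)], simp only: integral_mult_right_zero)
        finally show ?thesis by simp
      qed
      have "cmod (?g s) \<le> cmod (?g 0) + (B / (2 * om x \<xi>) * exp (l * \<bar>s\<bar>) - B / (2 * om x \<xi>))"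
      proof (rule phase_removal_growth[where c="\<lambda>s. V s (x + s *\<^sub>R \<xi>)" and r="?r"])
        have "continuous_on UNIV (\<lambda>s. (\<lambda>(t, x). V t x) (s, x + s *\<^sub>R \<xi>))"
          by (rule continuous_on_compose2[OF smooth_continuous[OF V]]) (auto intro!: continuous_intros)
        then show "continuous_on UNIV (\<lambda>s. V s (x + s *\<^sub>R \<xi>))" by simp
        show "(?g has_vector_derivative - \<i> * (complex_of_real (V s (x + s *\<^sub>R \<xi>)) * ?g s + ?r s)) (at s)" for s
          using dg[of s] unfolding hr .
        show "\<bar>s\<bar> \<le> T" by (rule s)
        show "cmod (?r s) \<le> l * (B / (2 * om x \<xi>) * exp (l * \<bar>s\<bar>))" if "\<bar>s\<bar> \<le> T" for s
        proof -
          have "cmod (?r s) \<le> Q * (exp (l * \<bar>s\<bar>) * (B / om x \<xi>)) / n0"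
            unfolding pos_le_divide_eq[OF n0] by (subst mult.commute) (rule rem[OF that])
          also have "\<dots> = l * (B / (2 * om x \<xi>) * exp (l * \<bar>s\<bar>))" unfolding l_def by (simp add: ac_simps)
          finally show ?thesis .
        qed
      qed
      moreover have "0 \<le> B / (2 * om x \<xi>)" using B0 om(1)[of x \<xi>] by simp
      ultimately show ?thesis unfolding Fg by simp
    qed
    have mF [measurable (raw)]: "(\<lambda>z. F 0 (f z) (g z)) \<in> borel_measurable N"
      if "f \<in> borel_measurable N" "g \<in> borel_measurable N" for f g :: "'z \<Rightarrow> real^'n" and N :: "'z measure"
    proof -
      obtain K' where K': "0 \<le> K'" "\<And>y. cmod (\<phi>0 y) \<le> K' * wt y" using rapid_wt_bound[OF schw_rapid[OF \<phi>0(1)]] by blast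
      have "continuous_on UNIV (\<lambda>(x, \<xi>). cmod (wave_packet \<phi>0 (u 0) x \<xi>))"
        using continuous_on_norm[OF continuous_wave_packet[OF uL schw_continuous[OF \<phi>0(1)] K'(2,1)]] by (simp add: case_prod_unfold)
      then have "(\<lambda>(x, \<xi>). F 0 x \<xi>) \<in> borel_measurable (borel \<Otimes>\<^sub>M borel)"
        unfolding F0 borel_prod by (rule borel_measurable_continuous_onI)
      from measurable_compose[OF measurable_Pair[OF that] this] show ?thesis by simp
    qed
    \<comment> \<open>A pointwise value of the transform is dominated by a weighted average of the
      transform (the kernel estimate with symbol 1). This turns the weighted supremum at time 0 into
      the integral \<open>?J\<close>.\<close>
    have init: "ennreal (F 0 x \<xi> * om x \<xi>) \<le> ennreal c1 * ?J" for x \<xi>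
    proof -
      have "ennreal (n0 * F 0 x \<xi>) \<le> (\<integral>\<^sup>+x'. (\<integral>\<^sup>+\<eta>. ennreal (C0 * M\<^sup>2 * 1 * (wt (x' - x) ^ 2 * wt \<eta> ^ 3 * cmod (wave_packet \<phi>0 (u 0) x' (\<xi> - \<eta>)))) \<partial>lborel) \<partial>lborel)"
      proof -
        have "deriv_bound ?N (\<lambda>y. M * wt y ^ 4) \<phi>0" using M(2)[of 0] T by (simp add: propagator_zero[OF \<phi>0(1)])
        from diag[OF uL schw_smooth[OF \<phi>0(1)] M(1) this smooth_const zero_le_one Lp, of 0 x \<xi>]
        show ?thesis unfolding F0 n0_def wave_packet_def by (simp add: mult.commute)
      qed
      then have "ennreal (om x \<xi> / n0) * ennreal (n0 * F 0 x \<xi>) \<le> ennreal (om x \<xi> / n0) * \<dots>" by (rule mult_left_mono) simp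
      also have "\<dots> = (\<integral>\<^sup>+x'. (\<integral>\<^sup>+\<eta>. ennreal (om x \<xi> / n0) * ennreal (C0 * M\<^sup>2 * 1 * (wt (x' - x) ^ 2 * wt \<eta> ^ 3 * F 0 x' (\<xi> - \<eta>))) \<partial>lborel) \<partial>lborel)"
        unfolding F0[symmetric] by (rule nn_integral_cmult2) measurable
      also have "\<dots> \<le> (\<integral>\<^sup>+x'. (\<integral>\<^sup>+\<eta>. ennreal c1 * ennreal (wt (x0 - x') * wt (\<xi>0 - (\<xi> - \<eta>)) * F 0 x' (\<xi> - \<eta>)) \<partial>lborel) \<partial>lborel)"
      proof (intro nn_integral_mono)
        fix x' \<eta>
        have e1: "wt (x0 - x) * wt (x' - x) \<le> 2 ^ ?d * wt (x0 - x')"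
          using wt_mult_diff_le[of x0 x x'] by simp
        have e3: "wt (\<xi>0 - \<xi>) * wt \<eta> \<le> 2 ^ ?d * wt (\<xi>0 - (\<xi> - \<eta>))" by (rule wt_quotient_shift)
        have "om x \<xi> * (wt (x' - x) ^ 2 * wt \<eta> ^ 3) \<le> om x \<xi> * (wt (x' - x) ^ 1 * wt \<eta> ^ 1)"
          using om(1)[of x \<xi>] by (intro mult_left_mono mult_mono wt_power_mono) auto
        also have "\<dots> = (wt (x0 - x) * wt (x' - x)) * (wt (\<xi>0 - \<xi>) * wt \<eta>)" by (simp add: om_def)
        also have "\<dots> \<le> (2 ^ ?d * wt (x0 - x')) * (2 ^ ?d * wt (\<xi>0 - (\<xi> - \<eta>)))" by (intro mult_mono e1 e3) auto
        finally have k: "om x \<xi> * (wt (x' - x) ^ 2 * wt \<eta> ^ 3) \<le> (2 ^ ?d * wt (x0 - x')) * (2 ^ ?d * wt (\<xi>0 - (\<xi> - \<eta>)))" .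
        have "om x \<xi> / n0 * (C0 * M\<^sup>2 * 1 * (wt (x' - x) ^ 2 * wt \<eta> ^ 3 * F 0 x' (\<xi> - \<eta>))) = (C0 * M\<^sup>2 / n0 * F 0 x' (\<xi> - \<eta>)) * (om x \<xi> * (wt (x' - x) ^ 2 * wt \<eta> ^ 3))"
          by simp
        also have "\<dots> \<le> (C0 * M\<^sup>2 / n0 * F 0 x' (\<xi> - \<eta>)) * ((2 ^ ?d * wt (x0 - x')) * (2 ^ ?d * wt (\<xi>0 - (\<xi> - \<eta>))))"
          using C0 n0 Fn by (intro mult_left_mono k mult_nonneg_nonneg) auto
        also have "\<dots> = c1 * (wt (x0 - x') * wt (\<xi>0 - (\<xi> - \<eta>)) * F 0 x' (\<xi> - \<eta>))" unfolding c1_def by simp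
        finally show "ennreal (om x \<xi> / n0) * ennreal (C0 * M\<^sup>2 * 1 * (wt (x' - x) ^ 2 * wt \<eta> ^ 3 * F 0 x' (\<xi> - \<eta>))) \<le> ennreal c1 * ennreal (wt (x0 - x') * wt (\<xi>0 - (\<xi> - \<eta>)) * F 0 x' (\<xi> - \<eta>))"
          using c1 om(1)[of x \<xi>] n0 C0 Fn by (subst (1 2) ennreal_mult[symmetric]) (auto intro!: ennreal_leI mult_nonneg_nonneg less_imp_le[OF om(1)])
      qed
      also have "\<dots> = (\<integral>\<^sup>+x'. (\<integral>\<^sup>+\<xi>'. ennreal c1 * ennreal (wt (x0 - x') * wt (\<xi>0 - \<xi>') * F 0 x' \<xi>') \<partial>lborel) \<partial>lborel)"
      proof (rule nn_integral_cong)
        fix x'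
        show "(\<integral>\<^sup>+\<eta>. ennreal c1 * ennreal (wt (x0 - x') * wt (\<xi>0 - (\<xi> - \<eta>)) * F 0 x' (\<xi> - \<eta>)) \<partial>lborel) = (\<integral>\<^sup>+\<xi>'. ennreal c1 * ennreal (wt (x0 - x') * wt (\<xi>0 - \<xi>') * F 0 x' \<xi>') \<partial>lborel)"
          by (rule lborel_nn_integral_reflect[where f="\<lambda>\<xi>'. ennreal c1 * ennreal (wt (x0 - x') * wt (\<xi>0 - \<xi>') * F 0 x' \<xi>')"]) measurable
      qed
      also have "\<dots> = ennreal c1 * ?J" by (rule nn_integral_cmult2[symmetric]) measurable
      finally show ?thesis using n0 om(1)[of x \<xi>] Fn by (simp add: mult.commute less_imp_le flip: ennreal_mult)
    qed
    show "ennreal (cmod (wave_packet (?\<phi> t) (u t) (x0 + t *\<^sub>R \<xi>0) \<xi>0)) \<le>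
      ennreal C * (\<integral>\<^sup>+x'. (\<integral>\<^sup>+\<xi>'. ennreal (wt (x0 - x') * wt (\<xi>0 - \<xi>') * cmod (wave_packet \<phi>0 (u 0) x' \<xi>')) \<partial>lborel) \<partial>lborel)"
      unfolding F0[symmetric] F_def[symmetric]
    proof (cases "?J = \<infinity>")
      case True
      then show "ennreal (F t x0 \<xi>0) \<le> ennreal C * ?J" using C by (simp add: ennreal_mult_top)
    next
      case False
      then obtain j where j: "0 \<le> j" "?J = ennreal j" by (cases ?J) auto
      have b0: "F 0 x \<xi> * om x \<xi> \<le> c1 * j" for x \<xi>
        using init[of x \<xi>] j c1 unfolding j(2) by (simp flip: ennreal_mult add: ennreal_le_iff)
      \<comment> \<open>Absorption: since \<open>B\<close> is finite, it is at most twice the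
        initial contribution.\<close>
      have "B \<le> c1 * j + B / 2"
        unfolding B_def
      proof (rule cSup_least)
        have "exp (- l * \<bar>0\<bar>) * (F 0 0 0 * om 0 0) \<in> S"
          unfolding S_def mem_Collect_eq by (intro exI[of _ 0] conjI refl) (use T in simp)
        then show "S \<noteq> {}" by blast
        fix z assume "z \<in> S"
        then obtain s x \<xi> where z: "z = exp (- l * \<bar>s\<bar>) * (F s x \<xi> * om x \<xi>)" "\<bar>s\<bar> \<le> T" unfolding S_def by blast
        have "F s x \<xi> * om x \<xi> \<le> (F 0 x \<xi> + (B / (2 * om x \<xi>)) * exp (l * \<bar>s\<bar>)) * om x \<xi>"
          using grow[OF z(2)] om(1)[of x \<xi>] by (intro mult_right_mono) auto
        also have "\<dots> = F 0 x \<xi> * om x \<xi> + B / 2 * exp (l * \<bar>s\<bar>)" using om(1)[of x \<xi>] by (simp add: field_simps)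
        also have "\<dots> \<le> c1 * j + B / 2 * exp (l * \<bar>s\<bar>)" using b0 by simp
        finally have "z \<le> exp (- l * \<bar>s\<bar>) * (c1 * j + B / 2 * exp (l * \<bar>s\<bar>))" unfolding z(1) by (intro mult_left_mono) auto
        also have "\<dots> = exp (- l * \<bar>s\<bar>) * (c1 * j) + B / 2" by (simp add: distrib_left exp_minus field_simps)
        also have "\<dots> \<le> 1 * (c1 * j) + B / 2" using l c1 j by (intro add_mono mult_right_mono) auto
        finally show "z \<le> c1 * j + Sup S / 2" unfolding B_def by simp
      qed
      then have B2: "B \<le> 2 * (c1 * j)" by simp
      \<comment> \<open>At the centre of the weight nothing is lost, so the bound on
        \<open>B\<close> is a bound on the transform itself.\<close>
      have "F t x0 \<xi>0 = F t x0 \<xi>0 * om x0 \<xi>0" by (simp add: om_def wt_def)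
      also have "\<dots> \<le> exp (l * \<bar>t\<bar>) * B" by (rule BF[OF t])
      also have "\<dots> \<le> exp (l * T) * (2 * (c1 * j))" using B2 B0 l t by (intro mult_mono) (auto intro: mult_left_mono)
      also have "\<dots> = (exp (l * T) * (2 * c1)) * j" by simp
      also have "\<dots> \<le> C * j" unfolding C_def using j by (intro mult_right_mono) auto
      finally show "ennreal (F t x0 \<xi>0) \<le> ennreal C * ?J" using j C by (simp add: ennreal_leI flip: ennreal_mult)
    qed
  qed
qed

section \<open>Modulation norms\<close>

text \<open>For fixed frequency the shear is a translation in x, invisible to the inner norm. After
  centring the convolution at (x - t \<xi>, \<xi>), Minkowski's inequality is applied in x and then
  in \<xi>, over the same measure on phase space.\<close>

lemma modulation_norm_convolution_bound:
  fixes W W0 :: "real^'n::finite \<Rightarrow> real^'n \<Rightarrow> real"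
  assumes p: "1 \<le> p" and q: "1 \<le> q" and C: "0 \<le> C"
    and W: "continuous_on UNIV (\<lambda>(x, \<xi>). W x \<xi>)" and W0: "continuous_on UNIV (\<lambda>(x, \<xi>). W0 x \<xi>)" and W0n: "\<And>x \<xi>. 0 \<le> W0 x \<xi>"
    and le: "\<And>x \<xi>. ennreal (W x \<xi>) \<le> ennreal C *
      (\<integral>\<^sup>+x'. (\<integral>\<^sup>+\<xi>'. ennreal (wt (x - t *\<^sub>R \<xi> - x') * wt (\<xi> - \<xi>') * W0 x' \<xi>') \<partial>lborel) \<partial>lborel)"
  shows "Lp_norm q (\<lambda>\<xi>. Lp_norm p (\<lambda>x. ennreal (W x \<xi>))) \<le>
    ennreal (C * (LINT x::real^'n|lborel. wt x)\<^sup>2) * Lp_norm q (\<lambda>\<xi>. Lp_norm p (\<lambda>x. ennreal (W0 x \<xi>)))"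
proof -
  let ?I = "LINT x::real^'n|lborel. wt x"
  let ?M = "lborel \<Otimes>\<^sub>M lborel :: ((real^'n) \<times> (real^'n)) measure"
  \<comment> \<open>The convolution kernel as one function on phase space; \<open>- 0\<close> only
    matches the shape of \<open>nn_integral_wt_product\<close>, which gives its total mass.\<close>
  define k where "k w = ennreal (C * (wt (fst w - 0) * wt (snd w)))" for w :: "(real^'n) \<times> (real^'n)"
  define a where "a \<xi> = Lp_norm p (\<lambda>x. ennreal (W0 x \<xi>))" for \<xi>
  have M: "sigma_finite_measure ?M" by (rule lborel_pair.P.sigma_finite_measure_axioms)
  have sM: "sets ?M = sets (borel \<Otimes>\<^sub>M borel)" by (rule sets_pair_measure_cong) auto
  have mW0 [measurable (raw)]: "(\<lambda>z. W0 (f z) (g z)) \<in> borel_measurable N"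
    if "f \<in> borel_measurable N" "g \<in> borel_measurable N" for f g :: "'z \<Rightarrow> real^'n" and N :: "'z measure"
  proof -
    have "(\<lambda>(x, \<xi>). W0 x \<xi>) \<in> borel_measurable (borel \<Otimes>\<^sub>M borel)"
      using W0 unfolding borel_prod by (rule borel_measurable_continuous_onI)
    from measurable_compose[OF measurable_Pair[OF that] this] show ?thesis by simp
  qed
  have ma [measurable]: "a \<in> borel_measurable borel" unfolding a_def[abs_def] by (rule measurable_Lp_norm_continuous[OF W0])
  have mk [measurable]: "k \<in> borel_measurable ?M" unfolding k_def[abs_def] by measurable
  have ki: "(\<integral>\<^sup>+w. k w \<partial>?M) = ennreal (C * ?I\<^sup>2)"
    unfolding nn_integral_wt_product[OF C, of 0, symmetric]
    by (subst lborel.nn_integral_fst[symmetric]) (auto simp: k_def mk)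
  have le': "ennreal (W x \<xi>) \<le> (\<integral>\<^sup>+w. k w * ennreal (W0 (x - t *\<^sub>R \<xi> - fst w) (\<xi> - snd w)) \<partial>?M)" for x \<xi>
  proof -
    have "ennreal C * (\<integral>\<^sup>+x'. (\<integral>\<^sup>+\<xi>'. ennreal (wt (x - t *\<^sub>R \<xi> - x') * wt (\<xi> - \<xi>') * W0 x' \<xi>') \<partial>lborel) \<partial>lborel)
      = (\<integral>\<^sup>+x'. (\<integral>\<^sup>+\<xi>'. ennreal C * ennreal (wt (x - t *\<^sub>R \<xi> - x') * wt (\<xi> - \<xi>') * W0 x' \<xi>') \<partial>lborel) \<partial>lborel)"
      by (rule nn_integral_cmult2) measurable
    \<comment> \<open>The two reflections, in frequency here and in position next, move the
      variables from the kernel to \<open>W0\<close>, so that \<open>k\<close> no longer depends on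
      the point (x, \<xi>).\<close>
    also have "\<dots> = (\<integral>\<^sup>+x'. (\<integral>\<^sup>+\<zeta>. ennreal C * ennreal (wt (x - t *\<^sub>R \<xi> - x') * wt (\<xi> - (\<xi> - \<zeta>)) * W0 x' (\<xi> - \<zeta>)) \<partial>lborel) \<partial>lborel)"
      by (intro nn_integral_cong
        lborel_nn_integral_reflect[symmetric, where f="\<lambda>\<xi>'. ennreal C * ennreal (wt (x - t *\<^sub>R \<xi> - _) * wt (\<xi> - \<xi>') * W0 _ \<xi>')"]) measurable
    also have "\<dots> = (\<integral>\<^sup>+z. (\<integral>\<^sup>+\<zeta>. ennreal C * ennreal (wt (x - t *\<^sub>R \<xi> - (x - t *\<^sub>R \<xi> - z)) * wt (\<xi> - (\<xi> - \<zeta>)) * W0 (x - t *\<^sub>R \<xi> - z) (\<xi> - \<zeta>)) \<partial>lborel) \<partial>lborel)"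
      by (rule lborel_nn_integral_reflect[symmetric, where f="\<lambda>x'. \<integral>\<^sup>+\<zeta>. ennreal C * ennreal (wt (x - t *\<^sub>R \<xi> - x') * wt (\<xi> - (\<xi> - \<zeta>)) * W0 x' (\<xi> - \<zeta>)) \<partial>lborel"]) measurable
    also have "\<dots> = (\<integral>\<^sup>+z. (\<integral>\<^sup>+\<zeta>. k (z, \<zeta>) * ennreal (W0 (x - t *\<^sub>R \<xi> - fst (z, \<zeta>)) (\<xi> - snd (z, \<zeta>))) \<partial>lborel) \<partial>lborel)"
      using C W0n by (simp add: k_def mult.assoc flip: ennreal_mult)
    also have "\<dots> = (\<integral>\<^sup>+w. k w * ennreal (W0 (x - t *\<^sub>R \<xi> - fst w) (\<xi> - snd w)) \<partial>?M)"
      by (rule lborel.nn_integral_fst) measurable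
    finally show ?thesis using le[of x \<xi>] by simp
  qed
  \<comment> \<open>The majorant for each phase-space shift is the inner norm of \<open>W0\<close>
    at the shifted frequency alone: the position shift, including t \<xi>, disappears by translation
    invariance.\<close>
  have inner: "Lp_norm p (\<lambda>x. ennreal (W x \<xi>)) \<le> (\<integral>\<^sup>+w. k w * a (\<xi> - snd w) \<partial>?M)" for \<xi>
  proof -
    have "continuous_on UNIV (\<lambda>x. (\<lambda>(x, \<xi>). W x \<xi>) (x, \<xi>))"
      by (rule continuous_on_compose2[OF W]) (auto intro!: continuous_intros)
    then have "(\<lambda>x. W x \<xi>) \<in> borel_measurable borel" by (intro borel_measurable_continuous_onI) simp
    then have "Lp_norm p (\<lambda>x. ennreal (W x \<xi>)) \<le> Lp_norm p (\<lambda>x. \<integral>\<^sup>+w. k w * ennreal (W0 (x - t *\<^sub>R \<xi> - fst w) (\<xi> - snd w)) \<partial>?M)"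
      by (intro Lp_norm_mono le') measurable
    also have "\<dots> \<le> (\<integral>\<^sup>+w. k w * a (\<xi> - snd w) \<partial>?M)"
    proof (rule Lp_norm_minkowski[OF p M])
      show "(\<lambda>(x, w). ennreal (W0 (x - t *\<^sub>R \<xi> - fst w) (\<xi> - snd w))) \<in> borel_measurable (borel \<Otimes>\<^sub>M ?M)" by measurable
      show "Lp_norm p (\<lambda>x. ennreal (W0 (x - t *\<^sub>R \<xi> - fst w) (\<xi> - snd w))) \<le> a (\<xi> - snd w)" for w
        using Lp_norm_translate[of "\<lambda>x. ennreal (W0 x (\<xi> - snd w))" p "t *\<^sub>R \<xi> + fst w"] unfolding a_def by (simp add: diff_diff_eq)
      show "(\<integral>\<^sup>+w. k w \<partial>?M) < \<infinity>" unfolding ki by simp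
    qed measurable
    finally show ?thesis .
  qed
  have "Lp_norm q (\<lambda>\<xi>. Lp_norm p (\<lambda>x. ennreal (W x \<xi>))) \<le> Lp_norm q (\<lambda>\<xi>. \<integral>\<^sup>+w. k w * a (\<xi> - snd w) \<partial>?M)"
    by (intro Lp_norm_mono inner measurable_Lp_norm_continuous W)
  also have "\<dots> \<le> (\<integral>\<^sup>+w. k w * Lp_norm q a \<partial>?M)"
  proof (rule Lp_norm_minkowski[OF q M])
    show "(\<lambda>(\<xi>, w). a (\<xi> - snd w)) \<in> borel_measurable (borel \<Otimes>\<^sub>M ?M)" by measurable
    show "Lp_norm q (\<lambda>\<xi>. a (\<xi> - snd w)) \<le> Lp_norm q a" for w by (rule Lp_norm_translate[OF ma])
    show "(\<integral>\<^sup>+w. k w \<partial>?M) < \<infinity>" unfolding ki by simp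
  qed measurable
  also have "\<dots> = ennreal (C * ?I\<^sup>2) * Lp_norm q a" by (simp add: nn_integral_multc ki)
  finally show ?thesis unfolding a_def[abs_def] .
qed

theorem theorem1p2:
  fixes p q :: ennreal
    and T :: real
    and \<phi>0 :: "real^'n::finite \<Rightarrow> complex"
    and V :: "real \<Rightarrow> real^'n \<Rightarrow> real"
  assumes "1 \<le> p" and "1 \<le> q"
    and "schwartz \<phi>0" and "\<phi>0 \<noteq> (\<lambda>x. 0)"
    and "T > 0"
    and "smooth (\<lambda>(t, x). V t x)"
    and "\<forall>\<alpha> :: 'n \<Rightarrow> nat. (\<Sum>i\<in>UNIV. \<alpha> i) \<ge> 1 \<longrightarrow>
           (\<exists>C>0. \<forall>t x. \<bar>multi_deriv \<alpha> (V t) x\<bar> \<le> C)"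
  shows "\<exists>C>0. \<forall>u0 u. schwartz u0 \<longrightarrow> schroedinger_solution V u0 u \<longrightarrow>
           (\<forall>t\<in>{-T..T}.
              modulation_norm p q (free_propagator t \<phi>0) (u t)
                \<le> ennreal C * modulation_norm p q \<phi>0 u0)"
proof -
  have \<phi>0: "schw \<phi>0" by (rule schwartz_imp_schw[OF assms(3)])
  obtain C where C: "0 < C" and bound: "\<And>u0 u t x \<xi>. schroedinger_solution V u0 u \<Longrightarrow> \<bar>t\<bar> \<le> T \<Longrightarrow>
    ennreal (cmod (wave_packet (free_propagator t \<phi>0) (u t) (x + t *\<^sub>R \<xi>) \<xi>)) \<le>
    ennreal C * (\<integral>\<^sup>+x'. (\<integral>\<^sup>+\<xi>'. ennreal (wt (x - x') * wt (\<xi> - \<xi>') * cmod (wave_packet \<phi>0 (u 0) x' \<xi>')) \<partial>lborel) \<partial>lborel)"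
    using wave_packet_pointwise_bound[OF \<phi>0 assms(4-7)] by blast
  \<comment> \<open>Fixed before the data and the solution are introduced; adding 1 later gives a
    positive constant at once.\<close>
  let ?D = "C * (LINT x::real^'n|lborel. wt x)\<^sup>2"
  have D: "0 < ?D + 1" using C by (simp add: add_nonneg_pos)
  show ?thesis
  proof (intro exI[of _ "?D + 1"] conjI allI impI ballI)
    show "0 < ?D + 1" by (rule D)
    fix u0 :: "real^'n \<Rightarrow> complex" and u and t
    assume u0: "schwartz u0" and sol: "schroedinger_solution V u0 u" and t: "t \<in> {-T..T}"
    have uL: "in_L2 (u s)" for s using sol by (simp add: schroedinger_solution_def continuous_L2_def)
    have cont: "continuous_on UNIV (\<lambda>(x, \<xi>). cmod (wave_packet (free_propagator s \<phi>0) (u s) x \<xi>))" for s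
    proof -
      obtain M where M: "0 \<le> M" "\<And>y. cmod (free_propagator s \<phi>0 y) \<le> M * wt y" using propagator_wt_bound[OF \<phi>0] by blast
      show ?thesis
        using continuous_on_norm[OF continuous_wave_packet[OF uL smooth_continuous[OF smooth_propagator[OF \<phi>0]] M(2,1)]]
        by (simp add: case_prod_unfold)
    qed
    \<comment> \<open>The solution attains its initial value only almost everywhere, which an
      integral transform does not notice.\<close>
    have init: "wave_packet \<phi>0 (u 0) x \<xi> = wave_packet \<phi>0 u0 x \<xi>" for x \<xi>
      unfolding wave_packet_def
    proof (rule integral_cong_AE)
      have [measurable]: "u0 \<in> borel_measurable borel" "\<phi>0 \<in> borel_measurable borel" "u 0 \<in> borel_measurable borel"
        using schwartz_imp_schw[OF u0] \<phi>0 uL by (auto intro: schw_measurable in_L2_measurable)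
      show "(\<lambda>y. cnj (\<phi>0 (y - x)) * u 0 y * exp (- \<i> * complex_of_real (y \<bullet> \<xi>))) \<in> borel_measurable lborel"
        "(\<lambda>y. cnj (\<phi>0 (y - x)) * u0 y * exp (- \<i> * complex_of_real (y \<bullet> \<xi>))) \<in> borel_measurable lborel" by measurable
      have "AE y in lborel. u 0 y = u0 y" using sol by (simp add: schroedinger_solution_def)
      then show "AE y in lborel. cnj (\<phi>0 (y - x)) * u 0 y * exp (- \<i> * complex_of_real (y \<bullet> \<xi>)) = cnj (\<phi>0 (y - x)) * u0 y * exp (- \<i> * complex_of_real (y \<bullet> \<xi>))"
        by eventually_elim simp
    qed
    have "modulation_norm p q (free_propagator t \<phi>0) (u t) \<le> ennreal ?D * modulation_norm p q \<phi>0 (u 0)"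
      unfolding modulation_norm_def
    proof (rule modulation_norm_convolution_bound[OF assms(1,2) less_imp_le[OF C] cont, where t=t])
      show "continuous_on UNIV (\<lambda>(x, \<xi>). cmod (wave_packet \<phi>0 (u 0) x \<xi>))"
        using cont[of 0] by (simp add: propagator_zero[OF \<phi>0])
      \<comment> \<open>The pointwise bound is taken at x - t \<xi>, so that the moving coordinate
        becomes x.\<close>
      show "ennreal (cmod (wave_packet (free_propagator t \<phi>0) (u t) x \<xi>)) \<le> ennreal C *
        (\<integral>\<^sup>+x'. (\<integral>\<^sup>+\<xi>'. ennreal (wt (x - t *\<^sub>R \<xi> - x') * wt (\<xi> - \<xi>') * cmod (wave_packet \<phi>0 (u 0) x' \<xi>')) \<partial>lborel) \<partial>lborel)" for x \<xi>
        using bound[OF sol, of t "x - t *\<^sub>R \<xi>" \<xi>] t by (simp add: abs_le_iff)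
    qed simp
    also have "\<dots> = ennreal ?D * modulation_norm p q \<phi>0 u0" by (simp add: modulation_norm_def init)
    also have "\<dots> \<le> ennreal (?D + 1) * modulation_norm p q \<phi>0 u0" by (intro mult_right_mono ennreal_leI) auto
    finally show "modulation_norm p q (free_propagator t \<phi>0) (u t) \<le> ennreal (?D + 1) * modulation_norm p q \<phi>0 u0" .
  qed
qed

end
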